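(* Let $p=m$. An irreducible representation $V^\lambda_{m|q}\otimes V^\lambda_{m|n}$ of $gl(m|q)\times gl(m|n)$ appears in the decomposition of $\mathbb{C}[\mathbf{x},\boldsymbol{\xi},\boldsymbol{\eta},\mathbf{y}]$ if and only if $\lambda$ is a Young diagram with $\lambda_{m+1}\le\min(q,n)$. Let $t$ be the length of $\lambda'$. Then: (1) if the length of $\lambda$ does not exceed $m$, then a highest weight vector corresponding to $\lambda$ is given by $\Delta_{\lambda'_1}\cdots\Delta_{\lambda'_t}$; (2) if the length of $\lambda$ is $m+s$, $s\ge1$, let $0\le r\le\min(q,n)$ be such that $\lambda'_r>m$ and $\lambda'_{r+1}\le m$; then a highest weight vector corresponding to $\lambda$ is given by $$(\Delta_m)^{-(\lambda_{m+2}+\cdots+\lambda_{m+s})}\,\Gamma_{\lambda_{m+1}}\Gamma_{\lambda_{m+2}}\cdots\Gamma_{\lambda_{m+s}}\,\Delta_{\lambda'_{r+1}}\cdots\Delta_{\lambda'_t}.$$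
   Context: $\mathbb{C}[\mathbf{x},\boldsymbol{\xi},\boldsymbol{\eta},\mathbf{y}]$ is the polynomial superalgebra over $\mathbb{C}$ in even variables $x_l^i$ ($1\le i\le p$, $1\le l\le m$), $y_k^j$ ($1\le j\le q$, $1\le k\le n$) and odd variables $\xi_l^j$ ($1\le j\le q$, $1\le l\le m$), $\eta_k^i$ ($1\le i\le p$, $1\le k\le n$); here $p=m$. It is identified with the (super)symmetric algebra $S(\mathbb{C}^{p|q}\otimes\mathbb{C}^{m|n})$, with its natural $gl(p|q)\times gl(m|n)$-action, via $x_l^i=e_l\otimes e^i$, $\xi_l^j=e_l\otimes f^j$, $\eta_k^i=f_k\otimes e^i$, $y_k^j=f_k\otimes f^j$, where $e^i;f^j$ and $e_l;f_k$ are the standard (even; odd) bases of $\mathbb{C}^{p|q}$ and $\mathbb{C}^{m|n}$. Cartan subalgebras: for $gl(p|q)$, $\sum_{j=1}^m x_j^i\frac{\partial}{\partial x_j^i}+\sum_{j=1}^n\eta_j^i\frac{\partial}{\partial\eta_j^i}$ ($1\le i\le p$) and $\sum_{j=1}^m\xi_j^l\frac{\partial}{\partial\xi_j^l}+\sum_{j=1}^n y_j^l\frac{\partial}{\partial y_j^l}$ ($1\le l\le q$); for $gl(m|n)$, $\sum_{j=1}^p x_s^j\frac{\partial}{\partial x_s^j}+\sum_{j=1}^q\xi_s^j\frac{\partial}{\partial\xi_s^j}$ ($1\le s\le m$) and $\sum_{j=1}^p\eta_k^j\frac{\partial}{\partial\eta_k^j}+\sum_{j=1}^q y_k^j\frac{\partial}{\partial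 y_k^j}$ ($1\le k\le n$). Simple root vectors: for $gl(p|q)$, $\sum_j x_j^{i-1}\frac{\partial}{\partial x_j^i}+\sum_j\eta_j^{i-1}\frac{\partial}{\partial\eta_j^i}$ ($1<i\le p$), $\sum_j\xi_j^{l-1}\frac{\partial}{\partial\xi_j^l}+\sum_j y_j^{l-1}\frac{\partial}{\partial y_j^l}$ ($1<l\le q$), $\sum_j x_j^p\frac{\partial}{\partial\xi_j^1}+\sum_j\eta_j^p\frac{\partial}{\partial y_j^1}$; for $gl(m|n)$, $\sum_j x_{s-1}^j\frac{\partial}{\partial x_s^j}+\sum_j\xi_{s-1}^j\frac{\partial}{\partial\xi_s^j}$ ($1<s\le m$), $\sum_j\eta_{k-1}^j\frac{\partial}{\partial\eta_k^j}+\sum_j y_{k-1}^j\frac{\partial}{\partial y_k^j}$ ($1<k\le n$), $\sum_j x_m^j\frac{\partial}{\partial\eta_1^j}-\sum_j\xi_m^j\frac{\partial}{\partial y_1^j}$. A highest weight vector is a nonzero weight vector annihilated by all simple root vectors of both algebras. $V^\lambda_{m|n}$ is the irreducible $gl(m|n)$-module of highest weight $(\lambda_1,\ldots,\lambda_m;\langle\lambda'_1-m\rangle,\ldots,\langle\lambda'_n-m\rangle)$, where $\lambda'$ is the transpose and $\langle l\rangle=\max(l,0)$; similarly for $gl(m|q)$. A highest weight vector corresponds to $\lambda$ if it has these weights. Determinants of matrices with entries in a superalgebra ($a_i^j$ in row $i$, column $j$) are $\det=\sum_{\sigma}\mathrm{sgn}(\sigma)a_1^{\sigma(1)}a_2^{\sigma(2)}\cdots$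 (row order). $\Delta_r=\det(x_l^i)_{1\le i,l\le r}$ for $1\le r\le m$. For $1\le r\le\min(q,n)$, $\Gamma_r$ is defined as follows. Let $X$ be the $m\times m$ matrix with $l$-th row $(x_l^1,\ldots,x_l^m)$ and $Y$ the $r\times r$ matrix with $k$-th row $(y_k^1,\ldots,y_k^r)$. A marked $m\times r$ diagram $D$ is a rectangle of $m$ rows and $r$ columns of boxes, some marked, at most one marked box per column; $|D|$ is the number of marked boxes. $Y_D$ is obtained from $Y$ by replacing, for each marked box in column $i$ and row $j$, the $i$-th row of $Y$ by $(\xi_j^1,\ldots,\xi_j^r)$. For $1\le i\le r$, $X_i=X$ if column $i$ of $D$ has no marked box; if it is marked in row $j$, $X_i$ is obtained from $X$ by replacing its $j$-th row by $(\eta_i^1,\ldots,\eta_i^m)$. Put $\det X_D:=\det X_1\cdots\det X_r$ and $\Gamma_r:=\sum_D(-1)^{\frac12|D|(|D|-1)}\det X_D\det Y_D$, summed over all marked $m\times r$ diagrams. The expression in (2) means the quotient in $\mathbb{C}[\mathbf{x},\boldsymbol{\xi},\boldsymbol{\eta},\mathbf{y}]$ of the product by the indicated power of $\Delta_m$; that this quotient exists in the polynomial superalgebra is part of the assertion. *)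

theory Defs
  imports Complex_Main "HOL-Library.Nat_Bijection" "HOL-Library.Poly_Mapping" "HOL-Combinatorics.Permutations"
begin

section \<open>Exterior algebras over a commutative ring\<close>

text \<open>
  An element of the exterior algebra with odd generators of a linearly ordered type \<open>'o\<close>
  over a commutative ring \<open>'c\<close> is given by its coefficients; the coefficient at a finite set
  \<open>S\<close> belongs to the product of the generators in \<open>S\<close>, taken in increasing order.
\<close>

typedef (overloaded) ('o, 'c::zero) grassmann =
  "{f :: 'o set \<Rightarrow> 'c. finite {S. f S \<noteq> 0} \<and> (\<forall>S. f S \<noteq> 0 \<longrightarrow> finite S)}"
  morphisms gcoeff Abs_grassmann
  by (rule exI[of _ "\<lambda>_. 0"]) auto

setup_lifting type_definition_grassmann

lemma gcoeff_inject_fun: "(\<And>S. gcoeff f S = gcoeff g S) \<Longrightarrow> f = g"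
  by (metis gcoeff_inject ext)

lemma gcoeff_infinite: "infinite S \<Longrightarrow> gcoeff f S = 0"
  using gcoeff[of f] by blast

text \<open>The sign needed to sort the product of the increasing words \<open>S\<close> and \<open>T\<close>.\<close>

definition shuffle_sign :: "'o::linorder set \<Rightarrow> 'o set \<Rightarrow> 'c::comm_ring_1" where
  "shuffle_sign S T = (-1) ^ card {(s, t). s \<in> S \<and> t \<in> T \<and> t < s}"

lemma shuffle_sign_empty [simp]: "shuffle_sign {} T = 1" "shuffle_sign S {} = 1"
  by (simp_all add: shuffle_sign_def)

lemma finite_inversions:
  "finite S \<Longrightarrow> finite T \<Longrightarrow> finite {(s, t). s \<in> S \<and> t \<in> T \<and> t < s}"
  by (rule finite_subset[of _ "S \<times> T"]) auto

lemma shuffle_sign_Un_left: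
  assumes "finite S" "finite T" "finite U" "S \<inter> T = {}"
  shows "shuffle_sign (S \<union> T) U = shuffle_sign S U * shuffle_sign T U"
proof -
  have "{(s, t). s \<in> S \<union> T \<and> t \<in> U \<and> t < s}
      = {(s, t). s \<in> S \<and> t \<in> U \<and> t < s} \<union> {(s, t). s \<in> T \<and> t \<in> U \<and> t < s}" by auto
  moreover have "{(s, t). s \<in> S \<and> t \<in> U \<and> t < s} \<inter> {(s, t). s \<in> T \<and> t \<in> U \<and> t < s} = {}"
    using assms(4) by auto
  ultimately show ?thesis
    using assms by (simp add: shuffle_sign_def card_Un_disjoint finite_inversions power_add)
qed

lemma shuffle_sign_Un_right:
  assumes "finite S" "finite T" "finite U" "T \<inter> U = {}"
  shows "shuffle_sign S (T \<union> U) = shuffle_sign S T * shuffle_sign S U"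
proof -
  have "{(s, t). s \<in> S \<and> t \<in> T \<union> U \<and> t < s}
      = {(s, t). s \<in> S \<and> t \<in> T \<and> t < s} \<union> {(s, t). s \<in> S \<and> t \<in> U \<and> t < s}" by auto
  moreover have "{(s, t). s \<in> S \<and> t \<in> T \<and> t < s} \<inter> {(s, t). s \<in> S \<and> t \<in> U \<and> t < s} = {}"
    using assms(4) by auto
  ultimately show ?thesis
    using assms by (simp add: shuffle_sign_def card_Un_disjoint finite_inversions power_add)
qed

instantiation grassmann :: (type, comm_ring_1) ab_group_add
begin

lift_definition zero_grassmann :: "('a, 'b) grassmann" is "\<lambda>_. 0" by simp

lift_definition plus_grassmann ::
    "('a, 'b) grassmann \<Rightarrow> ('a, 'b) grassmann \<Rightarrow> ('a, 'b) grassmann"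
  is "\<lambda>f g S. f S + g S"
proof -
  fix f g :: "'a set \<Rightarrow> 'b"
  assume "finite {S. f S \<noteq> 0} \<and> (\<forall>S. f S \<noteq> 0 \<longrightarrow> finite S)"
    and "finite {S. g S \<noteq> 0} \<and> (\<forall>S. g S \<noteq> 0 \<longrightarrow> finite S)"
  then have "finite ({S. f S \<noteq> 0} \<union> {S. g S \<noteq> 0})"
    and "\<forall>S. f S + g S \<noteq> 0 \<longrightarrow> finite S" by (simp, metis add_0)
  moreover have "{S. f S + g S \<noteq> 0} \<subseteq> {S. f S \<noteq> 0} \<union> {S. g S \<noteq> 0}" by auto
  ultimately show "finite {S. f S + g S \<noteq> 0} \<and> (\<forall>S. f S + g S \<noteq> 0 \<longrightarrow> finite S)"
    by (meson finite_subset)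
qed

lift_definition uminus_grassmann :: "('a, 'b) grassmann \<Rightarrow> ('a, 'b) grassmann"
  is "\<lambda>f S. - f S" by simp

definition minus_grassmann ::
    "('a, 'b) grassmann \<Rightarrow> ('a, 'b) grassmann \<Rightarrow> ('a, 'b) grassmann"
  where "minus_grassmann f g = f + - g"

instance
  by standard (transfer; simp add: ac_simps minus_grassmann_def fun_eq_iff)+

end

instantiation grassmann :: (linorder, comm_ring_1) ring_1
begin

lift_definition one_grassmann :: "('a, 'b) grassmann" is "\<lambda>S. if S = {} then 1 else 0" by simp

lift_definition times_grassmann ::
    "('a, 'b) grassmann \<Rightarrow> ('a, 'b) grassmann \<Rightarrow> ('a, 'b) grassmann"
  is "\<lambda>f g U. \<Sum>S\<in>Pow U. shuffle_sign S (U - S) * f S * g (U - S)"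
proof -
  fix f g :: "'a set \<Rightarrow> 'b"
  assume f: "finite {S. f S \<noteq> 0} \<and> (\<forall>S. f S \<noteq> 0 \<longrightarrow> finite S)"
    and g: "finite {S. g S \<noteq> 0} \<and> (\<forall>S. g S \<noteq> 0 \<longrightarrow> finite S)"
  let ?h = "\<lambda>U. \<Sum>S\<in>Pow U. shuffle_sign S (U - S) * f S * g (U - S)"
  have *: "\<exists>S T. f S \<noteq> 0 \<and> g T \<noteq> 0 \<and> U = S \<union> T" if U: "?h U \<noteq> 0" for U
  proof -
    from U obtain S where S: "S \<in> Pow U" "shuffle_sign S (U - S) * f S * g (U - S) \<noteq> 0"
      by (meson sum.neutral)
    then have "f S \<noteq> 0" "g (U - S) \<noteq> 0" by auto
    with S show ?thesis by (intro exI[of _ S] exI[of _ "U - S"]) auto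
  qed
  have "{U. ?h U \<noteq> 0} \<subseteq> (\<lambda>(S, T). S \<union> T) ` ({S. f S \<noteq> 0} \<times> {T. g T \<noteq> 0})"
    using * by force
  moreover have "finite ({S. f S \<noteq> 0} \<times> {T. g T \<noteq> 0})"
    using f g by simp
  ultimately have "finite {U. ?h U \<noteq> 0}"
    by (meson finite_imageI finite_subset)
  moreover have "finite U" if "?h U \<noteq> 0" for U
    using *[OF that] f g by auto
  ultimately show "finite {U. ?h U \<noteq> 0} \<and> (\<forall>U. ?h U \<noteq> 0 \<longrightarrow> finite U)" by blast
qed

instance
proof
  fix f g h :: "('a, 'b) grassmann"
  show "f * g * h = f * (g * h)"
  proof (rule gcoeff_inject_fun)
    fix U :: "'a set"
    show "gcoeff (f * g * h) U = gcoeff (f * (g * h)) U"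
    proof (cases "finite U")
      case False
      then show ?thesis by (simp add: gcoeff_infinite)
    next
      case True
      let ?s = "shuffle_sign :: 'a set \<Rightarrow> 'a set \<Rightarrow> 'b"
      let ?A = "Sigma (Pow U) (\<lambda>V. Pow V)" and ?B = "Sigma (Pow U) (\<lambda>S. Pow (U - S))"
      have fin: "finite S" if "S \<subseteq> U" for S using that True finite_subset by blast
      have "gcoeff (f * g * h) U = (\<Sum>V\<in>Pow U. \<Sum>S\<in>Pow V.
          ?s V (U - V) * (?s S (V - S) * gcoeff f S * gcoeff g (V - S)) * gcoeff h (U - V))"
        by (simp add: times_grassmann.rep_eq sum_distrib_left sum_distrib_right)
      also have "\<dots> = (\<Sum>(V, S)\<in>?A.
          ?s V (U - V) * (?s S (V - S) * gcoeff f S * gcoeff g (V - S)) * gcoeff h (U - V))"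
        using True fin by (subst sum.Sigma) auto
      also have "\<dots> = (\<Sum>(S, T)\<in>?B. ?s S (U - S) * gcoeff f S *
          (?s T (U - S - T) * gcoeff g T * gcoeff h (U - S - T)))"
      proof (rule sum.reindex_bij_witness[where j = "\<lambda>(V, S). (S, V - S)" and i = "\<lambda>(S, T). (S \<union> T, S)"])
        fix a assume a: "a \<in> ?A"
        then obtain V S where VS: "a = (V, S)" "V \<subseteq> U" "S \<subseteq> V" by auto
        have e: "U - S - (V - S) = U - V" "U - S = (V - S) \<union> (U - V)" "V = S \<union> (V - S)"
          using VS by auto
        have 1: "?s V (U - V) = ?s S (U - V) * ?s (V - S) (U - V)"
          using shuffle_sign_Un_left[of S "V - S" "U - V"] VS fin e(3)
          by (metis Diff_disjoint Diff_subset order_trans)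
        have 2: "?s S (U - S) = ?s S (V - S) * ?s S (U - V)"
          unfolding e(2) by (rule shuffle_sign_Un_right) (use VS fin in auto)
        show "(case case a of (V, S) \<Rightarrow> (S, V - S) of (S, T) \<Rightarrow> ?s S (U - S) * gcoeff f S *
            (?s T (U - S - T) * gcoeff g T * gcoeff h (U - S - T))) =
          (case a of (V, S) \<Rightarrow> ?s V (U - V) *
            (?s S (V - S) * gcoeff f S * gcoeff g (V - S)) * gcoeff h (U - V))"
          unfolding VS(1) prod.case e(1) 1 2 by (simp only: ac_simps)
      qed auto
      also have "\<dots> = (\<Sum>S\<in>Pow U. \<Sum>T\<in>Pow (U - S). ?s S (U - S) * gcoeff f S *
          (?s T (U - S - T) * gcoeff g T * gcoeff h (U - S - T)))"
        using True fin by (subst sum.Sigma) auto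
      also have "\<dots> = gcoeff (f * (g * h)) U"
        by (simp add: times_grassmann.rep_eq sum_distrib_left)
      finally show ?thesis .
    qed
  qed
  show "1 * f = f"
  proof (rule gcoeff_inject_fun)
    fix U
    show "gcoeff (1 * f) U = gcoeff f U"
    proof (cases "finite U")
      case False
      then show ?thesis by (simp add: gcoeff_infinite)
    next
      case True
      have "gcoeff (1 * f) U = (\<Sum>S\<in>Pow U. if S = {} then gcoeff f U else 0)"
        unfolding times_grassmann.rep_eq one_grassmann.rep_eq by (rule sum.cong) auto
      then show ?thesis using True by simp
    qed
  qed
  show "f * 1 = f"
  proof (rule gcoeff_inject_fun)
    fix U
    show "gcoeff (f * 1) U = gcoeff f U"
    proof (cases "finite U")
      case False
      then show ?thesis by (simp add: gcoeff_infinite)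
    next
      case True
      have "gcoeff (f * 1) U = (\<Sum>S\<in>Pow U. if S = U then gcoeff f U else 0)"
        unfolding times_grassmann.rep_eq one_grassmann.rep_eq by (rule sum.cong) auto
      then show ?thesis using True by simp
    qed
  qed
  show "(f + g) * h = f * h + g * h"
    by (rule gcoeff_inject_fun)
      (simp add: times_grassmann.rep_eq plus_grassmann.rep_eq algebra_simps sum.distrib)
  show "f * (g + h) = f * g + f * h"
    by (rule gcoeff_inject_fun)
      (simp add: times_grassmann.rep_eq plus_grassmann.rep_eq algebra_simps sum.distrib)
  show "(0::('a, 'b) grassmann) \<noteq> 1"
    by transfer (auto dest: fun_cong[of _ _ "{}"])
qed

end

lift_definition gterm :: "'o set \<Rightarrow> 'c::comm_ring_1 \<Rightarrow> ('o, 'c) grassmann"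
  is "\<lambda>S c T. if finite S \<and> T = S then c else 0"
  by (auto intro: finite_subset[where B = "{_}"])

text \<open>Left derivative with respect to an odd generator.\<close>

lift_definition odd_deriv :: "'o::linorder \<Rightarrow> ('o, 'c::comm_ring_1) grassmann \<Rightarrow> ('o, 'c) grassmann"
  is "\<lambda>b f S. if b \<in> S then 0 else shuffle_sign {b} S * f (insert b S)"
proof -
  fix b :: 'o and f :: "'o set \<Rightarrow> 'c"
  assume f: "finite {S. f S \<noteq> 0} \<and> (\<forall>S. f S \<noteq> 0 \<longrightarrow> finite S)"
  let ?h = "\<lambda>S. if b \<in> S then 0 else shuffle_sign {b} S * f (insert b S)"
  have *: "f (insert b S) \<noteq> 0 \<and> b \<notin> S" if "?h S \<noteq> 0" for S
    using that by (auto split: if_splits)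
  have "{S. ?h S \<noteq> 0} \<subseteq> (\<lambda>S. S - {b}) ` {S. f S \<noteq> 0}"
  proof
    fix S assume "S \<in> {S. ?h S \<noteq> 0}"
    with * have "f (insert b S) \<noteq> 0" "S = insert b S - {b}" by auto
    then show "S \<in> (\<lambda>S. S - {b}) ` {S. f S \<noteq> 0}" by blast
  qed
  then have "finite {S. ?h S \<noteq> 0}" using f by (meson finite_imageI finite_subset)
  moreover have "finite S" if "?h S \<noteq> 0" for S
    using *[OF that] f by (meson finite_insert)
  ultimately show "finite {S. ?h S \<noteq> 0} \<and> (\<forall>S. ?h S \<noteq> 0 \<longrightarrow> finite S)" by blast
qed

lift_definition coeff_map :: "('c \<Rightarrow> 'c) \<Rightarrow> ('o, 'c::zero) grassmann \<Rightarrow> ('o, 'c) grassmann"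
  is "\<lambda>\<phi> f S. if f S = 0 then 0 else \<phi> (f S)"
  by (auto elim!: rev_finite_subset)


section \<open>The polynomial superalgebra\<close>

text \<open>
  \<open>X l i\<close>, \<open>Y k j\<close>, \<open>Xi l j\<close>, \<open>Eta k i\<close> stand for the variables whose lower index is
  \<open>l\<close> resp. \<open>k\<close> and whose upper index is \<open>i\<close> resp. \<open>j\<close>.
\<close>

datatype even_var = X nat nat | Y nat nat
datatype odd_var = Xi nat nat | Eta nat nat

fun odd_var_code :: "odd_var \<Rightarrow> nat" where
  "odd_var_code (Xi l j) = 2 * prod_encode (l, j)"
| "odd_var_code (Eta k i) = 2 * prod_encode (k, i) + 1"

lemma odd_var_code_inject: "odd_var_code u = odd_var_code v \<longleftrightarrow> u = v"
  by (cases u; cases v) (auto, presburger+)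

text \<open>An arbitrary linear order, used only to normalise products of odd variables.\<close>

instantiation odd_var :: linorder
begin

definition less_eq_odd_var :: "odd_var \<Rightarrow> odd_var \<Rightarrow> bool" where
  "less_eq_odd_var u v \<longleftrightarrow> odd_var_code u \<le> odd_var_code v"

definition less_odd_var :: "odd_var \<Rightarrow> odd_var \<Rightarrow> bool" where
  "less_odd_var u v \<longleftrightarrow> odd_var_code u < odd_var_code v"

instance
  by standard (auto simp: less_eq_odd_var_def less_odd_var_def odd_var_code_inject
    simp flip: odd_var_code_inject)

end

type_synonym even_poly = "(even_var \<Rightarrow>\<^sub>0 nat) \<Rightarrow>\<^sub>0 complex"
type_synonym superpoly = "(odd_var, even_poly) grassmann"

lift_definition even_poly_deriv :: "even_var \<Rightarrow> even_poly \<Rightarrow> even_poly"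
  is "\<lambda>v f e. of_nat (Poly_Mapping.lookup e v + 1) * f (e + Poly_Mapping.single v 1)"
proof -
  fix v :: even_var and f :: "(even_var \<Rightarrow>\<^sub>0 nat) \<Rightarrow> complex"
  assume "finite {e. f e \<noteq> 0}"
  then have "finite ((\<lambda>e. e + Poly_Mapping.single v 1) -` {e. f e \<noteq> 0})"
    by (rule finite_vimageI) (simp add: inj_def)
  then show "finite {e. of_nat (Poly_Mapping.lookup e v + 1) * f (e + Poly_Mapping.single v 1) \<noteq> 0}"
    by (rule rev_finite_subset) auto
qed

definition sp_scale :: "complex \<Rightarrow> superpoly \<Rightarrow> superpoly" where
  "sp_scale c f = gterm {} (Poly_Mapping.single 0 c) * f"

definition sp_even :: "even_var \<Rightarrow> superpoly" where
  "sp_even v = gterm {} (Poly_Mapping.single (Poly_Mapping.single v 1) 1)"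

definition sp_odd :: "odd_var \<Rightarrow> superpoly" where
  "sp_odd v = gterm {v} 1"

text \<open>
  Standard basis of \<open>\<complex>\<^sup>m\<^sup>|\<^sup>n\<close>: the even vectors are \<open>Inl 1, \<dots>, Inl m\<close>,
  the odd ones are \<open>Inr 1, \<dots>, Inr n\<close>.
\<close>

type_synonym sindex = "nat + nat"

definition sidx :: "nat \<Rightarrow> nat \<Rightarrow> sindex set" where
  "sidx m n = Inl ` {1..m} \<union> Inr ` {1..n}"

fun odd_idx :: "sindex \<Rightarrow> bool" where
  "odd_idx (Inl _) = False"
| "odd_idx (Inr _) = True"

text \<open>
  \<open>gen a c\<close> is the variable identified with the tensor of the \<open>a\<close>-th basis vector of
  \<open>\<complex>\<^sup>p\<^sup>|\<^sup>q\<close> (upper index) and the \<open>c\<close>-th basis vector of \<open>\<complex>\<^sup>m\<^sup>|\<^sup>n\<close> (lower index), and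
  \<open>gen_deriv a c\<close> is the corresponding partial derivative (a left derivative if odd).
\<close>

fun gen :: "sindex \<Rightarrow> sindex \<Rightarrow> superpoly" where
  "gen (Inl i) (Inl l) = sp_even (X l i)"
| "gen (Inr j) (Inr k) = sp_even (Y k j)"
| "gen (Inr j) (Inl l) = sp_odd (Xi l j)"
| "gen (Inl i) (Inr k) = sp_odd (Eta k i)"

fun gen_deriv :: "sindex \<Rightarrow> sindex \<Rightarrow> superpoly \<Rightarrow> superpoly" where
  "gen_deriv (Inl i) (Inl l) f = coeff_map (even_poly_deriv (X l i)) f"
| "gen_deriv (Inr j) (Inr k) f = coeff_map (even_poly_deriv (Y k j)) f"
| "gen_deriv (Inr j) (Inl l) f = odd_deriv (Xi l j) f"
| "gen_deriv (Inl i) (Inr k) f = odd_deriv (Eta k i) f"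

definition even_vars :: "nat \<Rightarrow> nat \<Rightarrow> nat \<Rightarrow> nat \<Rightarrow> even_var set" where
  "even_vars p q m n = {X l i | l i. l \<in> {1..m} \<and> i \<in> {1..p}} \<union> {Y k j | k j. k \<in> {1..n} \<and> j \<in> {1..q}}"

definition odd_vars :: "nat \<Rightarrow> nat \<Rightarrow> nat \<Rightarrow> nat \<Rightarrow> odd_var set" where
  "odd_vars p q m n = {Xi l j | l j. l \<in> {1..m} \<and> j \<in> {1..q}} \<union> {Eta k i | k i. k \<in> {1..n} \<and> i \<in> {1..p}}"

definition superpolys :: "nat \<Rightarrow> nat \<Rightarrow> nat \<Rightarrow> nat \<Rightarrow> superpoly set" where
  "superpolys p q m n = {f. \<forall>S. gcoeff f S \<noteq> 0 \<longrightarrow>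
     S \<subseteq> odd_vars p q m n \<and> (\<forall>e \<in> Poly_Mapping.keys (gcoeff f S). Poly_Mapping.keys e \<subseteq> even_vars p q m n)}"


section \<open>Lie superalgebras and their modules\<close>

text \<open>
  A complex Lie superalgebra is given by a homogeneous basis \<open>units\<close>, the parities of the basis
  elements and the structure constants \<open>struct x y z\<close>, the coefficient of \<open>z\<close> in \<open>[x, y]\<close>.
\<close>

record 'x lie_super =
  units :: "'x set"
  odd_unit :: "'x \<Rightarrow> bool"
  struct :: "'x \<Rightarrow> 'x \<Rightarrow> 'x \<Rightarrow> complex"

definition koszul :: "bool \<Rightarrow> bool \<Rightarrow> complex" where
  "koszul p q = (if p \<and> q then -1 else 1)"

text \<open>\<open>gl(m|n)\<close>, the pair \<open>(a, b)\<close> being the matrix unit \<open>E\<^sub>a\<^sub>b\<close>.\<close>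

definition gl :: "nat \<Rightarrow> nat \<Rightarrow> (sindex \<times> sindex) lie_super" where
  "gl m n = \<lparr> units = sidx m n \<times> sidx m n,
     odd_unit = (\<lambda>(a, b). odd_idx a \<noteq> odd_idx b),
     struct = (\<lambda>(a, b) (c, d) z.
       of_bool (b = c \<and> z = (a, d))
       - koszul (odd_idx a \<noteq> odd_idx b) (odd_idx c \<noteq> odd_idx d) * of_bool (a = d \<and> z = (c, b))) \<rparr>"

definition lie_prod :: "'x lie_super \<Rightarrow> 'y lie_super \<Rightarrow> ('x + 'y) lie_super" where
  "lie_prod g h = \<lparr> units = units g <+> units h,
     odd_unit = case_sum (odd_unit g) (odd_unit h),
     struct = (\<lambda>x y z. case (x, y, z) of
         (Inl x', Inl y', Inl z') \<Rightarrow> struct g x' y' z'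
       | (Inr x', Inr y', Inr z') \<Rightarrow> struct h x' y' z'
       | _ \<Rightarrow> 0) \<rparr>"

text \<open>\<open>hpart M False\<close> and \<open>hpart M True\<close> are the even and the odd part of the module.\<close>

record ('x, 'v) rep =
  scal :: "complex \<Rightarrow> 'v \<Rightarrow> 'v"
  hpart :: "bool \<Rightarrow> 'v set"
  act :: "'x \<Rightarrow> 'v \<Rightarrow> 'v"

definition space :: "('x, 'v::ab_group_add) rep \<Rightarrow> 'v set" where
  "space M = {u + v | u v. u \<in> hpart M False \<and> v \<in> hpart M True}"

definition supermodule :: "'x lie_super \<Rightarrow> ('x, 'v::ab_group_add) rep \<Rightarrow> bool" where
  "supermodule g M \<longleftrightarrow>
     vector_space (scal M) \<and>
     (\<forall>s. module.subspace (scal M) (hpart M s)) \<and>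
     hpart M False \<inter> hpart M True = {0} \<and>
     (\<forall>x \<in> units g. \<forall>u \<in> space M. \<forall>v \<in> space M. act M x (u + v) = act M x u + act M x v) \<and>
     (\<forall>x \<in> units g. \<forall>c. \<forall>v \<in> space M. act M x (scal M c v) = scal M c (act M x v)) \<and>
     (\<forall>x \<in> units g. \<forall>s. \<forall>v \<in> hpart M s. act M x v \<in> hpart M (s \<noteq> odd_unit g x)) \<and>
     (\<forall>x \<in> units g. \<forall>y \<in> units g. \<forall>v \<in> space M.
        act M x (act M y v) - scal M (koszul (odd_unit g x) (odd_unit g y)) (act M y (act M x v))
        = (\<Sum>z \<in> units g. scal M (struct g x y z) (act M z v)))"

definition submodule :: "'x lie_super \<Rightarrow> ('x, 'v::ab_group_add) rep \<Rightarrow> 'v set \<Rightarrow> bool" where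
  "submodule g M U \<longleftrightarrow>
     module.subspace (scal M) U \<and>
     U = {u + v | u v. u \<in> U \<inter> hpart M False \<and> v \<in> U \<inter> hpart M True} \<and>
     (\<forall>x \<in> units g. \<forall>v \<in> U. act M x v \<in> U)"

definition subrep :: "('x, 'v) rep \<Rightarrow> 'v set \<Rightarrow> ('x, 'v) rep" where
  "subrep M U = M\<lparr>hpart := \<lambda>s. hpart M s \<inter> U\<rparr>"

definition irreducible_rep :: "'x lie_super \<Rightarrow> ('x, 'v::ab_group_add) rep \<Rightarrow> bool" where
  "irreducible_rep g M \<longleftrightarrow> supermodule g M \<and> space M \<noteq> {0} \<and>
     (\<forall>U. submodule g M U \<longrightarrow> U = {0} \<or> U = space M)"

text \<open>Isomorphism of modules, possibly exchanging the even and the odd part.\<close>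

definition rep_iso :: "'x lie_super \<Rightarrow> ('x, 'v::ab_group_add) rep \<Rightarrow> ('x, 'w::ab_group_add) rep \<Rightarrow> bool" where
  "rep_iso g M N \<longleftrightarrow> (\<exists>\<phi> \<epsilon>.
     bij_betw \<phi> (space M) (space N) \<and>
     (\<forall>u \<in> space M. \<forall>v \<in> space M. \<phi> (u + v) = \<phi> u + \<phi> v) \<and>
     (\<forall>c. \<forall>v \<in> space M. \<phi> (scal M c v) = scal N c (\<phi> v)) \<and>
     (\<forall>s. \<phi> ` hpart M s = hpart N (s \<noteq> \<epsilon>)) \<and>
     (\<forall>x \<in> units g. \<forall>v \<in> space M. \<phi> (act M x v) = act N x (\<phi> v)))"

text \<open>The members of \<open>\<D>\<close> are irreducible submodules of which \<open>M\<close> is the direct sum.\<close>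

definition decomposition :: "'x lie_super \<Rightarrow> ('x, 'v::ab_group_add) rep \<Rightarrow> 'v set set \<Rightarrow> bool" where
  "decomposition g M \<D> \<longleftrightarrow>
     (\<forall>U \<in> \<D>. submodule g M U \<and> irreducible_rep g (subrep M U)) \<and>
     (\<forall>v \<in> space M. \<exists>!f. (\<forall>U \<in> \<D>. f U \<in> U) \<and> (\<forall>U. U \<notin> \<D> \<longrightarrow> f U = 0) \<and>
        finite {U. f U \<noteq> 0} \<and> v = (\<Sum>U | f U \<noteq> 0. f U))"

definition appears_in_decomposition ::
    "'x lie_super \<Rightarrow> ('x, 'v::ab_group_add) rep \<Rightarrow> ('x, 'w::ab_group_add) rep \<Rightarrow> bool" where
  "appears_in_decomposition g M W \<longleftrightarrow>
     (\<exists>\<D>. decomposition g M \<D> \<and> (\<exists>U \<in> \<D>. rep_iso g (subrep M U) W))"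

definition basis_of :: "('x, 'v::ab_group_add) rep \<Rightarrow> 'v set \<Rightarrow> bool" where
  "basis_of M B \<longleftrightarrow> \<not> module.dependent (scal M) B \<and> module.span (scal M) B = space M"

text \<open>
  \<open>\<beta>\<close> exhibits \<open>T\<close> as the tensor product of the \<open>g\<close>-module \<open>M\<close> and the \<open>h\<close>-module \<open>N\<close>,
  \<open>\<beta> v u\<close> being the tensor of \<open>v\<close> and \<open>u\<close>.
\<close>

definition tensor_via :: "'x lie_super \<Rightarrow> 'y lie_super \<Rightarrow> ('x, 'a::ab_group_add) rep \<Rightarrow>
    ('y, 'b::ab_group_add) rep \<Rightarrow> ('x + 'y, 'c::ab_group_add) rep \<Rightarrow> ('a \<Rightarrow> 'b \<Rightarrow> 'c) \<Rightarrow> bool" where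
  "tensor_via g h M N T \<beta> \<longleftrightarrow>
     (\<forall>v \<in> space M. \<forall>v' \<in> space M. \<forall>u \<in> space N. \<beta> (v + v') u = \<beta> v u + \<beta> v' u) \<and>
     (\<forall>v \<in> space M. \<forall>u \<in> space N. \<forall>u' \<in> space N. \<beta> v (u + u') = \<beta> v u + \<beta> v u') \<and>
     (\<forall>c. \<forall>v \<in> space M. \<forall>u \<in> space N.
        \<beta> (scal M c v) u = scal T c (\<beta> v u) \<and> \<beta> v (scal N c u) = scal T c (\<beta> v u)) \<and>
     (\<forall>B C. basis_of M B \<and> basis_of N C \<longrightarrow>
        inj_on (\<lambda>(v, u). \<beta> v u) (B \<times> C) \<and> basis_of T ((\<lambda>(v, u). \<beta> v u) ` (B \<times> C))) \<and>
     (\<forall>s t. \<forall>v \<in> hpart M s. \<forall>u \<in> hpart N t. \<beta> v u \<in> hpart T (s \<noteq> t)) \<and>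
     (\<forall>x \<in> units g. \<forall>v \<in> space M. \<forall>u \<in> space N. act T (Inl x) (\<beta> v u) = \<beta> (act M x v) u) \<and>
     (\<forall>y \<in> units h. \<forall>s. \<forall>v \<in> hpart M s. \<forall>u \<in> space N.
        act T (Inr y) (\<beta> v u) = scal T (koszul (odd_unit h y) s) (\<beta> v (act N y u)))"

definition simple_roots :: "nat \<Rightarrow> nat \<Rightarrow> (sindex \<times> sindex) set" where
  "simple_roots m n =
     {(Inl (i - 1), Inl i) | i. 1 < i \<and> i \<le> m} \<union>
     {(Inr (j - 1), Inr j) | j. 1 < j \<and> j \<le> n} \<union>
     (if 1 \<le> m \<and> 1 \<le> n then {(Inl m, Inr 1)} else {})"

definition highest_weight_vector :: "nat \<Rightarrow> nat \<Rightarrow> (complex \<Rightarrow> 'v \<Rightarrow> 'v) \<Rightarrow>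
    (sindex \<times> sindex \<Rightarrow> 'v \<Rightarrow> 'v::ab_group_add) \<Rightarrow> (sindex \<Rightarrow> nat) \<Rightarrow> 'v \<Rightarrow> bool" where
  "highest_weight_vector m n s \<rho> \<mu> v \<longleftrightarrow> v \<noteq> 0 \<and>
     (\<forall>a \<in> sidx m n. \<rho> (a, a) v = s (of_nat (\<mu> a)) v) \<and>
     (\<forall>\<alpha> \<in> simple_roots m n. \<rho> \<alpha> v = 0)"


section \<open>Young diagrams and the modules attached to them\<close>

definition young :: "nat list \<Rightarrow> bool" where
  "young \<nu> \<longleftrightarrow> sorted_wrt (\<ge>) \<nu> \<and> 0 \<notin> set \<nu>"

definition row :: "nat list \<Rightarrow> nat \<Rightarrow> nat" where
  "row \<nu> i = (if 1 \<le> i \<and> i \<le> length \<nu> then \<nu> ! (i - 1) else 0)"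

text \<open>The parts of the transpose; \<open>col \<nu> 0\<close> is a dummy value.\<close>

definition col :: "nat list \<Rightarrow> nat \<Rightarrow> nat" where
  "col \<nu> j = card {i \<in> {1..length \<nu>}. j \<le> row \<nu> i}"

text \<open>Truncated subtraction is \<open>\<langle>\<nu>'\<^sub>j - m\<rangle>\<close>.\<close>

definition hook_weight :: "nat \<Rightarrow> nat list \<Rightarrow> sindex \<Rightarrow> nat" where
  "hook_weight m \<nu> a = (case a of Inl i \<Rightarrow> row \<nu> i | Inr j \<Rightarrow> col \<nu> j - m)"

definition is_V :: "nat \<Rightarrow> nat \<Rightarrow> nat list \<Rightarrow> (sindex \<times> sindex, 'v::ab_group_add) rep \<Rightarrow> bool" where
  "is_V m n \<nu> V \<longleftrightarrow> irreducible_rep (gl m n) V \<and>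
     (\<exists>v \<in> space V. highest_weight_vector m n (scal V) (act V) (hook_weight m \<nu>) v)"

text \<open>
  \<open>W\<close> is isomorphic to the tensor product of the irreducible modules attached to \<open>\<nu>\<close>. These have
  finite dimension, hence may be realised on subspaces of a space of countable dimension.
\<close>

definition is_VV :: "nat \<Rightarrow> nat \<Rightarrow> nat \<Rightarrow> nat list \<Rightarrow>
    ((sindex \<times> sindex) + (sindex \<times> sindex), 'w::ab_group_add) rep \<Rightarrow> bool" where
  "is_VV m q n \<nu> W \<longleftrightarrow> supermodule (lie_prod (gl m q) (gl m n)) W \<and>
     (\<exists>(V\<^sub>1 :: (sindex \<times> sindex, nat \<Rightarrow>\<^sub>0 complex) rep) (V\<^sub>2 :: (sindex \<times> sindex, nat \<Rightarrow>\<^sub>0 complex) rep) \<beta>.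
        is_V m q \<nu> V\<^sub>1 \<and> is_V m n \<nu> V\<^sub>2 \<and> tensor_via (gl m q) (gl m n) V\<^sub>1 V\<^sub>2 W \<beta>)"


section \<open>The action on the polynomial superalgebra\<close>

text \<open>
  The matrix unit \<open>E\<^sub>c\<^sub>d\<close> of \<open>gl(m|n)\<close> acts on the second tensor factor of
  \<open>\<complex>\<^sup>p\<^sup>|\<^sup>q \<otimes> \<complex>\<^sup>m\<^sup>|\<^sup>n\<close>, hence the sign.
\<close>

fun poly_act :: "nat \<Rightarrow> nat \<Rightarrow> nat \<Rightarrow> nat \<Rightarrow> (sindex \<times> sindex) + (sindex \<times> sindex) \<Rightarrow>
    superpoly \<Rightarrow> superpoly" where
  "poly_act p q m n (Inl (a, b)) f = (\<Sum>c \<in> sidx m n. gen a c * gen_deriv b c f)"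
| "poly_act p q m n (Inr (c, d)) f = (\<Sum>a \<in> sidx p q.
     sp_scale (koszul (odd_idx a) (odd_idx c \<noteq> odd_idx d)) (gen a c * gen_deriv a d f))"

definition poly_rep :: "nat \<Rightarrow> nat \<Rightarrow> nat \<Rightarrow> nat \<Rightarrow>
    ((sindex \<times> sindex) + (sindex \<times> sindex), superpoly) rep" where
  "poly_rep p q m n = \<lparr> scal = sp_scale,
     hpart = (\<lambda>s. {f \<in> superpolys p q m n. \<forall>S. gcoeff f S \<noteq> 0 \<longrightarrow> odd (card S) = s}),
     act = poly_act p q m n \<rparr>"

definition joint_hw_vector :: "nat \<Rightarrow> nat \<Rightarrow> nat \<Rightarrow> nat list \<Rightarrow> superpoly \<Rightarrow> bool" where
  "joint_hw_vector m q n \<nu> f \<longleftrightarrow> f \<in> superpolys m q m n \<and>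
     highest_weight_vector m q sp_scale (\<lambda>x. poly_act m q m n (Inl x)) (hook_weight m \<nu>) f \<and>
     highest_weight_vector m n sp_scale (\<lambda>x. poly_act m q m n (Inr x)) (hook_weight m \<nu>) f"


section \<open>Determinants\<close>

definition sdet :: "nat \<Rightarrow> (nat \<Rightarrow> nat \<Rightarrow> superpoly) \<Rightarrow> superpoly" where
  "sdet r a = (\<Sum>\<sigma> | \<sigma> permutes {1..r}.
     of_int (sign \<sigma>) * prod_list (map (\<lambda>i. a i (\<sigma> i)) [1..<r + 1]))"

definition Delta :: "nat \<Rightarrow> superpoly" where
  "Delta r = sdet r (\<lambda>l i. sp_even (X l i))"

text \<open>A marked diagram is given by its set of marked boxes \<open>(row, column)\<close>.\<close>

definition marked_diagrams :: "nat \<Rightarrow> nat \<Rightarrow> (nat \<times> nat) set set" where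
  "marked_diagrams m r = {D. D \<subseteq> {1..m} \<times> {1..r} \<and>
     (\<forall>j j' i. (j, i) \<in> D \<and> (j', i) \<in> D \<longrightarrow> j = j')}"

definition X_entry :: "(nat \<times> nat) set \<Rightarrow> nat \<Rightarrow> nat \<Rightarrow> nat \<Rightarrow> superpoly" where
  "X_entry D i l c = (if (l, i) \<in> D then sp_odd (Eta i c) else sp_even (X l c))"

definition Y_entry :: "(nat \<times> nat) set \<Rightarrow> nat \<Rightarrow> nat \<Rightarrow> superpoly" where
  "Y_entry D i c = (if \<exists>j. (j, i) \<in> D then sp_odd (Xi (THE j. (j, i) \<in> D) c) else sp_even (Y i c))"

definition Gamma :: "nat \<Rightarrow> nat \<Rightarrow> superpoly" where
  "Gamma m r = (\<Sum>D \<in> marked_diagrams m r.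
     (-1) ^ (card D * (card D - 1) div 2) *
     (prod_list (map (\<lambda>i. sdet m (X_entry D i)) [1..<r + 1]) * sdet r (Y_entry D)))"

end

theory Submission
 imports Defs "HOL-Library.Product_Plus" "HOL-Library.FuncSet" "HOL-Library.Countable_Set"
  "Jordan_Normal_Form.Determinant"
begin

text \<open>
 The proof is a super version of Howe's approach to dual pairs. The polynomial superalgebra carries the
 Fischer inner product, for which \<open>E\<^sub>a\<^sub>b\<close> and \<open>E\<^sub>b\<^sub>a\<close> are adjoint in both actions. A vector killed by the
 raising operators therefore generates an irreducible submodule (\<open>K_irreducible\<close>), the whole module is a
 direct sum of such submodules (\<open>submodule_has_singular\<close>, \<open>complete_reducibility\<close>), and irreducible
 modules with the same highest weight are isomorphic (\<open>irreducible_singular_iso\<close>).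

 Which weights occur? Look at a monomial of least off-diagonal degree in a joint highest weight vector: the
 raising operators force it to be a product of diagonal variables, so the two weights coincide. Positivity
 makes them decreasing, and odd reflections give the hook condition; thus the weights come from a Young
 diagram with \<open>\<lambda>\<^sub>m\<^sub>+\<^sub>1 \<le> min q n\<close> (\<open>joint_singular_hook\<close>). The submodule generated by such a vector \<open>f\<close> is a
 tensor product: after a sign twist the operators of the second factor commute with those of the first, and
 \<open>(g f, T f) \<mapsto> T g f\<close> is well defined and, up to a scalar, isometric (\<open>ip_tensor_map\<close>,
 \<open>component_tensor\<close>).

 It remains to exhibit a joint highest weight vector for each diagram in the hook. Let \<open>D\<^sub>k\<^sub>l\<close> be \<open>\<Delta>\<^sub>m\<close> with its
 \<open>l\<close>-th row replaced by the variables \<open>\<eta>\<^sub>k\<close>. The sum over marked diagrams is the expansion of a determinant over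
 the commutative ring of even elements, \<open>\<Gamma>\<^sub>r = det (w\<^sub>k\<^sup>j)\<close> with \<open>w\<^sub>k\<^sup>j = \<Delta>\<^sub>m y\<^sub>k\<^sup>j + \<Sum>\<^sub>l D\<^sub>k\<^sub>l \<xi>\<^sub>l\<^sup>j\<close> (\<open>Gamma_rep\<close>). By
 Cramer's rule the odd simple root vectors kill the entries \<open>w\<close>, while the even ones act by row and column
 operations; hence products of \<open>\<Delta>\<close>'s and \<open>\<Gamma>\<close>'s are joint highest weight vectors (\<open>hwp_Delta\<close>, \<open>hwp_Gamma\<close>).
 For the division, the odd derivation taking \<open>x\<^sub>l\<close> to \<open>\<eta>\<^sub>k\<close> shows inductively that \<open>D\<^sub>k\<^sub>l\<^sub>1 \<cdots> D\<^sub>k\<^sub>l\<^sub>c\<close> is divisible by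
 \<open>\<Delta>\<^sub>m\<^sup>c\<^sup>-\<^sup>1\<close>. So a product of \<open>N\<close> entries of the row \<open>k\<close> is divisible by \<open>\<Delta>\<^sub>m\<^sup>N\<^sup>-\<^sup>1\<close>, and adding up over the rows gives
 exactly the required power (\<open>Gamma_product_divisible\<close>). Since \<open>\<Delta>\<^sub>m\<close> is not a zero divisor, the quotient is unique
 and inherits weights and annihilation (\<open>hwp_div\<close>).
\<close>

hide_const (open) Matrix.row Matrix.col Module.submodule

section \<open>Monomials and the canonical commutation relations\<close>

type_synonym mono = "odd_var set \<times> (even_var \<Rightarrow>\<^sub>0 nat)"
type_synonym svar = "even_var + odd_var"

text \<open>
 Elements are studied through their coefficients at monomials, a monomial being a pair of
 a finite set of odd variables and an exponent vector of the even ones.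
\<close>

definition cf :: "superpoly => mono => complex" where
 "cf f x = Poly_Mapping.lookup (gcoeff f (fst x)) (snd x)"

lemma cf_eqI: "(\<And>x. cf f x = cf g x) ==> f = g"
 unfolding cf_def by (intro gcoeff_inject_fun poly_mapping_eqI) (metis fst_conv snd_conv)

lemma gcoeff_minus: "gcoeff (f - g) S = gcoeff f S - gcoeff g S" for f g :: superpoly
 unfolding minus_grassmann_def plus_grassmann.rep_eq uminus_grassmann.rep_eq by simp

lemma gcoeff_sum: "gcoeff (sum h I) S = (\<Sum>i\<in>I. gcoeff (h i) S)" for h :: "'i => superpoly"
 by (induction I rule: infinite_finite_induct)
  (simp_all add: zero_grassmann.rep_eq plus_grassmann.rep_eq)

lemma cf_zero [simp]: "cf 0 x = 0"
 and cf_add [simp]: "cf (f + g) x = cf f x + cf g x"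
 and cf_uminus [simp]: "cf (- f) x = - cf f x"
 and cf_minus [simp]: "cf (f - g) x = cf f x - cf g x"
 by (simp_all add: cf_def zero_grassmann.rep_eq plus_grassmann.rep_eq uminus_grassmann.rep_eq
   lookup_add gcoeff_minus lookup_minus)

lemma cf_sum [simp]: "cf (sum h I) x = (\<Sum>i\<in>I. cf (h i) x)"
 by (simp add: cf_def gcoeff_sum lookup_sum)

lemma cf_infinite: "infinite (fst x) ==> cf f x = 0"
 by (simp add: cf_def gcoeff_infinite)

lemma gcoeff_gterm_mult: "gcoeff (gterm {} p * f) S = p * gcoeff f S"
proof (cases "finite S")
 case True
 have "gcoeff (gterm {} p * f) S = (\<Sum>T\<in>Pow S. if T = {} then p * gcoeff f S else 0)"
  unfolding times_grassmann.rep_eq by (rule sum.cong) (auto simp: gterm.rep_eq)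
 then show ?thesis using True by simp
qed (simp add: gcoeff_infinite)

lemma gcoeff_odd_mult:
 "gcoeff (gterm {v} 1 * f) S = (if v \<in> S then shuffle_sign {v} (S - {v}) * gcoeff f (S - {v}) else 0)"
proof (cases "finite S")
 case True
 have "gcoeff (gterm {v} 1 * f) S
   = (\<Sum>T\<in>Pow S. if T = {v} then shuffle_sign {v} (S - {v}) * gcoeff f (S - {v}) else 0)"
  unfolding times_grassmann.rep_eq by (rule sum.cong) (auto simp: gterm.rep_eq)
 also have "\<dots> = (if {v} \<in> Pow S then shuffle_sign {v} (S - {v}) * gcoeff f (S - {v}) else 0)"
  by (rule sum.delta) (use True in simp)
 finally show ?thesis by (simp only: Pow_iff insert_subset empty_subsetI simp_thms)
qed (simp add: gcoeff_infinite)

lemma lookup_single_mult: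
 "Poly_Mapping.lookup (Poly_Mapping.single (k :: 'a \<Rightarrow>\<^sub>0 nat) (c :: 'b::comm_semiring_1) * p) (k + x) = c * Poly_Mapping.lookup p x"
 unfolding lookup_mult lookup_single by (simp add: when_mult)

lemma lookup_single_mult_0:
 assumes "\<And>y. x \<noteq> k + y"
 shows "Poly_Mapping.lookup (Poly_Mapping.single (k :: 'a \<Rightarrow>\<^sub>0 nat) (c :: 'b::comm_semiring_1) * p) x = 0"
 unfolding lookup_mult lookup_single using assms by (simp add: when_mult)

lemma cf_scale [simp]: "cf (sp_scale c f) x = c * cf f x"
 unfolding cf_def sp_scale_def gcoeff_gterm_mult
 using lookup_single_mult[of 0 c "gcoeff f (fst x)" "snd x"] by simp

lemma vector_space_scale: "vector_space sp_scale"
 by unfold_locales (rule cf_eqI, simp add: algebra_simps)+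

interpretation SP: vector_space sp_scale by (rule vector_space_scale)

fun up :: "svar => mono => mono" where
 "up (Inl v) x = (fst x, Poly_Mapping.single v 1 + snd x)"
| "up (Inr v) x = (insert v (fst x), snd x)"

fun down :: "svar => mono => mono" where
 "down (Inl v) x = (fst x, snd x - Poly_Mapping.single v 1)"
| "down (Inr v) x = (fst x - {v}, snd x)"

fun cnt :: "svar => mono => nat" where
 "cnt (Inl v) x = Poly_Mapping.lookup (snd x) v"
| "cnt (Inr v) x = of_bool (v \<in> fst x)"

text \<open>An odd variable can be adjoined to a monomial at most once.\<close>

fun raisable :: "svar => mono => bool" where
 "raisable (Inl v) x = True"
| "raisable (Inr v) x = (v \<notin> fst x)"

text \<open>
 The sign picked up when an odd variable is moved to its place in a sorted monomial; it governs both
 multiplication by a variable and the derivative.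
\<close>

fun eps :: "svar => mono => complex" where
 "eps (Inl v) x = 1"
| "eps (Inr v) x = shuffle_sign {v} (fst x)"

fun oddv :: "svar => bool" where
 "oddv (Inl v) = False"
| "oddv (Inr v) = True"

fun zv :: "svar => superpoly" where
 "zv (Inl v) = sp_even v"
| "zv (Inr v) = sp_odd v"

fun dd :: "svar => superpoly => superpoly" where
 "dd (Inl v) f = coeff_map (even_poly_deriv v) f"
| "dd (Inr v) f = odd_deriv v f"

abbreviation zz :: "svar => superpoly => superpoly" where "zz A f \<equiv> zv A * f"

lemma down_up: "raisable A x ==> down A (up A x) = x"
 by (cases A) (auto simp: prod_eq_iff)

lemma single_add_diff:
 "Poly_Mapping.lookup e v > 0 ==> Poly_Mapping.single v 1 + (e - Poly_Mapping.single v (1::nat)) = e"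
 by (rule poly_mapping_eqI) (auto simp: lookup_add lookup_minus lookup_single when_def)

lemma up_down: "cnt A x > 0 ==> up A (down A x) = x"
 by (cases A) (auto simp: prod_eq_iff single_add_diff simp del: One_nat_def split: if_splits)

lemma raisable_down: "cnt A x > 0 ==> raisable A (down A x)"
 by (cases A) auto

lemma cnt_up: "raisable A x ==> cnt A (up A x) = Suc (cnt A x)"
 by (cases A) (auto simp: lookup_add)

lemma cnt_up_other: "A \<noteq> B ==> cnt B (up A x) = cnt B x"
 by (cases A; cases B) (auto simp: lookup_add lookup_single)

lemma cnt_down_other: "A \<noteq> B ==> cnt B (down A x) = cnt B x"
 by (cases A; cases B) (auto simp: lookup_minus lookup_single)

lemma cnt_odd: "oddv A ==> cnt A x = (if raisable A x then 0 else 1)"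
 by (cases A) auto

lemma raisable_even: "\<not> oddv A ==> raisable A x"
 by (cases A) auto

lemma raisable_other: "A \<noteq> B ==> raisable A (up B x) = raisable A x" "A \<noteq> B ==> raisable A (down B x) = raisable A x"
 by (cases A; cases B; auto)+

lemma up_up: "up A (up B x) = up B (up A x)"
 by (cases A; cases B) (auto simp: add_ac)

lemma down_down: "down A (down B x) = down B (down A x)"
 by (cases A; cases B) (auto intro!: poly_mapping_eqI simp: lookup_minus)

lemma up_down_commute: "A \<noteq> B ==> down B (up A x) = up A (down B x)"
 by (cases A; cases B)
  (auto intro!: poly_mapping_eqI simp: lookup_minus lookup_add lookup_single when_def)

lemma eps_square: "eps A x * eps A x = 1"
 by (cases A) (auto simp: shuffle_sign_def power_mult_distrib[symmetric])

lemma eps_nz [simp]: "eps A x \<noteq> 0"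
 using eps_square[of A x] by auto

lemma shuffle_sign_insert:
 assumes "finite T" "b \<notin> T" "a \<noteq> b"
 shows "shuffle_sign {a} (insert b T) = (if b < a then -1 else 1) * (shuffle_sign {a} T :: 'c::comm_ring_1)"
proof -
 have "shuffle_sign {a} ({b} \<union> T) = (shuffle_sign {a} {b} * shuffle_sign {a} T :: 'c)"
  by (rule shuffle_sign_Un_right) (use assms in auto)
 moreover have "shuffle_sign {a} {b} = (if b < a then -1 else 1 :: 'c)"
 proof (cases "b < a")
  case True
  then have "{(s, t). s = a \<and> t = b \<and> t < s} = {(a, b)}" by auto
  then show ?thesis using True by (simp add: shuffle_sign_def)
 next
  case False
  then have e: "{(s, t). s = a \<and> t = b \<and> t < s} = {}" by auto
  show ?thesis using False unfolding shuffle_sign_def by (simp add: e)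
 qed
 ultimately show ?thesis by simp
qed

lemma eps_exchange:
 assumes "finite (fst x)" "A \<noteq> B" "raisable A x" "raisable B x"
 shows "eps A (up B x) * eps B x = (if oddv A \<and> oddv B then -1 else 1) * (eps B (up A x) * eps A x)"
proof (cases "oddv A \<and> oddv B")
 case False
 then show ?thesis by (cases A; cases B) auto
next
 case True
 then obtain a b where ab: "A = Inr a" "B = Inr b" by (cases A; cases B) auto
 with assms have *: "finite (fst x)" "a \<notin> fst x" "b \<notin> fst x" "a \<noteq> b" by auto
 have "(b < a) \<noteq> (a < b)" using *(4) by auto
 then show ?thesis
  using * by (auto simp: ab shuffle_sign_insert)
qed

lemma finite_up [simp]: "finite (fst (up A x)) = finite (fst x)"
 by (cases A) auto

lemma finite_down [simp]: "finite (fst (down A x)) = finite (fst x)"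
 by (cases A) auto

lemma cf_zz: "cf (zz A f) x = (if cnt A x > 0 then eps A (down A x) * cf f (down A x) else 0)"
proof (cases A)
 case (Inl v)
 show ?thesis
 proof (cases "Poly_Mapping.lookup (snd x) v > 0")
  case True
  then have "cf (zz A f) x = Poly_Mapping.lookup (Poly_Mapping.single (Poly_Mapping.single v 1) 1 * gcoeff f (fst x))
    (Poly_Mapping.single v 1 + (snd x - Poly_Mapping.single v 1))"
   unfolding Inl zv.simps sp_even_def cf_def gcoeff_gterm_mult by (simp add: single_add_diff del: One_nat_def)
  then show ?thesis unfolding lookup_single_mult using True by (simp add: Inl cf_def)
 next
  case False
  have "cf (zz A f) x = 0"
   unfolding Inl zv.simps sp_even_def cf_def gcoeff_gterm_mult
   by (rule lookup_single_mult_0) (use False in \<open>auto simp: lookup_add\<close>)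
  then show ?thesis using False by (simp add: Inl)
 qed
next
 case (Inr v)
 have "Poly_Mapping.lookup (shuffle_sign {v} (fst x - {v}) * p) e = shuffle_sign {v} (fst x - {v}) * Poly_Mapping.lookup p e"
  for p :: even_poly and e
  by (cases "even (card {(s, t). s \<in> {v} \<and> t \<in> fst x - {v} \<and> t < s})") (auto simp: shuffle_sign_def)
 then show ?thesis by (simp add: Inr cf_def sp_odd_def gcoeff_odd_mult)
qed

lemma cf_dd: "cf (dd A f) x = (if raisable A x then of_nat (cnt A x + 1) * eps A x * cf f (up A x) else 0)"
proof (cases A)
 case (Inl v)
 then show ?thesis
  by (simp add: cf_def coeff_map.rep_eq even_poly_deriv.rep_eq add.commute)
next
 case (Inr v)
 have "Poly_Mapping.lookup (shuffle_sign {v} (fst x) * p) e = shuffle_sign {v} (fst x) * Poly_Mapping.lookup p e"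
  for p :: even_poly and e
  by (cases "even (card {(s, t). s \<in> {v} \<and> t \<in> fst x \<and> t < s})") (auto simp: shuffle_sign_def)
 then show ?thesis by (simp add: Inr cf_def odd_deriv.rep_eq)
qed

definition vsign :: "svar => svar => complex" where
 "vsign A B = koszul (oddv A) (oddv B)"

text \<open>
 Together with \<open>dd_zz\<close> and \<open>dd_dd\<close> these are the canonical (anti)commutation relations. Every later
 computation with the two actions is a consequence of them; on coefficients they reduce to
 \<open>eps_exchange\<close>.
\<close>

lemma zz_zz: "zz A (zz B f) = sp_scale (vsign A B) (zz B (zz A f))"
proof (rule cf_eqI)
 fix x
 show "cf (zz A (zz B f)) x = cf (sp_scale (vsign A B) (zz B (zz A f))) x"
 proof (cases "finite (fst x)")
  case fin: True
  show ?thesis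
  proof (cases "A = B")
   case True
   show ?thesis
   proof (cases "oddv A")
    case True
    then have "\<not> cnt A (down A x) > 0" using raisable_down[of A x] cnt_odd[of A "down A x"] by (cases A) auto
    then show ?thesis using \<open>A = B\<close> by (simp add: cf_zz)
   next
    case False
    then show ?thesis using \<open>A = B\<close> by (simp add: vsign_def koszul_def)
   qed
  next
   case ne: False
   show ?thesis
   proof (cases "cnt A x > 0 \<and> cnt B x > 0")
    case True
    define y where "y = down A (down B x)"
    have c: "cnt A (down B x) > 0" "cnt B (down A x) > 0"
     using True ne by (simp_all add: cnt_down_other)
    have y2: "y = down B (down A x)" by (simp only: y_def down_down[of A B])
    have y: "finite (fst y)" "up A y = down B x" "up B y = down A x"
     using fin up_down[OF c(1)] up_down[OF c(2)] by (simp_all add: y_def) (simp add: down_down[of A B])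
    have r: "raisable A y" "raisable B y"
     using raisable_down[OF c(1)] raisable_down[OF c(2)] by (simp_all only: y_def down_down[of A B])
    have "cf (zz A (zz B f)) x = eps A (up B y) * eps B y * cf f y"
     using True c y(3) by (simp add: cf_zz y2[symmetric])
    moreover have "cf (zz B (zz A f)) x = eps B (up A y) * eps A y * cf f y"
     using True c y(2) by (simp add: cf_zz y_def[symmetric])
    ultimately show ?thesis using eps_exchange[OF y(1) ne r]
     by (simp add: vsign_def koszul_def)
   next
    case False
    then show ?thesis using ne by (auto simp: cf_zz cnt_down_other)
   qed
  qed
 qed (simp add: cf_infinite)
qed

lemma dd_zz: "dd A (zz B f) = (if A = B then f else 0) + sp_scale (vsign A B) (zz B (dd A f))"
proof (rule cf_eqI)
 fix x
 show "cf (dd A (zz B f)) x = cf ((if A = B then f else 0) + sp_scale (vsign A B) (zz B (dd A f))) x"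
 proof (cases "finite (fst x)")
  case fin: True
  show ?thesis
  proof (cases "A = B")
   case True
   have 1: "cf (dd A (zz A f)) x = (if raisable A x then of_nat (cnt A x + 1) * cf f x else 0)"
    using eps_square[of A x] by (auto simp: cf_dd cf_zz cnt_up down_up)
   have 2: "cf (zz A (dd A f)) x = of_nat (cnt A x) * cf f x"
   proof (cases "cnt A x > 0")
    case True
    then have c: "cnt A (down A x) + 1 = cnt A x" using cnt_up[OF raisable_down[OF True]] up_down[OF True] by simp
    have "cf (zz A (dd A f)) x = of_nat (cnt A (down A x) + 1) * (eps A (down A x) * eps A (down A x)) * cf f x"
     using True by (simp add: cf_dd cf_zz raisable_down up_down)
    then show ?thesis unfolding c eps_square by simp
   qed (simp add: cf_zz)
   show ?thesis
    using True 1 2 cnt_odd[of A x] raisable_even[of A x]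
    by (auto simp: vsign_def koszul_def algebra_simps)
  next
   case ne: False
   show ?thesis
   proof (cases "raisable A x \<and> cnt B x > 0")
    case True
    define y where "y = down B x"
    have y: "finite (fst y)" "raisable A y" "raisable B y" "up B y = x" "down B (up A x) = up A y"
     using True ne fin by (auto simp: raisable_other raisable_down up_down y_def up_down_commute)
    have e: "eps A x * eps B (up A y) = vsign A B * (eps B y * eps A y)"
    proof -
     have p: "eps A x * eps B y = vsign A B * (eps B (up A y) * eps A y)"
      using eps_exchange[OF y(1) ne y(2,3)] unfolding y(4) by (simp add: vsign_def koszul_def)
     have "eps A x * eps B (up A y) = (eps A x * eps B y) * (eps B y * eps B (up A y))"
      using eps_square[of B y] by (simp add: mult.assoc[symmetric])
     also have "\<dots> = vsign A B * (eps B y * eps A y) * (eps B (up A y) * eps B (up A y))"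
      unfolding p by (simp only: mult_ac)
     finally show ?thesis by (simp add: eps_square)
    qed
    have c: "cnt A y = cnt A x" "raisable A (down B x)" "cnt B (up A x) > 0"
     using True ne by (auto simp: y_def cnt_down_other raisable_other cnt_up_other)
    have "cf (dd A (zz B f)) x = of_nat (cnt A x + 1) * (eps A x * eps B (up A y)) * cf f (up A y)"
     using True ne c y by (simp add: cf_zz cf_dd)
    also have "\<dots> = vsign A B * cf (zz B (dd A f)) x"
     using True ne c y unfolding e by (simp add: cf_zz cf_dd y_def[symmetric])
    finally show ?thesis using ne by simp
   next
    case False
    then show ?thesis using ne by (auto simp: cf_zz cf_dd cnt_up_other raisable_other)
   qed
  qed
 qed (simp add: cf_infinite)
qed

lemma dd_add [simp]: "dd A (f + g) = dd A f + dd A g"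
 and dd_scale [simp]: "dd A (sp_scale c f) = sp_scale c (dd A f)"
 and dd_zero [simp]: "dd A 0 = 0"
 by (rule cf_eqI; simp add: cf_dd algebra_simps)+

lemma dd_minus [simp]: "dd A (f - g) = dd A f - dd A g"
 and dd_uminus [simp]: "dd A (- f) = - dd A f"
 by (rule cf_eqI; simp add: cf_dd algebra_simps)+

lemma dd_sum [simp]: "dd A (sum h I) = (\<Sum>i\<in>I. dd A (h i))"
 by (induction I rule: infinite_finite_induct) auto

lemma mult_scale_right [simp]: "f * sp_scale c g = sp_scale c (f * g)"
proof (rule gcoeff_inject_fun)
 fix S
 have e: "gcoeff (sp_scale c h) S = Poly_Mapping.single 0 c * gcoeff h S" for h S
  by (simp add: sp_scale_def gcoeff_gterm_mult)
 show "gcoeff (f * sp_scale c g) S = gcoeff (sp_scale c (f * g)) S"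
  unfolding times_grassmann.rep_eq e by (simp add: sum_distrib_left mult_ac)
qed

lemma mult_scale_left [simp]: "sp_scale c f * g = sp_scale c (f * g)"
 by (simp add: sp_scale_def mult.assoc)

lemma dd_dd: "dd A (dd B f) = sp_scale (vsign A B) (dd B (dd A f))"
proof (rule cf_eqI)
 fix x
 show "cf (dd A (dd B f)) x = cf (sp_scale (vsign A B) (dd B (dd A f))) x"
 proof (cases "finite (fst x)")
  case fin: True
  show ?thesis
  proof (cases "A = B")
   case True
   then show ?thesis by (cases A) (auto simp: vsign_def koszul_def cf_dd)
  next
   case ne: False
   show ?thesis
   proof (cases "raisable A x \<and> raisable B x")
    case True
    have c: "raisable A (up B x)" "raisable B (up A x)" "cnt A (up B x) = cnt A x" "cnt B (up A x) = cnt B x"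
     using True ne by (simp_all add: raisable_other cnt_up_other)
    have "cf (dd A (dd B f)) x = of_nat (cnt A x + 1) * of_nat (cnt B x + 1) * (eps A x * eps B (up A x)) * cf f (up A (up B x))"
     using True c by (simp add: cf_dd up_up[of A B])
    moreover have "cf (dd B (dd A f)) x = of_nat (cnt A x + 1) * of_nat (cnt B x + 1) * (eps B x * eps A (up B x)) * cf f (up A (up B x))"
     using True c by (simp add: cf_dd)
    moreover have "eps A x * eps B (up A x) = vsign A B * (eps B x * eps A (up B x))"
     using eps_exchange[OF fin ne] True by (simp add: vsign_def koszul_def mult.commute)
    ultimately show ?thesis by simp
   next
    case False
    then show ?thesis using ne by (auto simp: cf_dd raisable_other)
   qed
  qed
 qed (simp add: cf_infinite)
qed

text \<open>
 Even and odd variables are treated uniformly: \<open>gvar a c\<close> is the variable \<open>gen a c\<close>, which is odd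
 exactly when one of \<open>a\<close>, \<open>c\<close> is.
\<close>

fun gvar :: "sindex => sindex => svar" where
 "gvar (Inl i) (Inl l) = Inl (X l i)"
| "gvar (Inr j) (Inr k) = Inl (Y k j)"
| "gvar (Inr j) (Inl l) = Inr (Xi l j)"
| "gvar (Inl i) (Inr k) = Inr (Eta k i)"

lemma gen_eq: "gen a c = zv (gvar a c)"
 by (cases a; cases c) auto

lemma gen_deriv_eq: "gen_deriv a c = dd (gvar a c)"
 by (rule ext; cases a; cases c) auto

lemma gvar_inject [simp]: "gvar a c = gvar b d \<longleftrightarrow> a = b \<and> c = d"
 by (cases a; cases b; cases c; cases d) auto

lemma oddv_gvar [simp]: "oddv (gvar a c) \<longleftrightarrow> odd_idx a \<noteq> odd_idx c"
 by (cases a; cases c) auto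

section \<open>Modules generated by singular vectors\<close>

text \<open>
 The integer \<open>ht\<close> is a height for which raising operators are positive. The element
 \<open>\<Sum>x. hc x x\<close>, of height zero, acts by the bracket on each basis element by its height, so that its eigenvalues
 separate a highest weight vector from everything below it.
\<close>

locale graded_lie =
 fixes g :: "'x lie_super" and ht :: "'x => int" and hc :: "'x => complex"
 assumes finite_units: "finite (units g)"
  and even_ht0: "x \<in> units g ==> ht x = 0 ==> \<not> odd_unit g x"
  and struct_ht: "[|x \<in> units g; y \<in> units g; z \<in> units g; struct g x y z \<noteq> 0|] ==> ht z = ht x + ht y"
  and grading: "y \<in> units g ==> z \<in> units g ==>
   (\<Sum>x\<in>units g. hc x * struct g x y z) = (if z = y then of_int (ht y) else 0)"
  and hc_ht: "x \<in> units g ==> hc x \<noteq> 0 ==> ht x = 0"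

text \<open>
 Highest weight vectors without a choice of simple roots: all elements of positive height act by zero,
 those of height zero by scalars. For \<open>gl(m|n)\<close> this agrees with the definition by simple root vectors,
 see \<open>singular_gl_iff\<close>.
\<close>

definition singular :: "'x lie_super => ('x => int) => ('x, 'v::ab_group_add) rep => ('x => complex) => 'v => bool" where
 "singular g ht M \<chi> v \<longleftrightarrow> v \<in> space M \<and>
   (\<forall>x\<in>units g. ht x > 0 \<longrightarrow> act M x v = 0) \<and>
   (\<forall>x\<in>units g. ht x = 0 \<longrightarrow> act M x v = scal M (\<chi> x) v)"

locale supermod =
 fixes g :: "'x lie_super" and M :: "('x, 'v::ab_group_add) rep"
 assumes supermodule: "supermodule g M"
begin

sublocale V: vector_space "scal M" using supermodule by (simp add: Defs.supermodule_def)

lemma subspace_hpart: "V.subspace (hpart M s)"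
 using supermodule by (simp add: Defs.supermodule_def)

lemma hpart_Int: "u \<in> hpart M False ==> u \<in> hpart M True ==> u = 0"
 using supermodule unfolding Defs.supermodule_def by blast

lemma zero_hpart [simp]: "0 \<in> hpart M s"
 using V.subspace_0[OF subspace_hpart] .

lemma hpart_space: "u \<in> hpart M s ==> u \<in> space M"
proof -
 assume u: "u \<in> hpart M s"
 show "u \<in> space M"
 proof (cases s)
  case True
  then show ?thesis unfolding Defs.space_def using u by (intro CollectI exI[of _ 0] exI[of _ u]) simp
 next
  case False
  then show ?thesis unfolding Defs.space_def using u by (intro CollectI exI[of _ u] exI[of _ 0]) simp
 qed
qed

lemma spaceE:
 assumes "u \<in> space M"
 obtains u0 u1 where "u0 \<in> hpart M False" "u1 \<in> hpart M True" "u = u0 + u1"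
 using assms unfolding Defs.space_def by blast

lemma spaceI: "u0 \<in> hpart M False ==> u1 \<in> hpart M True ==> u0 + u1 \<in> space M"
 unfolding Defs.space_def by blast

lemma subspace_space: "V.subspace (space M)"
proof (rule V.subspaceI)
 show "0 \<in> space M" by (rule hpart_space[of 0 True]) simp
next
 fix x y assume "x \<in> space M" "y \<in> space M"
 then obtain x0 x1 y0 y1 where "x0 \<in> hpart M False" "x1 \<in> hpart M True" "x = x0 + x1"
  "y0 \<in> hpart M False" "y1 \<in> hpart M True" "y = y0 + y1" by (metis spaceE)
 then have "x + y = (x0 + y0) + (x1 + y1)" "x0 + y0 \<in> hpart M False" "x1 + y1 \<in> hpart M True"
  using V.subspace_add[OF subspace_hpart] by (auto simp: add_ac)
 then show "x + y \<in> space M" using spaceI by metis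
next
 fix c x assume "x \<in> space M"
 then obtain x0 x1 where "x0 \<in> hpart M False" "x1 \<in> hpart M True" "x = x0 + x1" by (metis spaceE)
 then have "scal M c x = scal M c x0 + scal M c x1" "scal M c x0 \<in> hpart M False" "scal M c x1 \<in> hpart M True"
  using V.subspace_scale[OF subspace_hpart] by (auto simp: V.scale_right_distrib)
 then show "scal M c x \<in> space M" using spaceI by metis
qed

lemmas space_add [intro] = V.subspace_add[OF subspace_space]
 and space_scale [intro] = V.subspace_scale[OF subspace_space]
 and space_zero [simp] = V.subspace_0[OF subspace_space]
 and space_sum = V.subspace_sum[OF subspace_space]
 and space_diff [intro] = V.subspace_diff[OF subspace_space]

lemma act_add: "x \<in> units g ==> u \<in> space M ==> v \<in> space M ==> act M x (u + v) = act M x u + act M x v"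
 and act_scale: "x \<in> units g ==> v \<in> space M ==> act M x (scal M c v) = scal M c (act M x v)"
 and act_hpart: "x \<in> units g ==> v \<in> hpart M s ==> act M x v \<in> hpart M (s \<noteq> odd_unit g x)"
 and bracket: "x \<in> units g ==> y \<in> units g ==> v \<in> space M ==>
   act M x (act M y v) - scal M (koszul (odd_unit g x) (odd_unit g y)) (act M y (act M x v))
    = (\<Sum>z \<in> units g. scal M (struct g x y z) (act M z v))"
 using supermodule unfolding Defs.supermodule_def by blast+

lemma act_space [intro]: "x \<in> units g ==> v \<in> space M ==> act M x v \<in> space M"
 by (metis spaceE act_add act_hpart hpart_space space_add)

lemma act_zero [simp]: "x \<in> units g ==> act M x 0 = 0"
 using act_scale[of x 0 0] by simp

lemma act_sum: "x \<in> units g ==> (\<And>i. i \<in> I ==> h i \<in> space M) ==> act M x (sum h I) = (\<Sum>i\<in>I. act M x (h i))"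
 by (induction I rule: infinite_finite_induct) (auto simp: act_add space_sum)

lemma span_space: "B \<subseteq> space M ==> V.span B \<subseteq> space M"
 by (rule V.span_minimal[OF _ subspace_space])

lemma act_span:
 assumes x: "x \<in> units g" and B: "B \<subseteq> space M" and C: "\<And>b. b \<in> B ==> act M x b \<in> V.span C"
  and v: "v \<in> V.span B"
 shows "act M x v \<in> V.span C"
proof -
 have "V.span B \<subseteq> {v \<in> space M. act M x v \<in> V.span C}"
 proof (rule V.span_minimal)
  show "B \<subseteq> {v \<in> space M. act M x v \<in> V.span C}" using B C by blast
  show "V.subspace {v \<in> space M. act M x v \<in> V.span C}"
   by (rule V.subspaceI) (use x in \<open>auto simp: V.span_zero act_add act_scale V.span_add V.span_scale\<close>)
 qed
 then show ?thesis using v by blast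
qed

lemma submodule_space: "submodule g M U ==> U \<subseteq> space M"
 unfolding Defs.submodule_def Defs.space_def by blast

lemma submodule_span:
 assumes B: "\<And>b. b \<in> B ==> b \<in> hpart M False \<or> b \<in> hpart M True"
  and stable: "\<And>x b. x \<in> units g ==> b \<in> B ==> act M x b \<in> V.span B"
 shows "submodule g M (V.span B)"
proof -
 have Bs: "B \<subseteq> space M" using B hpart_space by blast
 let ?S = "{u + v |u v. u \<in> V.span B \<inter> hpart M False \<and> v \<in> V.span B \<inter> hpart M True}"
 have sub: "V.subspace (V.span B \<inter> hpart M s)" for s
  by (rule V.subspace_inter) (auto simp: subspace_hpart)
 have "V.subspace ?S" using V.subspace_sums[OF sub sub] .
 moreover have "B \<subseteq> ?S"
 proof
  fix b assume b: "b \<in> B"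
  then have "b = b + 0" "b = 0 + b" "b \<in> V.span B" "0 \<in> V.span B" by (auto simp: V.span_base V.span_zero)
  then show "b \<in> ?S" using B[OF b] zero_hpart by blast
 qed
 ultimately have "V.span B \<subseteq> ?S" by (rule V.span_minimal[rotated])
 moreover have "?S \<subseteq> V.span B" by (auto simp: V.span_add)
 ultimately have "V.span B = ?S" by blast
 moreover have "act M x v \<in> V.span B" if "x \<in> units g" "v \<in> V.span B" for x v
  using act_span[OF that(1) Bs _ that(2)] stable that(1) by blast
 ultimately show ?thesis unfolding Defs.submodule_def by simp
qed

lemma subrep_simps [simp]:
 "scal (subrep M U) = scal M" "act (subrep M U) = act M" "hpart (subrep M U) s = hpart M s \<inter> U"
 by (simp_all add: Defs.subrep_def)

lemma space_subrep:
 assumes "submodule g M U" shows "space (subrep M U) = U"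
 using assms unfolding Defs.submodule_def Defs.space_def by (simp add: Int_commute)

lemma supermodule_subrep:
 assumes U: "submodule g M U" shows "supermodule g (subrep M U)"
proof -
 have Us: "U \<subseteq> space M" by (rule submodule_space[OF U])
 have sub: "V.subspace (hpart M s \<inter> U)" for s
  using U unfolding Defs.submodule_def by (intro V.subspace_inter subspace_hpart) simp
 have stable: "\<And>x v. x \<in> units g ==> v \<in> U ==> act M x v \<in> U" using U unfolding Defs.submodule_def by blast
 have "0 \<in> U" using U unfolding Defs.submodule_def by (simp add: V.subspace_0)
 then show ?thesis
  unfolding Defs.supermodule_def space_subrep[OF U]
  using Us sub stable act_add act_scale act_hpart bracket hpart_Int
  by (auto simp: V.vector_space_axioms subset_iff)
qed

lemma submodule_subrep:
 assumes "submodule g M U" "submodule g (subrep M U) U'"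
 shows "submodule g M U'" "U' \<subseteq> U"
proof -
 interpret S: supermod g "subrep M U" using supermodule_subrep[OF assms(1)] by unfold_locales
 show *: "U' \<subseteq> U" using S.submodule_space[OF assms(2)] space_subrep[OF assms(1)] by simp
 then have "U' \<inter> (hpart M s \<inter> U) = U' \<inter> hpart M s" for s by blast
 then show "submodule g M U'" using assms(2) unfolding Defs.submodule_def by simp
qed

lemma submodule_Int_subrep:
 assumes "submodule g M U" "submodule g M U'" "U' \<subseteq> U"
 shows "submodule g (subrep M U) U'"
proof -
 have "U' \<inter> (hpart M s \<inter> U) = U' \<inter> hpart M s" for s using assms(3) by blast
 then show ?thesis using assms(2) unfolding Defs.submodule_def by simp
qed

text \<open>
 Elements of height zero are even, so the even and the odd part of a singular vector are again singular.
\<close>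

lemma singular_component:
 assumes "singular g ht M \<chi> v" "v \<noteq> 0" "\<And>x. x \<in> units g ==> ht x = 0 ==> \<not> odd_unit g x"
 obtains s v' where "v' \<in> hpart M s" "v' \<noteq> 0" "singular g ht M \<chi> v'"
proof -
 obtain v0 v1 where v: "v0 \<in> hpart M False" "v1 \<in> hpart M True" "v = v0 + v1"
  using assms(1) spaceE unfolding singular_def by metis
 have sp: "v0 \<in> space M" "v1 \<in> space M" using v hpart_space by blast+
 have split: "a = a' \<and> b = b'" if "a + b = a' + b'" "a \<in> hpart M s" "a' \<in> hpart M s" "b \<in> hpart M (\<not> s)" "b' \<in> hpart M (\<not> s)"
  for a b a' b' s
 proof -
  have "a - a' = b' - b" using that(1) by (metis add_diff_cancel_left' add_diff_eq diff_add_eq diff_diff_eq2)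
  moreover have "a - a' \<in> hpart M s" "b' - b \<in> hpart M (\<not> s)"
   using that V.subspace_diff[OF subspace_hpart] by blast+
  ultimately have "a - a' = 0 \<and> b' - b = 0" using hpart_Int by (cases s) metis+
  then show ?thesis by simp
 qed
 have "singular g ht M \<chi> v0 \<and> singular g ht M \<chi> v1"
 proof -
  have "act M x v0 = 0 \<and> act M x v1 = 0" if x: "x \<in> units g" "ht x > 0" for x
  proof (rule split[of _ _ _ _ "odd_unit g x"])
   have "act M x v = 0" using assms(1) x unfolding singular_def by simp
   then show "act M x v0 + act M x v1 = 0 + 0" using v(3) act_add[OF x(1) sp] by simp
  qed (use act_hpart[OF x(1) v(1)] act_hpart[OF x(1) v(2)] in auto)
  moreover have "act M x v0 = scal M (\<chi> x) v0 \<and> act M x v1 = scal M (\<chi> x) v1" if x: "x \<in> units g" "ht x = 0" for x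
  proof (rule split[of _ _ _ _ False])
   have "act M x v = scal M (\<chi> x) v" using assms(1) x unfolding singular_def by simp
   then show "act M x v0 + act M x v1 = scal M (\<chi> x) v0 + scal M (\<chi> x) v1"
    using v(3) act_add[OF x(1) sp] by (simp add: V.scale_right_distrib)
  qed (use act_hpart[OF x(1) v(1)] act_hpart[OF x(1) v(2)] assms(3)[OF x] v V.subspace_scale[OF subspace_hpart] in auto)
  ultimately show ?thesis using sp unfolding singular_def by blast
 qed
 then show ?thesis using that[OF v(1)] that[OF v(2)] v(3) assms(2) by (metis add_0)
qed

end

locale lie_module = graded_lie g ht hc + supermod g M
 for g :: "'x lie_super" and ht hc and M :: "('x, 'v::ab_group_add) rep"
begin

definition H :: "'v => 'v" where "H v = (\<Sum>x\<in>units g. scal M (hc x) (act M x v))"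

lemma H_space [intro]: "v \<in> space M ==> H v \<in> space M"
 unfolding H_def by (intro space_sum space_scale act_space)

lemma H_add: "u \<in> space M ==> v \<in> space M ==> H (u + v) = H u + H v"
 by (simp add: H_def act_add V.scale_right_distrib sum.distrib)

lemma H_scale: "v \<in> space M ==> H (scal M c v) = scal M c (H v)"
 by (simp add: H_def act_scale V.scale_sum_right mult.commute)

lemma H_act:
 assumes y: "y \<in> units g" and v: "v \<in> space M"
 shows "H (act M y v) = act M y (H v) + scal M (of_int (ht y)) (act M y v)"
proof -
 have "scal M (hc x) (act M x (act M y v)) = scal M (hc x) (act M y (act M x v))
   + (\<Sum>z\<in>units g. scal M (hc x * struct g x y z) (act M z v))" if x: "x \<in> units g" for x
 proof (cases "hc x = 0")
  case False
  then have "\<not> odd_unit g x" using x hc_ht even_ht0 by blast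
  then have "act M x (act M y v) = act M y (act M x v) + (\<Sum>z \<in> units g. scal M (struct g x y z) (act M z v))"
   using bracket[OF x y v] by (simp add: koszul_def algebra_simps)
  then show ?thesis by (simp add: V.scale_right_distrib V.scale_sum_right)
 qed simp
 then have "H (act M y v) = (\<Sum>x\<in>units g. scal M (hc x) (act M y (act M x v)))
   + (\<Sum>x\<in>units g. \<Sum>z\<in>units g. scal M (hc x * struct g x y z) (act M z v))"
  unfolding H_def by (simp add: sum.distrib)
 also have "(\<Sum>x\<in>units g. scal M (hc x) (act M y (act M x v))) = act M y (H v)"
  unfolding H_def using y v by (subst act_sum) (auto simp: act_scale act_space)
 also have "(\<Sum>x\<in>units g. \<Sum>z\<in>units g. scal M (hc x * struct g x y z) (act M z v))
   = (\<Sum>z\<in>units g. scal M (\<Sum>x\<in>units g. hc x * struct g x y z) (act M z v))"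
  by (subst sum.swap) (simp add: V.scale_sum_left)
 also have "\<dots> = (\<Sum>z\<in>units g. if z = y then scal M (of_int (ht y)) (act M y v) else 0)"
  by (rule sum.cong) (auto simp: grading y)
 also have "\<dots> = scal M (of_int (ht y)) (act M y v)"
  using y finite_units by simp
 finally show ?thesis .
qed

definition low :: "'x set" where "low = {x \<in> units g. ht x < 0}"

definition word :: "'x list => 'v => 'v" where "word xs v = foldr (act M) xs v"

lemma word_simps [simp]: "word [] v = v" "word (x # xs) v = act M x (word xs v)"
 by (simp_all add: word_def)

definition words :: "'v => 'v set" where "words v = {word xs v | xs. set xs \<subseteq> low}"

definition nwords :: "'v => 'v set" where "nwords v = {word xs v | xs. set xs \<subseteq> low \<and> xs \<noteq> []}"

text \<open>
 The span of the vectors obtained from \<open>v\<close> by lowering operators. For a singular \<open>v\<close> it is the submodule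
 generated by \<open>v\<close> (\<open>K_submodule\<close>, \<open>K_least\<close>).
\<close>

definition K :: "'v => 'v set" where "K v = V.span (words v)"

lemma word_space: "v \<in> space M ==> set xs \<subseteq> low ==> word xs v \<in> space M"
 by (induction xs) (auto simp: low_def)

lemma words_space: "v \<in> space M ==> words v \<subseteq> space M"
 unfolding words_def using word_space by blast

lemma nwords_space: "v \<in> space M ==> nwords v \<subseteq> space M"
 unfolding nwords_def using word_space by blast

lemma word_hpart: "v \<in> hpart M s ==> set xs \<subseteq> low ==> \<exists>t. word xs v \<in> hpart M t"
proof (induction xs)
 case (Cons x xs)
 then obtain t where "word xs v \<in> hpart M t" by auto
 then show ?case using act_hpart[of x "word xs v" t] Cons.prems by (auto simp: low_def)
qed auto

lemma act_low_K:
 assumes "v \<in> space M" "x \<in> low" "u \<in> K v" shows "act M x u \<in> K v"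
 unfolding K_def
proof (rule act_span[of _ "words v"])
 show "x \<in> units g" using assms(2) by (simp add: low_def)
 show "words v \<subseteq> space M" by (rule words_space[OF assms(1)])
 show "u \<in> V.span (words v)" using assms(3) by (simp add: K_def)
 fix b assume "b \<in> words v"
 then obtain xs where "b = word xs v" "set xs \<subseteq> low" by (auto simp: words_def)
 then have "act M x b = word (x # xs) v" "set (x # xs) \<subseteq> low" using assms(2) by auto
 then show "act M x b \<in> V.span (words v)" unfolding words_def by (blast intro: V.span_base)
qed

text \<open>
 Induction on the word: the bracket moves an operator past the first letter, and what remains is either the
 operator itself or an element of the Lie superalgebra applied to a shorter word.
\<close>

lemma act_word_K:
 assumes v: "singular g ht M \<chi> v"
 shows "x \<in> units g ==> set xs \<subseteq> low ==> act M x (word xs v) \<in> K v"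
proof (induction xs arbitrary: x)
 case Nil
 have vK: "v \<in> K v" unfolding K_def words_def by (rule V.span_base) (auto intro: exI[of _ "[]"])
 show ?case
 proof (cases "ht x < 0")
  case True
  then show ?thesis using act_low_K[OF _ _ vK] v Nil by (auto simp: singular_def low_def)
 next
  case False
  then have "ht x > 0 \<or> ht x = 0" by auto
  then show ?thesis using v Nil vK by (auto simp: singular_def K_def V.span_zero V.span_scale)
 qed
next
 case (Cons y ys)
 have sp: "v \<in> space M" using v by (simp add: singular_def)
 have y: "y \<in> low" "y \<in> units g" "set ys \<subseteq> low" using Cons.prems by (auto simp: low_def)
 have w: "word ys v \<in> space M" by (rule word_space[OF sp y(3)])
 have "act M x (word (y # ys) v) = scal M (koszul (odd_unit g x) (odd_unit g y)) (act M y (act M x (word ys v)))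
   + (\<Sum>z \<in> units g. scal M (struct g x y z) (act M z (word ys v)))"
  using bracket[OF Cons.prems(1) y(2) w] by (simp add: algebra_simps)
 moreover have "act M y (act M x (word ys v)) \<in> K v"
  by (rule act_low_K[OF sp y(1)]) (rule Cons.IH[OF Cons.prems(1) y(3)])
 ultimately show ?case
  using Cons.IH[OF _ y(3)] unfolding K_def
  by (simp add: V.span_add V.span_scale V.span_sum)
qed

lemma K_submodule:
 assumes "singular g ht M \<chi> v" "v \<in> hpart M s"
 shows "submodule g M (K v)"
 unfolding K_def
proof (rule submodule_span)
 fix b assume "b \<in> words v"
 then obtain t where "b \<in> hpart M t" using word_hpart[OF assms(2)] by (auto simp: words_def)
 then show "b \<in> hpart M False \<or> b \<in> hpart M True" by (cases t) auto
next
 fix x b assume "x \<in> units g" "b \<in> words v"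
 then show "act M x b \<in> V.span (words v)"
  using act_word_K[OF assms(1)] by (auto simp: words_def K_def)
qed

lemma self_in_K: "v \<in> K v"
 unfolding K_def words_def by (rule V.span_base) (auto intro: exI[of _ "[]"])

lemma K_least:
 assumes "V.subspace U" "\<And>x u. x \<in> units g ==> u \<in> U ==> act M x u \<in> U" "v \<in> U"
 shows "K v \<subseteq> U"
 unfolding K_def
proof (rule V.span_minimal[OF _ assms(1)])
 have "word xs v \<in> U" if "set xs \<subseteq> low" for xs
  using that by (induction xs) (use assms in \<open>auto simp: low_def\<close>)
 then show "words v \<subseteq> U" by (auto simp: words_def)
qed

lemma K_decomp:
 assumes "k \<in> K v"
 obtains c k' where "k' \<in> V.span (nwords v)" "k = scal M c v + k'"
proof -
 have e: "words v = insert v (nwords v)"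
 proof
  show "words v \<subseteq> insert v (nwords v)"
  proof
   fix b assume "b \<in> words v"
   then obtain xs where "b = word xs v" "set xs \<subseteq> low" by (auto simp: words_def)
   then show "b \<in> insert v (nwords v)" by (cases "xs = []") (auto simp: nwords_def)
  qed
  have "v \<in> words v" unfolding words_def by (auto intro: exI[of _ "[]"])
  then show "insert v (nwords v) \<subseteq> words v" by (auto simp: words_def nwords_def)
 qed
 have "k \<in> V.span (insert v (nwords v))" using assms by (simp add: K_def e)
 then obtain c where "k - scal M c v \<in> V.span (nwords v)" using V.span_breakdown_eq by metis
 then show ?thesis using that[of "k - scal M c v" c] by simp
qed

abbreviation hval :: "('x => complex) => complex" where
 "hval \<chi> \<equiv> (\<Sum>x\<in>units g. hc x * \<chi> x)"

lemma H_singular: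
 assumes "singular g ht M \<chi> v" shows "H v = scal M (hval \<chi>) v"
proof -
 have "H v = (\<Sum>x\<in>units g. scal M (hc x * \<chi> x) v)"
  unfolding H_def
 proof (rule sum.cong)
  fix x assume x: "x \<in> units g"
  show "scal M (hc x) (act M x v) = scal M (hc x * \<chi> x) v"
   using assms x hc_ht[OF x] by (cases "hc x = 0") (auto simp: singular_def)
 qed simp
 then show ?thesis by (simp add: V.scale_sum_left)
qed

lemma H_word:
 assumes "singular g ht M \<chi> v" "set xs \<subseteq> low"
 shows "H (word xs v) = scal M (hval \<chi> + of_int (\<Sum>x\<leftarrow>xs. ht x)) (word xs v)"
 using assms(2)
proof (induction xs)
 case Nil then show ?case by (simp add: H_singular[OF assms(1)])
next
 case (Cons x xs)
 have sp: "word xs v \<in> space M" by (rule word_space) (use assms(1) Cons in \<open>auto simp: singular_def\<close>)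
 have "x \<in> units g" using Cons by (simp add: low_def)
 then show ?case using Cons H_act[of x "word xs v"] sp
  by (simp add: act_scale V.scale_left_distrib[symmetric] add_ac)
qed

text \<open>A vector that is annihilated by a product of factors \<open>H - l\<close> with all \<open>l \<noteq> e\<close> has no
 component in the eigenspace of \<open>H\<close> for the eigenvalue \<open>e\<close>.\<close>

definition shift :: "complex => 'v => 'v" where "shift l u = H u - scal M l u"

definition off_eigen :: "complex => 'v => bool" where
 "off_eigen e k \<longleftrightarrow> k \<in> space M \<and> (\<exists>ls. e \<notin> set ls \<and> foldr shift ls k = 0)"

lemma shift_space [intro]: "u \<in> space M ==> shift l u \<in> space M"
 unfolding shift_def by (intro space_diff H_space space_scale)

lemma shift_add: "u \<in> space M ==> v \<in> space M ==> shift l (u + v) = shift l u + shift l v"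
 unfolding shift_def by (simp add: H_add V.scale_right_distrib algebra_simps)

lemma shift_scale: "u \<in> space M ==> shift l (scal M c u) = scal M c (shift l u)"
 unfolding shift_def by (simp add: H_scale V.scale_right_diff_distrib V.scale_left_commute)

lemma H_diff: "u \<in> space M ==> v \<in> space M ==> H (u - v) = H u - H v"
 using H_add[of "u - v" v] by (simp add: space_diff algebra_simps)

lemma shift_commute: "u \<in> space M ==> shift l (shift l' u) = shift l' (shift l u)"
 unfolding shift_def
 by (simp add: H_diff H_scale H_space space_scale V.scale_right_diff_distrib algebra_simps V.scale_left_commute)

lemma shifts_space: "u \<in> space M ==> foldr shift ls u \<in> space M"
 by (induction ls) auto

lemma shifts_add: "u \<in> space M ==> v \<in> space M ==> foldr shift ls (u + v) = foldr shift ls u + foldr shift ls v"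
 by (induction ls) (simp_all add: shift_add shifts_space)

lemma shifts_scale: "u \<in> space M ==> foldr shift ls (scal M c u) = scal M c (foldr shift ls u)"
 by (induction ls) (simp_all add: shift_scale shifts_space)

lemma shifts_zero [simp]: "foldr shift ls 0 = 0"
 using shifts_scale[of 0 ls 0] by simp

lemma shifts_shift: "u \<in> space M ==> foldr shift ls (shift l u) = shift l (foldr shift ls u)"
 by (induction ls) (simp_all add: shift_commute[of _ l] shifts_space)

lemma shifts_commute: "u \<in> space M ==> foldr shift ls (foldr shift ls' u) = foldr shift ls' (foldr shift ls u)"
 by (induction ls') (simp_all add: shifts_shift shifts_space)

lemma shifts_eigen: "u \<in> space M ==> H u = scal M e u ==> foldr shift ls u = scal M (\<Prod>l\<leftarrow>ls. e - l) u"
 by (induction ls) (simp_all add: shift_scale, simp add: shift_def V.scale_left_diff_distrib[symmetric] mult.commute)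

lemma off_eigen_subspace: "V.subspace {k. off_eigen e k}"
proof (rule V.subspaceI)
 show "0 \<in> {k. off_eigen e k}" by (auto simp: off_eigen_def intro: exI[of _ "[]"])
next
 fix x y assume "x \<in> {k. off_eigen e k}" "y \<in> {k. off_eigen e k}"
 then obtain ls ls' where *: "x \<in> space M" "e \<notin> set ls" "foldr shift ls x = 0"
   "y \<in> space M" "e \<notin> set ls'" "foldr shift ls' y = 0" by (auto simp: off_eigen_def)
 have "foldr shift (ls @ ls') (x + y) = foldr shift ls (foldr shift ls' x)"
  using * by (simp add: shifts_add)
 also have "\<dots> = 0" using * by (simp add: shifts_commute[of x])
 finally show "x + y \<in> {k. off_eigen e k}"
  using * by (auto simp: off_eigen_def intro!: exI[of _ "ls @ ls'"])
next
 fix c x assume "x \<in> {k. off_eigen e k}"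
 then show "scal M c x \<in> {k. off_eigen e k}" by (auto simp: off_eigen_def shifts_scale)
qed

lemma eigen_off_eigen:
 assumes "u \<in> space M" "H u = scal M e u" "off_eigen e u" shows "u = 0"
proof -
 obtain ls where ls: "e \<notin> set ls" "foldr shift ls u = 0" using assms(3) by (auto simp: off_eigen_def)
 then have "scal M (\<Prod>l\<leftarrow>ls. e - l) u = 0" using shifts_eigen[OF assms(1,2)] by simp
 moreover have "(\<Prod>l\<leftarrow>ls. e - l) \<noteq> 0" using ls(1) by (induction ls) auto
 ultimately show ?thesis by simp
qed

lemma nwords_off_eigen:
 assumes v: "singular g ht M \<chi> v" and k: "k \<in> V.span (nwords v)"
 shows "off_eigen (hval \<chi>) k"
proof -
 have "nwords v \<subseteq> {k. off_eigen (hval \<chi>) k}"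
 proof
  fix b assume "b \<in> nwords v"
  then obtain xs where xs: "b = word xs v" "set xs \<subseteq> low" "xs \<noteq> []" by (auto simp: nwords_def)
  have neg: "(\<Sum>x\<leftarrow>xs. ht x) < 0" using xs(2,3)
  proof (induction xs)
   case (Cons a xs) then show ?case by (cases "xs = []") (auto simp: low_def)
  qed simp
  have sp: "b \<in> space M" using xs v word_space by (simp add: singular_def)
  have "shift (hval \<chi> + of_int (\<Sum>x\<leftarrow>xs. ht x)) b = 0"
   unfolding shift_def xs(1) H_word[OF v xs(2)] by simp
  moreover have "hval \<chi> + of_int (\<Sum>x\<leftarrow>xs. ht x) \<noteq> hval \<chi>" using neg by auto
  ultimately show "b \<in> {k. off_eigen (hval \<chi>) k}"
   using sp by (auto simp: off_eigen_def intro!: exI[of _ "[hval \<chi> + of_int (\<Sum>x\<leftarrow>xs. ht x)]"])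
 qed
 then have "V.span (nwords v) \<subseteq> {k. off_eigen (hval \<chi>) k}" by (rule V.span_minimal[OF _ off_eigen_subspace])
 then show ?thesis using k by blast
qed

text \<open>
 Words of positive length have other eigenvalues of \<open>H\<close> than \<open>v\<close>, so only \<open>v\<close> contributes to its
 eigenspace.
\<close>

lemma eigen_in_K:
 assumes v: "singular g ht M \<chi> v" and u: "u \<in> K v" "H u = scal M (hval \<chi>) u"
 obtains c where "u = scal M c v"
proof -
 obtain c k' where k: "k' \<in> V.span (nwords v)" "u = scal M c v + k'" using K_decomp[OF u(1)] by metis
 have sp: "v \<in> space M" "k' \<in> space M" "u \<in> space M"
  using v k nwords_space[of v] span_space[of "nwords v"] span_space[OF words_space, of v] u(1)
  by (auto simp: singular_def K_def)
 have "k' = u - scal M c v" using k by simp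
 then have "H k' = scal M (hval \<chi>) k'"
  using sp u(2) H_singular[OF v] by (simp add: H_diff space_scale H_scale V.scale_right_diff_distrib V.scale_left_commute)
 then have "k' = 0" using eigen_off_eigen[OF sp(2)] nwords_off_eigen[OF v k(1)] by blast
 then show ?thesis using that[of c] k(2) by simp
qed

text \<open>
 A product of factors \<open>H - l\<close> annihilates the component below the top and multiplies \<open>v\<close> by a nonzero
 number.
\<close>

lemma top_in_stable:
 assumes v: "singular g ht M \<chi> v" and U: "V.subspace U" "\<And>x u. x \<in> units g ==> u \<in> U ==> act M x u \<in> U"
  and u: "scal M c v + k' \<in> U" "k' \<in> V.span (nwords v)" "c \<noteq> 0"
 shows "v \<in> U"
proof -
 obtain ls where ls: "hval \<chi> \<notin> set ls" "foldr shift ls k' = 0" "k' \<in> space M"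
  using nwords_off_eigen[OF v u(2)] by (auto simp: off_eigen_def)
 have sp: "v \<in> space M" using v by (simp add: singular_def)
 have "shift l w \<in> U" if "w \<in> U" for l w
  unfolding shift_def H_def using U that by (intro V.subspace_diff V.subspace_sum V.subspace_scale) auto
 then have "foldr shift ls w \<in> U" if "w \<in> U" for w using that by (induction ls) auto
 then have "foldr shift ls (scal M c v + k') \<in> U" using u(1) by blast
 moreover have "foldr shift ls (scal M c v + k') = scal M (c * (\<Prod>l\<leftarrow>ls. hval \<chi> - l)) v"
  using ls sp by (simp add: shifts_add space_scale shifts_scale shifts_eigen[OF sp H_singular[OF v]])
 moreover have "c * (\<Prod>l\<leftarrow>ls. hval \<chi> - l) \<noteq> 0" using ls(1) u(3) by (induction ls) auto
 ultimately have "scal M (inverse (c * (\<Prod>l\<leftarrow>ls. hval \<chi> - l))) (scal M (c * (\<Prod>l\<leftarrow>ls. hval \<chi> - l)) v) \<in> U"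
  using V.subspace_scale[OF U(1)] by metis
 moreover have "inverse (c * (\<Prod>l\<leftarrow>ls. hval \<chi> - l)) * (c * (\<Prod>l\<leftarrow>ls. hval \<chi> - l)) = 1"
  using \<open>c * (\<Prod>l\<leftarrow>ls. hval \<chi> - l) \<noteq> 0\<close> by (rule left_inverse)
 ultimately show ?thesis by (simp only: V.scale_scale V.scale_one)
qed

end

text \<open>
 A positive definite Hermitian form for which every basis element has an adjoint basis element of opposite
 height. This is what replaces a general theory of finite-dimensional representations: it yields both the
 irreducibility of the modules generated by singular vectors and complete reducibility.
\<close>

locale unitary_module = lie_module g ht hc M
 for g :: "'x lie_super" and ht hc and M :: "('x, 'v::ab_group_add) rep" +
 fixes ip :: "'v => 'v => complex" and star :: "'x => 'x"
 assumes ip_add_left: "ip (u + v) w = ip u w + ip v w"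
  and ip_scale_left: "ip (scal M c u) w = c * ip u w"
  and ip_cnj: "ip u v = cnj (ip v u)"
  and ip_definite: "ip u u = 0 ==> u = 0"
  and star_units: "x \<in> units g ==> star x \<in> units g"
  and star_ht: "x \<in> units g ==> ht (star x) = - ht x"
  and adjoint: "x \<in> units g ==> u \<in> space M ==> v \<in> space M ==> ip (act M x u) v = ip u (act M (star x) v)"
begin

lemma ip_add_right: "ip u (v + w) = ip u v + ip u w"
 using ip_add_left[of v w u] ip_cnj[of u] by simp

lemma ip_scale_right: "ip u (scal M c v) = cnj c * ip u v"
 using ip_scale_left[of c v u] ip_cnj[of u] by simp

lemma ip_zero [simp]: "ip 0 u = 0" "ip u 0 = 0"
 using ip_scale_left[of 0 0 u] ip_scale_right[of u 0 0] by simp_all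

lemma subspace_ip_left: "V.subspace {u. ip u w = 0}"
 by (rule V.subspaceI) (auto simp: ip_add_left ip_scale_left)

lemma subspace_ip_right: "V.subspace {w. ip u w = 0}"
 by (rule V.subspaceI) (auto simp: ip_add_right ip_scale_right)

text \<open>A lowering operator is adjoint to a raising operator.\<close>

lemma ip_nwords:
 assumes v: "v \<in> space M" and y: "y \<in> space M" "\<And>x. x \<in> units g ==> ht x > 0 ==> act M x y = 0"
  and k: "k \<in> V.span (nwords v)"
 shows "ip k y = 0"
proof -
 have "nwords v \<subseteq> {u. ip u y = 0}"
 proof
  fix b assume "b \<in> nwords v"
  then obtain xs where "b = word xs v" "set xs \<subseteq> low" "xs \<noteq> []" by (auto simp: nwords_def)
  then obtain z zs where b: "b = act M z (word zs v)" "z \<in> low" "set zs \<subseteq> low" by (cases xs) auto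
  have z: "z \<in> units g" "ht (star z) > 0" "star z \<in> units g" using b by (auto simp: low_def star_ht star_units)
  have "ip b y = ip (word zs v) (act M (star z) y)"
   unfolding b(1) by (rule adjoint[OF z(1) word_space[OF v b(3)] y(1)])
  then show "b \<in> {u. ip u y = 0}" using y(2) z by simp
 qed
 then have "V.span (nwords v) \<subseteq> {u. ip u y = 0}" by (rule V.span_minimal[OF _ subspace_ip_left])
 then show ?thesis using k by blast
qed

text \<open>
 A submodule either contains a vector with nonzero component along \<open>v\<close>, and then \<open>v\<close> itself, or it
 consists of vectors orthogonal to \<open>v\<close>. In the latter case it is orthogonal to all lowering words applied
 to \<open>v\<close>, because adjoints of lowering operators preserve it, and hence it is zero.
\<close>

theorem K_irreducible:
 assumes v: "singular g ht M \<chi> v" "v \<in> hpart M s" "v \<noteq> 0"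
 shows "irreducible_rep g (subrep M (K v))"
proof -
 have sub: "submodule g M (K v)" by (rule K_submodule[OF v(1,2)])
 have sp: "v \<in> space M" using v(1) by (simp add: singular_def)
 have "U = {0} \<or> U = K v" if U: "submodule g (subrep M (K v)) U" for U
 proof -
  note U' = submodule_subrep[OF sub U]
  have Usub: "V.subspace U" and Ust: "\<And>x u. x \<in> units g ==> u \<in> U ==> act M x u \<in> U"
   and Usp: "U \<subseteq> space M"
   using U'(1) submodule_space[OF U'(1)] by (auto simp: Defs.submodule_def)
  show ?thesis
  proof (cases "v \<in> U")
   case True
   then show ?thesis using K_least[OF Usub Ust] U'(2) by blast
  next
   case False
   have perp: "ip u v = 0" if u: "u \<in> U" for u
   proof -
    obtain c k' where k: "k' \<in> V.span (nwords v)" "u = scal M c v + k'" using K_decomp U'(2) u by (metis subsetD)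
    have "c = 0" using top_in_stable[OF v(1) Usub Ust, of c k'] k u False by auto
    then have "u = k'" using k by simp
    then show ?thesis using ip_nwords[OF sp sp _ k(1)] v(1) by (simp add: singular_def)
   qed
   have "ip u (word xs v) = 0" if "u \<in> U" "set xs \<subseteq> low" for u xs
    using that
   proof (induction xs arbitrary: u)
    case (Cons x xs)
    have x: "x \<in> units g" using Cons.prems by (simp add: low_def)
    have "ip (word (x # xs) v) u = ip (word xs v) (act M (star x) u)"
     using adjoint[OF x word_space[OF sp] subsetD[OF Usp]] Cons.prems by simp
    also have "\<dots> = cnj (ip (act M (star x) u) (word xs v))" by (rule ip_cnj)
    also have "ip (act M (star x) u) (word xs v) = 0"
     by (rule Cons.IH) (use Cons.prems Ust star_units[OF x] in auto)
    finally show ?case using ip_cnj[of u] by simp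
   qed (simp add: perp)
   then have "K v \<subseteq> {w. ip u w = 0}" if "u \<in> U" for u
    unfolding K_def by (intro V.span_minimal subspace_ip_right) (use that in \<open>auto simp: words_def\<close>)
   then have "u = 0" if "u \<in> U" for u using that U'(2) ip_definite by blast
   then show ?thesis using V.subspace_0[OF Usub] by blast
  qed
 qed
 moreover have "K v \<noteq> {0}" using self_in_K v(3) by blast
 ultimately show ?thesis
  unfolding Defs.irreducible_rep_def using supermodule_subrep[OF sub] by (simp add: space_subrep[OF sub])
qed

end

section \<open>Uniqueness of the irreducible module with a given highest weight\<close>

text \<open>
 The direct sum, with the parity of the second summand shifted if \<open>\<epsilon>\<close> holds.
\<close>

definition pair_rep :: "bool => ('x, 'v::ab_group_add) rep => ('x, 'w::ab_group_add) rep => ('x, 'v \<times> 'w) rep" where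
 "pair_rep \<epsilon> M N = \<lparr> scal = (\<lambda>c p. (scal M c (fst p), scal N c (snd p))),
   hpart = (\<lambda>s. hpart M s \<times> hpart N (s \<noteq> \<epsilon>)),
   act = (\<lambda>x p. (act M x (fst p), act N x (snd p))) \<rparr>"

lemma pair_rep_simps [simp]:
 "scal (pair_rep \<epsilon> M N) c p = (scal M c (fst p), scal N c (snd p))"
 "hpart (pair_rep \<epsilon> M N) s = hpart M s \<times> hpart N (s \<noteq> \<epsilon>)"
 "act (pair_rep \<epsilon> M N) x p = (act M x (fst p), act N x (snd p))"
 by (simp_all add: pair_rep_def)

lemma space_pair_rep:
 assumes "supermodule g M" "supermodule g N"
 shows "space (pair_rep \<epsilon> M N) = space M \<times> space N"
proof -
 interpret M: supermod g M by unfold_locales (rule assms)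
 interpret N: supermod g N by unfold_locales (rule assms)
 have A: "(a, b) \<in> space (pair_rep \<epsilon> M N)" if "a \<in> space M" "b \<in> space N" for a b
 proof -
  obtain a0 a1 b0 b1 where *: "a0 \<in> hpart M False" "a1 \<in> hpart M True" "a = a0 + a1"
   "b0 \<in> hpart N False" "b1 \<in> hpart N True" "b = b0 + b1"
   using \<open>a \<in> space M\<close> \<open>b \<in> space N\<close> by (metis M.spaceE N.spaceE)
  show ?thesis
  proof (cases \<epsilon>)
   case True
   then show ?thesis unfolding Defs.space_def using *
    by (intro CollectI exI[of _ "(a0, b1)"] exI[of _ "(a1, b0)"]) (auto simp: add.commute)
  next
   case False
   then show ?thesis unfolding Defs.space_def using *
    by (intro CollectI exI[of _ "(a0, b0)"] exI[of _ "(a1, b1)"]) auto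
  qed
 qed
 have B: "fst p \<in> space M \<and> snd p \<in> space N" if p: "p \<in> space (pair_rep \<epsilon> M N)" for p
 proof -
  obtain u v where uv: "p = u + v" "fst u \<in> hpart M False" "fst v \<in> hpart M True"
   "snd u \<in> hpart N \<epsilon>" "snd v \<in> hpart N (\<not> \<epsilon>)"
   using p unfolding Defs.space_def by auto
  then show ?thesis using M.space_add N.space_add M.hpart_space N.hpart_space
   by (metis fst_add snd_add)
 qed
 show ?thesis
 proof (intro Set.set_eqI iffI)
  fix p assume "p \<in> space (pair_rep \<epsilon> M N)"
  then show "p \<in> space M \<times> space N" using B[of p] by (simp add: mem_Times_iff)
 next
  fix p assume "p \<in> space M \<times> space N"
  then show "p \<in> space (pair_rep \<epsilon> M N)" using A[of "fst p" "snd p"] by (simp add: mem_Times_iff)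
 qed
qed

lemma supermodule_pair_rep:
 assumes "supermodule g M" "supermodule g N"
 shows "supermodule g (pair_rep \<epsilon> M N)"
proof -
 interpret M: supermod g M by unfold_locales (rule assms)
 interpret N: supermod g N by unfold_locales (rule assms)
 have vs: "vector_space (scal (pair_rep \<epsilon> M N))"
  by unfold_locales (auto simp: M.V.scale_right_distrib N.V.scale_right_distrib
    M.V.scale_left_distrib N.V.scale_left_distrib)
 interpret V: vector_space "scal (pair_rep \<epsilon> M N)" by (rule vs)
 have sub: "V.subspace (hpart (pair_rep \<epsilon> M N) s)" for s
  by (rule V.subspaceI)
   (auto simp: zero_prod_def M.V.subspace_add[OF M.subspace_hpart] N.V.subspace_add[OF N.subspace_hpart]
    M.V.subspace_scale[OF M.subspace_hpart] N.V.subspace_scale[OF N.subspace_hpart])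
 have int: "hpart (pair_rep \<epsilon> M N) False \<inter> hpart (pair_rep \<epsilon> M N) True = {0}"
 proof -
  have "u = 0" if "u \<in> hpart N \<epsilon>" "u \<in> hpart N (\<not> \<epsilon>)" for u
   using that N.hpart_Int by (cases \<epsilon>) auto
  then show ?thesis by (auto simp: zero_prod_def M.hpart_Int)
 qed
 have br: "act (pair_rep \<epsilon> M N) x (act (pair_rep \<epsilon> M N) y v)
    - scal (pair_rep \<epsilon> M N) (koszul (odd_unit g x) (odd_unit g y)) (act (pair_rep \<epsilon> M N) y (act (pair_rep \<epsilon> M N) x v))
   = (\<Sum>z\<in>units g. scal (pair_rep \<epsilon> M N) (struct g x y z) (act (pair_rep \<epsilon> M N) z v))"
  if "x \<in> units g" "y \<in> units g" "fst v \<in> space M" "snd v \<in> space N" for x y v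
  by (rule prod_eqI) (use that M.bracket N.bracket in \<open>simp_all add: fst_sum snd_sum\<close>)
 have hp: "act (pair_rep \<epsilon> M N) x v \<in> hpart (pair_rep \<epsilon> M N) (s \<noteq> odd_unit g x)"
  if "x \<in> units g" "v \<in> hpart (pair_rep \<epsilon> M N) s" for x s v
 proof -
  have "((s \<noteq> odd_unit g x) \<noteq> \<epsilon>) = ((s \<noteq> \<epsilon>) \<noteq> odd_unit g x)" by auto
  then show ?thesis using that M.act_hpart[of x "fst v" s] N.act_hpart[of x "snd v" "s \<noteq> \<epsilon>"]
   by (simp add: mem_Times_iff)
 qed
 show ?thesis
  unfolding Defs.supermodule_def space_pair_rep[OF assms]
  using vs sub int br hp
  by (intro conjI ballI allI; simp add: mem_Times_iff M.act_add N.act_add M.act_scale N.act_scale)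
qed

text \<open>
 The submodule of the direct sum generated by \<open>(v, w)\<close> is the graph of an isomorphism: it projects onto
 both irreducible summands, and it meets them trivially since the only vectors of top weight in it are the
 multiples of \<open>(v, w)\<close>.
\<close>

theorem irreducible_singular_iso:
 fixes M :: "('x, 'v::ab_group_add) rep" and N :: "('x, 'w::ab_group_add) rep"
 assumes gl: "graded_lie g ht hc" and M: "irreducible_rep g M" and N: "irreducible_rep g N"
  and v: "v \<in> hpart M s" "v \<noteq> 0" "singular g ht M \<chi> v"
  and w: "w \<in> hpart N t" "w \<noteq> 0" "singular g ht N \<chi> w"
 shows "rep_iso g M N"
proof -
 define \<epsilon> where "\<epsilon> \<longleftrightarrow> s \<noteq> t"
 define P where "P = pair_rep \<epsilon> M N"
 have sM: "supermodule g M" and sN: "supermodule g N" using M N by (auto simp: Defs.irreducible_rep_def)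
 interpret g: graded_lie g ht hc by (rule gl)
 interpret M: supermod g M by unfold_locales (rule sM)
 interpret N: supermod g N by unfold_locales (rule sN)
 interpret P: lie_module g ht hc P by unfold_locales (simp add: P_def supermodule_pair_rep sM sN)
 have spP: "space P = space M \<times> space N" unfolding P_def by (rule space_pair_rep[OF sM sN])
 have P_simps: "scal P c p = (scal M c (fst p), scal N c (snd p))"
  "hpart P s = hpart M s \<times> hpart N (s \<noteq> \<epsilon>)" "act P x p = (act M x (fst p), act N x (snd p))" for c p s x
  by (simp_all add: P_def)
 have svw: "singular g ht P \<chi> (v, w)"
  using v w unfolding singular_def spP by (simp add: P_simps zero_prod_def)
 have hvw: "(v, w) \<in> hpart P s" using v w by (cases s; cases t) (auto simp: P_simps \<epsilon>_def)
 define K where "K = P.K (v, w)"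
 have K: "submodule g P K" unfolding K_def by (rule P.K_submodule[OF svw hvw])
 have KP: "K \<subseteq> space P" by (rule P.submodule_space[OF K])
 have vwK: "(v, w) \<in> K" unfolding K_def by (rule P.self_in_K)
 have Ksub: "P.V.subspace K" and Kact: "\<And>x u. x \<in> units g ==> u \<in> K ==> act P x u \<in> K"
  using K by (auto simp: Defs.submodule_def)
 have Kadd: "(a + a', b + b') \<in> K" if "(a, b) \<in> K" "(a', b') \<in> K" for a b a' b'
  using P.V.subspace_add[OF Ksub that] by simp
 have Kscal: "(scal M c a, scal N c b) \<in> K" if "(a, b) \<in> K" for a b c
  using P.V.subspace_scale[OF Ksub that, of c] by (simp add: P_simps)
 have Kact': "(act M x a, act N x b) \<in> K" if "x \<in> units g" "(a, b) \<in> K" for x a b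
  using Kact[OF that] by (simp add: P_simps)
 have K0: "(0, 0) \<in> K" using P.V.subspace_0[OF Ksub] by (simp add: zero_prod_def)
 have Kdec: "\<exists>a0 a1 b0 b1. a = a0 + a1 \<and> b = b0 + b1 \<and> (a0, b0) \<in> K \<and> (a1, b1) \<in> K \<and>
   a0 \<in> hpart M False \<and> a1 \<in> hpart M True \<and> b0 \<in> hpart N \<epsilon> \<and> b1 \<in> hpart N (\<not> \<epsilon>)" if ab: "(a, b) \<in> K" for a b
 proof -
  obtain p0 p1 where "(a, b) = p0 + p1" "p0 \<in> K" "p0 \<in> hpart P False" "p1 \<in> K" "p1 \<in> hpart P True"
   using K ab unfolding Defs.submodule_def by blast
  then show ?thesis by (cases p0; cases p1) (auto simp: P_simps)
 qed
 have HP: "P.H (a, b) = ((\<Sum>x\<in>units g. scal M (hc x) (act M x a)), (\<Sum>x\<in>units g. scal N (hc x) (act N x b)))" for a b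
  unfolding P.H_def by (rule prod_eqI) (simp_all add: fst_sum snd_sum P_simps)
 have Hvw: "P.H (v, w) = scal P (P.hval \<chi>) (v, w)" by (rule P.H_singular[OF svw])
 have M0: "(\<Sum>x\<in>units g. scal M (hc x) (act M x 0)) = 0"
  by (rule sum.neutral) (simp add: M.V.scale_zero_right)
 have N0: "(\<Sum>x\<in>units g. scal N (hc x) (act N x 0)) = 0"
  by (rule sum.neutral) (simp add: N.V.scale_zero_right)
 have "P.H (v, 0) = scal P (P.hval \<chi>) (v, 0)" "P.H (0, w) = scal P (P.hval \<chi>) (0, w)"
  using Hvw by (simp_all add: HP P_simps M0 N0)
 note H0 = this
 have nv: "(v, 0) \<notin> K"
 proof
  assume "(v, 0) \<in> K"
  then obtain c where "(v, 0) = scal P c (v, w)" using P.eigen_in_K[OF svw _ H0(1)] unfolding K_def by metis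
  then show False using v(2) w(2) by (auto simp: P_simps)
 qed
 have nw: "(0, w) \<notin> K"
 proof
  assume "(0, w) \<in> K"
  then obtain c where "(0, w) = scal P c (v, w)" using P.eigen_in_K[OF svw _ H0(2)] unfolding K_def by metis
  then show False using v(2) w(2) by (auto simp: P_simps)
 qed
 have spM: "a \<in> space M" and spN: "b \<in> space N" if "(a, b) \<in> K" for a b using KP that spP by auto
 have irrM: "U = {0} \<or> U = space M" if "submodule g M U" for U using M that by (auto simp: Defs.irreducible_rep_def)
 have irrN: "U = {0} \<or> U = space N" if "submodule g N U" for U using N that by (auto simp: Defs.irreducible_rep_def)
 \<comment> \<open>The kernels of the two projections of \<open>K\<close> vanish.\<close>
 have ker1: "a = 0" if "(a, 0) \<in> K" for a
 proof -
  have "submodule g M {a. (a, 0) \<in> K}"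
   unfolding Defs.submodule_def
  proof (intro conjI ballI Set.set_eqI iffI)
   show "M.V.subspace {a. (a, 0) \<in> K}"
    by (rule M.V.subspaceI) (use K0 Kadd[of _ 0 _ 0] Kscal[of _ 0] in auto)
   fix a assume "a \<in> {a. (a, 0) \<in> K}"
   then obtain a0 a1 b0 b1 where *: "a = a0 + a1" "0 = b0 + b1" "(a0, b0) \<in> K" "(a1, b1) \<in> K"
    "a0 \<in> hpart M False" "a1 \<in> hpart M True" "b0 \<in> hpart N \<epsilon>" "b1 \<in> hpart N (\<not> \<epsilon>)" using Kdec by blast
   have "b0 = - b1" using *(2) by (simp add: eq_neg_iff_add_eq_0)
   then have "b0 \<in> hpart N (\<not> \<epsilon>)" using *(8) N.V.subspace_neg[OF N.subspace_hpart] by simp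
   then have "b0 = 0" using *(7) N.hpart_Int by (cases \<epsilon>) auto
   then have "b0 = 0" "b1 = 0" using *(2) by auto
   then show "a \<in> {u + v |u v. u \<in> {a. (a, 0) \<in> K} \<inter> hpart M False \<and> v \<in> {a. (a, 0) \<in> K} \<inter> hpart M True}"
    using * by blast
  qed (use Kadd[of _ 0 _ 0] Kact'[of _ _ 0] in auto)
  from irrM[OF this] show ?thesis using that nv M.hpart_space[OF v(1)] by blast
 qed
 have ker2: "b = 0" if "(0, b) \<in> K" for b
 proof -
  have "submodule g N {b. (0, b) \<in> K}"
   unfolding Defs.submodule_def
  proof (intro conjI ballI Set.set_eqI iffI)
   show "N.V.subspace {b. (0, b) \<in> K}"
    by (rule N.V.subspaceI) (use K0 Kadd[of 0 _ 0] Kscal[of 0] in auto)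
   fix b assume "b \<in> {b. (0, b) \<in> K}"
   then obtain a0 a1 b0 b1 where *: "0 = a0 + a1" "b = b0 + b1" "(a0, b0) \<in> K" "(a1, b1) \<in> K"
    "a0 \<in> hpart M False" "a1 \<in> hpart M True" "b0 \<in> hpart N \<epsilon>" "b1 \<in> hpart N (\<not> \<epsilon>)" using Kdec by blast
   have "a0 = - a1" using *(1) by (simp add: eq_neg_iff_add_eq_0)
   then have "a0 \<in> hpart M True" using *(6) M.V.subspace_neg[OF M.subspace_hpart] by simp
   then have "a0 = 0" using *(5) M.hpart_Int by auto
   then have "a0 = 0" "a1 = 0" using *(1) by auto
   then have K01: "(0, b0) \<in> K" "(0, b1) \<in> K" using * by auto
   have "\<exists>u v. b = u + v \<and> (0, u) \<in> K \<and> u \<in> hpart N False \<and> (0, v) \<in> K \<and> v \<in> hpart N True"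
   proof (cases \<epsilon>)
    case True
    with K01 *(2,7,8) show ?thesis by (intro exI[of _ b1] exI[of _ b0]) (simp add: add.commute)
   next
    case False
    with K01 *(2,7,8) show ?thesis by (intro exI[of _ b0] exI[of _ b1]) simp
   qed
   then show "b \<in> {u + v |u v. u \<in> {b. (0, b) \<in> K} \<inter> hpart N False \<and> v \<in> {b. (0, b) \<in> K} \<inter> hpart N True}"
    by blast
  qed (use Kadd[of 0 _ 0] Kact'[of _ 0] in auto)
  from irrN[OF this] show ?thesis using that nw N.hpart_space[OF w(1)] by blast
 qed
 have im1: "\<exists>b. (a, b) \<in> K" if "a \<in> space M" for a
 proof -
  have "submodule g M (fst ` K)"
   unfolding Defs.submodule_def
  proof (intro conjI ballI Set.set_eqI iffI)
   show "M.V.subspace (fst ` K)"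
    by (rule M.V.subspaceI) (use K0 Kadd Kscal in \<open>force+\<close>)
   fix a assume "a \<in> fst ` K"
   then obtain b where "(a, b) \<in> K" by force
   from Kdec[OF this]
   show "a \<in> {u + v |u v. u \<in> fst ` K \<inter> hpart M False \<and> v \<in> fst ` K \<inter> hpart M True}" by force
  next
   fix a assume "a \<in> {u + v |u v. u \<in> fst ` K \<inter> hpart M False \<and> v \<in> fst ` K \<inter> hpart M True}"
   then show "a \<in> fst ` K" using Kadd by force
  next
   fix x a assume "x \<in> units g" "a \<in> fst ` K"
   then show "act M x a \<in> fst ` K" using Kact' by force
  qed
  moreover have "v \<in> fst ` K" using vwK by force
  ultimately have "fst ` K = space M" using irrM v(2) by blast
  then show ?thesis using that by force
 qed
 have im2: "\<exists>a. (a, b) \<in> K" if "b \<in> space N" for b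
 proof -
  have "submodule g N (snd ` K)"
   unfolding Defs.submodule_def
  proof (intro conjI ballI Set.set_eqI iffI)
   show "N.V.subspace (snd ` K)"
    by (rule N.V.subspaceI) (use K0 Kadd Kscal in \<open>force+\<close>)
   fix b assume "b \<in> snd ` K"
   then obtain a where "(a, b) \<in> K" by force
   from Kdec[OF this] obtain b0 b1 where *: "b = b0 + b1" "b0 \<in> snd ` K" "b1 \<in> snd ` K"
    "b0 \<in> hpart N \<epsilon>" "b1 \<in> hpart N (\<not> \<epsilon>)" by force
   have "\<exists>u v. b = u + v \<and> u \<in> snd ` K \<and> u \<in> hpart N False \<and> v \<in> snd ` K \<and> v \<in> hpart N True"
   proof (cases \<epsilon>)
    case True
    with * show ?thesis by (intro exI[of _ b1] exI[of _ b0]) (simp add: add.commute)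
   next
    case False
    with * show ?thesis by (intro exI[of _ b0] exI[of _ b1]) simp
   qed
   then show "b \<in> {u + v |u v. u \<in> snd ` K \<inter> hpart N False \<and> v \<in> snd ` K \<inter> hpart N True}"
    by blast
  next
   fix b assume "b \<in> {u + v |u v. u \<in> snd ` K \<inter> hpart N False \<and> v \<in> snd ` K \<inter> hpart N True}"
   then show "b \<in> snd ` K" using Kadd by force
  next
   fix x b assume "x \<in> units g" "b \<in> snd ` K"
   then show "act N x b \<in> snd ` K" using Kact' by force
  qed
  moreover have "w \<in> snd ` K" using vwK by force
  ultimately have "snd ` K = space N" using irrN w(2) by blast
  then show ?thesis using that by force
 qed
 have Kdiff: "(a - a', b - b') \<in> K" if "(a, b) \<in> K" "(a', b') \<in> K" for a b a' b'
  using P.V.subspace_diff[OF Ksub that] by simp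
 have uniq1: "b = b'" if "(a, b) \<in> K" "(a, b') \<in> K" for a b b'
  using ker2[of "b - b'"] Kdiff[OF that] by simp
 have uniq2: "a = a'" if "(a, b) \<in> K" "(a', b) \<in> K" for a a' b
  using ker1[of "a - a'"] Kdiff[OF that] by simp
 define \<phi> where "\<phi> a = (SOME b. (a, b) \<in> K)" for a
 have \<phi>: "(a, \<phi> a) \<in> K" if "a \<in> space M" for a unfolding \<phi>_def using im1[OF that] by (rule someI_ex)
 have \<phi>I: "\<phi> a = b" if "(a, b) \<in> K" for a b using uniq1[OF \<phi>[OF spM[OF that]] that] .
 have "\<phi> ` hpart M r = hpart N (r \<noteq> \<epsilon>)" for r
 proof (intro Set.set_eqI iffI)
  fix b assume "b \<in> \<phi> ` hpart M r"
  then obtain a where a: "a \<in> hpart M r" "b = \<phi> a" by auto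
  obtain a0 a1 b0 b1 where *: "a = a0 + a1" "b = b0 + b1" "(a0, b0) \<in> K" "(a1, b1) \<in> K"
    "a0 \<in> hpart M False" "a1 \<in> hpart M True" "b0 \<in> hpart N \<epsilon>" "b1 \<in> hpart N (\<not> \<epsilon>)"
   using Kdec[OF \<phi>[OF M.hpart_space[OF a(1)]]] a(2) by blast
  show "b \<in> hpart N (r \<noteq> \<epsilon>)"
  proof (cases r)
   case True
   then have aT: "a \<in> hpart M True" using a(1) by simp
   have "a0 = a - a1" using *(1) by simp
   then have "a0 \<in> hpart M True" using M.V.subspace_diff[OF M.subspace_hpart aT *(6)] by simp
   then have "a0 = 0" using *(5) M.hpart_Int by metis
   then have "b0 = 0" using ker2 *(3) by simp
   then show ?thesis using * True by simp
  next
   case False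
   then have aF: "a \<in> hpart M False" using a(1) by simp
   have "a1 = a - a0" using *(1) by simp
   then have "a1 \<in> hpart M False" using M.V.subspace_diff[OF M.subspace_hpart aF *(5)] by simp
   then have "a1 = 0" using *(6) M.hpart_Int by metis
   then have "b1 = 0" using ker2 *(4) by simp
   then show ?thesis using * False by simp
  qed
 next
  fix b assume b: "b \<in> hpart N (r \<noteq> \<epsilon>)"
  obtain a where a: "(a, b) \<in> K" using im2 N.hpart_space[OF b] by blast
  obtain a0 a1 b0 b1 where *: "a = a0 + a1" "b = b0 + b1" "(a0, b0) \<in> K" "(a1, b1) \<in> K"
    "a0 \<in> hpart M False" "a1 \<in> hpart M True" "b0 \<in> hpart N \<epsilon>" "b1 \<in> hpart N (\<not> \<epsilon>)"
   using Kdec[OF a] by blast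
  have "a \<in> hpart M r"
  proof (cases r)
   case True
   then have "b \<in> hpart N (\<not> \<epsilon>)" using b by simp
   then have "b - b1 \<in> hpart N (\<not> \<epsilon>)" using * N.V.subspace_diff[OF N.subspace_hpart] by blast
   then have "b0 \<in> hpart N (\<not> \<epsilon>)" using *(2) by simp
   then have "b0 = 0" using *(7) N.hpart_Int by (cases \<epsilon>) auto
   then have "a0 = 0" using ker1 *(3) by simp
   then show ?thesis using * True by simp
  next
   case False
   then have "b \<in> hpart N \<epsilon>" using b by simp
   then have "b - b0 \<in> hpart N \<epsilon>" using * N.V.subspace_diff[OF N.subspace_hpart] by blast
   then have "b1 \<in> hpart N \<epsilon>" using *(2) by simp
   then have "b1 = 0" using *(8) N.hpart_Int by (cases \<epsilon>) auto
   then have "a1 = 0" using ker1 *(4) by simp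
   then show ?thesis using * False by simp
  qed
  then show "b \<in> \<phi> ` hpart M r" using \<phi>I[OF a] by blast
 qed
 moreover have "bij_betw \<phi> (space M) (space N)"
  unfolding bij_betw_def
 proof
  show "inj_on \<phi> (space M)" by (rule inj_onI) (metis \<phi> uniq2)
  show "\<phi> ` space M = space N"
  proof (intro Set.set_eqI iffI)
   fix b assume "b \<in> \<phi> ` space M"
   then show "b \<in> space N" using \<phi> spN by blast
  next
   fix b assume "b \<in> space N"
   then obtain a where "(a, b) \<in> K" using im2 by blast
   then show "b \<in> \<phi> ` space M" using \<phi>I spM by blast
  qed
 qed
 ultimately show ?thesis
  unfolding Defs.rep_iso_def
  by (intro exI[of _ \<phi>] exI[of _ \<epsilon>]) (auto intro!: \<phi>I Kadd Kscal Kact' \<phi>)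
qed

lemma rep_iso_refl: "rep_iso g M M"
 unfolding Defs.rep_iso_def by (intro exI[of _ id] exI[of _ False]) auto

section \<open>The Lie superalgebras \<open>gl(m|n)\<close> and their products\<close>

fun pos :: "nat => sindex => nat" where
 "pos m (Inl i) = i"
| "pos m (Inr j) = m + j"

text \<open>
 The height of \<open>E\<^sub>a\<^sub>b\<close> is the difference of the positions of \<open>b\<close> and \<open>a\<close> when even indices precede odd
 ones, and it is measured by the diagonal matrix with entries \<open>- pos m a\<close>.
\<close>

definition gl_ht :: "nat => sindex \<times> sindex => int" where
 "gl_ht m x = int (pos m (snd x)) - int (pos m (fst x))"

definition gl_hc :: "nat => sindex \<times> sindex => complex" where
 "gl_hc m x = (if fst x = snd x then - of_nat (pos m (fst x)) else 0)"

lemma finite_sidx [simp]: "finite (sidx m n)"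
 by (simp add: sidx_def)

lemma sidx_simps [simp]:
 "Inl i \<in> sidx m n \<longleftrightarrow> 1 \<le> i \<and> i \<le> m" "Inr j \<in> sidx m n \<longleftrightarrow> 1 \<le> j \<and> j \<le> n"
 by (auto simp: sidx_def)

lemma pos_inject: "a \<in> sidx m n ==> b \<in> sidx m n' ==> pos m a = pos m b ==> a = b"
 by (cases a; cases b) (auto simp: sidx_def)

lemma gl_units: "units (gl m n) = sidx m n \<times> sidx m n"
 and gl_odd: "odd_unit (gl m n) x \<longleftrightarrow> odd_idx (fst x) \<noteq> odd_idx (snd x)"
 and gl_struct: "struct (gl m n) x y z = of_bool (snd x = fst y \<and> z = (fst x, snd y))
    - koszul (odd_idx (fst x) \<noteq> odd_idx (snd x)) (odd_idx (fst y) \<noteq> odd_idx (snd y)) * of_bool (fst x = snd y \<and> z = (fst y, snd x))"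
 by (simp_all add: Defs.gl_def case_prod_beta)

lemma graded_lie_gl: "graded_lie (gl m n) (gl_ht m) (gl_hc m)"
proof
 show "finite (units (gl m n))" by (simp add: gl_units)
next
 fix x assume "x \<in> units (gl m n)" "gl_ht m x = 0"
 then show "\<not> odd_unit (gl m n) x"
  using pos_inject[of "fst x" m n "snd x" n] by (auto simp: gl_units gl_ht_def gl_odd)
next
 fix x y z assume st: "struct (gl m n) x y z \<noteq> 0"
 have "(snd x = fst y \<and> z = (fst x, snd y)) \<or> (fst x = snd y \<and> z = (fst y, snd x))"
 proof (rule ccontr)
  assume "\<not> ?thesis"
  then have "\<not> (snd x = fst y \<and> z = (fst x, snd y))" "\<not> (fst x = snd y \<and> z = (fst y, snd x))" by blast+
  then have "struct (gl m n) x y z = 0" unfolding gl_struct by (simp only: of_bool_eq mult_zero_right diff_0_right)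
  then show False using st by simp
 qed
 then show "gl_ht m z = gl_ht m x + gl_ht m y" by (auto simp: gl_ht_def)
next
 fix y z assume yz: "y \<in> units (gl m n)" "z \<in> units (gl m n)"
 then obtain c d where y: "y = (c, d)" "c \<in> sidx m n" "d \<in> sidx m n" by (auto simp: gl_units)
 have "(\<Sum>x\<in>units (gl m n). gl_hc m x * struct (gl m n) x y z)
   = (\<Sum>a\<in>sidx m n. \<Sum>b\<in>sidx m n. gl_hc m (a, b) * struct (gl m n) (a, b) y z)"
  by (simp add: gl_units sum.cartesian_product)
 also have "\<dots> = (\<Sum>a\<in>sidx m n. \<Sum>b\<in>sidx m n. if b = a then - of_nat (pos m a) * struct (gl m n) (a, a) y z else 0)"
  by (intro sum.cong) (auto simp: gl_hc_def)
 also have "\<dots> = (\<Sum>a\<in>sidx m n. - of_nat (pos m a) * struct (gl m n) (a, a) y z)"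
  by (simp add: sum.delta)
 also have "\<dots> = (\<Sum>a\<in>sidx m n. (if a = d then of_nat (pos m d) * of_bool (z = (c, d)) else 0)
    - (if a = c then of_nat (pos m c) * of_bool (z = (c, d)) else 0))"
  by (intro sum.cong) (auto simp: gl_struct y koszul_def)
 also have "\<dots> = (of_nat (pos m d) - of_nat (pos m c)) * of_bool (z = (c, d))"
  using y by (simp add: sum_subtractf left_diff_distrib)
 finally show "(\<Sum>x\<in>units (gl m n). gl_hc m x * struct (gl m n) x y z) = (if z = y then of_int (gl_ht m y) else 0)"
  by (simp add: y gl_ht_def)
next
 fix x assume "gl_hc m x \<noteq> 0"
 then show "gl_ht m x = 0" by (auto simp: gl_hc_def gl_ht_def split: if_splits)
qed

lemma lie_prod_simps [simp]:
 "units (lie_prod g h) = units g <+> units h"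
 "odd_unit (lie_prod g h) (Inl x) = odd_unit g x" "odd_unit (lie_prod g h) (Inr y) = odd_unit h y"
 "struct (lie_prod g h) (Inl x) (Inl x') (Inl x'') = struct g x x' x''"
 "struct (lie_prod g h) (Inr y) (Inr y') (Inr y'') = struct h y y' y''"
 "struct (lie_prod g h) (Inl x) (Inl x') (Inr y'') = 0"
 "struct (lie_prod g h) (Inr y) (Inr y') (Inl x'') = 0"
 "struct (lie_prod g h) (Inl x) (Inr y) z = 0" "struct (lie_prod g h) (Inr y) (Inl x) z = 0"
 by (simp_all add: lie_prod_def)

lemma sum_Plus:
 "finite A ==> finite B ==> (\<Sum>z\<in>A <+> B. f z) = (\<Sum>x\<in>A. f (Inl x)) + (\<Sum>y\<in>B. f (Inr y))"
 by (simp add: sum.Plus comp_def)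

lemma graded_lie_prod:
 assumes "graded_lie g ht hc" "graded_lie h ht' hc'"
 shows "graded_lie (lie_prod g h) (case_sum ht ht') (case_sum hc hc')"
proof -
 interpret g: graded_lie g ht hc by fact
 interpret h: graded_lie h ht' hc' by fact
 show ?thesis
 proof
  show "finite (units (lie_prod g h))" using g.finite_units h.finite_units by simp
 next
  fix x assume "x \<in> units (lie_prod g h)" "case_sum ht ht' x = 0"
  then show "\<not> odd_unit (lie_prod g h) x" by (auto simp: g.even_ht0 h.even_ht0)
 next
  fix x y z assume "x \<in> units (lie_prod g h)" "y \<in> units (lie_prod g h)" "z \<in> units (lie_prod g h)" "struct (lie_prod g h) x y z \<noteq> 0"
  then show "case_sum ht ht' z = case_sum ht ht' x + case_sum ht ht' y"
   by (auto simp: g.struct_ht h.struct_ht elim!: PlusE)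
 next
  fix y z assume "y \<in> units (lie_prod g h)" "z \<in> units (lie_prod g h)"
  then show "(\<Sum>x\<in>units (lie_prod g h). case_sum hc hc' x * struct (lie_prod g h) x y z) = (if z = y then of_int (case_sum ht ht' y) else 0)"
   by (auto simp: sum_Plus g.finite_units h.finite_units g.grading h.grading elim!: PlusE split: if_splits)
 next
  fix x assume "x \<in> units (lie_prod g h)" "case_sum hc hc' x \<noteq> 0"
  then show "case_sum ht ht' x = 0" by (auto simp: g.hc_ht h.hc_ht)
 qed
qed

definition left_rep :: "('x + 'y, 'v) rep => ('x, 'v) rep" where
 "left_rep M = \<lparr> scal = scal M, hpart = hpart M, act = (\<lambda>x. act M (Inl x)) \<rparr>"

definition right_rep :: "('x + 'y, 'v) rep => ('y, 'v) rep" where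
 "right_rep M = \<lparr> scal = scal M, hpart = hpart M, act = (\<lambda>x. act M (Inr x)) \<rparr>"

lemma left_rep_simps [simp]: "scal (left_rep M) = scal M" "hpart (left_rep M) = hpart M" "act (left_rep M) x = act M (Inl x)"
 "space (left_rep M) = space M"
 by (simp_all add: left_rep_def Defs.space_def)

lemma right_rep_simps [simp]: "scal (right_rep M) = scal M" "hpart (right_rep M) = hpart M" "act (right_rep M) x = act M (Inr x)"
 "space (right_rep M) = space M"
 by (simp_all add: right_rep_def Defs.space_def)

lemma supermodule_left_right:
 assumes M: "supermodule (lie_prod g h) M" and fin: "finite (units g)" "finite (units h)"
 shows "supermodule g (left_rep M)" "supermodule h (right_rep M)"
proof -
 interpret supermod "lie_prod g h" M by unfold_locales (rule M)
 have "act M (Inl x) (act M (Inl y) v) - scal M (koszul (odd_unit g x) (odd_unit g y)) (act M (Inl y) (act M (Inl x) v))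
  = (\<Sum>z\<in>units g. scal M (struct g x y z) (act M (Inl z) v))" if "x \<in> units g" "y \<in> units g" "v \<in> space M" for x y v
  using bracket[of "Inl x" "Inl y" v] that by (simp add: sum_Plus fin InlI InrI)
 then show "supermodule g (left_rep M)"
  unfolding Defs.supermodule_def left_rep_simps
  using V.vector_space_axioms subspace_hpart hpart_Int act_add[of "Inl _"] act_scale[of "Inl _"] act_hpart[of "Inl _"]
  by (auto simp: InlI)
 have "act M (Inr x) (act M (Inr y) v) - scal M (koszul (odd_unit h x) (odd_unit h y)) (act M (Inr y) (act M (Inr x) v))
  = (\<Sum>z\<in>units h. scal M (struct h x y z) (act M (Inr z) v))" if "x \<in> units h" "y \<in> units h" "v \<in> space M" for x y v
  using bracket[of "Inr x" "Inr y" v] that by (simp add: sum_Plus fin InlI InrI)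
 then show "supermodule h (right_rep M)"
  unfolding Defs.supermodule_def right_rep_simps
  using V.vector_space_axioms subspace_hpart hpart_Int act_add[of "Inr _"] act_scale[of "Inr _"] act_hpart[of "Inr _"]
  by (auto simp: InrI)
qed

definition gl_weight :: "(sindex => nat) => sindex \<times> sindex => complex" where
 "gl_weight \<mu> x = of_nat (\<mu> (fst x))"

definition idx :: "nat => nat => sindex" where
 "idx m k = (if k \<le> m then Inl k else Inr (k - m))"

lemma idx_pos: "a \<in> sidx m n ==> idx m (pos m a) = a"
 by (cases a) (auto simp: sidx_def idx_def)

lemma pos_bounds: "a \<in> sidx m n ==> 1 \<le> pos m a \<and> pos m a \<le> m + n"
 by (cases a) (auto simp: sidx_def)

lemma idx_sidx: "1 \<le> k ==> k \<le> m + n ==> idx m k \<in> sidx m n"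
 by (auto simp: idx_def)

lemma simple_root_idx:
 assumes "1 \<le> k" "k < m + n" shows "(idx m k, idx m (Suc k)) \<in> simple_roots m n"
proof -
 consider "Suc k \<le> m" | "k = m" | "k > m" by linarith
 then show ?thesis
 proof cases
  case 1
  then show ?thesis using assms by (auto simp: Defs.simple_roots_def idx_def intro!: exI[of _ "Suc k"])
 next
  case 2
  then show ?thesis using assms by (auto simp: Defs.simple_roots_def idx_def)
 next
  case 3
  then have "(idx m k, idx m (Suc k)) = (Inr (Suc k - m - 1), Inr (Suc k - m))" "1 < Suc k - m" "Suc k - m \<le> n"
   using assms by (auto simp: idx_def)
  then show ?thesis unfolding Defs.simple_roots_def by blast
 qed
qed

lemma simple_roots_ht: "x \<in> simple_roots m n ==> x \<in> units (gl m n) \<and> gl_ht m x > 0"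
 by (auto simp: Defs.simple_roots_def gl_units gl_ht_def split: if_splits)

text \<open>Successive brackets of simple root vectors give all matrix units above the diagonal.\<close>

lemma singular_gl_iff:
 assumes M: "supermodule (gl m n) M"
 shows "v \<in> space M \<and> highest_weight_vector m n (scal M) (act M) \<mu> v
  \<longleftrightarrow> v \<noteq> 0 \<and> singular (gl m n) (gl_ht m) M (gl_weight \<mu>) v"
proof
 interpret supermod "gl m n" M by unfold_locales (rule M)
 assume v: "v \<in> space M \<and> highest_weight_vector m n (scal M) (act M) \<mu> v"
 have up: "act M (idx m i, idx m j) v = 0" if "1 \<le> i" "i < j" "j \<le> m + n" for i j
  using that
 proof (induction j)
  case (Suc j)
  show ?case
  proof (cases "i = j")
   case True
   then show ?thesis using simple_root_idx[of j m n] Suc v by (auto simp: highest_weight_vector_def)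
  next
   case False
   let ?x = "(idx m i, idx m j)" and ?y = "(idx m j, idx m (Suc j))"
   have u: "?x \<in> units (gl m n)" "?y \<in> units (gl m n)" "(idx m i, idx m (Suc j)) \<in> units (gl m n)"
    using Suc False by (auto simp: gl_units intro!: idx_sidx)
   have ne: "idx m i \<noteq> idx m (Suc j)" using Suc by (auto simp: idx_def split: if_splits)
   have "act M ?x v = 0" using Suc False by simp
   moreover have "act M ?y v = 0" using simple_root_idx[of j m n] Suc v by (auto simp: highest_weight_vector_def)
   ultimately have "0 = (\<Sum>z\<in>units (gl m n). scal M (struct (gl m n) ?x ?y z) (act M z v))"
    using bracket[OF u(1,2), of v] v u by simp
   also have "\<dots> = (\<Sum>z\<in>units (gl m n). if z = (idx m i, idx m (Suc j)) then act M (idx m i, idx m (Suc j)) v else 0)"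
    by (rule sum.cong) (use ne in \<open>auto simp: gl_struct\<close>)
   also have "\<dots> = act M (idx m i, idx m (Suc j)) v" using u by (simp add: gl_units)
   finally show ?thesis by simp
  qed
 qed simp
 have "act M x v = 0" if "x \<in> units (gl m n)" "gl_ht m x > 0" for x
  using up[of "pos m (fst x)" "pos m (snd x)"] that pos_bounds[of "fst x" m n] pos_bounds[of "snd x" m n]
   idx_pos[of "fst x" m n] idx_pos[of "snd x" m n] by (auto simp: gl_units gl_ht_def)
 moreover have "act M x v = scal M (gl_weight \<mu> x) v" if "x \<in> units (gl m n)" "gl_ht m x = 0" for x
  using v that pos_inject[of "fst x" m n "snd x" n]
  by (cases x) (auto simp: gl_units gl_ht_def gl_weight_def highest_weight_vector_def)
 ultimately show "v \<noteq> 0 \<and> singular (gl m n) (gl_ht m) M (gl_weight \<mu>) v"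
  using v by (auto simp: singular_def highest_weight_vector_def)
next
 assume v: "v \<noteq> 0 \<and> singular (gl m n) (gl_ht m) M (gl_weight \<mu>) v"
 then have "act M (a, a) v = scal M (of_nat (\<mu> a)) v" if "a \<in> sidx m n" for a
  using that unfolding singular_def by (force simp: gl_units gl_ht_def gl_weight_def)
 then show "v \<in> space M \<and> highest_weight_vector m n (scal M) (act M) \<mu> v"
  using v simple_roots_ht unfolding singular_def highest_weight_vector_def by blast
qed

section \<open>The polynomial superalgebra as a unitary module\<close>

lemma poly_act_Inl: "poly_act p q m n (Inl (a, b)) f = (\<Sum>c\<in>sidx m n. zz (gvar a c) (dd (gvar b c) f))"
 by (simp add: gen_eq gen_deriv_eq)

lemma poly_act_Inr: "poly_act p q m n (Inr (c, d)) f
  = (\<Sum>a\<in>sidx p q. sp_scale (koszul (odd_idx a) (odd_idx c \<noteq> odd_idx d)) (zz (gvar a c) (dd (gvar a d) f)))"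
 by (simp add: gen_eq gen_deriv_eq)

lemmas [simp del] = poly_act.simps

lemma poly_act_add: "poly_act p q m n x (f + g) = poly_act p q m n x f + poly_act p q m n x g"
 by (cases x; cases "projl x"; cases "projr x")
  (auto simp: poly_act_Inl poly_act_Inr distrib_left sum.distrib SP.scale_right_distrib)

lemma poly_act_scale: "poly_act p q m n x (sp_scale c f) = sp_scale c (poly_act p q m n x f)"
 by (cases x; cases "projl x"; cases "projr x")
  (auto simp: poly_act_Inl poly_act_Inr SP.scale_sum_right mult.commute)

subsection \<open>Supports and parity\<close>

definition in_range :: "nat => nat => nat => nat => svar => bool" where
 "in_range p q m n A \<longleftrightarrow> (\<exists>a\<in>sidx p q. \<exists>c\<in>sidx m n. A = gvar a c)"

lemma gvar_surj: "\<exists>a c. A = gvar a c"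
proof (cases A)
 case (Inl v)
 show ?thesis
 proof (cases v)
  case (X l i) then show ?thesis using Inl gvar.simps(1) by metis
 next
  case (Y k j) then show ?thesis using Inl gvar.simps(2) by metis
 qed
next
 case (Inr v)
 show ?thesis
 proof (cases v)
  case (Xi l j) then show ?thesis using Inr gvar.simps(3) by metis
 next
  case (Eta k i) then show ?thesis using Inr gvar.simps(4) by metis
 qed
qed

lemma in_range_gvar [simp]: "in_range p q m n (gvar a c) \<longleftrightarrow> a \<in> sidx p q \<and> c \<in> sidx m n"
 by (auto simp: in_range_def)

lemma in_range_Inl: "in_range p q m n (Inl v) \<longleftrightarrow> v \<in> even_vars p q m n"
proof (cases v)
 case (X l i)
 then have "Inl v = gvar (Inl i) (Inl l)" by simp
 then show ?thesis using X by (simp only: in_range_gvar) (auto simp: even_vars_def)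
next
 case (Y k j)
 then have "Inl v = gvar (Inr j) (Inr k)" by simp
 then show ?thesis using Y by (simp only: in_range_gvar) (auto simp: even_vars_def)
qed

lemma in_range_Inr: "in_range p q m n (Inr v) \<longleftrightarrow> v \<in> odd_vars p q m n"
proof (cases v)
 case (Xi l j)
 then have "Inr v = gvar (Inr j) (Inl l)" by simp
 then show ?thesis using Xi by (simp only: in_range_gvar) (auto simp: odd_vars_def)
next
 case (Eta k i)
 then have "Inr v = gvar (Inl i) (Inr k)" by simp
 then show ?thesis using Eta by (simp only: in_range_gvar) (auto simp: odd_vars_def)
qed

text \<open>
 Membership is a condition on the variables occurring in the monomials, hence stable under multiplication by
 admissible variables and under all derivatives.
\<close>

lemma superpolys_iff:
 "f \<in> superpolys p q m n \<longleftrightarrow> (\<forall>x A. cf f x \<noteq> 0 \<longrightarrow> cnt A x > 0 \<longrightarrow> in_range p q m n A)"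
proof
 assume f: "f \<in> superpolys p q m n"
 show "\<forall>x A. cf f x \<noteq> 0 \<longrightarrow> cnt A x > 0 \<longrightarrow> in_range p q m n A"
 proof (intro allI impI)
  fix x A assume x: "cf f x \<noteq> 0" "cnt A x > 0"
  then have "gcoeff f (fst x) \<noteq> 0" "snd x \<in> Poly_Mapping.keys (gcoeff f (fst x))"
   by (auto simp: cf_def in_keys_iff)
  then have "fst x \<subseteq> odd_vars p q m n" "Poly_Mapping.keys (snd x) \<subseteq> even_vars p q m n"
   using f unfolding superpolys_def by blast+
  then show "in_range p q m n A"
   using x(2) by (cases A) (auto simp: in_range_Inl in_range_Inr in_keys_iff split: if_splits)
 qed
next
 assume *: "\<forall>x A. cf f x \<noteq> 0 \<longrightarrow> cnt A x > 0 \<longrightarrow> in_range p q m n A"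
 show "f \<in> superpolys p q m n"
  unfolding superpolys_def
 proof (intro CollectI allI impI conjI subsetI ballI)
  fix S v assume "gcoeff f S \<noteq> 0" "v \<in> S"
  then obtain e where "cf f (S, e) \<noteq> 0" by (auto simp: cf_def poly_mapping_eq_iff fun_eq_iff)
  then show "v \<in> odd_vars p q m n" using *[rule_format, of "(S, e)" "Inr v"] \<open>v \<in> S\<close> by (simp add: in_range_Inr)
 next
  fix S e v assume "e \<in> Poly_Mapping.keys (gcoeff f S)" "v \<in> Poly_Mapping.keys e"
  then show "v \<in> even_vars p q m n"
   using *[rule_format, of "(S, e)" "Inl v"] by (simp add: cf_def in_keys_iff in_range_Inl)
 qed
qed

definition has_parity :: "bool => superpoly => bool" where
 "has_parity s f \<longleftrightarrow> (\<forall>x. cf f x \<noteq> 0 \<longrightarrow> odd (card (fst x)) = s)"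

lemma poly_rep_simps [simp]:
 "scal (poly_rep p q m n) = sp_scale" "act (poly_rep p q m n) = poly_act p q m n"
 by (simp_all add: poly_rep_def)

lemma hpart_poly_rep: "hpart (poly_rep p q m n) s = {f \<in> superpolys p q m n. has_parity s f}"
proof -
 have "(\<forall>S. gcoeff f S \<noteq> 0 \<longrightarrow> odd (card S) = s) \<longleftrightarrow> has_parity s f" for f
 proof
  assume "\<forall>S. gcoeff f S \<noteq> 0 \<longrightarrow> odd (card S) = s"
  then show "has_parity s f" unfolding has_parity_def cf_def by (metis lookup_zero)
 next
  assume *: "has_parity s f"
  show "\<forall>S. gcoeff f S \<noteq> 0 \<longrightarrow> odd (card S) = s"
  proof (intro allI impI)
   fix S assume "gcoeff f S \<noteq> 0"
   then obtain e where "cf f (S, e) \<noteq> 0" by (auto simp: cf_def poly_mapping_eq_iff fun_eq_iff)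
   then show "odd (card S) = s" using * unfolding has_parity_def by fastforce
  qed
 qed
 then show ?thesis by (simp add: poly_rep_def)
qed

text \<open>
 The parity automorphism. Expressing parities by its eigenvalues turns sign bookkeeping into algebra.
\<close>

lift_definition kap :: "('o, 'c::comm_ring_1) grassmann => ('o, 'c) grassmann"
 is "\<lambda>f S. if even (card S) then f S else - f S"
 by (auto elim!: rev_finite_subset split: if_splits)

lemma cf_kap: "cf (kap f) x = (if even (card (fst x)) then cf f x else - cf f x)"
 by (simp add: cf_def kap.rep_eq)

lemma kap_kap [simp]: "kap (kap f) = f" for f :: superpoly
 by (rule cf_eqI) (simp add: cf_kap)

lemma kap_add [simp]: "kap (f + g) = kap f + kap g" for f :: superpoly
 by (rule cf_eqI) (simp add: cf_kap)

lemma kap_scale [simp]: "kap (sp_scale c f) = sp_scale c (kap f)"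
 by (rule cf_eqI) (simp add: cf_kap)

lemma kap_zero [simp]: "kap (0 :: superpoly) = 0"
 by (rule cf_eqI) (simp add: cf_kap)

lemma complex_eq_neg: "(c :: complex) = - c \<longleftrightarrow> c = 0" "- c = c \<longleftrightarrow> c = 0"
 by (auto simp: complex_eq_iff)

lemma has_parity_iff: "has_parity s f \<longleftrightarrow> kap f = (if s then - f else f)"
proof -
 have "kap f = (if s then - f else f) \<longleftrightarrow> (\<forall>x. cf (kap f) x = cf (if s then - f else f) x)"
  using cf_eqI by metis
 also have "\<dots> \<longleftrightarrow> has_parity s f"
  unfolding has_parity_def cf_kap by (cases s) (auto simp: complex_eq_neg)
 finally show ?thesis by simp
qed

lemma card_down: "finite (fst x) ==> cnt A x > 0 ==> odd (card (fst x)) = (odd (card (fst (down A x))) \<noteq> oddv A)"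
 by (cases A) (auto simp: card_Diff_singleton split: if_splits dest: card_gt_0_iff[THEN iffD2, OF conjI, rotated])

lemma card_up: "finite (fst x) ==> raisable A x ==> odd (card (fst (up A x))) = (odd (card (fst x)) \<noteq> oddv A)"
 by (cases A) auto

lemma kap_zz: "kap (zz A f) = (if oddv A then - zz A (kap f) else zz A (kap f))"
proof (rule cf_eqI)
 fix x
 show "cf (kap (zz A f)) x = cf (if oddv A then - zz A (kap f) else zz A (kap f)) x"
  using card_down[of x A] by (cases "finite (fst x)") (auto simp: cf_kap cf_zz cf_infinite)
qed

lemma kap_dd: "kap (dd A f) = (if oddv A then - dd A (kap f) else dd A (kap f))"
proof (rule cf_eqI)
 fix x
 show "cf (kap (dd A f)) x = cf (if oddv A then - dd A (kap f) else dd A (kap f)) x"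
  using card_up[of x A] by (cases "finite (fst x)") (auto simp: cf_kap cf_dd cf_infinite)
qed

lemma superpolys_subspace: "SP.subspace (superpolys p q m n)"
proof (rule SP.subspaceI)
 fix f g assume f: "f \<in> superpolys p q m n" and g: "g \<in> superpolys p q m n"
 show "f + g \<in> superpolys p q m n"
  unfolding superpolys_iff
 proof (intro allI impI)
  fix x A assume x: "cf (f + g) x \<noteq> 0" "cnt A x > 0"
  then have "cf f x \<noteq> 0 \<or> cf g x \<noteq> 0" by auto
  then show "in_range p q m n A" using f g x(2) unfolding superpolys_iff by blast
 qed
qed (auto simp: superpolys_iff)

lemma zz_superpolys: "in_range p q m n A ==> f \<in> superpolys p q m n ==> zz A f \<in> superpolys p q m n"
 unfolding superpolys_iff
proof (intro allI impI)
 fix x B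
 assume A: "in_range p q m n A" and f: "\<forall>x A. cf f x \<noteq> 0 \<longrightarrow> 0 < cnt A x \<longrightarrow> in_range p q m n A"
  and x: "cf (zz A f) x \<noteq> 0" "0 < cnt B x"
 have "cf f (down A x) \<noteq> 0" using x(1) by (auto simp: cf_zz split: if_splits)
 moreover have "A \<noteq> B ==> cnt B (down A x) > 0" using x(2) by (simp add: cnt_down_other)
 ultimately show "in_range p q m n B" using A f by blast
qed

lemma dd_superpolys: "f \<in> superpolys p q m n ==> dd A f \<in> superpolys p q m n"
 unfolding superpolys_iff
proof (intro allI impI)
 fix x B assume f: "\<forall>x A. cf f x \<noteq> 0 \<longrightarrow> 0 < cnt A x \<longrightarrow> in_range p q m n A" and x: "cf (dd A f) x \<noteq> 0" "cnt B x > 0"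
 have r: "raisable A x" and c: "cf f (up A x) \<noteq> 0" using x(1) by (auto simp: cf_dd split: if_splits)
 have "cnt B (up A x) > 0" using x(2) cnt_up[OF r] cnt_up_other[of A B x] by (cases "A = B") auto
 then show "in_range p q m n B" using f c by blast
qed

lemma poly_act_superpolys:
 assumes "x \<in> units (lie_prod (gl p q) (gl m n))" "f \<in> superpolys p q m n"
 shows "poly_act p q m n x f \<in> superpolys p q m n"
proof (cases x)
 case (Inl y)
 then obtain a b where "y = (a, b)" "a \<in> sidx p q" "b \<in> sidx p q" using assms(1) by (auto simp: gl_units)
 then show ?thesis unfolding Inl
  by (auto simp: poly_act_Inl intro!: SP.subspace_sum[OF superpolys_subspace] zz_superpolys dd_superpolys assms(2))
next
 case (Inr y)
 then obtain a b where "y = (a, b)" "a \<in> sidx m n" "b \<in> sidx m n" using assms(1) by (auto simp: gl_units)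
 then show ?thesis unfolding Inr
  by (auto simp: poly_act_Inr intro!: SP.subspace_sum[OF superpolys_subspace] SP.subspace_scale[OF superpolys_subspace] zz_superpolys dd_superpolys assms(2))
qed

lemma kap_sum: "kap (sum h I) = (\<Sum>i\<in>I. kap (h i))" for h :: "_ => superpoly"
 by (induction I rule: infinite_finite_induct) simp_all

lemma kap_uminus [simp]: "kap (- f) = - kap f" for f :: superpoly
 by (rule cf_eqI) (simp add: cf_kap)

abbreviation glgl :: "nat => nat => nat => nat => ((sindex \<times> sindex) + (sindex \<times> sindex)) lie_super" where
 "glgl p q m n \<equiv> lie_prod (gl p q) (gl m n)"

lemma odd_unit_Inl: "odd_unit (glgl p q m n) (Inl (a, b)) \<longleftrightarrow> odd_idx a \<noteq> odd_idx b"
 and odd_unit_Inr: "odd_unit (glgl p q m n) (Inr (a, b)) \<longleftrightarrow> odd_idx a \<noteq> odd_idx b"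
 by (simp_all add: gl_odd)

lemma kap_poly_act:
 "kap (poly_act p q m n x f) = (if odd_unit (glgl p q m n) x then - poly_act p q m n x (kap f) else poly_act p q m n x (kap f))"
proof (cases x)
 case (Inl y)
 obtain a b where y: "y = (a, b)" by (cases y)
 have "kap (zz (gvar a c) (dd (gvar b c) f)) = (if odd_idx a \<noteq> odd_idx b then - zz (gvar a c) (dd (gvar b c) (kap f)) else zz (gvar a c) (dd (gvar b c) (kap f)))" for c
  by (auto simp: kap_zz kap_dd)
 then show ?thesis unfolding Inl y poly_act_Inl odd_unit_Inl kap_sum by (simp add: sum_negf)
next
 case (Inr y)
 obtain c d where y: "y = (c, d)" by (cases y)
 have "kap (zz (gvar a c) (dd (gvar a d) f)) = (if odd_idx c \<noteq> odd_idx d then - zz (gvar a c) (dd (gvar a d) (kap f)) else zz (gvar a c) (dd (gvar a d) (kap f)))" for a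
  by (auto simp: kap_zz kap_dd)
 then show ?thesis unfolding Inr y poly_act_Inr odd_unit_Inr kap_sum by (simp add: sum_negf)
qed

lemma space_poly_rep: "space (poly_rep p q m n) = superpolys p q m n"
proof (intro Set.set_eqI iffI)
 fix f assume "f \<in> space (poly_rep p q m n)"
 then show "f \<in> superpolys p q m n"
  unfolding Defs.space_def hpart_poly_rep using SP.subspace_add[OF superpolys_subspace] by auto
next
 fix f assume f: "f \<in> superpolys p q m n"
 define f0 where "f0 = sp_scale (1/2) (f + kap f)"
 define f1 where "f1 = sp_scale (1/2) (f - kap f)"
 have k: "kap f \<in> superpolys p q m n" using f by (auto simp: superpolys_iff cf_kap)
 have "f = f0 + f1" by (rule cf_eqI) (simp add: f0_def f1_def field_simps)
 moreover have "f0 \<in> superpolys p q m n" "f1 \<in> superpolys p q m n"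
  using f k unfolding f0_def f1_def
  by (auto intro!: SP.subspace_scale[OF superpolys_subspace] SP.subspace_add[OF superpolys_subspace] SP.subspace_diff[OF superpolys_subspace])
 moreover have "has_parity False f0" "has_parity True f1"
  unfolding has_parity_def f0_def f1_def by (auto simp: cf_kap split: if_splits)
 ultimately show "f \<in> space (poly_rep p q m n)" unfolding Defs.space_def hpart_poly_rep by blast
qed

text \<open>
 The commutator of two operators \<open>zz A \<circ> dd B\<close> is computed once, for variables of arbitrary parity. The
 bracket relations of both actions and their supercommutation are sums of instances.
\<close>

lemma quadratic_bracket:
 "zz A (dd B (zz C (dd D f))) - sp_scale (koszul (oddv A \<noteq> oddv B) (oddv C \<noteq> oddv D)) (zz C (dd D (zz A (dd B f))))
  = (if B = C then zz A (dd D f) else 0)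
   - sp_scale (koszul (oddv A \<noteq> oddv B) (oddv C \<noteq> oddv D)) (if D = A then zz C (dd B f) else 0)"
proof -
 let ?k = "koszul (oddv A \<noteq> oddv B) (oddv C \<noteq> oddv D)"
 have 1: "zz A (dd B (zz C (dd D f))) = (if B = C then zz A (dd D f) else 0) + sp_scale (vsign B C) (zz A (zz C (dd B (dd D f))))"
  by (simp add: dd_zz distrib_left)
 have "zz C (dd D (zz A (dd B f))) = (if D = A then zz C (dd B f) else 0) + sp_scale (vsign D A) (zz C (zz A (dd D (dd B f))))"
  by (simp add: dd_zz distrib_left)
 also have "zz C (zz A (dd D (dd B f))) = sp_scale (vsign C A * vsign D B) (zz A (zz C (dd B (dd D f))))"
  by (subst zz_zz, subst dd_dd) (simp add: mult.commute)
 finally have 2: "sp_scale ?k (zz C (dd D (zz A (dd B f)))) = sp_scale ?k (if D = A then zz C (dd B f) else 0)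
   + sp_scale (?k * (vsign D A * (vsign C A * vsign D B))) (zz A (zz C (dd B (dd D f))))"
  by (simp add: SP.scale_right_distrib)
 have "?k * (vsign D A * (vsign C A * vsign D B)) = vsign B C"
  by (auto simp: vsign_def koszul_def)
 then show ?thesis unfolding 1 2 by simp
qed

lemma sum_delta2:
 assumes "finite I" "finite J" "i \<in> I" "j \<in> J"
 shows "(\<Sum>x\<in>I. \<Sum>y\<in>J. if i = x \<and> j = y then h x y else 0) = (h i j :: 'a::ab_group_add)"
proof -
 have "(\<Sum>x\<in>I. \<Sum>y\<in>J. if i = x \<and> j = y then h x y else 0) = (\<Sum>x\<in>I. if x = i then h i j else 0)"
  using assms by (intro sum.cong) (auto simp: sum.delta)
 then show ?thesis using assms by simp
qed

lemma poly_bracket_Inl: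
 assumes "a \<in> sidx p q" "b \<in> sidx p q" "a' \<in> sidx p q" "b' \<in> sidx p q"
 shows "poly_act p q m n (Inl (a, b)) (poly_act p q m n (Inl (a', b')) f)
   - sp_scale (koszul (odd_idx a \<noteq> odd_idx b) (odd_idx a' \<noteq> odd_idx b')) (poly_act p q m n (Inl (a', b')) (poly_act p q m n (Inl (a, b)) f))
  = (if b = a' then poly_act p q m n (Inl (a, b')) f else 0)
   - sp_scale (koszul (odd_idx a \<noteq> odd_idx b) (odd_idx a' \<noteq> odd_idx b')) (if a = b' then poly_act p q m n (Inl (a', b)) f else 0)"
proof -
 let ?k = "koszul (odd_idx a \<noteq> odd_idx b) (odd_idx a' \<noteq> odd_idx b')" and ?J = "sidx m n"
 have k: "?k = koszul (oddv (gvar a c) \<noteq> oddv (gvar b c)) (oddv (gvar a' c') \<noteq> oddv (gvar b' c'))" for c c'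
  by (rule arg_cong2[of _ _ _ _ koszul]) auto
 have q: "zz (gvar a c) (dd (gvar b c) (zz (gvar a' c') (dd (gvar b' c') f))) - sp_scale ?k (zz (gvar a' c') (dd (gvar b' c') (zz (gvar a c) (dd (gvar b c) f))))
   = (if gvar b c = gvar a' c' then zz (gvar a c) (dd (gvar b' c') f) else 0) - sp_scale ?k (if gvar b' c' = gvar a c then zz (gvar a' c') (dd (gvar b c) f) else 0)" for c c'
  unfolding k[of c c'] by (rule quadratic_bracket)
 have "poly_act p q m n (Inl (a, b)) (poly_act p q m n (Inl (a', b')) f)
   - sp_scale ?k (poly_act p q m n (Inl (a', b')) (poly_act p q m n (Inl (a, b)) f))
  = (\<Sum>c\<in>?J. \<Sum>c'\<in>?J. zz (gvar a c) (dd (gvar b c) (zz (gvar a' c') (dd (gvar b' c') f)))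
    - sp_scale ?k (zz (gvar a' c') (dd (gvar b' c') (zz (gvar a c) (dd (gvar b c) f)))))"
  unfolding poly_act_Inl sum_subtractf
  by (subst (2) sum.swap) (simp add: sum_distrib_left SP.scale_sum_right)
 also have "\<dots> = (\<Sum>c\<in>?J. \<Sum>c'\<in>?J. (if gvar b c = gvar a' c' then zz (gvar a c) (dd (gvar b' c') f) else 0)
   - sp_scale ?k (if gvar b' c' = gvar a c then zz (gvar a' c') (dd (gvar b c) f) else 0))"
  by (simp only: q)
 also have "\<dots> = (\<Sum>c\<in>?J. (if b = a' then zz (gvar a c) (dd (gvar b' c) f) else 0)
   - sp_scale ?k (if a = b' then zz (gvar a' c) (dd (gvar b c) f) else 0))"
 proof (rule sum.cong[OF refl])
  fix c assume c: "c \<in> ?J"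
  have "(\<Sum>c'\<in>?J. if gvar b c = gvar a' c' then zz (gvar a c) (dd (gvar b' c') f) else 0)
   = (if b = a' then zz (gvar a c) (dd (gvar b' c) f) else 0)" using c by (simp add: sum.delta)
  moreover have "(\<Sum>c'\<in>?J. sp_scale ?k (if gvar b' c' = gvar a c then zz (gvar a' c') (dd (gvar b c) f) else 0))
   = sp_scale ?k (if a = b' then zz (gvar a' c) (dd (gvar b c) f) else 0)"
  proof -
   have "(\<Sum>c'\<in>?J. if gvar b' c' = gvar a c then zz (gvar a' c') (dd (gvar b c) f) else 0)
     = (\<Sum>c'\<in>?J. if c' = c then (if a = b' then zz (gvar a' c) (dd (gvar b c) f) else 0) else 0)"
    by (intro sum.cong) auto
   then show ?thesis using c unfolding SP.scale_sum_right[symmetric] by simp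
  qed
  ultimately show "(\<Sum>c'\<in>?J. (if gvar b c = gvar a' c' then zz (gvar a c) (dd (gvar b' c') f) else 0)
   - sp_scale ?k (if gvar b' c' = gvar a c then zz (gvar a' c') (dd (gvar b c) f) else 0))
   = (if b = a' then zz (gvar a c) (dd (gvar b' c) f) else 0)
   - sp_scale ?k (if a = b' then zz (gvar a' c) (dd (gvar b c) f) else 0)"
   by (simp only: sum_subtractf)
 qed
 finally show ?thesis unfolding poly_act_Inl by (simp add: sum_subtractf SP.scale_sum_right)
qed

lemma poly_bracket_Inr:
 assumes "c \<in> sidx m n" "d \<in> sidx m n" "c' \<in> sidx m n" "d' \<in> sidx m n"
 shows "poly_act p q m n (Inr (c, d)) (poly_act p q m n (Inr (c', d')) f)
   - sp_scale (koszul (odd_idx c \<noteq> odd_idx d) (odd_idx c' \<noteq> odd_idx d')) (poly_act p q m n (Inr (c', d')) (poly_act p q m n (Inr (c, d)) f))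
  = (if d = c' then poly_act p q m n (Inr (c, d')) f else 0)
   - sp_scale (koszul (odd_idx c \<noteq> odd_idx d) (odd_idx c' \<noteq> odd_idx d')) (if c = d' then poly_act p q m n (Inr (c', d)) f else 0)"
proof -
 let ?k = "koszul (odd_idx c \<noteq> odd_idx d) (odd_idx c' \<noteq> odd_idx d')" and ?J = "sidx p q"
 define s where "s a = koszul (odd_idx a) (odd_idx c \<noteq> odd_idx d)" for a
 define s' where "s' a = koszul (odd_idx a) (odd_idx c' \<noteq> odd_idx d')" for a
 have k: "?k = koszul (oddv (gvar a c) \<noteq> oddv (gvar a d)) (oddv (gvar a' c') \<noteq> oddv (gvar a' d'))" for a a'
  by (rule arg_cong2[of _ _ _ _ koszul]) auto
 have q: "zz (gvar a c) (dd (gvar a d) (zz (gvar a' c') (dd (gvar a' d') f))) - sp_scale ?k (zz (gvar a' c') (dd (gvar a' d') (zz (gvar a c) (dd (gvar a d) f))))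
   = (if gvar a d = gvar a' c' then zz (gvar a c) (dd (gvar a' d') f) else 0) - sp_scale ?k (if gvar a' d' = gvar a c then zz (gvar a' c') (dd (gvar a d) f) else 0)" for a a'
  unfolding k[of a a'] by (rule quadratic_bracket)
 have "poly_act p q m n (Inr (c, d)) (poly_act p q m n (Inr (c', d')) f)
   - sp_scale ?k (poly_act p q m n (Inr (c', d')) (poly_act p q m n (Inr (c, d)) f))
  = (\<Sum>a\<in>?J. \<Sum>a'\<in>?J. sp_scale (s a * s' a') (zz (gvar a c) (dd (gvar a d) (zz (gvar a' c') (dd (gvar a' d') f))))
    - sp_scale (s a * s' a') (sp_scale ?k (zz (gvar a' c') (dd (gvar a' d') (zz (gvar a c) (dd (gvar a d) f))))))"
  unfolding poly_act_Inr sum_subtractf s_def[symmetric] s'_def[symmetric]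
  by (subst (2) sum.swap) (simp add: sum_distrib_left SP.scale_sum_right mult_ac)
 also have "\<dots> = (\<Sum>a\<in>?J. \<Sum>a'\<in>?J. sp_scale (s a * s' a') ((if gvar a d = gvar a' c' then zz (gvar a c) (dd (gvar a' d') f) else 0)
   - sp_scale ?k (if gvar a' d' = gvar a c then zz (gvar a' c') (dd (gvar a d) f) else 0)))"
  by (simp only: SP.scale_right_diff_distrib[symmetric] q)
 also have "\<dots> = (\<Sum>a\<in>?J. sp_scale (s a * s' a) ((if d = c' then zz (gvar a c) (dd (gvar a d') f) else 0)
   - sp_scale ?k (if c = d' then zz (gvar a c') (dd (gvar a d) f) else 0)))"
 proof (rule sum.cong[OF refl])
  fix a assume a: "a \<in> ?J"
  have "(\<Sum>a'\<in>?J. sp_scale (s a * s' a') ((if gvar a d = gvar a' c' then zz (gvar a c) (dd (gvar a' d') f) else 0)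
   - sp_scale ?k (if gvar a' d' = gvar a c then zz (gvar a' c') (dd (gvar a d) f) else 0)))
   = (\<Sum>a'\<in>?J. if a' = a then sp_scale (s a * s' a) ((if d = c' then zz (gvar a c) (dd (gvar a d') f) else 0)
   - sp_scale ?k (if c = d' then zz (gvar a c') (dd (gvar a d) f) else 0)) else 0)"
   by (intro sum.cong) auto
  then show "(\<Sum>a'\<in>?J. sp_scale (s a * s' a') ((if gvar a d = gvar a' c' then zz (gvar a c) (dd (gvar a' d') f) else 0)
   - sp_scale ?k (if gvar a' d' = gvar a c then zz (gvar a' c') (dd (gvar a d) f) else 0)))
   = sp_scale (s a * s' a) ((if d = c' then zz (gvar a c) (dd (gvar a d') f) else 0)
   - sp_scale ?k (if c = d' then zz (gvar a c') (dd (gvar a d) f) else 0))" using a by simp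
 qed
 also have "\<dots> = (\<Sum>a\<in>?J. (if d = c' then sp_scale (koszul (odd_idx a) (odd_idx c \<noteq> odd_idx d')) (zz (gvar a c) (dd (gvar a d') f)) else 0)
   - sp_scale ?k (if c = d' then sp_scale (koszul (odd_idx a) (odd_idx c' \<noteq> odd_idx d)) (zz (gvar a c') (dd (gvar a d) f)) else 0))"
 proof (rule sum.cong[OF refl])
  fix a
  have "d = c' ==> s a * s' a = koszul (odd_idx a) (odd_idx c \<noteq> odd_idx d')"
   "c = d' ==> s a * s' a = koszul (odd_idx a) (odd_idx c' \<noteq> odd_idx d)"
   by (auto simp: s_def s'_def koszul_def)
  then show "sp_scale (s a * s' a) ((if d = c' then zz (gvar a c) (dd (gvar a d') f) else 0)
   - sp_scale ?k (if c = d' then zz (gvar a c') (dd (gvar a d) f) else 0))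
   = (if d = c' then sp_scale (koszul (odd_idx a) (odd_idx c \<noteq> odd_idx d')) (zz (gvar a c) (dd (gvar a d') f)) else 0)
   - sp_scale ?k (if c = d' then sp_scale (koszul (odd_idx a) (odd_idx c' \<noteq> odd_idx d)) (zz (gvar a c') (dd (gvar a d) f)) else 0)"
   by (simp add: SP.scale_right_diff_distrib mult.commute)
 qed
 finally show ?thesis unfolding poly_act_Inr by (simp add: sum_subtractf SP.scale_sum_right)
qed

lemma poly_bracket_mixed:
 assumes "a \<in> sidx p q" "b \<in> sidx p q" "c \<in> sidx m n" "d \<in> sidx m n"
 shows "poly_act p q m n (Inl (a, b)) (poly_act p q m n (Inr (c, d)) f)
   = sp_scale (koszul (odd_idx a \<noteq> odd_idx b) (odd_idx c \<noteq> odd_idx d)) (poly_act p q m n (Inr (c, d)) (poly_act p q m n (Inl (a, b)) f))"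
proof -
 let ?k = "koszul (odd_idx a \<noteq> odd_idx b) (odd_idx c \<noteq> odd_idx d)" and ?J = "sidx p q" and ?I = "sidx m n"
 define s where "s a = koszul (odd_idx a) (odd_idx c \<noteq> odd_idx d)" for a
 have k: "?k = koszul (oddv (gvar a u) \<noteq> oddv (gvar b u)) (oddv (gvar e c) \<noteq> oddv (gvar e d))" for e u
  by (rule arg_cong2[of _ _ _ _ koszul]) auto
 have q: "zz (gvar a u) (dd (gvar b u) (zz (gvar e c) (dd (gvar e d) f))) - sp_scale ?k (zz (gvar e c) (dd (gvar e d) (zz (gvar a u) (dd (gvar b u) f))))
   = (if gvar b u = gvar e c then zz (gvar a u) (dd (gvar e d) f) else 0) - sp_scale ?k (if gvar e d = gvar a u then zz (gvar e c) (dd (gvar b u) f) else 0)" for e u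
  unfolding k[of u e] by (rule quadratic_bracket)
 have "poly_act p q m n (Inl (a, b)) (poly_act p q m n (Inr (c, d)) f)
   - sp_scale ?k (poly_act p q m n (Inr (c, d)) (poly_act p q m n (Inl (a, b)) f))
  = (\<Sum>u\<in>?I. \<Sum>e\<in>?J. sp_scale (s e) (zz (gvar a u) (dd (gvar b u) (zz (gvar e c) (dd (gvar e d) f))))
    - sp_scale (s e) (sp_scale ?k (zz (gvar e c) (dd (gvar e d) (zz (gvar a u) (dd (gvar b u) f))))))"
  unfolding poly_act_Inl poly_act_Inr sum_subtractf s_def[symmetric]
  by (subst (2) sum.swap) (simp add: sum_distrib_left SP.scale_sum_right mult_ac)
 also have "\<dots> = (\<Sum>u\<in>?I. \<Sum>e\<in>?J. sp_scale (s e) ((if gvar b u = gvar e c then zz (gvar a u) (dd (gvar e d) f) else 0)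
   - sp_scale ?k (if gvar e d = gvar a u then zz (gvar e c) (dd (gvar b u) f) else 0)))"
  by (simp only: SP.scale_right_diff_distrib[symmetric] q)
 also have "\<dots> = (\<Sum>u\<in>?I. \<Sum>e\<in>?J. if c = u \<and> b = e then sp_scale (s b) (zz (gvar a c) (dd (gvar b d) f)) else 0)
   - (\<Sum>u\<in>?I. \<Sum>e\<in>?J. if d = u \<and> a = e then sp_scale (s a * ?k) (zz (gvar a c) (dd (gvar b d) f)) else 0)"
  unfolding sum_subtractf[symmetric] by (intro sum.cong) (auto simp: SP.scale_right_diff_distrib)
 also have "\<dots> = sp_scale (s b) (zz (gvar a c) (dd (gvar b d) f)) - sp_scale (s a * ?k) (zz (gvar a c) (dd (gvar b d) f))"
  using assms by (simp only: sum_delta2 finite_sidx)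
 also have "s a * ?k = s b" by (auto simp: s_def koszul_def)
 finally show ?thesis by simp
qed

theorem supermodule_poly_rep: "supermodule (glgl p q m n) (poly_rep p q m n)"
proof -
 let ?g = "glgl p q m n" and ?P = "poly_rep p q m n"
 have bracket: "poly_act p q m n x (poly_act p q m n y f)
   - sp_scale (koszul (odd_unit ?g x) (odd_unit ?g y)) (poly_act p q m n y (poly_act p q m n x f))
   = (\<Sum>z\<in>units ?g. sp_scale (struct ?g x y z) (poly_act p q m n z f))"
  if xy: "x \<in> units ?g" "y \<in> units ?g" for x y f
 proof (cases x; cases y)
  fix x' y' assume xy': "x = Inl x'" "y = Inl y'"
  then obtain a b a' b' where e: "x' = (a, b)" "y' = (a', b')" "a \<in> sidx p q" "b \<in> sidx p q" "a' \<in> sidx p q" "b' \<in> sidx p q"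
   using xy by (cases x'; cases y') (auto simp: gl_units)
  let ?k = "koszul (odd_idx a \<noteq> odd_idx b) (odd_idx a' \<noteq> odd_idx b')"
  have "(\<Sum>z\<in>units ?g. sp_scale (struct ?g x y z) (poly_act p q m n z f))
    = (\<Sum>z\<in>sidx p q \<times> sidx p q. sp_scale (struct (gl p q) (a, b) (a', b') z) (poly_act p q m n (Inl z) f))"
   by (simp add: sum_Plus gl_units xy' e)
  also have "\<dots> = (\<Sum>z\<in>sidx p q \<times> sidx p q. (if z = (a, b') then (if b = a' then poly_act p q m n (Inl (a, b')) f else 0) else 0)
    - (if z = (a', b) then sp_scale ?k (if a = b' then poly_act p q m n (Inl (a', b)) f else 0) else 0))"
   by (intro sum.cong) (auto simp: gl_struct SP.scale_left_diff_distrib)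
  also have "\<dots> = (if b = a' then poly_act p q m n (Inl (a, b')) f else 0)
   - sp_scale ?k (if a = b' then poly_act p q m n (Inl (a', b)) f else 0)"
   unfolding sum_subtractf using e by (subst (1 2) sum.delta) auto
  finally show ?thesis
   unfolding xy' e(1,2) odd_unit_Inl using poly_bracket_Inl[OF e(3-6)] by metis
 next
  fix x' y' assume xy': "x = Inr x'" "y = Inr y'"
  then obtain a b a' b' where e: "x' = (a, b)" "y' = (a', b')" "a \<in> sidx m n" "b \<in> sidx m n" "a' \<in> sidx m n" "b' \<in> sidx m n"
   using xy by (cases x'; cases y') (auto simp: gl_units)
  let ?k = "koszul (odd_idx a \<noteq> odd_idx b) (odd_idx a' \<noteq> odd_idx b')"
  have "(\<Sum>z\<in>units ?g. sp_scale (struct ?g x y z) (poly_act p q m n z f))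
    = (\<Sum>z\<in>sidx m n \<times> sidx m n. sp_scale (struct (gl m n) (a, b) (a', b') z) (poly_act p q m n (Inr z) f))"
   by (simp add: sum_Plus gl_units xy' e)
  also have "\<dots> = (\<Sum>z\<in>sidx m n \<times> sidx m n. (if z = (a, b') then (if b = a' then poly_act p q m n (Inr (a, b')) f else 0) else 0)
    - (if z = (a', b) then sp_scale ?k (if a = b' then poly_act p q m n (Inr (a', b)) f else 0) else 0))"
   by (intro sum.cong) (auto simp: gl_struct SP.scale_left_diff_distrib)
  also have "\<dots> = (if b = a' then poly_act p q m n (Inr (a, b')) f else 0)
   - sp_scale ?k (if a = b' then poly_act p q m n (Inr (a', b)) f else 0)"
   unfolding sum_subtractf using e by (subst (1 2) sum.delta) auto
  finally show ?thesis
   unfolding xy' e(1,2) odd_unit_Inr using poly_bracket_Inr[OF e(3-6)] by metis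
 next
  fix x' y' assume xy': "x = Inl x'" "y = Inr y'"
  then obtain a b c d where e: "x' = (a, b)" "y' = (c, d)" "a \<in> sidx p q" "b \<in> sidx p q" "c \<in> sidx m n" "d \<in> sidx m n"
   using xy by (cases x'; cases y') (auto simp: gl_units)
  show ?thesis
   unfolding xy' e(1,2) odd_unit_Inl odd_unit_Inr poly_bracket_mixed[OF e(3-6)] by simp
 next
  fix y' x' assume xy': "x = Inr y'" "y = Inl x'"
  then obtain a b c d where e: "x' = (a, b)" "y' = (c, d)" "a \<in> sidx p q" "b \<in> sidx p q" "c \<in> sidx m n" "d \<in> sidx m n"
   using xy by (cases x'; cases y') (auto simp: gl_units)
  show ?thesis
   unfolding xy' e(1,2) odd_unit_Inl odd_unit_Inr poly_bracket_mixed[OF e(3-6)] by (simp add: koszul_def)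
 qed
 have parity: "has_parity (s \<noteq> odd_unit ?g x) (poly_act p q m n x f)" if "has_parity s f" for x s f
  using that unfolding has_parity_iff kap_poly_act
  by (auto simp: poly_act_scale[of _ _ _ _ _ "-1", simplified SP.scale_minus_left SP.scale_one] split: if_splits)
 show ?thesis
  unfolding Defs.supermodule_def space_poly_rep poly_rep_simps
 proof (intro conjI ballI allI)
  show "SP.subspace (hpart ?P s)" for s
   unfolding hpart_poly_rep using superpolys_subspace
   by (intro SP.subspaceI) (auto simp: SP.subspace_0 SP.subspace_add SP.subspace_scale has_parity_iff)
  show "hpart ?P False \<inter> hpart ?P True = {0}"
   unfolding hpart_poly_rep using SP.subspace_0[OF superpolys_subspace]
   by (auto simp: has_parity_def intro!: cf_eqI)
  show "poly_act p q m n x v \<in> hpart ?P (s \<noteq> odd_unit ?g x)" if "x \<in> units ?g" "v \<in> hpart ?P s" for x s v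
   using that parity poly_act_superpolys unfolding hpart_poly_rep by blast
 qed (use bracket in \<open>auto simp: vector_space_scale poly_act_add poly_act_scale\<close>)
qed

subsection \<open>The Fischer inner product\<close>

definition mfact :: "mono => complex" where
 "mfact x = (\<Prod>v\<in>Poly_Mapping.keys (snd x). fact (Poly_Mapping.lookup (snd x) v))"

definition supp :: "superpoly => mono set" where "supp f = {x. cf f x \<noteq> 0}"

text \<open>
 The Fischer inner product: distinct monomials are orthogonal and the norm of a monomial is the product of the
 factorials of its exponents. It makes the derivative adjoint to the multiplication by a variable.
\<close>

definition ip :: "superpoly => superpoly => complex" where
 "ip f g = (\<Sum>x\<in>supp f. mfact x * cf f x * cnj (cf g x))"

lemma finite_supp [simp]: "finite (supp f)"
proof -
 have "finite {S. gcoeff f S \<noteq> 0}" using gcoeff[of f] by blast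
 moreover have "supp f \<subseteq> Sigma {S. gcoeff f S \<noteq> 0} (\<lambda>S. Poly_Mapping.keys (gcoeff f S))"
  by (auto simp: supp_def cf_def in_keys_iff)
 ultimately show ?thesis by (meson finite_SigmaI finite_keys finite_subset)
qed

lemma ip_superset:
 assumes "finite F" "supp f \<subseteq> F \<or> supp g \<subseteq> F"
 shows "ip f g = (\<Sum>x\<in>F. mfact x * cf f x * cnj (cf g x))"
proof -
 have "ip f g = (\<Sum>x\<in>supp f \<inter> supp g. mfact x * cf f x * cnj (cf g x))"
  unfolding ip_def by (rule sum.mono_neutral_right) (auto simp: supp_def finite_supp[unfolded supp_def])
 also have "\<dots> = (\<Sum>x\<in>F. mfact x * cf f x * cnj (cf g x))"
  by (rule sum.mono_neutral_left) (use assms in \<open>auto simp: supp_def\<close>)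
 finally show ?thesis .
qed

lemma mfact_superset:
 assumes "finite V" "Poly_Mapping.keys (snd x) \<subseteq> V"
 shows "mfact x = (\<Prod>v\<in>V. fact (Poly_Mapping.lookup (snd x) v))"
 unfolding mfact_def by (rule prod.mono_neutral_left) (use assms in \<open>auto simp: in_keys_iff\<close>)

lemma mfact_up: "raisable A x ==> mfact (up A x) = of_nat (cnt A x + 1) * mfact x"
proof (cases A)
 case (Inl v)
 let ?V = "insert v (Poly_Mapping.keys (snd x))"
 have V: "finite ?V" by simp
 have k: "Poly_Mapping.keys (snd (up A x)) \<subseteq> ?V"
  using keys_add[of "Poly_Mapping.single v 1" "snd x"] by (auto simp: Inl split: if_splits)
 have "mfact (up A x) = (\<Prod>u\<in>?V. fact (Poly_Mapping.lookup (snd (up A x)) u))"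
  by (rule mfact_superset[OF V k])
 also have "\<dots> = (\<Prod>u\<in>?V. (if u = v then of_nat (cnt A x + 1) else 1) * fact (Poly_Mapping.lookup (snd x) u))"
  by (rule prod.cong) (auto simp: Inl lookup_add lookup_single when_def)
 also have "\<dots> = of_nat (cnt A x + 1) * mfact x"
  by (subst prod.distrib, subst prod.delta[OF V]) (simp add: mfact_superset[OF V, of x] subset_insertI)
 finally show ?thesis .
qed (auto simp: mfact_def)

lemma cnj_eps [simp]: "cnj (eps A x) = eps A x"
 by (cases A) (auto simp: shuffle_sign_def)

lemma ip_zz: "ip (zz A f) g = ip f (dd A g)"
proof -
 define R where "R = {y \<in> supp f. raisable A y}"
 have fin: "finite R" by (simp add: R_def)
 have inj: "inj_on (up A) R" by (rule inj_on_inverseI[of _ "down A"]) (simp add: R_def down_up)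
 have sub: "supp (zz A f) \<subseteq> up A ` R"
 proof
  fix x assume "x \<in> supp (zz A f)"
  then have "cnt A x > 0" "cf f (down A x) \<noteq> 0" by (auto simp: supp_def cf_zz split: if_splits)
  then show "x \<in> up A ` R" using up_down[of A x] raisable_down[of A x] by (auto simp: R_def supp_def intro!: image_eqI[of _ _ "down A x"])
 qed
 have "ip (zz A f) g = (\<Sum>x\<in>up A ` R. mfact x * cf (zz A f) x * cnj (cf g x))"
  using sub fin by (intro ip_superset) auto
 also have "\<dots> = (\<Sum>y\<in>R. mfact (up A y) * cf (zz A f) (up A y) * cnj (cf g (up A y)))"
  by (simp add: sum.reindex[OF inj])
 also have "\<dots> = (\<Sum>y\<in>R. mfact y * cf f y * cnj (cf (dd A g) y))"
  by (rule sum.cong) (auto simp: R_def mfact_up cf_zz cnt_up down_up cf_dd)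
 also have "\<dots> = ip f (dd A g)"
  unfolding ip_def by (rule sum.mono_neutral_left) (auto simp: R_def cf_dd)
 finally show ?thesis .
qed

lemma ip_add_left: "ip (f + g) h = ip f h + ip g h"
proof -
 have *: "ip k h = (\<Sum>x\<in>supp h. mfact x * cf k x * cnj (cf h x))" for k by (rule ip_superset) auto
 show ?thesis unfolding * by (simp add: algebra_simps sum.distrib)
qed

lemma ip_scale_left: "ip (sp_scale c f) h = c * ip f h"
proof -
 have *: "ip k h = (\<Sum>x\<in>supp h. mfact x * cf k x * cnj (cf h x))" for k by (rule ip_superset) auto
 show ?thesis unfolding * by (simp add: sum_distrib_left mult_ac)
qed

lemma cnj_mfact [simp]: "cnj (mfact x) = mfact x"
 by (simp add: mfact_def)

lemma ip_cnj: "ip f g = cnj (ip g f)"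
proof -
 have "ip f g = (\<Sum>x\<in>supp g. mfact x * cf f x * cnj (cf g x))" by (rule ip_superset) auto
 then show ?thesis by (simp add: ip_def mult_ac)
qed

lemma mfact_pos: "\<exists>r > 0. mfact x = complex_of_real r"
proof -
 have "mfact x = complex_of_real (\<Prod>v\<in>Poly_Mapping.keys (snd x). fact (Poly_Mapping.lookup (snd x) v))"
  by (simp add: mfact_def)
 moreover have "(\<Prod>v\<in>Poly_Mapping.keys (snd x). fact (Poly_Mapping.lookup (snd x) v)) > (0::real)"
  by (rule prod_pos) simp
 ultimately show ?thesis by blast
qed

lemma ip_self: "\<exists>r \<ge> 0. ip f f = complex_of_real r \<and> (r = 0 \<longrightarrow> f = 0)"
proof -
 obtain w where w: "\<And>x. w x > 0" "\<And>x. mfact x = complex_of_real (w x)" using mfact_pos by metis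
 define r where "r = (\<Sum>x\<in>supp f. w x * (cmod (cf f x))\<^sup>2)"
 have "ip f f = complex_of_real r"
  unfolding ip_def r_def w(2) by (simp add: complex_norm_square[symmetric] mult.assoc)
 moreover have "r \<ge> 0" unfolding r_def by (rule sum_nonneg) (simp add: w(1) less_imp_le)
 moreover have "f = 0" if "r = 0"
 proof (rule cf_eqI)
  fix x
  have "\<forall>x\<in>supp f. w x * (cmod (cf f x))\<^sup>2 = 0"
   using that unfolding r_def by (subst (asm) sum_nonneg_eq_0_iff) (auto simp: w(1) less_imp_le)
  then have "w x * (cmod (cf f x))\<^sup>2 = 0" if "x \<in> supp f" using that by blast
  then show "cf f x = cf 0 x" using w(1)[of x] by (cases "x \<in> supp f") (auto simp: supp_def)
 qed
 ultimately show ?thesis by blast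
qed

lemma ip_definite: "ip f f = 0 ==> f = 0"
 using ip_self[of f] by auto

lemma ip_add_right: "ip f (g + h) = ip f g + ip f h"
 using ip_add_left[of g h f] ip_cnj[of f] by simp

lemma ip_scale_right: "ip f (sp_scale c g) = cnj c * ip f g"
 using ip_scale_left[of c g f] ip_cnj[of f] by simp

lemma ip_zero [simp]: "ip 0 f = 0" "ip f 0 = 0"
 using ip_scale_left[of 0 0 f] ip_scale_right[of f 0 0] by simp_all

lemma ip_sum_left: "ip (sum h I) g = (\<Sum>i\<in>I. ip (h i) g)"
 by (induction I rule: infinite_finite_induct) (auto simp: ip_add_left)

lemma ip_sum_right: "ip f (sum h I) = (\<Sum>i\<in>I. ip f (h i))"
 by (induction I rule: infinite_finite_induct) (auto simp: ip_add_right)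

lemma ip_dd: "ip (dd A f) g = ip f (zz A g)"
 using ip_zz[of A g f] ip_cnj by metis

fun ustar :: "('a \<times> 'a) + ('b \<times> 'b) => ('a \<times> 'a) + ('b \<times> 'b)" where
 "ustar (Inl (a, b)) = Inl (b, a)"
| "ustar (Inr (c, d)) = Inr (d, c)"

lemma cnj_koszul [simp]: "cnj (koszul a b) = koszul a b"
 by (simp add: koszul_def)

text \<open>
 The matrix unit \<open>E\<^sub>a\<^sub>b\<close> is adjoint to \<open>E\<^sub>b\<^sub>a\<close> for both actions, termwise from \<open>ip_zz\<close> and \<open>ip_dd\<close>.
\<close>

lemma ip_poly_act: "ip (poly_act p q m n x f) g = ip f (poly_act p q m n (ustar x) g)"
proof (cases x)
 case (Inl y)
 then show ?thesis by (cases y) (simp add: poly_act_Inl ip_sum_left ip_sum_right ip_zz ip_dd)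
next
 case (Inr y)
 obtain c d where y: "y = (c, d)" by (cases y)
 have "(odd_idx c \<noteq> odd_idx d) = (odd_idx d \<noteq> odd_idx c)" by auto
 then show ?thesis unfolding Inr y ustar.simps poly_act_Inr
  by (simp add: ip_sum_left ip_sum_right ip_zz ip_dd ip_scale_left ip_scale_right)
qed

abbreviation gght :: "nat => nat => (sindex \<times> sindex) + (sindex \<times> sindex) => int" where
 "gght p m \<equiv> case_sum (gl_ht p) (gl_ht m)"

lemma unitary_poly_rep:
 "unitary_module (glgl p q m n) (gght p m) (case_sum (gl_hc p) (gl_hc m)) (poly_rep p q m n) ip ustar"
proof -
 interpret graded_lie "glgl p q m n" "gght p m" "case_sum (gl_hc p) (gl_hc m)"
  by (rule graded_lie_prod[OF graded_lie_gl graded_lie_gl])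
 show ?thesis
 proof
  show "supermodule (glgl p q m n) (poly_rep p q m n)" by (rule supermodule_poly_rep)
  fix x assume "x \<in> units (glgl p q m n)"
  then show "ustar x \<in> units (glgl p q m n)" "gght p m (ustar x) = - gght p m x"
   by (auto simp: gl_units gl_ht_def elim!: PlusE)
 qed (auto simp: ip_add_left ip_scale_left ip_definite ip_poly_act intro: ip_cnj)
qed

lemma unitary_left:
 "unitary_module (gl p q) (gl_ht p) (gl_hc p) (left_rep (poly_rep p q m n)) ip (\<lambda>(a, b). (b, a))"
proof -
 interpret graded_lie "gl p q" "gl_ht p" "gl_hc p" by (rule graded_lie_gl)
 show ?thesis
 proof
  show "supermodule (gl p q) (left_rep (poly_rep p q m n))"
   by (rule supermodule_left_right(1)[OF supermodule_poly_rep]) (simp_all add: gl_units)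
 qed (auto simp: ip_add_left ip_scale_left ip_definite ip_poly_act gl_units gl_ht_def intro: ip_cnj)
qed

lemma unitary_right:
 "unitary_module (gl m n) (gl_ht m) (gl_hc m) (right_rep (poly_rep p q m n)) ip (\<lambda>(a, b). (b, a))"
proof -
 interpret graded_lie "gl m n" "gl_ht m" "gl_hc m" by (rule graded_lie_gl)
 show ?thesis
 proof
  show "supermodule (gl m n) (right_rep (poly_rep p q m n))"
   by (rule supermodule_left_right(2)[OF supermodule_poly_rep]) (simp_all add: gl_units)
 qed (auto simp: ip_add_left ip_scale_left ip_definite ip_poly_act gl_units gl_ht_def intro: ip_cnj)
qed

section \<open>Weight vectors and complete reducibility\<close>

definition mono_sp :: "mono => superpoly" where
 "mono_sp x = gterm (fst x) (Poly_Mapping.single (snd x) 1)"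

lemma cf_mono_sp: "finite (fst x) ==> cf (mono_sp x) y = (if y = x then 1 else 0)"
 by (auto simp: cf_def mono_sp_def gterm.rep_eq lookup_single when_def prod_eq_iff)

lemma cf_nonzero_finite: "cf f x \<noteq> 0 ==> finite (fst x)"
 using cf_infinite by blast

text \<open>The part of an element supported on a given set of monomials.\<close>

definition res :: "mono set => superpoly => superpoly" where
 "res Z f = (\<Sum>x\<in>supp f \<inter> Z. sp_scale (cf f x) (mono_sp x))"

lemma cf_res: "cf (res Z f) x = (if x \<in> Z then cf f x else 0)"
proof -
 have "cf (res Z f) x = (\<Sum>y\<in>supp f \<inter> Z. if y = x then cf f x else 0)"
  unfolding res_def cf_sum
 proof (rule sum.cong)
  fix y assume "y \<in> supp f \<inter> Z"
  then have "cf f y \<noteq> 0" by (simp add: supp_def)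
  then have "finite (fst y)" using cf_infinite[of y f] by blast
  then show "cf (sp_scale (cf f y) (mono_sp y)) x = (if y = x then cf f x else 0)"
   by (auto simp: cf_mono_sp)
 qed simp
 also have "\<dots> = (if x \<in> supp f \<inter> Z then cf f x else 0)" by (rule sum.delta) simp
 finally show ?thesis by (auto simp: supp_def)
qed

lemma res_superpolys: "f \<in> superpolys p q m n ==> res Z f \<in> superpolys p q m n"
 by (auto simp: superpolys_iff cf_res split: if_splits)

text \<open>A stable subspace of a diagonal operator contains the eigencomponents of its elements, by
 Lagrange interpolation.\<close>

lemma eigencomponent_mem:
 assumes U: "SP.subspace U" and stable: "\<And>u. u \<in> U ==> T u \<in> U"
  and diag: "\<And>u x. u \<in> U ==> cf (T u) x = t x * cf u x" and u: "u \<in> U"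
 shows "res {x. t x = c} u \<in> U"
proof -
 define P where "P l w = T w - sp_scale l w" for l w
 have PU: "foldr P ls u \<in> U" for ls
 proof (induction ls)
  case (Cons l ls)
  then show ?case unfolding P_def by (auto intro: SP.subspace_diff[OF U] SP.subspace_scale[OF U] stable)
 qed (simp add: u)
 have cfP: "cf (foldr P ls u) x = (\<Prod>l\<leftarrow>ls. t x - l) * cf u x" for ls x
 proof (induction ls)
  case (Cons l ls)
  have "cf (foldr P (l # ls) u) x = (t x - l) * cf (foldr P ls u) x"
   using diag[OF PU] by (simp add: P_def left_diff_distrib)
  then show ?case using Cons by simp
 qed simp
 obtain ls where ls: "set ls = t ` supp u - {c}" using finite_list[of "t ` supp u - {c}"] by auto
 define k where "k = (\<Prod>l\<leftarrow>ls. c - l)"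
 have k: "k \<noteq> 0"
 proof -
  have "c \<notin> set ls" using ls by auto
  then show ?thesis unfolding k_def by (induction ls) auto
 qed
 have z: "(\<Prod>l\<leftarrow>ls. a - l) = 0" if "a \<in> set ls" for a using that by (induction ls) auto
 have "res {x. t x = c} u = sp_scale (inverse k) (foldr P ls u)"
 proof (rule cf_eqI)
  fix x
  show "cf (res {x. t x = c} u) x = cf (sp_scale (inverse k) (foldr P ls u)) x"
  proof (cases "t x = c")
   case True
   then show ?thesis using k by (simp add: cf_res cfP k_def)
  next
   case False
   then have "cf u x = 0 \<or> t x \<in> set ls" unfolding ls supp_def by auto
   then show ?thesis using False z[of "t x"] by (auto simp: cf_res cfP)
  qed
 qed
 then show ?thesis using SP.subspace_scale[OF U PU] by simp
qed

lemma cf_zz_dd: "cf (zz A (dd A f)) x = of_nat (cnt A x) * cf f x"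
proof (cases "cnt A x > 0")
 case True
 then have c: "cnt A (down A x) + 1 = cnt A x" using cnt_up[OF raisable_down[OF True]] up_down[OF True] by simp
 have "cf (zz A (dd A f)) x = of_nat (cnt A (down A x) + 1) * (eps A (down A x) * eps A (down A x)) * cf f x"
  using True by (simp add: cf_dd cf_zz raisable_down up_down)
 then show ?thesis unfolding c eps_square by simp
qed (simp add: cf_zz)

text \<open>
 The weight of a monomial under the first action: the degree in the variables with upper index \<open>a\<close>.
 Monomials are therefore joint eigenvectors of both Cartan subalgebras.
\<close>

definition wtL :: "nat => nat => sindex => mono => nat" where
 "wtL m n a x = (\<Sum>c\<in>sidx m n. cnt (gvar a c) x)"

definition wtR :: "nat => nat => sindex => mono => nat" where
 "wtR p q c x = (\<Sum>a\<in>sidx p q. cnt (gvar a c) x)"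

lemma cf_cartan_left: "cf (poly_act p q m n (Inl (a, a)) f) x = of_nat (wtL m n a x) * cf f x"
 by (simp add: poly_act_Inl cf_zz_dd wtL_def sum_distrib_right)

lemma cf_cartan_right: "cf (poly_act p q m n (Inr (c, c)) f) x = of_nat (wtR p q c x) * cf f x"
 by (simp add: poly_act_Inr cf_zz_dd wtR_def sum_distrib_right koszul_def)

definition hgt :: "nat => nat => nat => nat => mono => nat" where
 "hgt p q m n x = (\<Sum>a\<in>sidx p q. pos p a * wtL m n a x) + (\<Sum>c\<in>sidx m n. pos m c * wtR p q c x)"

lemma sum_diag:
 "finite I ==> (\<Sum>x\<in>I \<times> I. if fst x = snd x then h (fst x) else 0) = (\<Sum>a\<in>I. h a :: 'a::comm_monoid_add)"
proof -
 assume I: "finite I"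
 have "(\<Sum>x\<in>I \<times> I. if fst x = snd x then h (fst x) else 0) = (\<Sum>a\<in>I. \<Sum>b\<in>I. if a = b then h a else 0)"
  by (simp add: sum.cartesian_product case_prod_beta)
 then show ?thesis using I by simp
qed

context
 fixes p q m n :: nat
begin

interpretation P: unitary_module "glgl p q m n" "gght p m" "case_sum (gl_hc p) (gl_hc m)" "poly_rep p q m n" ip ustar
 by (rule unitary_poly_rep)

lemma cf_H: "cf (P.H f) x = - of_nat (hgt p q m n x) * cf f x"
proof -
 have "P.H f = (\<Sum>y\<in>sidx p q \<times> sidx p q. sp_scale (gl_hc p y) (poly_act p q m n (Inl y) f))
   + (\<Sum>y\<in>sidx m n \<times> sidx m n. sp_scale (gl_hc m y) (poly_act p q m n (Inr y) f))"
  unfolding P.H_def by (simp add: sum_Plus gl_units)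
 also have "(\<Sum>y\<in>sidx p q \<times> sidx p q. sp_scale (gl_hc p y) (poly_act p q m n (Inl y) f))
  = (\<Sum>y\<in>sidx p q \<times> sidx p q. if fst y = snd y then sp_scale (- of_nat (pos p (fst y))) (poly_act p q m n (Inl (fst y, fst y)) f) else 0)"
  by (rule sum.cong) (auto simp: gl_hc_def)
 also have "\<dots> = (\<Sum>a\<in>sidx p q. sp_scale (- of_nat (pos p a)) (poly_act p q m n (Inl (a, a)) f))"
  by (rule sum_diag) simp
 also have "(\<Sum>y\<in>sidx m n \<times> sidx m n. sp_scale (gl_hc m y) (poly_act p q m n (Inr y) f))
  = (\<Sum>y\<in>sidx m n \<times> sidx m n. if fst y = snd y then sp_scale (- of_nat (pos m (fst y))) (poly_act p q m n (Inr (fst y, fst y)) f) else 0)"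
  by (rule sum.cong) (auto simp: gl_hc_def)
 also have "\<dots> = (\<Sum>c\<in>sidx m n. sp_scale (- of_nat (pos m c)) (poly_act p q m n (Inr (c, c)) f))"
  by (rule sum_diag) simp
 finally have eq: "P.H f = (\<Sum>a\<in>sidx p q. sp_scale (- of_nat (pos p a)) (poly_act p q m n (Inl (a, a)) f))
   + (\<Sum>c\<in>sidx m n. sp_scale (- of_nat (pos m c)) (poly_act p q m n (Inr (c, c)) f))" .
 show ?thesis unfolding eq
  by (simp add: cf_cartan_left cf_cartan_right hgt_def sum_distrib_right sum_negf left_diff_distrib mult.assoc)
qed

definition same_weight :: "mono => mono set" where
 "same_weight x0 = {x. (\<forall>a\<in>sidx p q. wtL m n a x = wtL m n a x0) \<and> (\<forall>c\<in>sidx m n. wtR p q c x = wtR p q c x0)}"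

lemma res_res: "res Z (res Z' f) = res (Z \<inter> Z') f"
 by (rule cf_eqI) (simp add: cf_res)

lemma weight_component_mem:
 assumes U: "submodule (glgl p q m n) (poly_rep p q m n) U" and u: "u \<in> U"
 shows "res (same_weight x0) u \<in> U"
proof -
 have sub: "SP.subspace U" and st: "\<And>x u. x \<in> units (glgl p q m n) ==> u \<in> U ==> poly_act p q m n x u \<in> U"
  using U by (auto simp: Defs.submodule_def)
 have L: "res {x. \<forall>a\<in>set as. wtL m n a x = wtL m n a x0} u \<in> U" if "set as \<subseteq> sidx p q" for as
  using that
 proof (induction as)
  case Nil
  have "res UNIV u = u" by (rule cf_eqI) (simp add: cf_res)
  then show ?case using u by simp
 next
  case (Cons a as)
  let ?w = "res {x. \<forall>a\<in>set as. wtL m n a x = wtL m n a x0} u"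
  have "res {x. complex_of_nat (wtL m n a x) = of_nat (wtL m n a x0)} ?w \<in> U"
   by (rule eigencomponent_mem[OF sub, where T = "poly_act p q m n (Inl (a, a))"])
    (use Cons st[of "Inl (a, a)"] in \<open>auto simp: gl_units cf_cartan_left\<close>)
  then show ?case by (simp add: res_res Collect_conj_eq[symmetric])
 qed
 obtain as where as: "set as = sidx p q" using finite_list[OF finite_sidx] by blast
 define w where "w = res {x. \<forall>a\<in>set as. wtL m n a x = wtL m n a x0} u"
 have w: "w \<in> U" unfolding w_def using L as by blast
 have R: "res {x. \<forall>c\<in>set cs. wtR p q c x = wtR p q c x0} w \<in> U" if "set cs \<subseteq> sidx m n" for cs
  using that
 proof (induction cs)
  case Nil
  have "res UNIV w = w" by (rule cf_eqI) (simp add: cf_res)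
  then show ?case using w by simp
 next
  case (Cons c cs)
  let ?w = "res {x. \<forall>c\<in>set cs. wtR p q c x = wtR p q c x0} w"
  have "res {x. complex_of_nat (wtR p q c x) = of_nat (wtR p q c x0)} ?w \<in> U"
   by (rule eigencomponent_mem[OF sub, where T = "poly_act p q m n (Inr (c, c))"])
    (use Cons st[of "Inr (c, c)"] in \<open>auto simp: gl_units cf_cartan_right\<close>)
  then show ?case by (simp add: res_res Collect_conj_eq[symmetric])
 qed
 obtain cs where cs: "set cs = sidx m n" using finite_list[OF finite_sidx] by blast
 have "res (same_weight x0) u = res {x. \<forall>c\<in>set cs. wtR p q c x = wtR p q c x0} w"
  unfolding w_def res_res same_weight_def as cs by (rule arg_cong[of _ _ "\<lambda>Z. res Z u"]) auto
 then show ?thesis using R[of cs] cs by simp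
qed

definition pweight :: "mono => (sindex \<times> sindex) + (sindex \<times> sindex) => complex" where
 "pweight x0 = case_sum (gl_weight (\<lambda>a. wtL m n a x0)) (gl_weight (\<lambda>c. wtR p q c x0))"

text \<open>
 Among all monomials of elements of the submodule choose one of least \<open>hgt\<close>, and let \<open>u\<close> be the
 corresponding weight component. A raising operator strictly decreases \<open>hgt\<close>, so it kills \<open>u\<close>.
\<close>

theorem submodule_has_singular:
 assumes U: "submodule (glgl p q m n) (poly_rep p q m n) U" and ne: "U \<noteq> {0}"
 obtains v s x0 where "v \<in> U" "v \<in> hpart (poly_rep p q m n) s" "v \<noteq> 0"
  "singular (glgl p q m n) (gght p m) (poly_rep p q m n) (pweight x0) v"
proof -
 have sub: "SP.subspace U" and st: "\<And>x u. x \<in> units (glgl p q m n) ==> u \<in> U ==> poly_act p q m n x u \<in> U"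
  using U by (auto simp: Defs.submodule_def)
 have Usp: "U \<subseteq> superpolys p q m n" using P.submodule_space[OF U] by (simp add: space_poly_rep)
 have ex: "\<exists>x u. u \<in> U \<and> cf u x \<noteq> 0"
 proof -
  obtain u where "u \<in> U" "u \<noteq> 0" using ne SP.subspace_0[OF sub] by blast
  then show ?thesis using cf_eqI[of u 0] by (metis cf_zero)
 qed
 then obtain k x0 u0 where k: "u0 \<in> U" "cf u0 x0 \<noteq> 0" "hgt p q m n x0 = k"
  and least: "\<And>x u. u \<in> U ==> cf u x \<noteq> 0 ==> k \<le> hgt p q m n x"
 proof -
  define k where "k = (LEAST k. \<exists>x u. u \<in> U \<and> cf u x \<noteq> 0 \<and> hgt p q m n x = k)"
  have "\<exists>x u. u \<in> U \<and> cf u x \<noteq> 0 \<and> hgt p q m n x = k"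
   unfolding k_def by (rule LeastI_ex) (use ex in blast)
  moreover have "k \<le> hgt p q m n x" if "u \<in> U" "cf u x \<noteq> 0" for x u
   unfolding k_def by (rule Least_le) (use that in blast)
  ultimately show ?thesis using that by blast
 qed
 define u where "u = res (same_weight x0) u0"
 have u: "u \<in> U" unfolding u_def by (rule weight_component_mem[OF U k(1)])
 have x0: "cf u x0 \<noteq> 0" using k(2) by (simp add: u_def cf_res same_weight_def)
 have wt: "x \<in> same_weight x0" if "cf u x \<noteq> 0" for x using that by (auto simp: u_def cf_res split: if_splits)
 have hx: "hgt p q m n x = k" if "cf u x \<noteq> 0" for x
  using wt[OF that] k(3) by (simp add: hgt_def same_weight_def)
 have Hu: "P.H u = sp_scale (- of_nat k) u"
  by (rule cf_eqI) (use hx in \<open>auto simp: cf_H\<close>)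
 have "singular (glgl p q m n) (gght p m) (poly_rep p q m n) (pweight x0) u"
  unfolding singular_def
 proof (intro conjI ballI impI)
  show "u \<in> space (poly_rep p q m n)" using u Usp by (auto simp: space_poly_rep)
 next
  fix y assume y: "y \<in> units (glgl p q m n)" "gght p m y > 0"
  let ?w = "poly_act p q m n y u"
  have w: "?w \<in> U" by (rule st[OF y(1) u])
  have "P.H ?w = sp_scale (- of_nat k + of_int (gght p m y)) ?w"
  proof -
   have "P.H ?w = poly_act p q m n y (sp_scale (- of_nat k) u) + sp_scale (of_int (gght p m y)) ?w"
    using P.H_act[OF y(1), of u] u Usp unfolding Hu by (simp only: space_poly_rep subset_iff poly_rep_simps)
   then show ?thesis by (simp only: poly_act_scale SP.scale_left_distrib)
  qed
  then have e: "- of_nat (hgt p q m n x) * cf ?w x = (- of_nat k + of_int (gght p m y)) * cf ?w x" for x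
   using cf_H[of ?w x] by simp
  have "cf ?w x = 0" for x
  proof (rule ccontr)
   assume nz: "cf ?w x \<noteq> 0"
   have "- (of_nat (hgt p q m n x) :: complex) = - of_nat k + of_int (gght p m y)"
    by (rule mult_right_cancel[OF nz, THEN iffD1, OF e])
   then have "(of_int (- int (hgt p q m n x)) :: complex) = of_int (- int k + gght p m y)" by simp
   then have "- int (hgt p q m n x) = - int k + gght p m y" by (simp only: of_int_eq_iff)
   then show False using least[OF w nz] y(2) by linarith
  qed
  then show "act (poly_rep p q m n) y u = 0" by (simp add: cf_eqI)
 next
  fix y assume y: "y \<in> units (glgl p q m n)" "gght p m y = 0"
  show "act (poly_rep p q m n) y u = scal (poly_rep p q m n) (pweight x0 y) u"
  proof (rule cf_eqI, cases y)
   fix x z assume z: "y = Inl z"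
   then obtain a where a: "z = (a, a)" "a \<in> sidx p q"
    using y pos_inject[of _ p q _ q] by (cases z) (auto simp: gl_units gl_ht_def)
   show "cf (act (poly_rep p q m n) y u) x = cf (scal (poly_rep p q m n) (pweight x0 y) u) x"
    using wt[of x] a(2) by (cases "cf u x = 0") (auto simp: z a(1) cf_cartan_left pweight_def gl_weight_def same_weight_def)
  next
   fix x z assume z: "y = Inr z"
   then obtain a where a: "z = (a, a)" "a \<in> sidx m n"
    using y pos_inject[of _ m n _ n] by (cases z) (auto simp: gl_units gl_ht_def)
   show "cf (act (poly_rep p q m n) y u) x = cf (scal (poly_rep p q m n) (pweight x0 y) u) x"
    using wt[of x] a(2) by (cases "cf u x = 0") (auto simp: z a(1) cf_cartan_right pweight_def gl_weight_def same_weight_def)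
  qed
 qed
 then have s: "singular (glgl p q m n) (gght p m) (subrep (poly_rep p q m n) U) (pweight x0) u"
  using u unfolding singular_def P.space_subrep[OF U] P.subrep_simps by blast
 interpret S: supermod "glgl p q m n" "subrep (poly_rep p q m n) U"
  by unfold_locales (rule P.supermodule_subrep[OF U])
 have "u \<noteq> 0" using x0 by auto
 then obtain t v where v: "v \<in> hpart (subrep (poly_rep p q m n) U) t" "v \<noteq> 0"
  "singular (glgl p q m n) (gght p m) (subrep (poly_rep p q m n) U) (pweight x0) v"
  using S.singular_component[OF s _ P.even_ht0] by blast
 show ?thesis
 proof (rule that[of v t x0])
  show "v \<in> U" "v \<in> hpart (poly_rep p q m n) t" "v \<noteq> 0" using v by auto
  then show "singular (glgl p q m n) (gght p m) (poly_rep p q m n) (pweight x0) v"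
   using v(3) P.submodule_space[OF U] unfolding singular_def P.subrep_simps by blast
 qed
qed

subsection \<open>Orthogonal complements\<close>

lemma ip_parity: "has_parity s f ==> has_parity t g ==> s \<noteq> t ==> ip f g = 0"
 unfolding ip_def by (rule sum.neutral) (auto simp: supp_def has_parity_def)

definition perp :: "superpoly set => superpoly set" where
 "perp U = {f \<in> superpolys p q m n. \<forall>u\<in>U. ip f u = 0}"

lemma perp_submodule:
 assumes U: "submodule (glgl p q m n) (poly_rep p q m n) U"
 shows "submodule (glgl p q m n) (poly_rep p q m n) (perp U)"
 unfolding Defs.submodule_def poly_rep_simps
proof (intro conjI ballI)
 have st: "\<And>x u. x \<in> units (glgl p q m n) ==> u \<in> U ==> poly_act p q m n x u \<in> U"
  using U by (auto simp: Defs.submodule_def)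
 show sub: "SP.subspace (perp U)"
  using superpolys_subspace unfolding perp_def
  by (intro SP.subspaceI) (auto simp: SP.subspace_0 SP.subspace_add SP.subspace_scale ip_add_left ip_scale_left)
 show "perp U = {u + v |u v. u \<in> perp U \<inter> hpart (poly_rep p q m n) False \<and> v \<in> perp U \<inter> hpart (poly_rep p q m n) True}"
 proof (intro Set.set_eqI iffI)
  fix f assume f: "f \<in> perp U"
  then obtain f0 f1 where f01: "f0 \<in> hpart (poly_rep p q m n) False" "f1 \<in> hpart (poly_rep p q m n) True" "f = f0 + f1"
   using P.spaceE[of f] by (auto simp: perp_def space_poly_rep)
  have "ip f0 u = 0 \<and> ip f1 u = 0" if "u \<in> U" for u
  proof -
   obtain u0 u1 where u: "u = u0 + u1" "u0 \<in> U" "u0 \<in> hpart (poly_rep p q m n) False" "u1 \<in> U" "u1 \<in> hpart (poly_rep p q m n) True"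
    using U \<open>u \<in> U\<close> unfolding Defs.submodule_def by blast
   have z: "ip f0 u1 = 0" "ip f1 u0 = 0"
    using f01 u by (auto simp: hpart_poly_rep intro: ip_parity)
   have "ip f u0 = 0" "ip f u1 = 0" using f u by (auto simp: perp_def)
   then show ?thesis using z by (simp add: f01(3) u(1) ip_add_left ip_add_right)
  qed
  then have "f0 \<in> perp U" "f1 \<in> perp U" using f01 by (auto simp: perp_def hpart_poly_rep)
  then show "f \<in> {u + v |u v. u \<in> perp U \<inter> hpart (poly_rep p q m n) False \<and> v \<in> perp U \<inter> hpart (poly_rep p q m n) True}"
   using f01 by blast
 qed (auto intro: SP.subspace_add[OF sub])
 fix x f assume x: "x \<in> units (glgl p q m n)" and f: "f \<in> perp U"
 show "poly_act p q m n x f \<in> perp U"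
  using f poly_act_superpolys[OF x] st[OF P.star_units[OF x]] unfolding perp_def by (auto simp: ip_poly_act)
qed

lemma orthogonal_projection:
 assumes "finite B" shows "\<exists>w\<in>SP.span B. \<forall>b\<in>SP.span B. ip (v - w) b = 0"
 using assms
proof (induction B arbitrary: v rule: finite_induct)
 case (insert b B)
 obtain b' where b': "b' \<in> SP.span B" "\<forall>c\<in>SP.span B. ip (b - b') c = 0" using insert.IH by blast
 obtain w where w: "w \<in> SP.span B" "\<forall>c\<in>SP.span B. ip (v - w) c = 0" using insert.IH by blast
 define d where "d = b - b'"
 have mono: "SP.span B \<subseteq> SP.span (insert b B)" by (rule SP.span_mono) blast
 have d: "d \<in> SP.span (insert b B)" unfolding d_def
  by (rule SP.span_diff) (use b'(1) mono in \<open>auto intro: SP.span_base\<close>)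
 define k where "k = ip (v - w) d / ip d d"
 define w' where "w' = w + sp_scale k d"
 have "w' \<in> SP.span (insert b B)" unfolding w'_def
  by (rule SP.span_add[OF _ SP.span_scale[OF d]]) (use w(1) mono in blast)
 moreover have "ip (v - w') c = 0" if "c \<in> SP.span (insert b B)" for c
 proof -
  obtain l where "c - sp_scale l b \<in> SP.span B" using SP.span_breakdown_eq \<open>c \<in> _\<close> by metis
  define c0 where "c0 = c - sp_scale l d"
  have "c0 = (c - sp_scale l b) + sp_scale l b'" by (simp add: c0_def d_def SP.scale_right_diff_distrib)
  then have c0: "c0 \<in> SP.span B" using \<open>c - sp_scale l b \<in> SP.span B\<close> b'(1) by (simp add: SP.span_add SP.span_scale)
  have e: "v - w' = (v - w) + sp_scale (- k) d" by (simp add: w'_def)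
  have "ip (v - w') c0 = 0"
   unfolding e ip_add_left ip_scale_left using w(2) b'(2) c0 by (simp add: d_def)
  moreover have "ip (v - w') d = 0"
   unfolding e ip_add_left ip_scale_left k_def using ip_definite[of d] by (cases "ip d d = 0") auto
  moreover have "c = c0 + sp_scale l d" by (simp add: c0_def)
  ultimately show ?thesis by (simp add: ip_add_right ip_scale_right)
 qed
 ultimately show ?case by blast
qed (auto intro!: bexI[of _ 0])

definition tdeg :: "mono => nat" where
 "tdeg x = (\<Sum>a\<in>sidx p q. wtL m n a x)"

definition degset :: "nat => mono set" where
 "degset N = {x. finite (fst x) \<and> tdeg x = N \<and> (\<forall>A. cnt A x > 0 \<longrightarrow> in_range p q m n A)}"

lemma cnt_le_tdeg: "in_range p q m n A ==> cnt A x \<le> tdeg x"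
proof -
 assume "in_range p q m n A"
 then obtain a c where a: "a \<in> sidx p q" "c \<in> sidx m n" "A = gvar a c" by (auto simp: in_range_def)
 have "cnt A x \<le> wtL m n a x" unfolding wtL_def a(3) by (rule member_le_sum) (use a in auto)
 also have "\<dots> \<le> tdeg x" unfolding tdeg_def by (rule member_le_sum) (use a in auto)
 finally show ?thesis .
qed

lemma finite_vars: "finite (even_vars p q m n)" "finite (odd_vars p q m n)"
proof -
 have fin: "finite {A. in_range p q m n A}"
 proof (rule finite_subset)
  show "{A. in_range p q m n A} \<subseteq> (\<lambda>(a, c). gvar a c) ` (sidx p q \<times> sidx m n)" by (auto simp: in_range_def)
 qed simp
 have "even_vars p q m n \<subseteq> projl ` {A. in_range p q m n A}"
  using in_range_Inl by (force intro!: image_eqI[where x = "Inl _"])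
 then show "finite (even_vars p q m n)" using fin by (meson finite_imageI finite_subset)
 have "odd_vars p q m n \<subseteq> projr ` {A. in_range p q m n A}"
  using in_range_Inr by (force intro!: image_eqI[where x = "Inr _"])
 then show "finite (odd_vars p q m n)" using fin by (meson finite_imageI finite_subset)
qed

lemma finite_degset: "finite (degset N)"
proof (rule finite_subset)
 let ?E = "{e :: even_var \<Rightarrow>\<^sub>0 nat. \<forall>v. (v \<in> even_vars p q m n \<longrightarrow> Poly_Mapping.lookup e v \<in> {..N}) \<and> (v \<notin> even_vars p q m n \<longrightarrow> Poly_Mapping.lookup e v = 0)}"
 have "finite (Poly_Mapping.lookup ` ?E)"
  by (rule finite_subset[OF _ finite_set_of_finite_funs[OF finite_vars(1) finite_atMost[of N], of 0]]) auto
 then have "finite ?E" by (rule finite_imageD) (rule inj_onI, rule poly_mapping_eqI, simp)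
 then show "finite (Pow (odd_vars p q m n) \<times> ?E)" using finite_vars(2) by simp
 show "degset N \<subseteq> Pow (odd_vars p q m n) \<times> ?E"
 proof
  fix x assume x: "x \<in> degset N"
  have "v \<in> odd_vars p q m n" if "v \<in> fst x" for v
   using x that unfolding degset_def in_range_Inr[symmetric] by force
  moreover have "v \<in> even_vars p q m n" if "Poly_Mapping.lookup (snd x) v > 0" for v
   using x that unfolding degset_def in_range_Inl[symmetric] by force
  moreover have "Poly_Mapping.lookup (snd x) v \<le> N" if "v \<in> even_vars p q m n" for v
   using x cnt_le_tdeg[of "Inl v" x] that by (simp add: degset_def in_range_Inl)
  ultimately show "x \<in> Pow (odd_vars p q m n) \<times> ?E" by (auto simp: mem_Times_iff)
 qed
qed

lemma degree_component_mem:
 assumes U: "submodule (glgl p q m n) (poly_rep p q m n) U" and u: "u \<in> U"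
 shows "res {x. tdeg x = N} u \<in> U"
proof -
 have sub: "SP.subspace U" and st: "\<And>x u. x \<in> units (glgl p q m n) ==> u \<in> U ==> poly_act p q m n x u \<in> U"
  using U by (auto simp: Defs.submodule_def)
 have "res {x. complex_of_nat (tdeg x) = of_nat N} u \<in> U"
 proof (rule eigencomponent_mem[OF sub _ _ u, where T = "\<lambda>f. \<Sum>a\<in>sidx p q. poly_act p q m n (Inl (a, a)) f"])
  fix w assume "w \<in> U"
  then show "(\<Sum>a\<in>sidx p q. poly_act p q m n (Inl (a, a)) w) \<in> U"
   by (intro SP.subspace_sum[OF sub] st) (auto simp: gl_units)
 next
  fix w x
  show "cf (\<Sum>a\<in>sidx p q. poly_act p q m n (Inl (a, a)) w) x = complex_of_nat (tdeg x) * cf w x"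
   by (simp add: cf_cartan_left tdeg_def sum_distrib_right)
 qed
 then show ?thesis by simp
qed

text \<open>In each degree the space is finite-dimensional, so a proper submodule has a nonzero
 orthogonal complement.\<close>

lemma perp_nonzero:
 assumes U: "submodule (glgl p q m n) (poly_rep p q m n) U" and ne: "U \<noteq> superpolys p q m n"
 shows "perp U \<noteq> {0}"
proof -
 have sub: "SP.subspace U" using U by (simp add: Defs.submodule_def)
 have Usp: "U \<subseteq> superpolys p q m n" using P.submodule_space[OF U] by (simp add: space_poly_rep)
 then obtain v where v: "v \<in> superpolys p q m n" "v \<notin> U" using ne by blast
 have "\<exists>N. res {x. tdeg x = N} v \<notin> U"
 proof (rule ccontr)
  assume "\<not> ?thesis"
  then have *: "res {x. tdeg x = N} v \<in> U" for N by blast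
  have veq: "v = (\<Sum>N\<in>tdeg ` supp v. res {x. tdeg x = N} v)"
  proof (rule cf_eqI)
   fix x
   have "cf (\<Sum>N\<in>tdeg ` supp v. res {x. tdeg x = N} v) x = (\<Sum>N\<in>tdeg ` supp v. if N = tdeg x then cf v x else 0)"
    unfolding cf_sum by (rule sum.cong) (auto simp: cf_res)
   also have "\<dots> = (if tdeg x \<in> tdeg ` supp v then cf v x else 0)" by (rule sum.delta) simp
   also have "\<dots> = cf v x" by (auto simp: supp_def)
   finally show "cf v x = cf (\<Sum>N\<in>tdeg ` supp v. res {x. tdeg x = N} v) x" by simp
  qed
  have "v \<in> U" by (subst veq) (rule SP.subspace_sum[OF sub *])
  then show False using v by simp
 qed
 then obtain N where N: "res {x. tdeg x = N} v \<notin> U" by blast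
 define vN where "vN = res {x. tdeg x = N} v"
 define VN where "VN = {f \<in> superpolys p q m n. \<forall>x. cf f x \<noteq> 0 \<longrightarrow> tdeg x = N}"
 have vN: "vN \<in> VN" unfolding VN_def vN_def using res_superpolys[OF v(1)] by (auto simp: cf_res)
 have VN_span: "VN \<subseteq> SP.span (mono_sp ` degset N)"
 proof
  fix f assume f: "f \<in> VN"
  have s: "supp f \<subseteq> degset N"
   using f by (auto simp: VN_def supp_def degset_def superpolys_iff dest: cf_nonzero_finite)
  have "res UNIV f = f" by (rule cf_eqI) (simp add: cf_res)
  then have "f = (\<Sum>x\<in>supp f. sp_scale (cf f x) (mono_sp x))" by (simp add: res_def)
  also have "\<dots> \<in> SP.span (mono_sp ` degset N)"
   using s by (intro SP.span_sum SP.span_scale SP.span_base) auto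
  finally show "f \<in> SP.span (mono_sp ` degset N)" .
 qed
 have VNsub: "SP.subspace VN"
 proof (rule SP.subspaceI)
  fix f g assume f: "f \<in> VN" and g: "g \<in> VN"
  have "tdeg x = N" if "cf (f + g) x \<noteq> 0" for x
  proof -
   have "cf f x \<noteq> 0 \<or> cf g x \<noteq> 0" using that by auto
   then show ?thesis using f g unfolding VN_def by blast
  qed
  then show "f + g \<in> VN" using f g SP.subspace_add[OF superpolys_subspace] by (auto simp: VN_def)
 qed (auto simp: VN_def SP.subspace_0[OF superpolys_subspace] SP.subspace_scale[OF superpolys_subspace])
 obtain B where B: "B \<subseteq> U \<inter> VN" "SP.independent B" "U \<inter> VN \<subseteq> SP.span B"
  using SP.maximal_independent_subset by blast
 have "finite B"
  by (rule conjunct1[OF SP.independent_span_bound[OF _ B(2)]], rule finite_imageI[OF finite_degset[of N]])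
   (use B(1) VN_span in blast)
 have spB: "SP.span B \<subseteq> U \<inter> VN" by (rule SP.span_minimal[OF B(1)]) (rule SP.subspace_inter[OF sub VNsub])
 obtain w where w: "w \<in> SP.span B" "\<forall>b\<in>SP.span B. ip (vN - w) b = 0" using orthogonal_projection[OF \<open>finite B\<close>] by blast
 have wV: "vN - w \<in> VN" using SP.subspace_diff[OF VNsub vN] w(1) spB by blast
 have "ip (vN - w) u = 0" if u: "u \<in> U" for u
 proof -
  define uN where "uN = res {x. tdeg x = N} u"
  have "uN \<in> U" unfolding uN_def by (rule degree_component_mem[OF U u])
  moreover have "uN \<in> VN" using u Usp res_superpolys by (auto simp: VN_def uN_def cf_res)
  ultimately have "ip (vN - w) uN = 0" using w(2) B(3) by blast
  moreover have "ip (vN - w) u = ip (vN - w) uN"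
   unfolding ip_def by (rule sum.cong) (use wV in \<open>auto simp: uN_def cf_res VN_def supp_def\<close>)
  ultimately show ?thesis by simp
 qed
 then have "vN - w \<in> perp U" using wV by (auto simp: perp_def VN_def)
 moreover have "vN - w \<noteq> 0" using N w(1) spB by (auto simp: vN_def)
 ultimately show ?thesis by blast
qed

text \<open>
 By Zorn's lemma there is a maximal family of pairwise orthogonal irreducible submodules containing \<open>U0\<close>.
 If its sum were proper, the orthogonal complement would contain a singular vector, which generates an
 irreducible submodule enlarging the family.
\<close>

theorem complete_reducibility:
 assumes U0: "submodule (glgl p q m n) (poly_rep p q m n) U0"
  "irreducible_rep (glgl p q m n) (subrep (poly_rep p q m n) U0)"
 shows "\<exists>D. decomposition (glgl p q m n) (poly_rep p q m n) D \<and> U0 \<in> D"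
proof -
 let ?g = "glgl p q m n" and ?P = "poly_rep p q m n"
 define good where "good D \<longleftrightarrow> U0 \<in> D \<and> (\<forall>U\<in>D. submodule ?g ?P U \<and> irreducible_rep ?g (subrep ?P U)) \<and>
  (\<forall>U\<in>D. \<forall>U'\<in>D. U \<noteq> U' \<longrightarrow> (\<forall>u\<in>U. \<forall>u'\<in>U'. ip u u' = 0))" for D
 have "\<exists>M\<in>{D. good D}. \<forall>Z\<in>{D. good D}. M \<subseteq> Z \<longrightarrow> Z = M"
 proof (rule subset_Zorn_nonempty)
  show "{D. good D} \<noteq> {}" using U0 by (auto simp: good_def intro!: exI[of _ "{U0}"])
  fix \<C> assume C: "\<C> \<noteq> {}" "subset.chain {D. good D} \<C>"
  have g: "good D" if "D \<in> \<C>" for D using C(2) that by (auto simp: subset.chain_def)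
  have "\<exists>D\<in>\<C>. U \<in> D \<and> U' \<in> D" if UU': "U \<in> \<Union>\<C>" "U' \<in> \<Union>\<C>" for U U'
  proof -
   obtain D D' where D: "D \<in> \<C>" "U \<in> D" "D' \<in> \<C>" "U' \<in> D'" using UU' by blast
   then have "D \<subseteq> D' \<or> D' \<subseteq> D" using C(2) by (auto simp: subset.chain_def)
   then show ?thesis using D by blast
  qed
  note both = this
  have "U0 \<in> \<Union>\<C>"
  proof -
   obtain D where "D \<in> \<C>" using C(1) by blast
   then show ?thesis using g[of D] unfolding good_def by blast
  qed
  moreover have "submodule ?g ?P U \<and> irreducible_rep ?g (subrep ?P U)" if UC: "U \<in> \<Union>\<C>" for U
  proof -
   obtain D where D: "D \<in> \<C>" "U \<in> D" using UC by blast
   then show ?thesis using g[OF D(1)] by (simp add: good_def)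
  qed
  moreover have "ip u u' = 0" if *: "U \<in> \<Union>\<C>" "U' \<in> \<Union>\<C>" "U \<noteq> U'" "u \<in> U" "u' \<in> U'" for U U' u u'
  proof -
   obtain D where D: "D \<in> \<C>" "U \<in> D" "U' \<in> D" using both[OF *(1,2)] by blast
   then show ?thesis using g[OF D(1)] *(3-5) unfolding good_def by blast
  qed
  ultimately show "\<Union>\<C> \<in> {D. good D}" unfolding good_def by simp
 qed
 then obtain D where D: "good D" and max: "\<And>Z. good Z ==> D \<subseteq> Z ==> Z = D" by blast
 have DU: "submodule ?g ?P U" "irreducible_rep ?g (subrep ?P U)" if "U \<in> D" for U using D that by (auto simp: good_def)
 have orth: "ip u u' = 0" if "U \<in> D" "U' \<in> D" "U \<noteq> U'" "u \<in> U" "u' \<in> U'" for U U' u u'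
  using D that unfolding good_def by blast
 have Dsp: "U \<subseteq> superpolys p q m n" if "U \<in> D" for U
  using P.submodule_space[OF DU(1)[OF that]] by (simp add: space_poly_rep)
 have Dsub: "SP.subspace U" if "U \<in> D" for U using DU(1)[OF that] by (simp add: Defs.submodule_def)
 define M where "M = SP.span {u \<in> \<Union>D. u \<in> hpart ?P False \<or> u \<in> hpart ?P True}"
 have UM: "U \<subseteq> M" if "U \<in> D" for U
 proof
  fix u assume "u \<in> U"
  then obtain u0 u1 where u: "u = u0 + u1" "u0 \<in> U" "u0 \<in> hpart ?P False" "u1 \<in> U" "u1 \<in> hpart ?P True"
   using DU(1)[OF \<open>U \<in> D\<close>] unfolding Defs.submodule_def by blast
  have "u0 \<in> M" "u1 \<in> M" unfolding M_def by (rule SP.span_base, use u \<open>U \<in> D\<close> in blast)+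
  then show "u \<in> M" unfolding u(1) M_def by (rule SP.span_add)
 qed
 have Msub: "submodule ?g ?P M"
 proof -
  have "submodule ?g ?P (module.span (scal ?P) {u \<in> \<Union>D. u \<in> hpart ?P False \<or> u \<in> hpart ?P True})"
  proof (rule P.submodule_span)
   fix x b assume x: "x \<in> units ?g" and b: "b \<in> {u \<in> \<Union>D. u \<in> hpart ?P False \<or> u \<in> hpart ?P True}"
   then obtain U s where U: "U \<in> D" "b \<in> U" "b \<in> hpart ?P s" by blast
   have "act ?P x b \<in> U" using DU(1)[OF U(1)] x U(2) unfolding Defs.submodule_def by blast
   then show "act ?P x b \<in> module.span (scal ?P) {u \<in> \<Union>D. u \<in> hpart ?P False \<or> u \<in> hpart ?P True}"
    using UM[OF U(1)] by (auto simp: M_def)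
  qed blast
  then show ?thesis by (simp add: M_def)
 qed
 have "M = superpolys p q m n"
 proof (rule ccontr)
  assume "M \<noteq> superpolys p q m n"
  then have "perp M \<noteq> {0}" by (rule perp_nonzero[OF Msub])
  then obtain v s x0 where v: "v \<in> perp M" "v \<in> hpart ?P s" "v \<noteq> 0" "singular ?g (gght p m) ?P (pweight x0) v"
   using submodule_has_singular[OF perp_submodule[OF Msub]] by metis
  define U where "U = P.K v"
  have U: "submodule ?g ?P U" "irreducible_rep ?g (subrep ?P U)" "v \<in> U"
   unfolding U_def using P.K_submodule[OF v(4,2)] P.K_irreducible[OF v(4,2,3)] P.self_in_K by auto
  have UM': "U \<subseteq> perp M"
   unfolding U_def using perp_submodule[OF Msub] v(1) by (intro P.K_least) (auto simp: Defs.submodule_def)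
  have p1: "ip u u' = 0" if "u \<in> U" "U' \<in> D" "u' \<in> U'" for u u' U'
   using that UM' UM by (auto simp: perp_def)
  then have p2: "ip u' u = 0" if "u \<in> U" "U' \<in> D" "u' \<in> U'" for u u' U'
   using that ip_cnj[of u' u] by simp
  have "ip u u' = 0" if *: "V \<in> insert U D" "V' \<in> insert U D" "V \<noteq> V'" "u \<in> V" "u' \<in> V'" for V V' u u'
  proof -
   consider "V = U" "V' \<in> D" | "V \<in> D" "V' = U" | "V \<in> D" "V' \<in> D" using *(1-3) by blast
   then show ?thesis
   proof cases
    case 1 then show ?thesis using p1 *(4,5) by simp
   next
    case 2 then show ?thesis using p2 *(4,5) by simp
   next
    case 3 then show ?thesis using orth *(3-5) by simp
   qed
  qed
  moreover have "U0 \<in> D" using D by (simp add: good_def)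
  ultimately have "good (insert U D)"
   using DU U(1,2) unfolding good_def by simp
  then have "U \<in> D" using max by blast
  then have "ip v v = 0" using p1[OF U(3) _ U(3)] by blast
  then show False using ip_definite v(3) by blast
 qed
 moreover define R where "R v f \<longleftrightarrow> (\<forall>U\<in>D. f U \<in> U) \<and> (\<forall>U. U \<notin> D \<longrightarrow> f U = 0) \<and> finite {U. f U \<noteq> 0} \<and> v = (\<Sum>U | f U \<noteq> 0. f U)"
  for v :: superpoly and f :: "superpoly set => superpoly"
 have Rsum: "v = (\<Sum>U\<in>F. f U)" if "R v f" "finite F" "{U. f U \<noteq> 0} \<subseteq> F" for v f F
  using that unfolding R_def by (auto intro!: sum.mono_neutral_left)
 have RI: "R v f" if "\<forall>U\<in>D. f U \<in> U" "\<forall>U. U \<notin> D \<longrightarrow> f U = 0" "finite F" "{U. f U \<noteq> 0} \<subseteq> F" "v = (\<Sum>U\<in>F. f U)" for v f F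
  using that finite_subset[OF that(4,3)] unfolding R_def by (auto intro!: sum.mono_neutral_right)
 have "M \<subseteq> {v. \<exists>f. R v f}"
  unfolding M_def
 proof (rule SP.span_minimal)
  show "{u \<in> \<Union> D. u \<in> hpart ?P False \<or> u \<in> hpart ?P True} \<subseteq> {v. \<exists>f. R v f}"
  proof
   fix u assume "u \<in> {u \<in> \<Union> D. u \<in> hpart ?P False \<or> u \<in> hpart ?P True}"
   then obtain U where U: "U \<in> D" "u \<in> U" by blast
   have "R u (\<lambda>U'. if U' = U then u else 0)"
    by (rule RI[where F = "{U}"]) (use U Dsub in \<open>auto simp: SP.subspace_0\<close>)
   then show "u \<in> {v. \<exists>f. R v f}" by blast
  qed
  show "SP.subspace {v. \<exists>f. R v f}"
  proof (rule SP.subspaceI)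
   have "R 0 (\<lambda>_. 0)" by (rule RI[where F = "{}"]) (auto simp: Dsub SP.subspace_0)
   then show "0 \<in> {v. \<exists>f. R v f}" by blast
  next
   fix v w assume "v \<in> {v. \<exists>f. R v f}" "w \<in> {v. \<exists>f. R v f}"
   then obtain f h where fh: "R v f" "R w h" by blast
   define F where "F = {U. f U \<noteq> 0} \<union> {U. h U \<noteq> 0}"
   have F: "finite F" "{U. f U \<noteq> 0} \<subseteq> F" "{U. h U \<noteq> 0} \<subseteq> F" using fh by (auto simp: F_def R_def)
   have "R (v + w) (\<lambda>U. f U + h U)"
   proof (rule RI[where F = F])
    show "v + w = (\<Sum>U\<in>F. f U + h U)"
     using Rsum[OF fh(1) F(1,2)] Rsum[OF fh(2) F(1,3)] by (simp add: sum.distrib)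
    show "\<forall>U\<in>D. f U + h U \<in> U" using fh SP.subspace_add[OF Dsub] by (auto simp: R_def)
    show "{U. f U + h U \<noteq> 0} \<subseteq> F" by (auto simp: F_def)
   qed (use fh F in \<open>auto simp: R_def\<close>)
   then show "v + w \<in> {v. \<exists>f. R v f}" by blast
  next
   fix c v assume "v \<in> {v. \<exists>f. R v f}"
   then obtain f where f: "R v f" by blast
   have "R (sp_scale c v) (\<lambda>U. sp_scale c (f U))"
   proof (rule RI[where F = "{U. f U \<noteq> 0}"])
    have "v = (\<Sum>U | f U \<noteq> 0. f U)" using f by (simp add: R_def)
    then show "sp_scale c v = (\<Sum>U | f U \<noteq> 0. sp_scale c (f U))" by (simp add: SP.scale_sum_right[symmetric])
    show "\<forall>U\<in>D. sp_scale c (f U) \<in> U" using f SP.subspace_scale[OF Dsub] by (auto simp: R_def)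
   qed (use f in \<open>auto simp: R_def\<close>)
   then show "sp_scale c v \<in> {v. \<exists>f. R v f}" by blast
  qed
 qed
 moreover have "f = h" if fh: "R v f" "R v h" for v f h
 proof
  fix U
  show "f U = h U"
  proof (cases "U \<in> D")
   case False then show ?thesis using fh by (simp add: R_def)
  next
   case True
   define F where "F = insert U ({U. f U \<noteq> 0} \<union> {U. h U \<noteq> 0})"
   have F: "finite F" "{U. f U \<noteq> 0} \<subseteq> F" "{U. h U \<noteq> 0} \<subseteq> F" using fh by (auto simp: F_def R_def)
   have s: "(\<Sum>V\<in>F. f V - h V) = 0" using Rsum[OF fh(1) F(1,2)] Rsum[OF fh(2) F(1,3)] by (simp add: sum_subtractf)
   have dU: "f V - h V \<in> V" if "V \<in> D" for V using fh that SP.subspace_diff[OF Dsub] by (auto simp: R_def)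
   have d0: "f V - h V = 0" if "V \<notin> D" for V using fh that by (auto simp: R_def)
   have "0 = (\<Sum>V\<in>F. ip (f V - h V) (f U - h U))" using s by (simp add: ip_sum_left[symmetric])
   also have "\<dots> = (\<Sum>V\<in>F. if V = U then ip (f U - h U) (f U - h U) else 0)"
   proof (rule sum.cong[OF refl])
    fix V assume "V \<in> F"
    show "ip (f V - h V) (f U - h U) = (if V = U then ip (f U - h U) (f U - h U) else 0)"
     using orth[OF _ True _ dU dU[OF True], of V] d0[of V] by (cases "V \<in> D") auto
   qed
   also have "\<dots> = ip (f U - h U) (f U - h U)" using F by (simp add: F_def)
   finally show ?thesis using ip_definite[of "f U - h U"] by simp
  qed
 qed
 ultimately have "\<exists>!f. R v f" if "v \<in> superpolys p q m n" for v using that by blast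
 then have "decomposition ?g ?P D"
  unfolding Defs.decomposition_def space_poly_rep using DU by (auto simp: R_def)
 then show ?thesis using D by (auto simp: good_def)
qed

end

section \<open>The weights of joint highest weight vectors\<close>

lemma singular_kill: "singular g ht M \<chi> v ==> x \<in> units g ==> ht x > 0 ==> act M x v = 0"
 and singular_weight: "singular g ht M \<chi> v ==> x \<in> units g ==> ht x = 0 ==> act M x v = scal M (\<chi> x) v"
 by (simp_all add: singular_def)

definition offdeg :: "nat => nat => nat => mono => nat" where
 "offdeg m q n x = (\<Sum>a\<in>sidx m q. \<Sum>c\<in>sidx m n. if a = c then 0 else cnt (gvar a c) x)"

lemma cnt_up_of_bool: "raisable A x ==> cnt B (up A x) = cnt B x + of_bool (A = B)"
 by (cases "A = B") (auto simp: cnt_up cnt_up_other)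

lemma offdeg_up:
 assumes r: "raisable (gvar a c) x" and a: "a \<in> sidx m q" and c: "c \<in> sidx m n"
 shows "offdeg m q n (up (gvar a c) x) = offdeg m q n x + of_bool (a \<noteq> c)"
proof -
 have "offdeg m q n (up (gvar a c) x)
   = (\<Sum>b\<in>sidx m q. \<Sum>d\<in>sidx m n. (if b = d then 0 else cnt (gvar b d) x) + (if a = b \<and> c = d then of_bool (b \<noteq> d) else 0))"
  unfolding offdeg_def cnt_up_of_bool[OF r] by (intro sum.cong) auto
 also have "\<dots> = offdeg m q n x + (\<Sum>b\<in>sidx m q. \<Sum>d\<in>sidx m n. if a = b \<and> c = d then of_bool (b \<noteq> d) else 0)"
  unfolding offdeg_def sum.distrib by simp
 also have "(\<Sum>b\<in>sidx m q. \<Sum>d\<in>sidx m n. if a = b \<and> c = d then of_bool (b \<noteq> d) else 0)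
   = (\<Sum>b\<in>sidx m q. if b = a then of_bool (a \<noteq> c) else (0::nat))"
  by (intro sum.cong) (use c in \<open>auto simp: sum.delta\<close>)
 also have "\<dots> = of_bool (a \<noteq> c)" using a by simp
 finally show ?thesis .
qed

lemma offdeg_down:
 assumes "cnt (gvar a c) x > 0" "a \<in> sidx m q" "c \<in> sidx m n"
 shows "offdeg m q n x = offdeg m q n (down (gvar a c) x) + of_bool (a \<noteq> c)"
 using offdeg_up[OF raisable_down[OF assms(1)] assms(2,3)] up_down[OF assms(1)] by simp

lemma raisable_diag [simp]: "raisable (gvar a a) x"
 by (rule raisable_even) simp

text \<open>Consider a monomial of least off-diagonal degree in a singular vector. A factor below or above
 the diagonal could be replaced by a diagonal variable by one of the raising operators, and no other
 monomial of the vector could contribute to the result.\<close>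

lemma quadratic_coeff_leading:
 assumes B: "cnt (gvar b c) x > 0" and y: "y = down (gvar b c) x" and x': "x' = up (gvar a a') y" and ne: "raisable (gvar a a') y"
 shows "cf (zz (gvar a a') (dd (gvar b c) f)) x'
  = eps (gvar a a') y * of_nat (cnt (gvar b c) y + 1) * eps (gvar b c) y * cf f x"
 using up_down[OF B] raisable_down[OF B] down_up[OF ne] cnt_up[OF ne]
 by (simp add: cf_zz cf_dd x' y)

lemma quadratic_coeff_nonzero:
 assumes "cf (zz (gvar a c) (dd (gvar b d) f)) x' \<noteq> 0"
 shows "cnt (gvar a c) x' > 0" "raisable (gvar b d) (down (gvar a c) x')" "cf f (up (gvar b d) (down (gvar a c) x')) \<noteq> 0"
 using assms by (auto simp: cf_zz cf_dd split: if_splits)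

text \<open>
 By the preceding remark a monomial of least off-diagonal degree in \<open>v\<close> has only diagonal variables. This is
 why the two weights of a joint singular vector agree.
\<close>

lemma singular_has_diagonal_monomial:
 assumes v: "singular (glgl m q m n) (gght m m) (poly_rep m q m n) \<chi> v" and ne: "v \<noteq> 0"
 obtains x where "cf v x \<noteq> 0" "\<And>a c. cnt (gvar a c) x > 0 ==> a = c \<and> a \<in> sidx m q \<and> c \<in> sidx m n"
proof -
 have vsp: "v \<in> superpolys m q m n" using v by (simp add: singular_def space_poly_rep)
 have kill: "poly_act m q m n y v = 0" if "y \<in> units (glgl m q m n)" "gght m m y > 0" for y
  using v that by (simp add: singular_def)
 have ex: "\<exists>x. cf v x \<noteq> 0" using ne cf_eqI[of v 0] by (metis cf_zero)
 define k where "k = (LEAST k. \<exists>x. cf v x \<noteq> 0 \<and> offdeg m q n x = k)"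
 have "\<exists>x. cf v x \<noteq> 0 \<and> offdeg m q n x = k" unfolding k_def by (rule LeastI_ex) (use ex in blast)
 then obtain x where x: "cf v x \<noteq> 0" "offdeg m q n x = k" by blast
 have least: "k \<le> offdeg m q n z" if "cf v z \<noteq> 0" for z
  unfolding k_def by (rule Least_le) (use that in blast)
 have range: "b \<in> sidx m q" "a \<in> sidx m n" if "cnt (gvar b a) x > 0" for b a
 proof -
  have "in_range m q m n (gvar b a)" using vsp x(1) that unfolding superpolys_iff by blast
  then show "b \<in> sidx m q" "a \<in> sidx m n" by simp_all
 qed
 have "b = a" if B: "cnt (gvar b a) x > 0" for a b
 proof (rule ccontr)
  assume ba: "b \<noteq> a"
  note r = range[OF B]
  define y where "y = down (gvar b a) x"
  have yk: "k = offdeg m q n y + 1" using offdeg_down[OF B r] ba x(2) by (simp add: y_def)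
  show False
  proof (cases "pos m a < pos m b")
   case True
   then have a: "a \<in> sidx m q" using r by (cases a; cases b) auto
   define x' where "x' = up (gvar a a) y"
   have ox': "offdeg m q n x' = offdeg m q n y" using offdeg_up[of a a y m q n] a r by (simp add: x'_def)
   have "0 = cf (poly_act m q m n (Inl (a, b)) v) x'"
    using kill[of "Inl (a, b)"] a r True by (simp add: gl_units gl_ht_def InlI)
   also have "\<dots> = (\<Sum>c\<in>sidx m n. cf (zz (gvar a c) (dd (gvar b c) v)) x')" by (simp add: poly_act_Inl)
   also have "\<dots> = (\<Sum>c\<in>sidx m n. if c = a then cf (zz (gvar a a) (dd (gvar b a) v)) x' else 0)"
   proof (rule sum.cong[OF refl])
    fix c assume c: "c \<in> sidx m n"
    have "cf (zz (gvar a c) (dd (gvar b c) v)) x' = 0" if "c \<noteq> a"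
    proof (rule ccontr)
     assume "\<not> ?thesis"
     note q = quadratic_coeff_nonzero[OF this]
     have "offdeg m q n (up (gvar b c) (down (gvar a c) x')) \<le> offdeg m q n (down (gvar a c) x') + 1"
      using offdeg_up[OF q(2) r(1) c] by simp
     also have "\<dots> = offdeg m q n x'" using offdeg_down[OF q(1) a c] that by simp
     finally show False using least[OF q(3)] ox' yk by simp
    qed
    then show "cf (zz (gvar a c) (dd (gvar b c) v)) x' = (if c = a then cf (zz (gvar a a) (dd (gvar b a) v)) x' else 0)" by simp
   qed
   also have "\<dots> = cf (zz (gvar a a) (dd (gvar b a) v)) x'" using r by simp
   also have "\<dots> \<noteq> 0" using quadratic_coeff_leading[OF B y_def x'_def raisable_diag] x(1) by (simp del: of_nat_Suc)
   finally show False by simp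
  next
   case False
   then have lt: "pos m b < pos m a" using pos_inject[OF r(1) r(2)] ba by linarith
   then have b: "b \<in> sidx m n" using r by (cases a; cases b) auto
   define x' where "x' = up (gvar b b) y"
   have ox': "offdeg m q n x' = offdeg m q n y" using offdeg_up[of b b y m q n] b r by (simp add: x'_def)
   have "0 = cf (poly_act m q m n (Inr (b, a)) v) x'"
    using kill[of "Inr (b, a)"] b r lt by (simp add: gl_units gl_ht_def InrI)
   also have "\<dots> = (\<Sum>c\<in>sidx m q. koszul (odd_idx c) (odd_idx b \<noteq> odd_idx a) * cf (zz (gvar c b) (dd (gvar c a) v)) x')"
    by (simp add: poly_act_Inr)
   also have "\<dots> = (\<Sum>c\<in>sidx m q. if c = b then koszul (odd_idx b) (odd_idx b \<noteq> odd_idx a) * cf (zz (gvar b b) (dd (gvar b a) v)) x' else 0)"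
   proof (rule sum.cong[OF refl])
    fix c assume c: "c \<in> sidx m q"
    have "cf (zz (gvar c b) (dd (gvar c a) v)) x' = 0" if "c \<noteq> b"
    proof (rule ccontr)
     assume "\<not> ?thesis"
     note q = quadratic_coeff_nonzero[OF this]
     have "offdeg m q n (up (gvar c a) (down (gvar c b) x')) \<le> offdeg m q n (down (gvar c b) x') + 1"
      using offdeg_up[OF q(2) c r(2)] by simp
     also have "\<dots> = offdeg m q n x'" using offdeg_down[OF q(1) c b] that by simp
     finally show False using least[OF q(3)] ox' yk by simp
    qed
    then show "koszul (odd_idx c) (odd_idx b \<noteq> odd_idx a) * cf (zz (gvar c b) (dd (gvar c a) v)) x'
     = (if c = b then koszul (odd_idx b) (odd_idx b \<noteq> odd_idx a) * cf (zz (gvar b b) (dd (gvar b a) v)) x' else 0)" by simp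
   qed
   also have "\<dots> = koszul (odd_idx b) (odd_idx b \<noteq> odd_idx a) * cf (zz (gvar b b) (dd (gvar b a) v)) x'" using r by simp
   also have "\<dots> \<noteq> 0" using quadratic_coeff_leading[OF B y_def x'_def raisable_diag] x(1)
    by (simp add: koszul_def del: of_nat_Suc)
   finally show False by simp
  qed
 qed
 then show ?thesis using that[OF x(1)] range by blast
qed

lemma joint_weights:
 assumes v: "singular (glgl m q m n) (gght m m) (poly_rep m q m n) (case_sum (gl_weight \<mu>) (gl_weight \<nu>)) v" and ne: "v \<noteq> 0"
 shows "\<And>a. a \<in> sidx m q ==> a \<in> sidx m n ==> \<mu> a = \<nu> a"
  and "\<And>a. a \<in> sidx m q ==> a \<notin> sidx m n ==> \<mu> a = 0"
  and "\<And>a. a \<in> sidx m n ==> a \<notin> sidx m q ==> \<nu> a = 0"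
  and "v \<in> hpart (poly_rep m q m n) s ==> \<not> s"
proof -
 obtain x where x: "cf v x \<noteq> 0" and d: "\<And>a c. cnt (gvar a c) x > 0 ==> a = c \<and> a \<in> sidx m q \<and> c \<in> sidx m n"
  using singular_has_diagonal_monomial[OF v ne] by metis
 have dz: "cnt (gvar a c) x = 0" if "a \<noteq> c" for a c
  using d[of a c] that by (cases "cnt (gvar a c) x") auto
 have L: "\<mu> a = (if a \<in> sidx m n then cnt (gvar a a) x else 0)" if a: "a \<in> sidx m q" for a
 proof -
  have "poly_act m q m n (Inl (a, a)) v = sp_scale (of_nat (\<mu> a)) v"
   using singular_weight[OF v, of "Inl (a, a)"] a by (simp add: InlI gl_units gl_ht_def gl_weight_def)
  then have "of_nat (wtL m n a x) * cf v x = of_nat (\<mu> a) * cf v x"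
   using cf_cartan_left[of m q m n a v x] by (simp only: cf_scale)
  then have "\<mu> a = wtL m n a x" using x by simp
  also have "\<dots> = (\<Sum>c\<in>sidx m n. if c = a then cnt (gvar a a) x else 0)"
   unfolding wtL_def by (intro sum.cong) (auto simp: dz)
  finally show ?thesis by simp
 qed
 have R: "\<nu> c = (if c \<in> sidx m q then cnt (gvar c c) x else 0)" if c: "c \<in> sidx m n" for c
 proof -
  have "poly_act m q m n (Inr (c, c)) v = sp_scale (of_nat (\<nu> c)) v"
   using singular_weight[OF v, of "Inr (c, c)"] c by (simp add: InrI gl_units gl_ht_def gl_weight_def)
  then have "of_nat (wtR m q c x) * cf v x = of_nat (\<nu> c) * cf v x"
   using cf_cartan_right[of m q m n c v x] by (simp only: cf_scale)
  then have "\<nu> c = wtR m q c x" using x by simp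
  also have "\<dots> = (\<Sum>a\<in>sidx m q. if a = c then cnt (gvar c c) x else 0)"
   unfolding wtR_def by (intro sum.cong) (auto simp: dz)
  finally show ?thesis by simp
 qed
 show "\<mu> a = \<nu> a" if "a \<in> sidx m q" "a \<in> sidx m n" for a using L R that by simp
 show "\<mu> a = 0" if "a \<in> sidx m q" "a \<notin> sidx m n" for a using L that by simp
 show "\<nu> a = 0" if "a \<in> sidx m n" "a \<notin> sidx m q" for a using R that by simp
 have "fst x = {}"
 proof (rule ccontr)
  assume "fst x \<noteq> {}"
  then obtain u where u: "u \<in> fst x" by blast
  obtain a c where ac: "Inr u = gvar a c" using gvar_surj by metis
  then have "cnt (gvar a c) x > 0" using u by (simp flip: ac)
  then have "a = c" using d by blast
  have "oddv (gvar a c)" by (simp flip: ac)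
  then show False using \<open>a = c\<close> by simp
 qed
 moreover have "odd (card (fst x)) = s" if "v \<in> hpart (poly_rep m q m n) s"
  using that x unfolding hpart_poly_rep has_parity_def by blast
 ultimately show "\<not> s" if "v \<in> hpart (poly_rep m q m n) s" using that by simp
qed

text \<open>Unitarity forces dominance: the norm of a lowered vector is the difference of two weights.\<close>

lemma dominant_weights:
 assumes kill: "poly_act p q m n (Inl (a, b)) v = 0" and ab: "a \<in> sidx p q" "b \<in> sidx p q" "a \<noteq> b" "odd_idx a = odd_idx b"
  and wt: "poly_act p q m n (Inl (a, a)) v = sp_scale (of_nat i) v" "poly_act p q m n (Inl (b, b)) v = sp_scale (of_nat j) v"
  and ne: "v \<noteq> 0"
 shows "j \<le> i"
proof -
 let ?F = "poly_act p q m n (Inl (b, a)) v"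
 have "poly_act p q m n (Inl (a, b)) ?F = sp_scale (of_nat i - of_nat j) v"
  using poly_bracket_Inl[OF ab(1,2,2,1), of m n v] ab kill poly_act_scale[of p q m n "Inl (b, a)" 0 0]
  by (simp add: koszul_def wt SP.scale_left_diff_distrib)
 then have "ip ?F ?F = cnj (of_nat i - of_nat j) * ip v v"
  using ip_poly_act[of p q m n "Inl (b, a)" v ?F] by (simp add: ip_scale_right)
 moreover obtain r where r: "r \<ge> 0" "ip ?F ?F = complex_of_real r" using ip_self by blast
 moreover obtain t where t: "t \<ge> 0" "ip v v = complex_of_real t" "t = 0 \<longrightarrow> v = 0" using ip_self by blast
 ultimately have "complex_of_real r = complex_of_real ((real i - real j) * t)" by simp
 then have "r = (real i - real j) * t" by (simp only: of_real_eq_iff)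
 moreover have "t > 0" using t ne by linarith
 ultimately have "real i - real j \<ge> 0" using r(1) by (metis not_le zero_le_mult_iff)
 then show ?thesis by simp
qed

lemma eigenvalue_nat:
 assumes "poly_act p q m n (Inl (a, a)) w = sp_scale z w" "w \<noteq> 0"
 shows "\<exists>k. z = of_nat k"
proof -
 obtain x where x: "cf w x \<noteq> 0" using assms(2) cf_eqI[of w 0] by (metis cf_zero)
 have "of_nat (wtL m n a x) * cf w x = z * cf w x"
  using cf_cartan_left[of p q m n a w x] assms(1) by (simp only: cf_scale)
 then show ?thesis using x by (intro exI[of _ "wtL m n a x"]) auto
qed

text \<open>The hook condition comes from successive odd reflections: applying the lowering operators from
 the last even to the odd indices \<open>1, 2, \<dots>\<close> stays nonzero as long as the odd weights are positive, and
 each step lowers the last even weight by one.\<close>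

lemma hook_condition:
 assumes v: "singular (gl m q) (gl_ht m) (left_rep (poly_rep m q m n)) (gl_weight \<mu>) v" and ne: "v \<noteq> 0"
  and m: "1 \<le> m" and K: "K \<le> q" and pos: "\<And>j. 1 \<le> j ==> j \<le> K ==> \<mu> (Inr j) > 0"
 shows "K \<le> \<mu> (Inl m)"
proof -
 define E where "E a b = poly_act m q m n (Inl (a, b))" for a b
 have br: "E a b (E c d f) - sp_scale (koszul (odd_idx a \<noteq> odd_idx b) (odd_idx c \<noteq> odd_idx d)) (E c d (E a b f))
  = (if b = c then E a d f else 0) - sp_scale (koszul (odd_idx a \<noteq> odd_idx b) (odd_idx c \<noteq> odd_idx d)) (if a = d then E c b f else 0)"
  if "a \<in> sidx m q" "b \<in> sidx m q" "c \<in> sidx m q" "d \<in> sidx m q" for a b c d f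
  unfolding E_def by (rule poly_bracket_Inl[OF that])
 have E0: "E a b 0 = 0" for a b unfolding E_def using poly_act_scale[of m q m n "Inl (a, b)" 0 0] by simp
 have Es: "E a b (sp_scale c f) = sp_scale c (E a b f)" for a b c f unfolding E_def by (rule poly_act_scale)
 have em: "Inl m \<in> sidx m q" using m by simp
 have "\<exists>w. w \<noteq> 0 \<and> E (Inl m) (Inl m) w = sp_scale (of_nat (\<mu> (Inl m)) - of_nat k) w
   \<and> (\<forall>j. k < j \<and> j \<le> q \<longrightarrow> E (Inr j) (Inr j) w = sp_scale (of_nat (\<mu> (Inr j))) w \<and> E (Inl m) (Inr j) w = 0)
   \<and> (\<forall>i j. k < i \<and> i < j \<and> j \<le> q \<longrightarrow> E (Inr i) (Inr j) w = 0)" if "k \<le> K" for k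
  using that
 proof (induction k)
  case 0
  have up: "E a b v = 0" if "a \<in> sidx m q" "b \<in> sidx m q" "pos m a < pos m b" for a b
   using singular_kill[OF v, of "(a, b)"] that by (simp add: E_def gl_units gl_ht_def)
  have ca: "E a a v = sp_scale (of_nat (\<mu> a)) v" if "a \<in> sidx m q" for a
   using singular_weight[OF v, of "(a, a)"] that by (simp add: E_def gl_units gl_ht_def gl_weight_def)
  show ?case by (rule exI[of _ v]) (use up ca ne em in auto)
 next
  case (Suc k)
  then obtain w where w: "w \<noteq> 0" "E (Inl m) (Inl m) w = sp_scale (of_nat (\<mu> (Inl m)) - of_nat k) w"
   and wj: "\<And>j. k < j ==> j \<le> q ==> E (Inr j) (Inr j) w = sp_scale (of_nat (\<mu> (Inr j))) w"
   and wm: "\<And>j. k < j ==> j \<le> q ==> E (Inl m) (Inr j) w = 0"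
   and wij: "\<And>i j. k < i ==> i < j ==> j \<le> q ==> E (Inr i) (Inr j) w = 0" by auto
  define w' where "w' = E (Inr (Suc k)) (Inl m) w"
  have sk: "Inr (Suc k) \<in> sidx m q" using Suc K by simp
  have skq: "k < Suc k" "Suc k \<le> q" using Suc K by auto
  have EF: "E (Inl m) (Inr (Suc k)) w' = sp_scale (of_nat (\<mu> (Inl m)) - of_nat k + of_nat (\<mu> (Inr (Suc k)))) w"
   using br[OF em sk sk em, of w] wm[OF skq] w(2) wj[OF skq]
   by (simp add: w'_def koszul_def E0 SP.scale_left_distrib)
  obtain l where l: "of_nat (\<mu> (Inl m)) - of_nat k = (of_nat l :: complex)"
   using eigenvalue_nat[of m q m n "Inl m" w] w unfolding E_def by blast
  have "w' \<noteq> 0"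
  proof
   assume "w' = 0"
   then have "sp_scale (of_nat (l + \<mu> (Inr (Suc k)))) w = 0" using EF l E0 by simp
   moreover have "l + \<mu> (Inr (Suc k)) > 0" using pos[of "Suc k"] Suc by simp
   ultimately show False using w(1) by (simp del: of_nat_add)
  qed
  moreover have "E (Inl m) (Inl m) w' = sp_scale (of_nat (\<mu> (Inl m)) - of_nat (Suc k)) w'"
  proof -
   have "E (Inl m) (Inl m) w' = E (Inr (Suc k)) (Inl m) (E (Inl m) (Inl m) w) - w'"
    using br[OF em em sk em, of w] by (simp add: w'_def koszul_def algebra_simps)
   then show ?thesis unfolding w(2) Es w'_def[symmetric]
    by (simp add: SP.scale_left_distrib SP.scale_left_diff_distrib)
  qed
  moreover have "E (Inr j) (Inr j) w' = sp_scale (of_nat (\<mu> (Inr j))) w'" if "Suc k < j" "j \<le> q" for j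
   using br[of "Inr j" "Inr j" "Inr (Suc k)" "Inl m" w] em sk that wj[of j] by (simp add: w'_def koszul_def Es)
  moreover have "E (Inl m) (Inr j) w' = 0" if "Suc k < j" "j \<le> q" for j
   using br[of "Inl m" "Inr j" "Inr (Suc k)" "Inl m" w] em sk that wm[of j] wij[of "Suc k" j] by (simp add: w'_def koszul_def E0)
  moreover have "E (Inr i) (Inr j) w' = 0" if "Suc k < i" "i < j" "j \<le> q" for i j
   using br[of "Inr i" "Inr j" "Inr (Suc k)" "Inl m" w] em sk that wij[of i j] by (simp add: w'_def koszul_def E0)
  ultimately show ?case by (intro exI[of _ w']) blast
 qed
 from this[of K] obtain w where w: "w \<noteq> 0" "E (Inl m) (Inl m) w = sp_scale (of_nat (\<mu> (Inl m)) - of_nat K) w" by blast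
 obtain l where "of_nat (\<mu> (Inl m)) - of_nat K = (of_nat l :: complex)"
  using eigenvalue_nat[of m q m n "Inl m" w] w unfolding E_def by blast
 then have "complex_of_nat (\<mu> (Inl m)) = of_nat (l + K)" by (simp add: algebra_simps)
 then have "\<mu> (Inl m) = l + K" by (simp only: of_nat_eq_iff)
 then show ?thesis by simp
qed

subsection \<open>Young diagrams in a hook\<close>

lemma young_of_antitone:
 assumes r: "\<And>i j. 1 \<le> i ==> i \<le> j ==> r j \<le> (r i :: nat)" and L: "\<And>i. i > L ==> r i = 0"
 obtains \<nu> where "young \<nu>" "\<And>i. 1 \<le> i ==> row \<nu> i = r i"
proof -
 define N where "N = card {i\<in>{1..L}. r i > 0}"
 have pos: "r i > 0 \<longleftrightarrow> i \<le> N" if i: "1 \<le> i" for i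
 proof
  assume "r i > 0"
  then have "j \<in> {i\<in>{1..L}. r i > 0}" if "j \<in> {1..i}" for j
   using that r[of j i] L[of i] by (auto intro!: leI)
  then have "{1..i} \<subseteq> {i\<in>{1..L}. r i > 0}" by blast
  then have "card {1..i} \<le> N" unfolding N_def by (rule card_mono[rotated]) simp
  then show "i \<le> N" by simp
 next
  assume iN: "i \<le> N"
  show "r i > 0"
  proof (rule ccontr)
   assume "\<not> r i > 0"
   then have z: "r j = 0" if "j \<ge> i" for j using r[OF i that] by simp
   have "{i\<in>{1..L}. r i > 0} \<subseteq> {1..<i}"
   proof
    fix x assume x: "x \<in> {i\<in>{1..L}. r i > 0}"
    then have "\<not> x \<ge> i" using z[of x] by auto
    then show "x \<in> {1..<i}" using x by simp
   qed
   then have "N \<le> card {1..<i}" unfolding N_def by (rule card_mono[rotated]) simp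
   then show False using iN i by simp
  qed
 qed
 define \<nu> where "\<nu> = map r [1..<Suc N]"
 have row: "row \<nu> i = r i" if "1 \<le> i" for i
  using that pos[OF that] by (auto simp: Defs.row_def \<nu>_def simp del: upt_Suc)
 moreover have "young \<nu>"
  unfolding Defs.young_def
 proof
  show "sorted_wrt (\<ge>) \<nu>" unfolding \<nu>_def sorted_wrt_iff_nth_less by (auto intro!: r simp del: upt_Suc)
  show "0 \<notin> set \<nu>" using pos by (force simp: \<nu>_def simp del: upt_Suc)
 qed
 ultimately show ?thesis using that by blast
qed

lemma row_antitone: "young \<nu> ==> 1 \<le> i ==> i \<le> j ==> row \<nu> j \<le> row \<nu> i"
proof (cases "i = j")
 case False
 assume "young \<nu>" "1 \<le> i" "i \<le> j"
 then show ?thesis using False by (auto simp: Defs.young_def Defs.row_def sorted_wrt_iff_nth_less)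
qed simp

lemma row_pos_iff: "young \<nu> ==> 1 \<le> i ==> row \<nu> i > 0 \<longleftrightarrow> i \<le> length \<nu>"
 by (auto simp: Defs.young_def Defs.row_def) (metis Suc_le_lessD Suc_pred less_nat_zero_code linorder_neqE_nat nth_mem)

lemma col_superset:
 assumes "young \<nu>" "1 \<le> j" "length \<nu> \<le> L" shows "col \<nu> j = card {i\<in>{1..L}. j \<le> row \<nu> i}"
proof -
 have "{i\<in>{1..length \<nu>}. j \<le> row \<nu> i} = {i\<in>{1..L}. j \<le> row \<nu> i}"
 proof (intro Set.set_eqI iffI)
  fix x assume x: "x \<in> {i\<in>{1..L}. j \<le> row \<nu> i}"
  then have "x \<le> length \<nu>" using row_pos_iff[OF assms(1), of x] assms(2) by simp
  then show "x \<in> {i\<in>{1..length \<nu>}. j \<le> row \<nu> i}" using x by simp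
 qed (use assms(3) in auto)
 then show ?thesis by (simp add: Defs.col_def)
qed

text \<open>
 The even weights are the first \<open>m\<close> rows; the odd weights \<open>\<beta>\<close>, read as columns, are placed below them. The
 hook condition guarantees that the rows remain decreasing at the seam.
\<close>

lemma hook_partition:
 assumes \<alpha>: "\<And>i j. 1 \<le> i ==> i \<le> j ==> j \<le> m ==> \<alpha> j \<le> (\<alpha> i :: nat)"
  and \<beta>: "\<And>i j. 1 \<le> i ==> i \<le> j ==> \<beta> j \<le> (\<beta> i :: nat)" and M: "\<And>j. j > M ==> \<beta> j = 0"
  and hook: "\<And>j. 1 \<le> m ==> 1 \<le> j ==> \<beta> j > 0 ==> j \<le> \<alpha> m"
 obtains \<nu> where "young \<nu>" "row \<nu> (m + 1) \<le> M" "\<And>i. 1 \<le> i ==> i \<le> m ==> row \<nu> i = \<alpha> i"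
  "\<And>j. 1 \<le> j ==> col \<nu> j - m = \<beta> j"
proof -
 define s where "s i = card {j\<in>{1..M}. i \<le> \<beta> j}" for i
 define r where "r i = (if i \<le> m then \<alpha> i else s (i - m))" for i
 have s: "j \<le> s i \<longleftrightarrow> i \<le> \<beta> j" if "1 \<le> i" "1 \<le> j" for i j
 proof
  assume ij: "i \<le> \<beta> j"
  then have "j \<le> M" using M[of j] that by (cases "j \<le> M") auto
  then have "{1..j} \<subseteq> {j\<in>{1..M}. i \<le> \<beta> j}" using \<beta>[of _ j] ij by force
  then have "card {1..j} \<le> s i" unfolding s_def by (rule card_mono[rotated]) simp
  then show "j \<le> s i" by simp
 next
  assume js: "j \<le> s i"
  show "i \<le> \<beta> j"
  proof (rule ccontr)
   assume "\<not> i \<le> \<beta> j"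
   then have "\<not> i \<le> \<beta> k" if "k \<ge> j" for k using \<beta>[OF \<open>1 \<le> j\<close> that] by simp
   then have "{j\<in>{1..M}. i \<le> \<beta> j} \<subseteq> {1..<j}" by (auto intro: leI simp: not_le[symmetric])
   then have "s i \<le> card {1..<j}" unfolding s_def by (rule card_mono[rotated]) simp
   then show False using js \<open>1 \<le> j\<close> by simp
  qed
 qed
 have "r j \<le> r i" if ij: "1 \<le> i" "i \<le> j" for i j
 proof -
  consider "j \<le> m" | "m < i" | "i \<le> m" "m < j" using ij by linarith
  then show ?thesis
  proof cases
   case 1 then show ?thesis using \<alpha> ij by (simp add: r_def)
  next
   case 2
   then have "s (j - m) \<le> s (i - m)" unfolding s_def by (intro card_mono) (use ij in auto)
   then show ?thesis using 2 ij by (simp add: r_def)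
  next
   case 3
   have "s (j - m) \<le> \<alpha> m"
   proof (cases "s (j - m) = 0")
    case False
    then have "j - m \<le> \<beta> (s (j - m))" using s[of "j - m" "s (j - m)"] 3 by simp
    then show ?thesis using hook[of "s (j - m)"] 3 ij False by simp
   qed simp
   also have "\<dots> \<le> \<alpha> i" using \<alpha> ij 3 by simp
   finally show ?thesis using 3 by (simp add: r_def)
  qed
 qed
 moreover have "r i = 0" if "i > m + \<beta> 1" for i
 proof -
  have "\<not> 1 \<le> s (i - m)" using s[of "i - m" 1] that by simp
  then show ?thesis using that by (simp add: r_def)
 qed
 ultimately obtain \<nu> where \<nu>: "young \<nu>" "\<And>i. 1 \<le> i ==> row \<nu> i = r i"
  using young_of_antitone[of r "m + \<beta> 1"] by metis
 show ?thesis
 proof (rule that[OF \<nu>(1)])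
  have "s 1 \<le> card {1..M}" unfolding s_def by (rule card_mono) auto
  then show "row \<nu> (m + 1) \<le> M" by (simp add: \<nu>(2) r_def)
  show "row \<nu> i = \<alpha> i" if "1 \<le> i" "i \<le> m" for i using that by (simp add: \<nu>(2) r_def)
  fix j :: nat assume j: "1 \<le> j"
  define L where "L = m + length \<nu> + \<beta> j"
  have c: "col \<nu> j = card {i\<in>{1..L}. j \<le> r i}"
   using col_superset[OF \<nu>(1) j, of L] by (simp add: L_def \<nu>(2) cong: conj_cong)
  show "col \<nu> j - m = \<beta> j"
  proof (cases "\<beta> j > 0")
   case True
   have "{i\<in>{1..L}. j \<le> r i} = {1..m + \<beta> j}"
   proof (intro Set.set_eqI iffI)
    fix i assume "i \<in> {i\<in>{1..L}. j \<le> r i}"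
    then show "i \<in> {1..m + \<beta> j}" using s[of "i - m" j] j by (cases "i \<le> m") (auto simp: r_def)
   next
    fix i assume i: "i \<in> {1..m + \<beta> j}"
    have "j \<le> r i"
    proof (cases "i \<le> m")
     case True
     then have "j \<le> \<alpha> m" using hook[of j] i j \<open>\<beta> j > 0\<close> by simp
     also have "\<dots> \<le> \<alpha> i" using \<alpha>[of i m] True i by simp
     finally show ?thesis using True by (simp add: r_def)
    next
     case False
     then show ?thesis using s[of "i - m" j] i j by (simp add: r_def)
    qed
    then show "i \<in> {i\<in>{1..L}. j \<le> r i}" using i by (simp add: L_def)
   qed
   then show ?thesis by (simp add: c)
  next
   case False
   have "{i\<in>{1..L}. j \<le> r i} \<subseteq> {1..m}"
   proof
    fix i assume "i \<in> {i\<in>{1..L}. j \<le> r i}"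
    then show "i \<in> {1..m}" using s[of "i - m" j] j False by (cases "i \<le> m") (auto simp: r_def)
   qed
   then have "card {i\<in>{1..L}. j \<le> r i} \<le> card {1..m}" by (rule card_mono[rotated]) simp
   then show ?thesis using False by (simp add: c)
  qed
 qed
qed

text \<open>
 The equality of the weights confines the odd weights to the first \<open>min q n\<close> indices, unitarity makes the
 even and the odd weights decrease, and the odd reflections give the hook condition; \<open>hook_partition\<close> turns
 such weights into a diagram.
\<close>

theorem joint_singular_hook:
 assumes v: "singular (glgl m q m n) (gght m m) (poly_rep m q m n) (case_sum (gl_weight \<mu>) (gl_weight \<nu>)) v" and ne: "v \<noteq> 0"
 obtains \<kappa> where "young \<kappa>" "row \<kappa> (m + 1) \<le> min q n"
  "\<And>a. a \<in> sidx m q ==> \<mu> a = hook_weight m \<kappa> a" "\<And>a. a \<in> sidx m n ==> \<nu> a = hook_weight m \<kappa> a"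
proof -
 let ?P = "poly_rep m q m n"
 have vL: "singular (gl m q) (gl_ht m) (left_rep ?P) (gl_weight \<mu>) v"
  using v by (auto simp: singular_def InlI)
 have up: "poly_act m q m n (Inl (a, b)) v = 0" if "a \<in> sidx m q" "b \<in> sidx m q" "pos m a < pos m b" for a b
  using singular_kill[OF v, of "Inl (a, b)"] that by (simp add: InlI gl_units gl_ht_def)
 have ca: "poly_act m q m n (Inl (a, a)) v = sp_scale (of_nat (\<mu> a)) v" if "a \<in> sidx m q" for a
  using singular_weight[OF v, of "Inl (a, a)"] that by (simp add: InlI gl_units gl_ht_def gl_weight_def)
 have dom: "\<mu> b \<le> \<mu> a" if "a \<in> sidx m q" "b \<in> sidx m q" "pos m a \<le> pos m b" "odd_idx a = odd_idx b" for a b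
 proof (cases "a = b")
  case False
  then have "pos m a < pos m b" using that pos_inject[OF that(1,2)] by linarith
  then show ?thesis using dominant_weights[OF up[OF that(1,2)] that(1,2) False that(4) ca[OF that(1)] ca[OF that(2)] ne] by simp
 qed simp
 define \<beta> where "\<beta> j = (if 1 \<le> j \<and> j \<le> min q n then \<mu> (Inr j) else 0)" for j
 obtain \<kappa> where \<kappa>: "young \<kappa>" "row \<kappa> (m + 1) \<le> min q n" "\<And>i. 1 \<le> i ==> i \<le> m ==> row \<kappa> i = \<mu> (Inl i)"
  "\<And>j. 1 \<le> j ==> col \<kappa> j - m = \<beta> j"
 proof (rule hook_partition[where M = "min q n" and \<alpha> = "\<lambda>i. \<mu> (Inl i)" and \<beta> = \<beta> and m = m])
  show "\<mu> (Inl j) \<le> \<mu> (Inl i)" if "1 \<le> i" "i \<le> j" "j \<le> m" for i j using dom that by simp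
  show "\<beta> j \<le> \<beta> i" if "1 \<le> i" "i \<le> j" for i j using dom[of "Inr i" "Inr j"] that by (simp add: \<beta>_def)
  show "\<beta> j = 0" if "min q n < j" for j using that by (auto simp: \<beta>_def)
  show "j \<le> \<mu> (Inl m)" if "1 \<le> m" "1 \<le> j" "0 < \<beta> j" for j
  proof (rule hook_condition[OF vL ne that(1)])
   have jq: "j \<le> q" "0 < \<mu> (Inr j)" using that(3) by (auto simp: \<beta>_def split: if_splits)
   show "j \<le> q" by (rule jq)
   show "0 < \<mu> (Inr i)" if "1 \<le> i" "i \<le> j" for i using dom[of "Inr i" "Inr j"] that jq by simp
  qed
 qed blast
 note jw = joint_weights[OF v ne]
 show ?thesis
 proof (rule that[OF \<kappa>(1,2)])
  show "\<mu> a = hook_weight m \<kappa> a" if "a \<in> sidx m q" for a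
   using that \<kappa>(3,4) jw(2)[of a] by (cases a) (auto simp: hook_weight_def \<beta>_def)
  show "\<nu> a = hook_weight m \<kappa> a" if "a \<in> sidx m n" for a
   using that \<kappa>(3,4) jw(1)[of a] jw(3)[of a] by (cases a) (auto simp: hook_weight_def \<beta>_def)
 qed
qed

section \<open>The irreducible components are tensor products\<close>

lemma independent_family:
 assumes vs: "vector_space s"
  and ind: "\<And>F a. finite F ==> F \<subseteq> I ==> (\<Sum>i\<in>F. s (a i) (h i)) = 0 ==> (\<forall>i\<in>F. a i = 0)"
 shows "inj_on h I \<and> \<not> module.dependent s (h ` I)"
proof -
 interpret vector_space s by (rule vs)
 have inj: "inj_on h I"
 proof (rule inj_onI, rule ccontr)
  fix i j assume ij: "i \<in> I" "j \<in> I" "h i = h j" "i \<noteq> j"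
  have "(\<Sum>k\<in>{i, j}. s (if k = i then 1 else - 1) (h k)) = 0" using ij by simp
  from ind[OF _ _ this] ij show False by auto
 qed
 have "independent (h ` I)"
  unfolding dependent_explicit
 proof (intro notI, elim exE conjE)
  fix t u assume t: "finite t" "t \<subseteq> h ` I" "(\<Sum>v\<in>t. s (u v) v) = 0" "\<exists>v\<in>t. u v \<noteq> 0"
  obtain F where F: "F \<subseteq> I" "finite F" "t = h ` F" using finite_subset_image[OF t(1,2)] by blast
  have "(\<Sum>i\<in>F. s (u (h i)) (h i)) = 0"
   using t(3) unfolding F(3) by (subst (asm) sum.reindex) (auto intro: inj_on_subset[OF inj F(1)])
  from ind[OF F(2,1) this] show False using t(4) F(3) by auto
 qed
 then show ?thesis using inj by blast
qed

lemma independent_coeffs: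
 assumes "vector_space s" "\<not> module.dependent s B" "finite F" "F \<subseteq> B" "(\<Sum>b\<in>F. s (a b) b) = 0" "b \<in> F"
 shows "a b = 0"
proof -
 interpret vector_space s by (rule assms(1))
 show ?thesis using assms(2-) unfolding dependent_explicit by blast
qed

text \<open>The operators generated by \<open>gl(m|n)\<close>, with the sign twist that makes them commute with
 \<open>gl(p|q)\<close> in the ordinary sense.\<close>

definition twist :: "nat => nat => nat => nat => sindex \<times> sindex => superpoly => superpoly" where
 "twist p q m n y w = poly_act p q m n (Inr y) (if odd_unit (gl m n) y then kap w else w)"

inductive_set hops :: "nat => nat => nat => nat => (superpoly => superpoly) set" for p q m n where
 hops_id: "(\<lambda>w. w) \<in> hops p q m n"
| hops_step: "T \<in> hops p q m n ==> y \<in> units (gl m n) ==> (\<lambda>w. twist p q m n y (T w)) \<in> hops p q m n"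
| hops_add: "T \<in> hops p q m n ==> T' \<in> hops p q m n ==> (\<lambda>w. T w + T' w) \<in> hops p q m n"
| hops_scale: "T \<in> hops p q m n ==> (\<lambda>w. sp_scale c (T w)) \<in> hops p q m n"

context
 fixes p q m n :: nat
begin

lemma poly_act_neg: "poly_act p q m n x (- f) = - poly_act p q m n x f"
 using poly_act_scale[of p q m n x "-1" f] by simp

lemma twist_add: "twist p q m n y (u + w) = twist p q m n y u + twist p q m n y w"
 and twist_scale: "twist p q m n y (sp_scale c u) = sp_scale c (twist p q m n y u)"
 by (simp_all add: twist_def poly_act_add poly_act_scale)

lemma twist_kap: "kap (twist p q m n y w) = (if odd_unit (gl m n) y then - twist p q m n y (kap w) else twist p q m n y (kap w))"
 by (auto simp: twist_def kap_poly_act)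

lemma hops_linear:
 assumes "T \<in> hops p q m n"
 shows "T (u + w) = T u + T w" "T (sp_scale c u) = sp_scale c (T u)"
 using assms
 by (induction arbitrary: u w c rule: hops.induct)
  (simp_all add: twist_add twist_scale algebra_simps SP.scale_right_distrib mult.commute)

lemma twist_commute:
 assumes x: "x \<in> units (gl p q)" and y: "y \<in> units (gl m n)"
 shows "twist p q m n y (poly_act p q m n (Inl x) w) = poly_act p q m n (Inl x) (twist p q m n y w)"
proof -
 obtain a b c d where e: "x = (a, b)" "y = (c, d)" "a \<in> sidx p q" "b \<in> sidx p q" "c \<in> sidx m n" "d \<in> sidx m n"
  using x y by (cases x; cases y) (auto simp: gl_units)
 note br = poly_bracket_mixed[OF e(3-6)]
 show ?thesis
  unfolding twist_def e(1,2) kap_poly_act lie_prod_simps gl_odd br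
  by (auto simp: koszul_def poly_act_neg)
qed

text \<open>
 The twist by \<open>kap\<close> exactly cancels the sign with which odd elements of the two factors anticommute.
\<close>

lemma hops_commute:
 assumes x: "x \<in> units (gl p q)" and T: "T \<in> hops p q m n"
 shows "T (poly_act p q m n (Inl x) w) = poly_act p q m n (Inl x) (T w)"
 using T by (induction arbitrary: w rule: hops.induct) (simp_all add: twist_commute[OF x] poly_act_add poly_act_scale)

lemma hops_comp:
 assumes "T \<in> hops p q m n" "T' \<in> hops p q m n" shows "(\<lambda>w. T (T' w)) \<in> hops p q m n"
 using assms(1) by (induction rule: hops.induct) (auto intro: hops.intros assms(2))

lemma ip_kap: "ip (kap f) g = ip f (kap g)"
proof -
 have "supp (kap f) = supp f" by (auto simp: supp_def cf_kap)
 then show ?thesis unfolding ip_def by (intro sum.cong) (auto simp: cf_kap)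
qed

lemma ip_neg_right: "ip f (- g) = - ip f g"
 using ip_scale_right[of f "-1" g] by simp

lemma hops_adjoint:
 assumes "T \<in> hops p q m n"
 shows "\<exists>Z\<in>hops p q m n. \<forall>u w. ip (T u) w = ip u (Z w)"
 using assms
proof (induction rule: hops.induct)
 case hops_id
 then show ?case by (auto intro!: bexI[OF _ hops.hops_id])
next
 case (hops_step T y)
 then obtain Z where Z: "Z \<in> hops p q m n" "\<And>u w. ip (T u) w = ip u (Z w)" by blast
 obtain c d where y: "y = (c, d)" by (cases y)
 have y': "(d, c) \<in> units (gl m n)" using hops_step.hyps(2) by (auto simp: y gl_units)
 have "ip (twist p q m n y u) w = ip u (sp_scale (if odd_unit (gl m n) y then - 1 else 1) (twist p q m n (d, c) w))" for u w
  by (auto simp: twist_def y ip_poly_act gl_odd ip_kap kap_poly_act ip_neg_right)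
 then have e: "ip (twist p q m n y (T u)) w = ip u (Z (sp_scale (if odd_unit (gl m n) y then - 1 else 1) (twist p q m n (d, c) w)))" for u w
  by (simp only: Z(2))
 have "(\<lambda>w. Z (sp_scale (if odd_unit (gl m n) y then - 1 else 1) (twist p q m n (d, c) w))) \<in> hops p q m n"
  by (rule hops_comp[OF Z(1)]) (rule hops.hops_scale[OF hops.hops_step[OF hops.hops_id y']])
 then show ?case by (rule bexI[rotated]) (simp add: e)
next
 case (hops_add T T')
 then obtain Z Z' where Z: "Z \<in> hops p q m n" "\<And>u w. ip (T u) w = ip u (Z w)" "Z' \<in> hops p q m n" "\<And>u w. ip (T' u) w = ip u (Z' w)" by blast
 then show ?case by (intro bexI[OF _ hops.hops_add[OF Z(1,3)]]) (simp add: ip_add_left ip_add_right)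
next
 case (hops_scale T c)
 then obtain Z where Z: "Z \<in> hops p q m n" "\<And>u w. ip (T u) w = ip u (Z w)" by blast
 then show ?case by (intro bexI[OF _ hops.hops_scale[OF Z(1), of "cnj c"]]) (simp add: ip_scale_left ip_scale_right)
qed

lemma hops_conj:
 assumes "T \<in> hops p q m n" shows "(\<lambda>w. kap (T (kap w))) \<in> hops p q m n"
 using assms
proof (induction rule: hops.induct)
 case hops_id then show ?case using hops.hops_id by simp
next
 case (hops_step T y)
 have "kap (twist p q m n y (T (kap w))) = sp_scale (if odd_unit (gl m n) y then - 1 else 1) (twist p q m n y (kap (T (kap w))))" for w
  by (simp add: twist_kap)
 then show ?case using hops.hops_scale[OF hops.hops_step[OF hops_step.IH hops_step.hyps(2)]] by simp
next
 case (hops_add T T')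
 then show ?case using hops.hops_add by simp
next
 case (hops_scale T c)
 then show ?case using hops.hops_scale by simp
qed

interpretation P: unitary_module "glgl p q m n" "gght p m" "case_sum (gl_hc p) (gl_hc m)" "poly_rep p q m n" ip ustar
 by (rule unitary_poly_rep)

interpretation L: unitary_module "gl p q" "gl_ht p" "gl_hc p" "left_rep (poly_rep p q m n)" ip "\<lambda>(a, b). (b, a)"
 by (rule unitary_left)

interpretation R: unitary_module "gl m n" "gl_ht m" "gl_hc m" "right_rep (poly_rep p q m n)" ip "\<lambda>(a, b). (b, a)"
 by (rule unitary_right)

context
 fixes f :: superpoly and \<mu> \<nu> :: "sindex => nat"
 assumes f: "singular (glgl p q m n) (gght p m) (poly_rep p q m n) (case_sum (gl_weight \<mu>) (gl_weight \<nu>)) f"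
  and even: "f \<in> hpart (poly_rep p q m n) False" and ne: "f \<noteq> 0"
begin

text \<open>
 The modules generated by \<open>f\<close> under the first, the second and both factors. The last one will be shown to
 be the tensor product of the first two, the tensor of \<open>v = g f\<close> and \<open>u = T f\<close> being \<open>T g f\<close>.
\<close>

definition VL :: "superpoly set" where "VL = L.K f"
definition VR :: "superpoly set" where "VR = R.K f"
definition VU :: "superpoly set" where "VU = P.K f"

lemma fL: "singular (gl p q) (gl_ht p) (left_rep (poly_rep p q m n)) (gl_weight \<mu>) f"
 using f by (auto simp: singular_def InlI)

lemma fR: "singular (gl m n) (gl_ht m) (right_rep (poly_rep p q m n)) (gl_weight \<nu>) f"
 using f by (auto simp: singular_def InrI)

lemma kap_f [simp]: "kap f = f"
 using even by (simp add: hpart_poly_rep has_parity_iff)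

lemma VL_sub: "submodule (gl p q) (left_rep (poly_rep p q m n)) VL"
 unfolding VL_def by (rule L.K_submodule[OF fL]) (use even in simp)

lemma VR_sub: "submodule (gl m n) (right_rep (poly_rep p q m n)) VR"
 unfolding VR_def by (rule R.K_submodule[OF fR]) (use even in simp)

lemma VU_sub: "submodule (glgl p q m n) (poly_rep p q m n) VU"
 unfolding VU_def by (rule P.K_submodule[OF f even])

lemma VL_facts: "SP.subspace VL" "x \<in> units (gl p q) ==> v \<in> VL ==> poly_act p q m n (Inl x) v \<in> VL"
  "VL \<subseteq> superpolys p q m n" "f \<in> VL"
 using VL_sub L.submodule_space[OF VL_sub] L.self_in_K[of f] by (auto simp: Defs.submodule_def space_poly_rep VL_def)

lemma VR_facts: "SP.subspace VR" "y \<in> units (gl m n) ==> v \<in> VR ==> poly_act p q m n (Inr y) v \<in> VR"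
  "VR \<subseteq> superpolys p q m n" "f \<in> VR"
 using VR_sub R.submodule_space[OF VR_sub] R.self_in_K[of f] by (auto simp: Defs.submodule_def space_poly_rep VR_def)

lemma VU_facts: "SP.subspace VU" "y \<in> units (glgl p q m n) ==> v \<in> VU ==> poly_act p q m n y v \<in> VU"
  "VU \<subseteq> superpolys p q m n" "f \<in> VU"
 using VU_sub P.submodule_space[OF VU_sub] P.self_in_K[of f] by (auto simp: Defs.submodule_def space_poly_rep VU_def)

lemma VL_least: "SP.subspace U ==> (\<And>x u. x \<in> units (gl p q) ==> u \<in> U ==> poly_act p q m n (Inl x) u \<in> U) ==> f \<in> U ==> VL \<subseteq> U"
 using L.K_least[of U f] by (simp add: VL_def)

lemma VR_least: "SP.subspace U ==> (\<And>x u. x \<in> units (gl m n) ==> u \<in> U ==> poly_act p q m n (Inr x) u \<in> U) ==> f \<in> U ==> VR \<subseteq> U"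
 using R.K_least[of U f] by (simp add: VR_def)

lemma VU_least: "SP.subspace U ==> (\<And>x u. x \<in> units (glgl p q m n) ==> u \<in> U ==> poly_act p q m n x u \<in> U) ==> f \<in> U ==> VU \<subseteq> U"
 using P.K_least[of U f] by (simp add: VU_def)

lemma VL_irr: "irreducible_rep (gl p q) (subrep (left_rep (poly_rep p q m n)) VL)"
 unfolding VL_def by (rule L.K_irreducible[OF fL _ ne, of False]) (use even in simp)

lemma VR_irr: "irreducible_rep (gl m n) (subrep (right_rep (poly_rep p q m n)) VR)"
 unfolding VR_def by (rule R.K_irreducible[OF fR _ ne, of False]) (use even in simp)

lemma VU_irr: "irreducible_rep (glgl p q m n) (subrep (poly_rep p q m n) VU)"
 unfolding VU_def by (rule P.K_irreducible[OF f even ne])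

lemma kap_stable:
 assumes "SP.subspace U" "U = {u + v |u v. u \<in> U \<inter> hpart (poly_rep p q m n) False \<and> v \<in> U \<inter> hpart (poly_rep p q m n) True}" "w \<in> U"
 shows "kap w \<in> U"
proof -
 obtain w0 w1 where w: "w = w0 + w1" "w0 \<in> U" "w0 \<in> hpart (poly_rep p q m n) False" "w1 \<in> U" "w1 \<in> hpart (poly_rep p q m n) True"
  using assms(2,3) by blast
 then have "kap w = w0 - w1" by (simp add: hpart_poly_rep has_parity_iff)
 then show ?thesis using w SP.subspace_diff[OF assms(1)] by simp
qed

lemma VR_kap: "w \<in> VR ==> kap w \<in> VR"
 using VR_sub kap_stable[of VR w] by (simp add: Defs.submodule_def)

lemma VU_kap: "w \<in> VU ==> kap w \<in> VU"
 using VU_sub kap_stable[of VU w] by (simp add: Defs.submodule_def)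

lemma hops_VR: "T \<in> hops p q m n ==> w \<in> VR ==> T w \<in> VR"
 by (induction rule: hops.induct)
  (auto simp: twist_def intro: VR_facts VR_kap SP.subspace_add[OF VR_facts(1)] SP.subspace_scale[OF VR_facts(1)])

lemma hops_VU: "T \<in> hops p q m n ==> w \<in> VU ==> T w \<in> VU"
 by (induction rule: hops.induct)
  (auto simp: twist_def InrI intro: VU_facts VU_kap SP.subspace_add[OF VU_facts(1)] SP.subspace_scale[OF VU_facts(1)])

text \<open>On vectors of a fixed parity the twist only contributes a sign.\<close>

lemma act_hops:
 assumes "T \<in> hops p q m n" "y \<in> units (gl m n)"
 obtains T' where "T' \<in> hops p q m n"
  "\<And>s w. kap w = (if s then - w else w) ==>
   T' w = sp_scale (koszul (odd_unit (gl m n) y) s) (poly_act p q m n (Inr y) (T w))"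
proof (cases "odd_unit (gl m n) y")
 case False
 show ?thesis
  by (rule that[OF hops.hops_step[OF assms]]) (simp add: twist_def False koszul_def)
next
 case True
 show ?thesis
  by (rule that[OF hops.hops_step[OF hops_conj[OF assms(1)] assms(2)]])
   (use hops_linear[OF assms(1)] in \<open>auto simp: twist_def True koszul_def hops_linear(2)[OF assms(1), of "-1", simplified] poly_act_neg\<close>)
qed

lemma VR_eq: "VR = {T f | T. T \<in> hops p q m n}"
proof
 show "{T f | T. T \<in> hops p q m n} \<subseteq> VR" using hops_VR VR_facts(4) by blast
 show "VR \<subseteq> {T f | T. T \<in> hops p q m n}"
 proof (rule VR_least)
  show "SP.subspace {T f | T. T \<in> hops p q m n}"
  proof (rule SP.subspaceI)
   show "0 \<in> {T f | T. T \<in> hops p q m n}"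
    using hops.hops_scale[OF hops.hops_id, of 0] by (intro CollectI exI[of _ "\<lambda>w. sp_scale 0 w"]) simp
  next
   fix a b assume "a \<in> {T f | T. T \<in> hops p q m n}" "b \<in> {T f | T. T \<in> hops p q m n}"
   then obtain T T' where "T \<in> hops p q m n" "a = T f" "T' \<in> hops p q m n" "b = T' f" by blast
   then show "a + b \<in> {T f | T. T \<in> hops p q m n}"
    by (intro CollectI exI[of _ "\<lambda>w. T w + T' w"]) (simp add: hops.hops_add)
  next
   fix c a assume "a \<in> {T f | T. T \<in> hops p q m n}"
   then obtain T where "T \<in> hops p q m n" "a = T f" by blast
   then show "sp_scale c a \<in> {T f | T. T \<in> hops p q m n}"
    by (intro CollectI exI[of _ "\<lambda>w. sp_scale c (T w)"]) (simp add: hops.hops_scale)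
  qed
  show "f \<in> {T f | T. T \<in> hops p q m n}" using hops.hops_id by (intro CollectI exI[of _ "\<lambda>w. w"]) simp
  fix y u assume y: "y \<in> units (gl m n)" and "u \<in> {T f | T. T \<in> hops p q m n}"
  then obtain T where T: "T \<in> hops p q m n" "u = T f" by blast
  obtain T' where T': "T' \<in> hops p q m n" "\<And>s w. kap w = (if s then - w else w) ==>
   T' w = sp_scale (koszul (odd_unit (gl m n) y) s) (poly_act p q m n (Inr y) (T w))"
   using act_hops[OF T(1) y] by blast
  have "T' f = poly_act p q m n (Inr y) u" using T'(2)[of f False] by (simp add: koszul_def T(2))
  then show "poly_act p q m n (Inr y) u \<in> {T f | T. T \<in> hops p q m n}" using T'(1) by (metis (mono_tags, lifting) CollectI)
 qed
qed

text \<open>The choice of \<open>T\<close> does not matter, by \<open>hops_determined\<close>.\<close>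

definition tensor_map :: "superpoly => superpoly => superpoly" where
 "tensor_map v u = (SOME T. T \<in> hops p q m n \<and> T f = u) v"

text \<open>
 The operators commute with the first action, so the set where they agree is stable under it, and \<open>f\<close>
 generates \<open>VL\<close>.
\<close>

lemma hops_determined:
 assumes "T \<in> hops p q m n" "T' \<in> hops p q m n" "T f = T' f" "v \<in> VL" shows "T v = T' v"
proof -
 have "VL \<subseteq> {v. T v = T' v}"
 proof (rule VL_least)
  show "SP.subspace {v. T v = T' v}"
   by (rule SP.subspaceI)
    (use hops_linear[OF assms(1)] hops_linear[OF assms(2)] hops_linear(2)[OF assms(1), of 0 0] hops_linear(2)[OF assms(2), of 0 0] in simp_all)
 qed (use assms(3) hops_commute[OF _ assms(1)] hops_commute[OF _ assms(2)] in auto)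
 then show ?thesis using assms(4) by blast
qed

lemma tensor_map_eq: "T \<in> hops p q m n ==> T f = u ==> v \<in> VL ==> tensor_map v u = T v"
 unfolding tensor_map_def
proof -
 assume T: "T \<in> hops p q m n" "T f = u" and v: "v \<in> VL"
 have "(SOME T. T \<in> hops p q m n \<and> T f = u) \<in> hops p q m n \<and> (SOME T. T \<in> hops p q m n \<and> T f = u) f = u"
  by (rule someI_ex[of "\<lambda>T. T \<in> hops p q m n \<and> T f = u"]) (use T in blast)
 then show "(SOME T. T \<in> hops p q m n \<and> T f = u) v = T v" using hops_determined[OF _ T(1) _ v] T(2) by simp
qed

lemma VR_E:
 assumes "u \<in> VR" obtains T where "T \<in> hops p q m n" "T f = u" "\<And>v. v \<in> VL ==> tensor_map v u = T v"
proof -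
 obtain T where T: "T \<in> hops p q m n" "T f = u" using assms unfolding VR_eq by auto
 show ?thesis by (rule that[OF T]) (rule tensor_map_eq[OF T])
qed

lemma tensor_map_add_left: "v \<in> VL ==> v' \<in> VL ==> u \<in> VR ==> tensor_map (v + v') u = tensor_map v u + tensor_map v' u"
 by (erule VR_E) (simp add: hops_linear SP.subspace_add[OF VL_facts(1)])

lemma tensor_map_scale_left: "v \<in> VL ==> u \<in> VR ==> tensor_map (sp_scale c v) u = sp_scale c (tensor_map v u)"
 by (erule VR_E) (simp add: hops_linear SP.subspace_scale[OF VL_facts(1)])

lemma tensor_map_add_right: "v \<in> VL ==> u \<in> VR ==> u' \<in> VR ==> tensor_map v (u + u') = tensor_map v u + tensor_map v u'"
 apply (erule VR_E, erule VR_E)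
 subgoal for T T' using tensor_map_eq[OF hops.hops_add[of T p q m n T'], of "u + u'" v] by simp
 done

lemma tensor_map_scale_right: "v \<in> VL ==> u \<in> VR ==> tensor_map v (sp_scale c u) = sp_scale c (tensor_map v u)"
 apply (erule VR_E)
 subgoal for T using tensor_map_eq[OF hops.hops_scale[of T p q m n c], of "sp_scale c u" v] by simp
 done

lemma tensor_map_parity:
 assumes "v \<in> VL" "v \<in> hpart (poly_rep p q m n) s" "u \<in> VR" "u \<in> hpart (poly_rep p q m n) t"
 shows "tensor_map v u \<in> hpart (poly_rep p q m n) (s \<noteq> t)"
proof -
 obtain T where T: "T \<in> hops p q m n" "T f = u" "\<And>v. v \<in> VL ==> tensor_map v u = T v" using VR_E[OF assms(3)] by blast
 define k where "k = (if t then - 1 else 1 :: complex)"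
 have "kap (T (kap f)) = sp_scale k (T f)" using assms(4) by (simp add: hpart_poly_rep has_parity_iff T(2) k_def)
 then have "kap (T (kap v)) = sp_scale k (T v)"
  using hops_determined[OF hops_conj[OF T(1)] hops.hops_scale[OF T(1), of k] _ assms(1)] by simp
 moreover have "kap v = (if s then - v else v)" using assms(2) by (simp add: hpart_poly_rep has_parity_iff)
 ultimately have "kap (T v) = (if s \<noteq> t then - T v else T v)"
  using hops_linear(2)[OF T(1), of "-1" v] by (auto simp: k_def minus_equation_iff split: if_splits)
 moreover have "T v \<in> superpolys p q m n"
  using hops_VU[OF T(1), of v] VL_least[OF VU_facts(1), OF VU_facts(2)] VU_facts(3,4) assms(1) by (auto simp: InlI)
 ultimately show ?thesis by (simp add: hpart_poly_rep has_parity_iff T(3)[OF assms(1)])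
qed

lemma tensor_map_act_left:
 assumes "x \<in> units (gl p q)" "v \<in> VL" "u \<in> VR"
 shows "poly_act p q m n (Inl x) (tensor_map v u) = tensor_map (poly_act p q m n (Inl x) v) u"
 using VR_E[OF assms(3)] assms(1,2) VL_facts(2) hops_commute by metis

lemma tensor_map_act_right:
 assumes "y \<in> units (gl m n)" "v \<in> VL" "v \<in> hpart (poly_rep p q m n) s" "u \<in> VR"
 shows "poly_act p q m n (Inr y) (tensor_map v u) = sp_scale (koszul (odd_unit (gl m n) y) s) (tensor_map v (poly_act p q m n (Inr y) u))"
proof -
 obtain T where T: "T \<in> hops p q m n" "T f = u" "\<And>v. v \<in> VL ==> tensor_map v u = T v" using VR_E[OF assms(4)] by blast
 obtain T' where T': "T' \<in> hops p q m n" "\<And>s w. kap w = (if s then - w else w) ==>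
   T' w = sp_scale (koszul (odd_unit (gl m n) y) s) (poly_act p q m n (Inr y) (T w))"
  using act_hops[OF T(1) assms(1)] by blast
 have "T' f = poly_act p q m n (Inr y) u" using T'(2)[of f False] by (simp add: koszul_def T(2))
 then have "tensor_map v (poly_act p q m n (Inr y) u) = T' v" by (rule tensor_map_eq[OF T'(1) _ assms(2)])
 also have "\<dots> = sp_scale (koszul (odd_unit (gl m n) y) s) (poly_act p q m n (Inr y) (T v))"
  by (rule T'(2)) (use assms(3) in \<open>simp add: hpart_poly_rep has_parity_iff\<close>)
 finally show ?thesis by (simp add: T(3)[OF assms(2)] koszul_def)
qed

text \<open>
 Elements of the first factor can be moved from \<open>v'\<close> to \<open>v\<close> on both sides, so \<open>v' = f\<close> may be assumed. Then only
 the component of \<open>v\<close> along \<open>f\<close> matters, since \<open>f\<close> and \<open>Z f\<close> are killed by the raising operators. It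
 follows that \<open>tensor_map\<close> is an isometry up to the norm of \<open>f\<close>.
\<close>

lemma ip_hops:
 assumes Z: "Z \<in> hops p q m n" and v: "v \<in> VL" "v' \<in> VL"
 shows "ip v (Z v') * ip f f = ip v v' * ip f (Z f)"
proof -
 have "VL \<subseteq> {v'. \<forall>v\<in>VL. ip v (Z v') * ip f f = ip v v' * ip f (Z f)}"
 proof (rule VL_least)
  show "SP.subspace {v'. \<forall>v\<in>VL. ip v (Z v') * ip f f = ip v v' * ip f (Z f)}"
   by (rule SP.subspaceI)
    (use hops_linear(2)[OF Z, of 0 0] in \<open>auto simp: hops_linear[OF Z] ip_add_right ip_scale_right distrib_right\<close>)
 next
  fix x w assume x: "x \<in> units (gl p q)" and w: "w \<in> {v'. \<forall>v\<in>VL. ip v (Z v') * ip f f = ip v v' * ip f (Z f)}"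
  obtain a b where ab: "x = (a, b)" by (cases x)
  have x': "(b, a) \<in> units (gl p q)" using x by (auto simp: ab gl_units)
  have "ip v (poly_act p q m n (Inl x) z) = ip (poly_act p q m n (Inl (b, a)) v) z" for v z
   by (simp add: ip_poly_act ab)
  then show "poly_act p q m n (Inl x) w \<in> {v'. \<forall>v\<in>VL. ip v (Z v') * ip f f = ip v v' * ip f (Z f)}"
   using w VL_facts(2)[OF x'] by (simp add: hops_commute[OF x Z])
 next
  have "ip v (Z f) * ip f f = ip v f * ip f (Z f)" if v: "v \<in> VL" for v
  proof -
   have vK: "v \<in> L.K f" using v by (simp add: VL_def)
   obtain c k where k: "k \<in> L.V.span (L.nwords f)" "v = sp_scale c f + k"
    by (rule L.K_decomp[OF vK]) (rule that, simp_all)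
   have fs: "f \<in> space (left_rep (poly_rep p q m n))" using fL by (simp add: singular_def)
   have kill: "poly_act p q m n (Inl x) f = 0" if "x \<in> units (gl p q)" "0 < gl_ht p x" for x
    using singular_kill[OF fL that] by simp
   have 1: "ip k f = 0" by (rule L.ip_nwords[OF fs fs _ k(1)]) (simp add: kill)
   have Z0: "Z 0 = 0" using hops_linear(2)[OF Z, of 0 0] by simp
   have "Z f \<in> superpolys p q m n" using hops_VU[OF Z VU_facts(4)] VU_facts(3) by blast
   then have 2: "ip k (Z f) = 0"
    by (intro L.ip_nwords[OF fs _ _ k(1)]) (simp_all add: space_poly_rep hops_commute[OF _ Z, symmetric] kill Z0)
   show ?thesis using 1 2 by (simp add: k(2) ip_add_left ip_scale_left)
  qed
  then show "f \<in> {v'. \<forall>v\<in>VL. ip v (Z v') * ip f f = ip v v' * ip f (Z f)}" by simp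
 qed
 then show ?thesis using v by blast
qed

lemma ip_tensor_map:
 assumes "v \<in> VL" "v' \<in> VL" "u \<in> VR" "u' \<in> VR"
 shows "ip (tensor_map v u) (tensor_map v' u') * ip f f = ip v v' * ip u u'"
proof -
 obtain T where T: "T \<in> hops p q m n" "T f = u" "\<And>v. v \<in> VL ==> tensor_map v u = T v" using VR_E[OF assms(3)] by blast
 obtain T' where T': "T' \<in> hops p q m n" "T' f = u'" "\<And>v. v \<in> VL ==> tensor_map v u' = T' v" using VR_E[OF assms(4)] by blast
 obtain Z where Z: "Z \<in> hops p q m n" "\<And>u w. ip (T u) w = ip u (Z w)" using hops_adjoint[OF T(1)] by blast
 show ?thesis
  using ip_hops[OF hops_comp[OF Z(1) T'(1)] assms(1,2)]
  by (simp add: T(3)[OF assms(1)] T'(3)[OF assms(2)] Z(2)[symmetric] T(2) T'(2))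
qed

lemma VU_eq_span: "VU = SP.span {tensor_map v u | v u. v \<in> VL \<and> u \<in> VR}"
proof
 let ?B = "{tensor_map v u | v u. v \<in> VL \<and> u \<in> VR}"
 have "tensor_map v u \<in> VU" if "v \<in> VL" "u \<in> VR" for v u
 proof -
  have "v \<in> VU" using VL_least[OF VU_facts(1), OF VU_facts(2)] VU_facts(4) that(1) by (auto simp: InlI)
  then show ?thesis using VR_E[OF that(2)] that(1) hops_VU by metis
 qed
 then show "SP.span ?B \<subseteq> VU" by (intro SP.span_minimal[OF _ VU_facts(1)]) blast
 show "VU \<subseteq> SP.span ?B"
 proof (rule VU_least)
  have "f = tensor_map f f" using tensor_map_eq[OF hops.hops_id, of f f] VL_facts(4) by simp
  then show "f \<in> SP.span ?B" using VL_facts(4) VR_facts(4) by (intro SP.span_base) blast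
  fix x u assume x: "x \<in> units (glgl p q m n)" and u: "u \<in> SP.span ?B"
  have "?B \<subseteq> {u. poly_act p q m n x u \<in> SP.span ?B}"
  proof
   fix b assume "b \<in> ?B"
   then obtain v u where b: "b = tensor_map v u" "v \<in> VL" "u \<in> VR" by blast
   show "b \<in> {u. poly_act p q m n x u \<in> SP.span ?B}"
   proof (cases x)
    case (Inl x')
    then have x': "x' \<in> units (gl p q)" using x by auto
    have "tensor_map (poly_act p q m n (Inl x') v) u \<in> ?B" using b VL_facts(2)[OF x'] by blast
    then show ?thesis by (simp add: Inl b(1) tensor_map_act_left[OF x' b(2,3)] SP.span_base)
   next
    case (Inr y)
    then have y: "y \<in> units (gl m n)" using x by auto
    obtain v0 v1 where v: "v = v0 + v1" "v0 \<in> VL" "v0 \<in> hpart (poly_rep p q m n) False" "v1 \<in> VL" "v1 \<in> hpart (poly_rep p q m n) True"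
     using VL_sub b(2) unfolding Defs.submodule_def left_rep_simps by blast
    show ?thesis using b v VR_facts(2)[OF y]
     by (auto simp: Inr tensor_map_add_left poly_act_add tensor_map_act_right[OF y] intro!: SP.span_add SP.span_scale) (auto intro!: SP.span_base)
   qed
  qed
  moreover have "SP.subspace {u. poly_act p q m n x u \<in> SP.span ?B}"
   using poly_act_scale[of p q m n x 0 0]
   by (intro SP.subspaceI) (auto simp: poly_act_add poly_act_scale SP.span_add SP.span_scale SP.span_zero)
  ultimately show "poly_act p q m n x u \<in> SP.span ?B" using SP.span_minimal u by blast
 qed (rule SP.subspace_span)
qed

lemma tensor_map_span:
 assumes B: "SP.span B = VL" and C: "SP.span C = VR"
 shows "SP.span ((\<lambda>(v, u). tensor_map v u) ` (B \<times> C)) = VU"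
proof -
 let ?S = "SP.span ((\<lambda>(v, u). tensor_map v u) ` (B \<times> C))"
 have BV: "B \<subseteq> VL" "C \<subseteq> VR" using B C SP.span_superset by blast+
 have z: "tensor_map 0 u = 0" if "u \<in> VR" for u using tensor_map_scale_left[of 0 u 0] that SP.subspace_0[OF VL_facts(1)] by simp
 have z': "tensor_map v 0 = 0" if "v \<in> VL" for v using tensor_map_scale_right[of v 0 0] that SP.subspace_0[OF VR_facts(1)] by simp
 have 1: "tensor_map b u \<in> ?S" if b: "b \<in> B" and u: "u \<in> VR" for b u
 proof -
  have bV: "b \<in> VL" using b BV by blast
  have "SP.span C \<subseteq> {u \<in> VR. tensor_map b u \<in> ?S}"
  proof (rule SP.span_minimal)
   show "C \<subseteq> {u \<in> VR. tensor_map b u \<in> ?S}" using BV b by (auto intro!: SP.span_base)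
   show "SP.subspace {u \<in> VR. tensor_map b u \<in> ?S}"
    by (rule SP.subspaceI)
     (auto simp: z'[OF bV] tensor_map_add_right[OF bV] tensor_map_scale_right[OF bV] SP.span_zero SP.span_add SP.span_scale
      SP.subspace_0[OF VR_facts(1)] SP.subspace_add[OF VR_facts(1)] SP.subspace_scale[OF VR_facts(1)])
  qed
  then show ?thesis using u C by blast
 qed
 have 2: "tensor_map v u \<in> ?S" if v: "v \<in> VL" and u: "u \<in> VR" for v u
 proof -
  have "SP.span B \<subseteq> {v \<in> VL. tensor_map v u \<in> ?S}"
  proof (rule SP.span_minimal)
   show "B \<subseteq> {v \<in> VL. tensor_map v u \<in> ?S}" using BV u 1 by auto
   show "SP.subspace {v \<in> VL. tensor_map v u \<in> ?S}"
    by (rule SP.subspaceI)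
     (auto simp: z[OF u] tensor_map_add_left[OF _ _ u] tensor_map_scale_left[OF _ u] SP.span_zero SP.span_add SP.span_scale
      SP.subspace_0[OF VL_facts(1)] SP.subspace_add[OF VL_facts(1)] SP.subspace_scale[OF VL_facts(1)])
  qed
  then show ?thesis using v B by blast
 qed
 show ?thesis
 proof
  show "?S \<subseteq> VU" unfolding VU_eq_span by (rule SP.span_mono) (use BV in auto)
  show "VU \<subseteq> ?S" unfolding VU_eq_span by (rule SP.span_minimal) (use 2 in auto)
 qed
qed

text \<open>
 Pairing a linear relation with arbitrary tensors separates the two factors by \<open>ip_tensor_map\<close>; positivity of the
 form is then used once in each of them.
\<close>

lemma tensor_map_independent:
 assumes B: "SP.independent B" "B \<subseteq> VL" and C: "SP.independent C" "C \<subseteq> VR"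
 shows "inj_on (\<lambda>(v, u). tensor_map v u) (B \<times> C) \<and> SP.independent ((\<lambda>(v, u). tensor_map v u) ` (B \<times> C))"
proof (rule independent_family[OF vector_space_scale])
 fix F and a :: "superpoly \<times> superpoly => complex"
 assume F: "finite F" "F \<subseteq> B \<times> C" and 0: "(\<Sum>i\<in>F. sp_scale (a i) (case i of (v, u) => tensor_map v u)) = 0"
 define F1 where "F1 = fst ` F"
 define F2 where "F2 = snd ` F"
 define a' where "a' b c = (if (b, c) \<in> F then a (b, c) else 0)" for b c
 have fin: "finite F1" "finite F2" "F1 \<subseteq> B" "F2 \<subseteq> C" using F by (auto simp: F1_def F2_def)
 have V: "b \<in> VL" "c \<in> VR" if "b \<in> F1" "c \<in> F2" for b c using that fin B(2) C(2) by blast+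
 have "(\<Sum>b\<in>F1. \<Sum>c\<in>F2. sp_scale (a' b c) (tensor_map b c)) = (\<Sum>i\<in>F1 \<times> F2. sp_scale (a' (fst i) (snd i)) (tensor_map (fst i) (snd i)))"
  by (simp add: sum.cartesian_product case_prod_beta)
 also have "\<dots> = (\<Sum>i\<in>F. sp_scale (a i) (case i of (v, u) => tensor_map v u))"
  by (rule sum.mono_neutral_cong_right) (use fin F in \<open>auto simp: a'_def F1_def F2_def case_prod_beta image_iff\<close>, force+)
 finally have S: "(\<Sum>b\<in>F1. \<Sum>c\<in>F2. sp_scale (a' b c) (tensor_map b c)) = 0" using 0 by simp
 have 1: "(\<Sum>c\<in>F2. (\<Sum>b\<in>F1. a' b c * ip b v') * ip c u') = 0" if v': "v' \<in> VL" and u': "u' \<in> VR" for v' u'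
 proof -
  have "0 = ip (\<Sum>b\<in>F1. \<Sum>c\<in>F2. sp_scale (a' b c) (tensor_map b c)) (tensor_map v' u') * ip f f" by (simp add: S)
  also have "\<dots> = (\<Sum>b\<in>F1. \<Sum>c\<in>F2. a' b c * (ip (tensor_map b c) (tensor_map v' u') * ip f f))"
   by (simp add: ip_sum_left ip_scale_left sum_distrib_right mult.assoc)
  also have "\<dots> = (\<Sum>b\<in>F1. \<Sum>c\<in>F2. a' b c * (ip b v' * ip c u'))"
   by (intro sum.cong refl) (simp add: ip_tensor_map V v' u')
  also have "\<dots> = (\<Sum>c\<in>F2. (\<Sum>b\<in>F1. a' b c * ip b v') * ip c u')"
   by (subst sum.swap) (simp add: sum_distrib_right mult.assoc)
  finally show ?thesis by simp
 qed
 have 2: "(\<Sum>b\<in>F1. a' b c * ip b v') = 0" if v': "v' \<in> VL" and c: "c \<in> F2" for v' c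
 proof -
  define w where "w = (\<Sum>c\<in>F2. sp_scale (\<Sum>b\<in>F1. a' b c * ip b v') c)"
  have "w \<in> VR" unfolding w_def
   by (intro SP.subspace_sum[OF VR_facts(1)] SP.subspace_scale[OF VR_facts(1)]) (use fin C in blast)
  then have "ip w w = 0" using 1[OF v', of w] by (simp add: w_def ip_sum_left ip_scale_left)
  then have "w = 0" by (rule ip_definite)
  then show ?thesis using independent_coeffs[OF vector_space_scale C(1) fin(2,4) _ c, of "\<lambda>c. \<Sum>b\<in>F1. a' b c * ip b v'"]
   by (simp add: w_def)
 qed
 have 3: "a' b c = 0" if b: "b \<in> F1" and c: "c \<in> F2" for b c
 proof -
  define w where "w = (\<Sum>b\<in>F1. sp_scale (a' b c) b)"
  have "w \<in> VL" unfolding w_def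
   by (intro SP.subspace_sum[OF VL_facts(1)] SP.subspace_scale[OF VL_facts(1)]) (use fin B in blast)
  then have "ip w w = 0" using 2[OF _ c, of w] by (simp add: w_def ip_sum_left ip_scale_left)
  then have "w = 0" by (rule ip_definite)
  then show ?thesis using independent_coeffs[OF vector_space_scale B(1) fin(1,3) _ b, of "\<lambda>b. a' b c"]
   by (simp add: w_def)
 qed
 show "\<forall>i\<in>F. a i = 0"
 proof
  fix i assume i: "i \<in> F"
  then have "fst i \<in> F1" "snd i \<in> F2" by (auto simp: F1_def F2_def)
  from 3[OF this] show "a i = 0" using i by (simp add: a'_def)
 qed
qed

theorem component_tensor:
 "tensor_via (gl p q) (gl m n) (subrep (left_rep (poly_rep p q m n)) VL) (subrep (right_rep (poly_rep p q m n)) VR)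
   (subrep (poly_rep p q m n) VU) tensor_map"
 unfolding tensor_via_def L.space_subrep[OF VL_sub] R.space_subrep[OF VR_sub]
  L.subrep_simps R.subrep_simps P.subrep_simps left_rep_simps right_rep_simps poly_rep_simps
proof (intro conjI ballI allI impI)
 fix B C
 assume "basis_of (subrep (left_rep (poly_rep p q m n)) VL) B \<and> basis_of (subrep (right_rep (poly_rep p q m n)) VR) C"
 then have BC: "SP.independent B" "SP.span B = VL" "SP.independent C" "SP.span C = VR"
  by (auto simp: Defs.basis_of_def L.space_subrep[OF VL_sub] R.space_subrep[OF VR_sub])
 then have sub: "B \<subseteq> VL" "C \<subseteq> VR" using SP.span_superset by blast+
 note ind = tensor_map_independent[OF BC(1) sub(1) BC(3) sub(2)]
 show "inj_on (\<lambda>(v, u). tensor_map v u) (B \<times> C)" using ind by blast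
 show "basis_of (subrep (poly_rep p q m n) VU) ((\<lambda>(v, u). tensor_map v u) ` (B \<times> C))"
  using ind tensor_map_span[OF BC(2,4)] by (simp add: Defs.basis_of_def P.space_subrep[OF VU_sub])
next
 fix s t v u
 assume "v \<in> hpart (poly_rep p q m n) s \<inter> VL" "u \<in> hpart (poly_rep p q m n) t \<inter> VR"
 moreover from this have "tensor_map v u \<in> VU" unfolding VU_eq_span by (intro SP.span_base) blast
 ultimately show "tensor_map v u \<in> hpart (poly_rep p q m n) (s \<noteq> t) \<inter> VU" using tensor_map_parity by simp
qed (auto simp: tensor_map_add_left tensor_map_add_right tensor_map_scale_left tensor_map_scale_right tensor_map_act_left intro: tensor_map_act_right)

end

end

section \<open>Transport along isomorphisms\<close>

text \<open>
 The body of \<open>rep_iso\<close> for a given map and parity shift, so that structure can be transported along a fixed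
 isomorphism.
\<close>

definition iso_via :: "'x lie_super => ('x, 'v::ab_group_add) rep => ('x, 'w::ab_group_add) rep => ('v => 'w) => bool => bool" where
 "iso_via g M N \<phi> \<epsilon> \<longleftrightarrow>
   bij_betw \<phi> (space M) (space N) \<and>
   (\<forall>u \<in> space M. \<forall>v \<in> space M. \<phi> (u + v) = \<phi> u + \<phi> v) \<and>
   (\<forall>c. \<forall>v \<in> space M. \<phi> (scal M c v) = scal N c (\<phi> v)) \<and>
   (\<forall>s. \<phi> ` hpart M s = hpart N (s \<noteq> \<epsilon>)) \<and>
   (\<forall>x \<in> units g. \<forall>v \<in> space M. \<phi> (act M x v) = act N x (\<phi> v))"

lemma rep_iso_iff: "rep_iso g M N \<longleftrightarrow> (\<exists>\<phi> \<epsilon>. iso_via g M N \<phi> \<epsilon>)"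
 by (simp add: Defs.rep_iso_def iso_via_def)

locale module_iso = M: supermod g M + N: supermod g N
 for g :: "'x lie_super" and M :: "('x, 'v::ab_group_add) rep" and N :: "('x, 'w::ab_group_add) rep" +
 fixes \<phi> \<epsilon> assumes iso: "iso_via g M N \<phi> \<epsilon>"
begin

lemma bij: "bij_betw \<phi> (space M) (space N)"
 and add: "u \<in> space M ==> v \<in> space M ==> \<phi> (u + v) = \<phi> u + \<phi> v"
 and scale: "v \<in> space M ==> \<phi> (scal M c v) = scal N c (\<phi> v)"
 and hpart: "\<phi> ` hpart M s = hpart N (s \<noteq> \<epsilon>)"
 and act: "x \<in> units g ==> v \<in> space M ==> \<phi> (rep.act M x v) = rep.act N x (\<phi> v)"
 using iso unfolding iso_via_def by blast+

lemma inj: "u \<in> space M ==> v \<in> space M ==> \<phi> u = \<phi> v \<longleftrightarrow> u = v"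
 using bij unfolding bij_betw_def inj_on_def by blast

lemma mem [intro]: "v \<in> space M ==> \<phi> v \<in> space N"
 using bij unfolding bij_betw_def by blast

lemma surj: "w \<in> space N ==> \<exists>v\<in>space M. w = \<phi> v"
 using bij unfolding bij_betw_def by blast

lemma zero [simp]: "\<phi> 0 = 0"
 using scale[of 0 0] by simp

lemma sum: "(\<And>i. i \<in> I ==> h i \<in> space M) ==> \<phi> (\<Sum>i\<in>I. h i) = (\<Sum>i\<in>I. \<phi> (h i))"
 by (induction I rule: infinite_finite_induct) (auto simp: add M.space_sum)

lemma hpart_mem: "v \<in> hpart M s ==> \<phi> v \<in> hpart N (s \<noteq> \<epsilon>)"
 using hpart[of s] by blast

lemma subspace_vimage: "N.V.subspace S ==> M.V.subspace {v \<in> space M. \<phi> v \<in> S}"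
 by (rule M.V.subspaceI) (auto simp: add scale N.V.subspace_0 N.V.subspace_add N.V.subspace_scale)

lemma basis:
 assumes "basis_of M B" shows "basis_of N (\<phi> ` B)"
proof -
 have B: "\<not> M.V.dependent B" "M.V.span B = space M" using assms by (auto simp: Defs.basis_of_def)
 then have BM: "B \<subseteq> space M" using M.V.span_superset by blast
 have "inj_on \<phi> B \<and> \<not> N.V.dependent (\<phi> ` B)"
 proof (rule independent_family[OF N.V.vector_space_axioms])
  fix F a assume F: "finite F" "F \<subseteq> B" and 0: "(\<Sum>i\<in>F. scal N (a i) (\<phi> i)) = 0"
  have FM: "i \<in> space M" if "i \<in> F" for i using F BM that by blast
  have "\<phi> (\<Sum>i\<in>F. scal M (a i) i) = (\<Sum>i\<in>F. scal N (a i) (\<phi> i))"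
   by (subst sum) (use FM in \<open>auto simp: scale\<close>)
  then have "\<phi> (\<Sum>i\<in>F. scal M (a i) i) = \<phi> 0" using 0 by simp
  moreover have "(\<Sum>i\<in>F. scal M (a i) i) \<in> space M" by (rule M.space_sum) (rule M.space_scale, rule FM)
  ultimately have "(\<Sum>i\<in>F. scal M (a i) i) = 0" using inj M.space_zero by blast
  then show "\<forall>i\<in>F. a i = 0" using independent_coeffs[OF M.V.vector_space_axioms B(1) F] by blast
 qed
 moreover have "N.V.span (\<phi> ` B) = space N"
 proof
  show "N.V.span (\<phi> ` B) \<subseteq> space N" by (rule N.span_space) (use BM in blast)
  have "M.V.span B \<subseteq> {v \<in> space M. \<phi> v \<in> N.V.span (\<phi> ` B)}"
   by (rule M.V.span_minimal[OF _ subspace_vimage]) (use BM in \<open>auto intro: N.V.span_base\<close>)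
  then show "space N \<subseteq> N.V.span (\<phi> ` B)" using surj unfolding B(2) by blast
 qed
 ultimately show ?thesis by (simp add: Defs.basis_of_def)
qed

lemma irreducible:
 assumes N: "irreducible_rep g N" shows "irreducible_rep g M"
proof -
 have "U = {0} \<or> U = space M" if U: "submodule g M U" for U
 proof -
  have Usp: "U \<subseteq> space M" by (rule M.submodule_space[OF U])
  have Usub: "M.V.subspace U" and Uact: "\<And>x v. x \<in> units g ==> v \<in> U ==> rep.act M x v \<in> U"
   using U by (auto simp: Defs.submodule_def)
  have "submodule g N (\<phi> ` U)"
   unfolding Defs.submodule_def
  proof (intro conjI ballI)
   show sub: "N.V.subspace (\<phi> ` U)"
   proof (rule N.V.subspaceI)
    show "0 \<in> \<phi> ` U" using M.V.subspace_0[OF Usub] by (intro image_eqI[of _ _ 0]) auto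
    fix a b assume "a \<in> \<phi> ` U" "b \<in> \<phi> ` U"
    then obtain a' b' where "a = \<phi> a'" "b = \<phi> b'" "a' \<in> U" "b' \<in> U" by blast
    then show "a + b \<in> \<phi> ` U" using M.V.subspace_add[OF Usub] Usp add
     by (intro image_eqI[of _ _ "a' + b'"]) (auto simp: subset_iff)
   next
    fix c a assume "a \<in> \<phi> ` U"
    then obtain a' where "a = \<phi> a'" "a' \<in> U" by blast
    then show "scal N c a \<in> \<phi> ` U" using M.V.subspace_scale[OF Usub] Usp scale
     by (intro image_eqI[of _ _ "scal M c a'"]) (auto simp: subset_iff)
   qed
   show "\<phi> ` U = {u + v |u v. u \<in> \<phi> ` U \<inter> rep.hpart N False \<and> v \<in> \<phi> ` U \<inter> rep.hpart N True}"
   proof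
    show "\<phi> ` U \<subseteq> {u + v |u v. u \<in> \<phi> ` U \<inter> rep.hpart N False \<and> v \<in> \<phi> ` U \<inter> rep.hpart N True}"
    proof
     fix w assume "w \<in> \<phi> ` U"
     then obtain u where u: "u \<in> U" "w = \<phi> u" by blast
     then obtain u0 u1 where *: "u = u0 + u1" "u0 \<in> U" "u0 \<in> rep.hpart M False" "u1 \<in> U" "u1 \<in> rep.hpart M True"
      using U unfolding Defs.submodule_def by blast
     have e: "w = \<phi> u0 + \<phi> u1" using u * Usp add by auto
     have p: "\<phi> u0 \<in> rep.hpart N \<epsilon>" "\<phi> u1 \<in> rep.hpart N (\<not> \<epsilon>)" using hpart_mem[OF *(3)] hpart_mem[OF *(5)] by simp_all
     have "\<exists>a b. w = a + b \<and> a \<in> \<phi> ` U \<and> a \<in> rep.hpart N False \<and> b \<in> \<phi> ` U \<and> b \<in> rep.hpart N True"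
     proof (cases \<epsilon>)
      case True
      with e p * show ?thesis by (intro exI[of _ "\<phi> u1"] exI[of _ "\<phi> u0"]) (simp add: add.commute)
     next
      case False
      with e p * show ?thesis by (intro exI[of _ "\<phi> u0"] exI[of _ "\<phi> u1"]) simp
     qed
     then show "w \<in> {u + v |u v. u \<in> \<phi> ` U \<inter> rep.hpart N False \<and> v \<in> \<phi> ` U \<inter> rep.hpart N True}" by blast
    qed
    show "{u + v |u v. u \<in> \<phi> ` U \<inter> rep.hpart N False \<and> v \<in> \<phi> ` U \<inter> rep.hpart N True} \<subseteq> \<phi> ` U"
     using N.V.subspace_add[OF sub] by blast
   qed
   fix x w assume x: "x \<in> units g" and "w \<in> \<phi> ` U"
   then obtain u where "u \<in> U" "w = \<phi> u" by blast
   then show "rep.act N x w \<in> \<phi> ` U" using Uact[OF x] Usp act[OF x]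
    by (intro image_eqI[of _ _ "rep.act M x u"]) (auto simp: subset_iff)
  qed
  then have "\<phi> ` U = {0} \<or> \<phi> ` U = space N" using N by (auto simp: Defs.irreducible_rep_def)
  then show ?thesis
  proof
   assume e: "\<phi> ` U = {0}"
   have "u = 0" if "u \<in> U" for u
   proof -
    have "\<phi> u = \<phi> 0" using e that by auto
    then show ?thesis using inj[of u 0] Usp that M.space_zero by blast
   qed
   then show ?thesis using M.V.subspace_0[OF Usub] by blast
  next
   assume e: "\<phi> ` U = space N"
   have "v \<in> U" if v: "v \<in> space M" for v
   proof -
    obtain u where "u \<in> U" "\<phi> v = \<phi> u" using e mem[OF v] by blast
    then show ?thesis using inj[OF v] Usp by auto
   qed
   then show ?thesis using Usp by blast
  qed
 qed
 moreover have "space M \<noteq> {0}"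
 proof
  assume "space M = {0}"
  then have "space N = {0}" using bij by (simp add: bij_betw_def)
  then show False using N by (simp add: Defs.irreducible_rep_def)
 qed
 ultimately show ?thesis using M.supermodule by (simp add: Defs.irreducible_rep_def)
qed

lemma singular_pullback:
 assumes v: "v \<in> space M" and s: "singular g ht N \<chi> (\<phi> v)"
 shows "singular g ht M \<chi> v"
 unfolding singular_def
proof (intro conjI ballI impI v)
 fix x assume x: "x \<in> units g" "ht x > 0"
 then have "\<phi> (rep.act M x v) = \<phi> 0" using act[OF x(1) v] singular_kill[OF s x] by simp
 then show "rep.act M x v = 0" by (subst (asm) inj) (use x v in auto)
next
 fix x assume x: "x \<in> units g" "ht x = 0"
 then have "\<phi> (rep.act M x v) = \<phi> (scal M (\<chi> x) v)" using act[OF x(1) v] singular_weight[OF s x] scale[OF v] by simp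
 then show "rep.act M x v = scal M (\<chi> x) v" by (subst (asm) inj) (use x v in auto)
qed

end

theorem tensor_transport:
 assumes T: "tensor_via g h M N T \<beta>"
  and M': "module_iso g M' M \<phi>1 False" and N': "module_iso h N' N \<phi>2 \<epsilon>" and T': "module_iso (lie_prod g h) T T' \<phi>3 \<epsilon>"
  and \<beta>: "\<And>v u. v \<in> space M ==> u \<in> space N ==> \<beta> v u \<in> space T"
 shows "tensor_via g h M' N' T' (\<lambda>v u. \<phi>3 (\<beta> (\<phi>1 v) (\<phi>2 u)))"
proof -
 interpret M: module_iso g M' M \<phi>1 False by (rule M')
 interpret N: module_iso h N' N \<phi>2 \<epsilon> by (rule N')
 interpret T: module_iso "lie_prod g h" T T' \<phi>3 \<epsilon> by (rule T')
 note t = T[unfolded tensor_via_def]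
 note c1 = conjunct1[OF t] and d1 = conjunct2[OF t]
 note c2 = conjunct1[OF d1] and d2 = conjunct2[OF d1]
 note c3 = conjunct1[OF d2] and d3 = conjunct2[OF d2]
 note c4 = conjunct1[OF d3] and d4 = conjunct2[OF d3]
 note c5 = conjunct1[OF d4] and d5 = conjunct2[OF d4]
 note c6 = conjunct1[OF d5] and c7 = conjunct2[OF d5]
 have t1: "\<beta> (v + v') u = \<beta> v u + \<beta> v' u" if "v \<in> space M" "v' \<in> space M" "u \<in> space N" for v v' u using c1 that by blast
 have t2: "\<beta> v (u + u') = \<beta> v u + \<beta> v u'" if "v \<in> space M" "u \<in> space N" "u' \<in> space N" for v u u' using c2 that by blast
 have t3: "\<beta> (scal M c v) u = scal T c (\<beta> v u)" "\<beta> v (scal N c u) = scal T c (\<beta> v u)" if "v \<in> space M" "u \<in> space N" for c v u using c3 that by blast+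
 have t4: "inj_on (\<lambda>(v, u). \<beta> v u) (B \<times> C)" "basis_of T ((\<lambda>(v, u). \<beta> v u) ` (B \<times> C))" if "basis_of M B" "basis_of N C" for B C using c4 that by blast+
 have t5: "\<beta> v u \<in> hpart T (s \<noteq> r)" if "v \<in> hpart M s" "u \<in> hpart N r" for v u s r using c5 that by blast
 have t6: "act T (Inl x) (\<beta> v u) = \<beta> (act M x v) u" if "x \<in> units g" "v \<in> space M" "u \<in> space N" for x v u using c6 that by blast
 have t7: "act T (Inr y) (\<beta> v u) = scal T (koszul (odd_unit h y) s) (\<beta> v (act N y u))" if "y \<in> units h" "v \<in> hpart M s" "u \<in> space N" for y v u s using c7 that by blast
 show ?thesis
  unfolding tensor_via_def
 proof (intro conjI ballI allI impI)
  fix B C assume "basis_of M' B \<and> basis_of N' C"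
  then have BC: "basis_of M' B" "basis_of N' C" by blast+
  have sub: "B \<subseteq> space M'" "C \<subseteq> space N'"
   using BC M.M.V.span_superset[of B] N.M.V.span_superset[of C] by (auto simp: Defs.basis_of_def)
  note i = t4[OF M.basis[OF BC(1)] N.basis[OF BC(2)]]
  have im: "(\<lambda>(v, u). \<beta> v u) ` (\<phi>1 ` B \<times> \<phi>2 ` C) = (\<lambda>(v, u). \<beta> (\<phi>1 v) (\<phi>2 u)) ` (B \<times> C)" by force
  show "inj_on (\<lambda>(v, u). \<phi>3 (\<beta> (\<phi>1 v) (\<phi>2 u))) (B \<times> C)"
  proof (rule inj_onI, clarify)
   fix a b a' b' assume *: "a \<in> B" "b \<in> C" "a' \<in> B" "b' \<in> C" "\<phi>3 (\<beta> (\<phi>1 a) (\<phi>2 b)) = \<phi>3 (\<beta> (\<phi>1 a') (\<phi>2 b'))"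
   have m: "a \<in> space M'" "a' \<in> space M'" "b \<in> space N'" "b' \<in> space N'" using * sub by blast+
   have "\<beta> (\<phi>1 a) (\<phi>2 b) = \<beta> (\<phi>1 a') (\<phi>2 b')"
    using *(5) T.inj[of "\<beta> (\<phi>1 a) (\<phi>2 b)" "\<beta> (\<phi>1 a') (\<phi>2 b')"] \<beta> m M.mem N.mem by blast
   then have "(\<phi>1 a, \<phi>2 b) = (\<phi>1 a', \<phi>2 b')" using inj_onD[OF i(1), of "(\<phi>1 a, \<phi>2 b)" "(\<phi>1 a', \<phi>2 b')"] * by auto
   then show "a = a' \<and> b = b'" using M.inj[OF m(1,2)] N.inj[OF m(3,4)] by blast
  qed
  have "basis_of T' (\<phi>3 ` (\<lambda>(v, u). \<beta> v u) ` (\<phi>1 ` B \<times> \<phi>2 ` C))" by (rule T.basis[OF i(2)])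
  moreover have "\<phi>3 ` (\<lambda>(v, u). \<beta> v u) ` (\<phi>1 ` B \<times> \<phi>2 ` C) = (\<lambda>(v, u). \<phi>3 (\<beta> (\<phi>1 v) (\<phi>2 u))) ` (B \<times> C)"
   unfolding im image_image by (rule image_cong) auto
  ultimately show "basis_of T' ((\<lambda>(v, u). \<phi>3 (\<beta> (\<phi>1 v) (\<phi>2 u))) ` (B \<times> C))" by simp
 next
  fix s t v u assume "v \<in> hpart M' s" "u \<in> hpart N' t"
  then have h: "\<phi>3 (\<beta> (\<phi>1 v) (\<phi>2 u)) \<in> hpart T' ((s \<noteq> (t \<noteq> \<epsilon>)) \<noteq> \<epsilon>)"
   using T.hpart_mem[OF t5[OF M.hpart_mem N.hpart_mem]] by simp
  have e: "((s \<noteq> (t \<noteq> \<epsilon>)) \<noteq> \<epsilon>) = (s \<noteq> t)" by auto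
  show "\<phi>3 (\<beta> (\<phi>1 v) (\<phi>2 u)) \<in> hpart T' (s \<noteq> t)" using h unfolding e .
 next
  fix y s v u assume y: "y \<in> units h" "v \<in> hpart M' s" "u \<in> space N'"
  have m: "\<phi>1 v \<in> hpart M s" "\<phi>1 v \<in> space M" "\<phi>2 u \<in> space N"
   using M.hpart_mem[OF y(2)] M.N.hpart_space N.mem[OF y(3)] by auto
  have m2: "\<beta> (\<phi>1 v) (\<phi>2 u) \<in> space T" "\<beta> (\<phi>1 v) (act N y (\<phi>2 u)) \<in> space T"
   using \<beta> m N.N.act_space[OF y(1)] by blast+
  show "act T' (Inr y) (\<phi>3 (\<beta> (\<phi>1 v) (\<phi>2 u))) = scal T' (koszul (odd_unit h y) s) (\<phi>3 (\<beta> (\<phi>1 v) (\<phi>2 (act N' y u))))"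
   using T.act[OF _ m2(1), of "Inr y"] y(1) t7[OF y(1) m(1,3)] T.scale[OF m2(2)] N.act[OF y(1,3)] by (simp add: InrI)
 next
  fix x v u assume x: "x \<in> units g" "v \<in> space M'" "u \<in> space N'"
  have m: "\<phi>1 v \<in> space M" "\<phi>2 u \<in> space N" using x by auto
  show "act T' (Inl x) (\<phi>3 (\<beta> (\<phi>1 v) (\<phi>2 u))) = \<phi>3 (\<beta> (\<phi>1 (act M' x v)) (\<phi>2 u))"
   using T.act[OF _ \<beta>[OF m], of "Inl x"] x t6[OF x(1) m] M.act[OF x(1,2)] by (simp add: InlI)
 qed (simp_all add: M.add N.add M.scale N.scale M.mem N.mem t1 t2 t3 T.add T.scale \<beta>)
qed

text \<open>The module structure carried over to the image of an injective linear map.\<close>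

definition transp :: "('v => 'w) => (complex => 'w => 'w) => bool => ('x, 'v) rep => ('x, 'w) rep" where
 "transp \<iota> s \<epsilon> M = \<lparr> scal = s, hpart = (\<lambda>r. \<iota> ` hpart M (r \<noteq> \<epsilon>)), act = (\<lambda>x w. \<iota> (act M x (inv_into UNIV \<iota> w))) \<rparr>"

lemma module_iso_transp:
 assumes M: "supermodule g M" and s: "vector_space s" and add: "\<And>u v. \<iota> (u + v) = \<iota> u + \<iota> v"
  and scale: "\<And>c v. \<iota> (scal M c v) = s c (\<iota> v)" and inj: "inj \<iota>"
 shows "module_iso g (transp \<iota> s \<epsilon> M) M (inv_into UNIV \<iota>) \<epsilon>"
proof -
 let ?N = "transp \<iota> s \<epsilon> M"
 interpret M: supermod g M by unfold_locales (rule M)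
 interpret S: vector_space s by (rule s)
 have i [simp]: "inv_into UNIV \<iota> (\<iota> v) = v" for v using inj by simp
 have z: "\<iota> 0 = 0" using scale[of 0 0] by simp
 have sum: "\<iota> (sum h I) = (\<Sum>i\<in>I. \<iota> (h i))" for h :: "'x => _" and I
  by (induction I rule: infinite_finite_induct) (simp_all add: z add)
 have simps: "scal ?N = s" "hpart ?N r = \<iota> ` hpart M (r \<noteq> \<epsilon>)" "act ?N x w = \<iota> (act M x (inv_into UNIV \<iota> w))" for r x w
  by (simp_all add: transp_def)
 have sp: "space ?N = \<iota> ` space M"
 proof (intro Set.set_eqI iffI)
  fix w assume "w \<in> space ?N"
  then obtain a b where "w = \<iota> a + \<iota> b" "a \<in> hpart M (False \<noteq> \<epsilon>)" "b \<in> hpart M (True \<noteq> \<epsilon>)"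
   unfolding Defs.space_def simps by blast
  then show "w \<in> \<iota> ` space M" using M.hpart_space M.space_add by (metis add image_eqI)
 next
  fix w assume "w \<in> \<iota> ` space M"
  then obtain a b where w: "w = \<iota> (a + b)" "a \<in> hpart M False" "b \<in> hpart M True" using M.spaceE by (metis imageE)
  show "w \<in> space ?N"
  proof (cases \<epsilon>)
   case True
   then show ?thesis unfolding Defs.space_def simps using w
    by (intro CollectI exI[of _ "\<iota> b"] exI[of _ "\<iota> a"]) (simp add: add add.commute)
  next
   case False
   then show ?thesis unfolding Defs.space_def simps using w
    by (intro CollectI exI[of _ "\<iota> a"] exI[of _ "\<iota> b"]) (simp add: add)
  qed
 qed
 have diff: "\<iota> (a - b) = \<iota> a - \<iota> b" for a b using add[of "a - b" b] by (simp add: algebra_simps)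
 have "supermodule g ?N"
  unfolding Defs.supermodule_def
 proof (intro conjI ballI allI)
  show "vector_space (scal ?N)" by (simp add: simps s)
  show "module.subspace (scal ?N) (hpart ?N r)" for r
   unfolding simps
  proof (rule S.subspaceI)
   show "0 \<in> \<iota> ` hpart M (r \<noteq> \<epsilon>)" using z M.zero_hpart by (metis image_eqI)
   show "a + b \<in> \<iota> ` hpart M (r \<noteq> \<epsilon>)" if "a \<in> \<iota> ` hpart M (r \<noteq> \<epsilon>)" "b \<in> \<iota> ` hpart M (r \<noteq> \<epsilon>)" for a b
    using that M.V.subspace_add[OF M.subspace_hpart] by (auto simp: add[symmetric])
   show "s c a \<in> \<iota> ` hpart M (r \<noteq> \<epsilon>)" if "a \<in> \<iota> ` hpart M (r \<noteq> \<epsilon>)" for c a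
    using that M.V.subspace_scale[OF M.subspace_hpart] by (auto simp: scale[symmetric])
  qed
  show "hpart ?N False \<inter> hpart ?N True = {0}"
  proof -
   have "a = 0" if "a \<in> hpart M \<epsilon>" "a \<in> hpart M (\<not> \<epsilon>)" for a using that M.hpart_Int by (cases \<epsilon>) auto
   then show ?thesis unfolding simps using M.zero_hpart z inj_eq[OF inj] by (auto simp: image_iff) (metis+)
  qed
  show "act ?N x v \<in> hpart ?N (r \<noteq> odd_unit g x)" if x: "x \<in> units g" and v: "v \<in> hpart ?N r" for x r v
  proof -
   obtain a where a: "v = \<iota> a" "a \<in> hpart M (r \<noteq> \<epsilon>)" using v unfolding simps by blast
   have e: "((r \<noteq> \<epsilon>) \<noteq> odd_unit g x) = ((r \<noteq> odd_unit g x) \<noteq> \<epsilon>)" by auto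
   have "act M x a \<in> hpart M ((r \<noteq> odd_unit g x) \<noteq> \<epsilon>)"
    unfolding e[symmetric] by (rule M.act_hpart[OF x a(2)])
   then show ?thesis unfolding simps a(1) i by (rule imageI)
  qed
  show "act ?N x (act ?N y v) - scal ?N (koszul (odd_unit g x) (odd_unit g y)) (act ?N y (act ?N x v))
    = (\<Sum>z\<in>units g. scal ?N (struct g x y z) (act ?N z v))" if x: "x \<in> units g" and y: "y \<in> units g" and v: "v \<in> space ?N" for x y v
  proof -
   obtain a where a: "v = \<iota> a" "a \<in> space M" using v unfolding sp by blast
   show ?thesis using M.bracket[OF x y a(2)]
    by (simp add: simps a(1) scale[symmetric] diff[symmetric] sum[symmetric])
  qed
 qed (auto simp: simps sp add[symmetric] scale[symmetric] M.act_add M.act_scale)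
 moreover have "iso_via g ?N M (inv_into UNIV \<iota>) \<epsilon>"
  unfolding iso_via_def
 proof (intro conjI ballI allI)
  show "bij_betw (inv_into UNIV \<iota>) (space ?N) (space M)"
   unfolding bij_betw_def sp by (auto simp: inj_on_def image_image)
  show "inv_into UNIV \<iota> ` hpart ?N r = hpart M (r \<noteq> \<epsilon>)" for r by (simp add: simps image_image)
 qed (auto simp: sp simps add[symmetric] scale[symmetric])
 ultimately show ?thesis by unfold_locales (auto intro: M)
qed

subsection \<open>Coordinates\<close>

instance even_var :: countable by countable_datatype

lemma countable_exponents: "countable (UNIV :: (even_var \<Rightarrow>\<^sub>0 nat) set)"
proof (rule countableI')
 let ?G = "\<lambda>e :: even_var \<Rightarrow>\<^sub>0 nat. (\<lambda>v. (v, Poly_Mapping.lookup e v)) ` Poly_Mapping.keys e"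
 have "inj ?G"
 proof (rule injI)
  fix e e' assume *: "?G e = ?G e'"
  show "e = e'"
  proof (rule poly_mapping_eqI)
   fix v
   have "Poly_Mapping.lookup e v = k \<longleftrightarrow> (v, k) \<in> ?G e" if "k \<noteq> 0" for e :: "even_var \<Rightarrow>\<^sub>0 nat" and k
    using that by (auto simp: in_keys_iff)
   then show "Poly_Mapping.lookup e v = Poly_Mapping.lookup e' v" using * by metis
  qed
 qed
 note inj = this
 show "inj_on (\<lambda>e. to_nat_on (Collect finite) (?G e)) UNIV"
 proof (rule inj_onI)
  fix e e' assume "to_nat_on (Collect finite) (?G e) = to_nat_on (Collect finite) (?G e')"
  then have "?G e = ?G e'" by (rule inj_onD[OF inj_on_to_nat_on[OF countable_Collect_finite]]) auto
  then show "e = e'" by (rule injD[OF inj])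
 qed
qed

definition enc :: "mono => nat" where "enc = to_nat_on {x. finite (fst x)}"

lemma inj_enc: "inj_on enc {x. finite (fst x)}"
proof -
 have "countable (Collect finite :: odd_var set set)"
 proof -
  have "inj odd_var_code" by (rule injI) (simp add: odd_var_code_inject)
  then have "inj (\<lambda>S. odd_var_code ` S)" by (intro inj_on_image) simp
  moreover have "countable ((\<lambda>S. odd_var_code ` S) ` Collect finite)"
   by (rule countable_subset[OF _ countable_Collect_finite]) auto
  ultimately show ?thesis by (meson countable_image_inj_on inj_on_subset subset_UNIV)
 qed
 then have "countable (Collect finite \<times> UNIV :: mono set)" using countable_exponents by (rule countable_SIGMA)
 moreover have "{x :: mono. finite (fst x)} = Collect finite \<times> UNIV" by auto
 ultimately show ?thesis unfolding enc_def by (intro inj_on_to_nat_on) simp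
qed

definition nscale :: "complex => (nat \<Rightarrow>\<^sub>0 complex) => (nat \<Rightarrow>\<^sub>0 complex)" where
 "nscale c = Poly_Mapping.map ((*) c)"

lemma lookup_nscale [simp]: "Poly_Mapping.lookup (nscale c f) k = c * Poly_Mapping.lookup f k"
 by (simp add: nscale_def Poly_Mapping.map.rep_eq when_def)

lemma vector_space_nscale: "vector_space nscale"
 by unfold_locales (rule poly_mapping_eqI, simp add: lookup_add algebra_simps)+

text \<open>
 There are countably many monomials, so the polynomial superalgebra embeds linearly into the finitely supported
 sequences, where the tensor factors are to be realised.
\<close>

definition coords :: "superpoly => (nat \<Rightarrow>\<^sub>0 complex)" where
 "coords f = (\<Sum>x\<in>supp f. Poly_Mapping.single (enc x) (cf f x))"

lemma lookup_coords:
 "finite (fst x) ==> Poly_Mapping.lookup (coords f) (enc x) = cf f x"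
 "k \<notin> enc ` {x. finite (fst x)} ==> Poly_Mapping.lookup (coords f) k = 0"
proof -
 have fin: "finite (fst y)" if "y \<in> supp f" for y using that cf_nonzero_finite by (auto simp: supp_def)
 show "Poly_Mapping.lookup (coords f) (enc x) = cf f x" if x: "finite (fst x)"
 proof -
  have "Poly_Mapping.lookup (coords f) (enc x) = (\<Sum>y\<in>supp f. if y = x then cf f x else 0)"
   unfolding coords_def lookup_sum
   by (rule sum.cong) (use fin x inj_onD[OF inj_enc] in \<open>auto simp: lookup_single when_def\<close>)
  also have "\<dots> = (if x \<in> supp f then cf f x else 0)" by (rule sum.delta) simp
  finally show ?thesis by (simp add: supp_def)
 qed
 show "Poly_Mapping.lookup (coords f) k = 0" if "k \<notin> enc ` {x. finite (fst x)}"
  unfolding coords_def lookup_sum by (rule sum.neutral) (use fin that in \<open>auto simp: lookup_single when_def\<close>)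
qed

lemma coords_add: "coords (f + g) = coords f + coords g"
proof (rule poly_mapping_eqI)
 fix k show "Poly_Mapping.lookup (coords (f + g)) k = Poly_Mapping.lookup (coords f + coords g) k"
  by (cases "k \<in> enc ` {x. finite (fst x)}") (auto simp: lookup_coords lookup_add)
qed

lemma coords_scale: "coords (sp_scale c f) = nscale c (coords f)"
proof (rule poly_mapping_eqI)
 fix k show "Poly_Mapping.lookup (coords (sp_scale c f)) k = Poly_Mapping.lookup (nscale c (coords f)) k"
  by (cases "k \<in> enc ` {x. finite (fst x)}") (auto simp: lookup_coords)
qed

lemma inj_coords: "inj coords"
proof (rule injI, rule cf_eqI)
 fix f g x assume "coords f = coords g"
 then show "cf f x = cf g x"
  using lookup_coords(1)[of x f] lookup_coords(1)[of x g] by (cases "finite (fst x)") (auto simp: cf_infinite)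
qed

section \<open>The irreducible modules that occur\<close>

lemma singular_cong:
 assumes "singular g ht M \<chi> v" "\<And>x. x \<in> units g ==> ht x = 0 ==> \<chi> x = \<chi>' x"
 shows "singular g ht M \<chi>' v"
 using assms by (simp add: singular_def)

lemma is_V_transp:
 assumes M: "irreducible_rep (gl m n) M" and add: "\<And>u v. \<iota> (u + v) = \<iota> u + \<iota> v"
  and scale: "\<And>c v. \<iota> (scal M c v) = s c (\<iota> v)" and inj: "inj \<iota>" and s: "vector_space s"
  and f: "singular (gl m n) (gl_ht m) M (gl_weight \<mu>) f" "f \<noteq> 0"
  and \<mu>: "\<And>a. a \<in> sidx m n ==> \<mu> a = hook_weight m \<nu> a"
 shows "is_V m n \<nu> (transp \<iota> s \<epsilon> M)"
proof -
 have sM: "supermodule (gl m n) M" using M by (simp add: Defs.irreducible_rep_def)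
 interpret I: module_iso "gl m n" "transp \<iota> s \<epsilon> M" M "inv_into UNIV \<iota>" \<epsilon>
  by (rule module_iso_transp[OF sM s add scale inj])
 have fM: "f \<in> space M" using f by (simp add: singular_def)
 then obtain f' where f': "f' \<in> space (transp \<iota> s \<epsilon> M)" "f = inv_into UNIV \<iota> f'" using I.surj by blast
 have "singular (gl m n) (gl_ht m) (transp \<iota> s \<epsilon> M) (gl_weight \<mu>) f'"
  by (rule I.singular_pullback[OF f'(1)]) (use f f' in simp)
 then have "singular (gl m n) (gl_ht m) (transp \<iota> s \<epsilon> M) (gl_weight (hook_weight m \<nu>)) f'"
  by (rule singular_cong) (use \<mu> in \<open>auto simp: gl_units gl_weight_def\<close>)
 moreover have "f' \<noteq> 0" using f(2) f'(2) I.zero by auto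
 ultimately show ?thesis
  unfolding is_V_def using I.irreducible[OF M] singular_gl_iff[OF I.M.supermodule, of f'] by blast
qed

text \<open>
 The tensor product decomposition of the submodule generated by \<open>f\<close>, with the two factors transported by
 \<open>coords\<close> and the product along the given isomorphism.
\<close>

theorem component_is_VV:
 fixes W :: "((sindex \<times> sindex) + (sindex \<times> sindex), 'w::ab_group_add) rep"
 assumes f: "singular (glgl m q m n) (gght m m) (poly_rep m q m n) (case_sum (gl_weight \<mu>) (gl_weight \<mu>')) f"
  "f \<in> hpart (poly_rep m q m n) False" "f \<noteq> 0"
  and \<mu>: "\<And>a. a \<in> sidx m q ==> \<mu> a = hook_weight m \<nu> a" "\<And>a. a \<in> sidx m n ==> \<mu>' a = hook_weight m \<nu> a"
  and W: "supermodule (glgl m q m n) W" and iso: "rep_iso (glgl m q m n) (subrep (poly_rep m q m n) (VU m q m n f)) W"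
 shows "is_VV m q n \<nu> W"
proof -
 let ?P = "poly_rep m q m n"
 obtain \<phi> \<epsilon> where \<phi>: "iso_via (glgl m q m n) (subrep ?P (VU m q m n f)) W \<phi> \<epsilon>" using iso by (auto simp: rep_iso_iff)
 define V1 where "V1 = subrep (left_rep ?P) (VL m q m n f)"
 define V2 where "V2 = subrep (right_rep ?P) (VR m q m n f)"
 have irr: "irreducible_rep (gl m q) V1" "irreducible_rep (gl m n) V2"
  unfolding V1_def V2_def by (rule VL_irr[OF f] VR_irr[OF f])+
 have sup: "supermodule (gl m q) V1" "supermodule (gl m n) V2" using irr by (simp_all add: Defs.irreducible_rep_def)
 have supU: "supermodule (glgl m q m n) (subrep ?P (VU m q m n f))"
  using VU_irr[OF f] by (simp add: Defs.irreducible_rep_def)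
 have ss: "scal V1 = sp_scale" "scal V2 = sp_scale" by (simp_all add: V1_def V2_def Defs.subrep_def)
 interpret PL: supermod "gl m q" "left_rep ?P"
  by unfold_locales (rule supermodule_left_right(1)[OF supermodule_poly_rep], simp_all add: gl_units)
 interpret PR: supermod "gl m n" "right_rep ?P"
  by unfold_locales (rule supermodule_left_right(2)[OF supermodule_poly_rep], simp_all add: gl_units)
 interpret PP: supermod "glgl m q m n" ?P by unfold_locales (rule supermodule_poly_rep)
 have sp: "space V1 = VL m q m n f" "space V2 = VR m q m n f" "space (subrep ?P (VU m q m n f)) = VU m q m n f"
  unfolding V1_def V2_def
  by (rule PL.space_subrep[OF VL_sub[OF f]] PR.space_subrep[OF VR_sub[OF f]] PP.space_subrep[OF VU_sub[OF f]])+
 have i1: "module_iso (gl m q) (transp coords nscale False V1) V1 (inv_into UNIV coords) False"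
  and i2: "module_iso (gl m n) (transp coords nscale \<epsilon> V2) V2 (inv_into UNIV coords) \<epsilon>"
  by (rule module_iso_transp[OF _ vector_space_nscale coords_add _ inj_coords]; simp add: sup ss coords_scale)+
 have i3: "module_iso (glgl m q m n) (subrep ?P (VU m q m n f)) W \<phi> \<epsilon>"
  using \<phi> supU W by unfold_locales
 have mem: "tensor_map m q m n f v u \<in> space (subrep ?P (VU m q m n f))" if "v \<in> space V1" "u \<in> space V2" for v u
 proof -
  have "tensor_map m q m n f v u \<in> VU m q m n f"
   unfolding VU_eq_span[OF f] by (rule SP.span_base) (use that sp(1,2) in blast)
  then show ?thesis by (simp only: sp)
 qed
 have sf: "singular (gl m q) (gl_ht m) V1 (gl_weight \<mu>) f" "singular (gl m n) (gl_ht m) V2 (gl_weight \<mu>') f"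
  using fL[OF f] fR[OF f] VL_facts(4)[OF f] VR_facts(4)[OF f] unfolding singular_def sp
  by (simp_all add: V1_def V2_def Defs.subrep_def)
 have "is_V m q \<nu> (transp coords nscale False V1)"
  by (rule is_V_transp[OF irr(1) coords_add _ inj_coords vector_space_nscale sf(1) f(3) \<mu>(1)]) (simp_all add: ss coords_scale)
 moreover have "is_V m n \<nu> (transp coords nscale \<epsilon> V2)"
  by (rule is_V_transp[OF irr(2) coords_add _ inj_coords vector_space_nscale sf(2) f(3) \<mu>(2)]) (simp_all add: ss coords_scale)
 moreover have "tensor_via (gl m q) (gl m n) (transp coords nscale False V1) (transp coords nscale \<epsilon> V2) W
   (\<lambda>v u. \<phi> (tensor_map m q m n f (inv_into UNIV coords v) (inv_into UNIV coords u)))"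
  by (rule tensor_transport[OF _ i1 i2 i3 mem]) (simp_all add: V1_def V2_def component_tensor[OF f])
 ultimately show ?thesis unfolding is_VV_def using W by blast
qed

text \<open>The tensor of the two highest weight vectors.\<close>

lemma is_VV_singular:
 assumes W: "is_VV m q n \<nu> W"
 obtains w t where "w \<in> hpart W t" "w \<noteq> 0"
  "singular (glgl m q m n) (gght m m) W (case_sum (gl_weight (hook_weight m \<nu>)) (gl_weight (hook_weight m \<nu>))) w"
proof -
 obtain V1 V2 :: "(sindex \<times> sindex, nat \<Rightarrow>\<^sub>0 complex) rep" and b where
  V: "is_V m q \<nu> V1" "is_V m n \<nu> V2" and T: "tensor_via (gl m q) (gl m n) V1 V2 W b"
  and sW: "supermodule (glgl m q m n) W" using W unfolding is_VV_def by blast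
 have sV: "supermodule (gl m q) V1" "supermodule (gl m n) V2" using V by (auto simp: is_V_def Defs.irreducible_rep_def)
 interpret A: supermod "gl m q" V1 by unfold_locales (rule sV)
 interpret B: supermod "gl m n" V2 by unfold_locales (rule sV)
 interpret W: supermod "glgl m q m n" W by unfold_locales (rule sW)
 interpret GA: graded_lie "gl m q" "gl_ht m" "gl_hc m" by (rule graded_lie_gl)
 interpret GB: graded_lie "gl m n" "gl_ht m" "gl_hc m" by (rule graded_lie_gl)
 obtain a0 where "a0 \<noteq> 0" "singular (gl m q) (gl_ht m) V1 (gl_weight (hook_weight m \<nu>)) a0"
  using V(1) singular_gl_iff[OF sV(1)] unfolding is_V_def by blast
 then obtain s a where a: "a \<in> hpart V1 s" "a \<noteq> 0" "singular (gl m q) (gl_ht m) V1 (gl_weight (hook_weight m \<nu>)) a"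
  using A.singular_component GA.even_ht0 by metis
 obtain c0 where "c0 \<noteq> 0" "singular (gl m n) (gl_ht m) V2 (gl_weight (hook_weight m \<nu>)) c0"
  using V(2) singular_gl_iff[OF sV(2)] unfolding is_V_def by blast
 then obtain t c where c: "c \<in> hpart V2 t" "c \<noteq> 0" "singular (gl m n) (gl_ht m) V2 (gl_weight (hook_weight m \<nu>)) c"
  using B.singular_component GB.even_ht0 by metis
 note sp = A.hpart_space[OF a(1)] B.hpart_space[OF c(1)]
 note t = T[unfolded tensor_via_def]
 note c1 = conjunct1[OF t] and d1 = conjunct2[OF t]
 note c2 = conjunct1[OF d1] and d2 = conjunct2[OF d1]
 note c3 = conjunct1[OF d2] and d3 = conjunct2[OF d2]
 note c4 = conjunct1[OF d3] and d4 = conjunct2[OF d3]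
 note c5 = conjunct1[OF d4] and d5 = conjunct2[OF d4]
 note c6 = conjunct1[OF d5] and c7 = conjunct2[OF d5]
 have t3: "b (scal V1 k a) c = scal W k (b a c)" "b a (scal V2 k c) = scal W k (b a c)" for k using c3 sp by blast+
 have t4: "basis_of W ((\<lambda>(v, u). b v u) ` (B \<times> C))" if "basis_of V1 B" "basis_of V2 C" for B C using c4 that by blast
 have t5: "b a c \<in> hpart W (s \<noteq> t)" using c5 a(1) c(1) by blast
 have t6: "act W (Inl x) (b a c) = b (act V1 x a) c" if "x \<in> units (gl m q)" for x using c6 that sp by blast
 have t7: "act W (Inr y) (b a c) = scal W (koszul (odd_unit (gl m n) y) s) (b a (act V2 y c))" if "y \<in> units (gl m n)" for y
  using c7 that a(1) sp by blast
 have z: "b 0 c = 0" "b a 0 = 0" using t3[of 0] by simp_all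
 have "\<exists>B. basis_of V1 B \<and> a \<in> B"
 proof -
  have "A.V.independent {a}" using a(2) by simp
  then obtain B where B: "{a} \<subseteq> B" "B \<subseteq> space V1" "A.V.independent B" "space V1 \<subseteq> A.V.span B"
   using A.V.maximal_independent_subset_extend[of "{a}" "space V1"] sp by blast
  then have "A.V.span B = space V1" using A.span_space[OF B(2)] by blast
  then show ?thesis using B by (auto simp: Defs.basis_of_def)
 qed
 then obtain B1 where B1: "basis_of V1 B1" "a \<in> B1" by blast
 have "\<exists>B. basis_of V2 B \<and> c \<in> B"
 proof -
  have "B.V.independent {c}" using c(2) by simp
  then obtain B where B: "{c} \<subseteq> B" "B \<subseteq> space V2" "B.V.independent B" "space V2 \<subseteq> B.V.span B"
   using B.V.maximal_independent_subset_extend[of "{c}" "space V2"] sp by blast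
  then have "B.V.span B = space V2" using B.span_space[OF B(2)] by blast
  then show ?thesis using B by (auto simp: Defs.basis_of_def)
 qed
 then obtain B2 where B2: "basis_of V2 B2" "c \<in> B2" by blast
 have nz: "b a c \<noteq> 0"
 proof
  assume "b a c = 0"
  then have "0 \<in> (\<lambda>(v, u). b v u) ` (B1 \<times> B2)" using B1(2) B2(2) by (intro image_eqI[of _ _ "(a, c)"]) auto
  then show False using t4[OF B1(1) B2(1)] W.V.dependent_zero by (auto simp: Defs.basis_of_def)
 qed
 have "singular (glgl m q m n) (gght m m) W (case_sum (gl_weight (hook_weight m \<nu>)) (gl_weight (hook_weight m \<nu>))) (b a c)"
  unfolding singular_def
 proof (intro conjI ballI impI)
  show "b a c \<in> space W" by (rule W.hpart_space[OF t5])
 next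
  fix x assume x: "x \<in> units (glgl m q m n)" "gght m m x > 0"
  then show "act W x (b a c) = 0"
   using singular_kill[OF a(3)] singular_kill[OF c(3)] by (cases x) (auto simp: t6 t7 z)
 next
  fix x assume x: "x \<in> units (glgl m q m n)" "gght m m x = 0"
  then show "act W x (b a c) = scal W (case_sum (gl_weight (hook_weight m \<nu>)) (gl_weight (hook_weight m \<nu>)) x) (b a c)"
   using singular_weight[OF a(3)] singular_weight[OF c(3)] GB.even_ht0
   by (cases x) (auto simp: t6 t7 t3 koszul_def)
 qed
 then show ?thesis using that t5 nz by blast
qed

lemma joint_hw_singular:
 "joint_hw_vector m q n \<nu> f \<longleftrightarrow> f \<noteq> 0 \<and>
   singular (glgl m q m n) (gght m m) (poly_rep m q m n) (case_sum (gl_weight (hook_weight m \<nu>)) (gl_weight (hook_weight m \<nu>))) f"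
proof -
 let ?P = "poly_rep m q m n" and ?w = "gl_weight (hook_weight m \<nu>)"
 have L: "supermodule (gl m q) (left_rep ?P)" and R: "supermodule (gl m n) (right_rep ?P)"
  by (rule supermodule_left_right[OF supermodule_poly_rep]; simp add: gl_units)+
 have l: "scal (left_rep ?P) = sp_scale" "act (left_rep ?P) = (\<lambda>x. poly_act m q m n (Inl x))" "space (left_rep ?P) = superpolys m q m n"
  by (simp_all add: left_rep_def fun_eq_iff space_poly_rep[symmetric] Defs.space_def)
 have r: "scal (right_rep ?P) = sp_scale" "act (right_rep ?P) = (\<lambda>x. poly_act m q m n (Inr x))" "space (right_rep ?P) = superpolys m q m n"
  by (simp_all add: right_rep_def fun_eq_iff space_poly_rep[symmetric] Defs.space_def)
 have "joint_hw_vector m q n \<nu> f \<longleftrightarrow> f \<noteq> 0 \<and> singular (gl m q) (gl_ht m) (left_rep ?P) ?w f \<and> singular (gl m n) (gl_ht m) (right_rep ?P) ?w f"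
  using singular_gl_iff[OF L, of f "hook_weight m \<nu>"] singular_gl_iff[OF R, of f "hook_weight m \<nu>"]
  unfolding joint_hw_vector_def l r by blast
 also have "\<dots> \<longleftrightarrow> f \<noteq> 0 \<and> singular (glgl m q m n) (gght m m) ?P (case_sum ?w ?w) f"
  unfolding singular_def by (auto simp: InlI InrI elim!: PlusE)
 finally show ?thesis .
qed

lemma joint_hw_even:
 assumes "joint_hw_vector m q n \<nu> f"
 obtains f' where "f' \<in> hpart (poly_rep m q m n) False" "f' \<noteq> 0"
  "singular (glgl m q m n) (gght m m) (poly_rep m q m n) (case_sum (gl_weight (hook_weight m \<nu>)) (gl_weight (hook_weight m \<nu>))) f'"
proof -
 interpret P: unitary_module "glgl m q m n" "gght m m" "case_sum (gl_hc m) (gl_hc m)" "poly_rep m q m n" ip ustar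
  by (rule unitary_poly_rep)
 have f: "f \<noteq> 0" "singular (glgl m q m n) (gght m m) (poly_rep m q m n) (case_sum (gl_weight (hook_weight m \<nu>)) (gl_weight (hook_weight m \<nu>))) f"
  using assms by (simp_all add: joint_hw_singular)
 obtain s f' where f': "f' \<in> hpart (poly_rep m q m n) s" "f' \<noteq> 0"
  "singular (glgl m q m n) (gght m m) (poly_rep m q m n) (case_sum (gl_weight (hook_weight m \<nu>)) (gl_weight (hook_weight m \<nu>))) f'"
  using P.singular_component[OF f(2,1) P.even_ht0] by blast
 moreover have "\<not> s" using joint_weights(4)[OF f'(3,2,1)] .
 ultimately show ?thesis using that by simp
qed

text \<open>
 A component contains a joint singular vector. Its weights are those of a diagram in the hook, it is even, and it
 generates the component.
\<close>

theorem appears_imp_is_VV: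
 assumes W: "irreducible_rep (glgl m q m n) W"
  and app: "appears_in_decomposition (glgl m q m n) (poly_rep m q m n) W"
 shows "\<exists>\<nu>. young \<nu> \<and> row \<nu> (m + 1) \<le> min q n \<and> is_VV m q n \<nu> W"
proof -
 let ?P = "poly_rep m q m n" and ?g = "glgl m q m n"
 interpret P: unitary_module ?g "gght m m" "case_sum (gl_hc m) (gl_hc m)" ?P ip ustar
  by (rule unitary_poly_rep)
 obtain U where U: "submodule ?g ?P U" "irreducible_rep ?g (subrep ?P U)" "rep_iso ?g (subrep ?P U) W"
  using app unfolding appears_in_decomposition_def Defs.decomposition_def by blast
 have "U \<noteq> {0}" using U(2) by (auto simp: Defs.irreducible_rep_def P.space_subrep[OF U(1)])
 then obtain v s x0 where v: "v \<in> U" "v \<in> hpart ?P s" "v \<noteq> 0" "singular ?g (gght m m) ?P (pweight m q m n x0) v"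
  using submodule_has_singular[OF U(1)] by metis
 note sv = v(4)[unfolded pweight_def]
 obtain \<nu> where \<nu>: "young \<nu>" "row \<nu> (m + 1) \<le> min q n"
  "\<And>a. a \<in> sidx m q ==> wtL m n a x0 = hook_weight m \<nu> a" "\<And>a. a \<in> sidx m n ==> wtR m q a x0 = hook_weight m \<nu> a"
  using joint_singular_hook[OF sv v(3)] by metis
 have even: "v \<in> hpart ?P False" using joint_weights(4)[OF sv v(3,2)] v(2) by simp
 have sub: "submodule ?g ?P (VU m q m n v)" by (rule VU_sub[OF sv even v(3)])
 have "VU m q m n v \<subseteq> U"
  by (rule VU_least[OF sv even v(3)]) (use U(1) v(1) in \<open>auto simp: Defs.submodule_def\<close>)
 then have "submodule ?g (subrep ?P U) (VU m q m n v)" by (rule P.submodule_Int_subrep[OF U(1) sub])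
 moreover have "VU m q m n v \<noteq> {0}" using VU_facts(4)[OF sv even v(3)] v(3) by blast
 ultimately have e: "VU m q m n v = U"
  using U(2) unfolding Defs.irreducible_rep_def P.space_subrep[OF U(1)] by blast
 have "is_VV m q n \<nu> W"
  by (rule component_is_VV[OF sv even v(3) \<nu>(3,4)]) (use W U(3) e in \<open>auto simp: Defs.irreducible_rep_def\<close>)
 then show ?thesis using \<nu> by blast
qed

text \<open>
 An irreducible module is determined by its highest weight, so \<open>W\<close> is isomorphic to the submodule generated
 by \<open>f\<close>, which complete reducibility makes a member of a decomposition.
\<close>

theorem is_VV_imp_appears:
 assumes W: "irreducible_rep (glgl m q m n) W" and VV: "is_VV m q n \<nu> W" and f: "joint_hw_vector m q n \<nu> f"
 shows "appears_in_decomposition (glgl m q m n) (poly_rep m q m n) W"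
proof -
 let ?P = "poly_rep m q m n" and ?g = "glgl m q m n"
 obtain f' where f': "f' \<in> hpart ?P False" "f' \<noteq> 0"
  "singular ?g (gght m m) ?P (case_sum (gl_weight (hook_weight m \<nu>)) (gl_weight (hook_weight m \<nu>))) f'"
  using joint_hw_even[OF f] by blast
 note F = f'(3,1,2)
 obtain w t where w: "w \<in> hpart W t" "w \<noteq> 0"
  "singular ?g (gght m m) W (case_sum (gl_weight (hook_weight m \<nu>)) (gl_weight (hook_weight m \<nu>))) w"
  using is_VV_singular[OF VV] by blast
 have fU: "f' \<in> VU m q m n f'" by (rule VU_facts(4)[OF F])
 interpret P: supermod ?g ?P by unfold_locales (rule supermodule_poly_rep)
 have "rep_iso ?g (subrep ?P (VU m q m n f')) W"
 proof (rule irreducible_singular_iso[OF graded_lie_prod[OF graded_lie_gl graded_lie_gl] VU_irr[OF F] W _ f'(2) _ w])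
  show "f' \<in> hpart (subrep ?P (VU m q m n f')) False" using fU f'(1) by simp
  show "singular ?g (gght m m) (subrep ?P (VU m q m n f')) (case_sum (gl_weight (hook_weight m \<nu>)) (gl_weight (hook_weight m \<nu>))) f'"
   using f'(3) fU unfolding singular_def P.space_subrep[OF VU_sub[OF F]] by simp
 qed
 moreover obtain D where "decomposition ?g ?P D" "VU m q m n f' \<in> D"
  using complete_reducibility[OF VU_sub[OF F] VU_irr[OF F]] by blast
 ultimately show ?thesis unfolding appears_in_decomposition_def by blast
qed

theorem joint_hw_component:
 assumes f: "joint_hw_vector m q n \<nu> f"
 shows "\<exists>W :: ((sindex \<times> sindex) + (sindex \<times> sindex), superpoly) rep.
   is_VV m q n \<nu> W \<and> appears_in_decomposition (glgl m q m n) (poly_rep m q m n) W"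
proof -
 let ?P = "poly_rep m q m n" and ?g = "glgl m q m n"
 obtain f' where f': "f' \<in> hpart ?P False" "f' \<noteq> 0"
  "singular ?g (gght m m) ?P (case_sum (gl_weight (hook_weight m \<nu>)) (gl_weight (hook_weight m \<nu>))) f'"
  using joint_hw_even[OF f] by blast
 note F = f'(3,1,2)
 have "is_VV m q n \<nu> (subrep ?P (VU m q m n f'))"
  by (rule component_is_VV[OF F refl refl _ rep_iso_refl]) (use VU_irr[OF F] in \<open>simp add: Defs.irreducible_rep_def\<close>)
 moreover obtain D where "decomposition ?g ?P D" "VU m q m n f' \<in> D"
  using complete_reducibility[OF VU_sub[OF F] VU_irr[OF F]] by blast
 ultimately show ?thesis unfolding appears_in_decomposition_def using rep_iso_refl by blast
qed

section \<open>Superderivations and the commutative subring of even elements\<close>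

lemma exponent_induct [case_names zero step]:
 assumes "Q 0" "\<And>e v. Q e ==> Q (Poly_Mapping.single v 1 + e)"
 shows "Q (e :: 'a \<Rightarrow>\<^sub>0 nat)"
proof (induction e rule: Poly_Mapping.update_induct)
 case const
 show ?case by (rule assms(1))
next
 case (update e v k)
 have "Q (Poly_Mapping.single v k + e)" for k
 proof (induction k)
  case 0 then show ?case using update by simp
 next
  case (Suc k)
  have "Poly_Mapping.single v (Suc k) = Poly_Mapping.single v 1 + Poly_Mapping.single v k"
   by (simp add: single_add[symmetric])
  then show ?case using assms(2)[OF Suc] by (simp add: add.assoc)
 qed
 moreover have "Poly_Mapping.update v k e = Poly_Mapping.single v k + e"
  by (rule poly_mapping_eqI) (use update in \<open>auto simp: lookup_update lookup_add lookup_single when_def in_keys_iff\<close>)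
 ultimately show ?case by simp
qed

lemma mono_sp_up:
 assumes "finite (fst x)" "raisable A x"
 shows "mono_sp (up A x) = sp_scale (eps A x) (zz A (mono_sp x))"
proof (rule cf_eqI)
 fix z
 have "cf (zz A (mono_sp x)) z = (if z = up A x then eps A x else 0)"
  using assms up_down[of A z] by (auto simp: cf_zz cf_mono_sp cnt_up down_up)
 then show "cf (mono_sp (up A x)) z = cf (sp_scale (eps A x) (zz A (mono_sp x))) z"
  using assms eps_square[of A x] by (simp add: cf_mono_sp)
qed

text \<open>
 Elements are linear combinations of products of variables, so a superalgebra identity need only be checked for
 multiplication by one variable on the left.
\<close>

lemma superpoly_induct [case_names one add scale var]:
 fixes f :: superpoly
 assumes one: "Q 1" and add: "\<And>f g. Q f ==> Q g ==> Q (f + g)" and scale: "\<And>c f. Q f ==> Q (sp_scale c f)"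
  and var: "\<And>A f. Q f ==> Q (zz A f)"
 shows "Q f"
proof -
 have base: "mono_sp ({}, 0) = 1"
 proof (rule cf_eqI)
  fix x :: mono
  show "cf (mono_sp ({}, 0)) x = cf 1 x"
   by (simp add: cf_mono_sp) (auto simp: cf_def one_grassmann.rep_eq lookup_one prod_eq_iff when_def)
 qed
 have m: "Q (mono_sp (S, e))" if "finite S" for S e
  using that
 proof (induction S rule: finite_induct)
  case empty
  show ?case
  proof (induction e rule: exponent_induct)
   case zero then show ?case using one base by simp
  next
   case (step e v)
   have "mono_sp ({}, Poly_Mapping.single v 1 + e) = sp_scale 1 (zz (Inl v) (mono_sp ({}, e)))"
    using mono_sp_up[of "({}, e)" "Inl v"] by simp
   then show ?case using scale[OF var[OF step]] by metis
  qed
 next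
  case (insert s S)
  have "mono_sp (insert s S, e) = sp_scale (eps (Inr s) (S, e)) (zz (Inr s) (mono_sp (S, e)))"
   using mono_sp_up[of "(S, e)" "Inr s"] insert by simp
  then show ?case using scale[OF var[OF insert.IH]] by metis
 qed
 have zero: "Q 0" using scale[OF one, of 0] by simp
 have sum: "Q (\<Sum>x\<in>F. sp_scale (cf f x) (mono_sp x))" if "finite F" "\<And>x. x \<in> F ==> finite (fst x)" for F
  using that
 proof (induction F rule: finite_induct)
  case empty then show ?case using zero by simp
 next
  case (insert x F)
  have "Q (mono_sp x)" using m[of "fst x" "snd x"] insert.prems by simp
  then show ?case using insert by (simp add: add scale)
 qed
 have "res UNIV f = f" by (rule cf_eqI) (simp add: cf_res)
 then have "f = (\<Sum>x\<in>supp f. sp_scale (cf f x) (mono_sp x))" by (simp add: res_def)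
 moreover have "finite (fst x)" if "x \<in> supp f" for x using that cf_nonzero_finite by (auto simp: supp_def)
 ultimately show ?thesis using sum[of "supp f"] by simp
qed

lemma dd_one [simp]: "dd A 1 = 0"
proof (rule cf_eqI)
 fix x
 have "cf (1 :: superpoly) (up A x) = 0" if "raisable A x"
  using that by (cases A) (auto simp: cf_def one_grassmann.rep_eq lookup_one when_def poly_mapping_eq_iff fun_eq_iff lookup_add lookup_single)
 then show "cf (dd A 1) x = cf 0 x" by (simp add: cf_dd)
qed

lemma kap_one [simp]: "kap (1 :: superpoly) = 1"
proof (rule cf_eqI)
 fix x show "cf (kap 1) x = cf (1 :: superpoly) x"
  by (cases "fst x = {}") (auto simp: cf_kap cf_def one_grassmann.rep_eq kap.rep_eq)
qed

lemma kap_mult: "kap (f * g) = kap f * kap g" for f g :: superpoly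
 by (induction f rule: superpoly_induct) (auto simp: distrib_right kap_zz mult.assoc)

text \<open>
 The sign rule for moving an operator or element of parity \<open>s\<close> past \<open>f\<close>.
\<close>

definition kpow :: "bool => superpoly => superpoly" where
 "kpow s f = (if s then kap f else f)"

lemma kpow_simps: "kpow s (f + g) = kpow s f + kpow s g" "kpow s (sp_scale c f) = sp_scale c (kpow s f)"
 "kpow s (f * g) = kpow s f * kpow s g" "kpow s 1 = 1" "kpow s (kpow t f) = kpow (s \<noteq> t) f"
 by (auto simp: kpow_def kap_mult)

lemma zz_kpow: "kpow (oddv A) (zz B f) = sp_scale (vsign A B) (zz B (kpow (oddv A) f))"
 by (auto simp: kpow_def kap_zz vsign_def koszul_def)

lemma dd_mult: "dd A (f * g) = dd A f * g + kpow (oddv A) f * dd A g"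
proof (induction f rule: superpoly_induct)
 case (var B f)
 have "dd A (zz B f * g) = (if A = B then f * g else 0) + sp_scale (vsign A B) (zz B (dd A (f * g)))"
  by (simp only: mult.assoc dd_zz)
 also have "\<dots> = ((if A = B then f else 0) + sp_scale (vsign A B) (zz B (dd A f))) * g
   + sp_scale (vsign A B) (zz B (kpow (oddv A) f)) * dd A g"
  by (simp add: var distrib_left distrib_right SP.scale_right_distrib mult.assoc)
 also have "\<dots> = dd A (zz B f) * g + kpow (oddv A) (zz B f) * dd A g"
  by (simp only: dd_zz zz_kpow)
 finally show ?case .
qed (auto simp: kpow_simps distrib_right SP.scale_right_distrib)

lemma zv_commute: "zz A f = kpow (oddv A) f * zv A"
proof (induction f rule: superpoly_induct)
 case (var B f)
 have "zz A (zz B f) = sp_scale (vsign A B) (zz B (zz A f))" by (rule zz_zz)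
 also have "\<dots> = sp_scale (vsign A B) (zz B (kpow (oddv A) f)) * zv A" by (simp add: var mult.assoc)
 finally show ?case by (simp only: zz_kpow)
qed (auto simp: kpow_simps distrib_left distrib_right)

text \<open>
 It suffices to move \<open>g\<close> past one variable at a time, which is \<open>zv_commute\<close>.
\<close>

lemma supercommute:
 assumes "has_parity s g" shows "g * f = kpow s f * g"
proof (induction f rule: superpoly_induct)
 case (var A f)
 have gA: "g * zv A = sp_scale (koszul s (oddv A)) (zz A g)"
  using zv_commute[of A g] assms by (auto simp: kpow_def has_parity_iff koszul_def)
 have "g * zz A f = sp_scale (koszul s (oddv A)) (zz A (g * f))" by (simp add: mult.assoc[symmetric] gA)
 also have "\<dots> = kpow s (zz A f) * g" by (auto simp: var mult.assoc kpow_def kap_zz koszul_def)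
 finally show ?case .
qed (auto simp: kpow_simps distrib_left distrib_right)

lemma has_parity_mult: "has_parity s f ==> has_parity t g ==> has_parity (s \<noteq> t) (f * g)"
 by (auto simp: has_parity_iff kap_mult)

lemma has_parity_add: "has_parity s f ==> has_parity s g ==> has_parity s (f + g)"
 by (auto simp: has_parity_iff)

lemma has_parity_sum: "(\<And>i. i \<in> I ==> has_parity s (h i)) ==> has_parity s (sum h I)"
 by (auto simp: has_parity_iff kap_sum sum_negf)

lemma has_parity_zv: "has_parity (oddv A) (zv A)"
 using kap_zz[of A 1] by (auto simp: has_parity_iff)

lemma even_commute: "kap g = g ==> g * f = f * g" for f g :: superpoly
 using supercommute[of False g f] by (simp add: has_parity_iff kpow_def)

text \<open>
 The even elements form a commutative ring, over which the usual theory of determinants applies.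
\<close>

typedef evsp = "{f :: superpoly. kap f = f}" morphisms rep_ev Abs_ev
 by (rule exI[of _ 0]) simp

setup_lifting type_definition_evsp

instantiation evsp :: comm_ring_1
begin

lift_definition zero_evsp :: evsp is 0 by simp
lift_definition one_evsp :: evsp is 1 by simp
lift_definition plus_evsp :: "evsp => evsp => evsp" is "(+)" by simp
lift_definition times_evsp :: "evsp => evsp => evsp" is "(*)" by (simp add: kap_mult)
lift_definition uminus_evsp :: "evsp => evsp" is uminus by simp
lift_definition minus_evsp :: "evsp => evsp => evsp" is "(-)"
 by (simp only: diff_conv_add_uminus kap_add kap_uminus)

instance
proof
 fix a b c :: evsp
 show "a * b * c = a * (b * c)" by transfer (simp add: mult.assoc)
 show "a * b = b * a" by transfer (rule even_commute)
 show "1 * a = a" by transfer simp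
 show "a + b + c = a + (b + c)" by transfer simp
 show "a + b = b + a" by transfer simp
 show "0 + a = a" by transfer simp
 show "- a + a = 0" by transfer simp
 show "a - b = a + - b" by transfer simp
 show "(a + b) * c = a * c + b * c" by transfer (simp add: distrib_right)
 show "(0 :: evsp) \<noteq> 1" by transfer simp
qed

end

lemmas rep_ev_simps [simp] = zero_evsp.rep_eq one_evsp.rep_eq plus_evsp.rep_eq times_evsp.rep_eq uminus_evsp.rep_eq minus_evsp.rep_eq

lemma kap_rep_ev [simp]: "kap (rep_ev a) = rep_ev a"
 using rep_ev[of a] by simp

lemma even_rep_ev: "has_parity False (rep_ev a)"
 by (simp add: has_parity_iff)

lemma kpow_rep_ev [simp]: "kpow s (rep_ev a) = rep_ev a"
 by (simp add: kpow_def)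

lemma rep_ev_commute: "rep_ev a * f = f * rep_ev a"
 using supercommute[OF even_rep_ev] by (simp add: kpow_def)

lemma rep_ev_sum [simp]: "rep_ev (sum h I) = (\<Sum>i\<in>I. rep_ev (h i))"
 by (induction I rule: infinite_finite_induct) auto

lemma rep_ev_prod_list: "rep_ev (prod_list xs) = prod_list (map rep_ev xs)"
 by (induction xs) auto

lemma rep_ev_power [simp]: "rep_ev (a ^ k) = rep_ev a ^ k"
 by (induction k) auto

lemma rep_ev_of_nat [simp]: "rep_ev (of_nat k) = of_nat k"
 by (induction k) auto

lemma rep_ev_of_int [simp]: "rep_ev (of_int k) = of_int k"
 by (cases k) (simp_all)

lemma rep_ev_Abs: "has_parity False f ==> rep_ev (Abs_ev f) = f"
 by (rule Abs_ev_inverse) (simp add: has_parity_iff)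

definition xe :: "nat => nat => evsp" where "xe l i = Abs_ev (sp_even (X l i))"

lemma rep_xe: "rep_ev (xe l i) = zv (gvar (Inl i) (Inl l))"
 unfolding xe_def using has_parity_zv[of "gvar (Inl i) (Inl l)"] by (simp add: rep_ev_Abs)

lemma sdet_rep_ev: "sdet r (\<lambda>i j. rep_ev (a i j)) = rep_ev (det (mat r r (\<lambda>(i, j). a (Suc i) (Suc j))))"
proof -
 let ?A = "mat r r (\<lambda>(i, j). a (Suc i) (Suc j))"
 let ?f = "map_permutation {0..<r} Suc"
 have img: "Suc ` {0..<r} = {1..r}" unfolding image_Suc_atLeastLessThan by (simp only: atLeastLessThanSuc_atLeastAtMost One_nat_def)
 have bij: "bij_betw Suc {0..<r} {1..r}" unfolding bij_betw_def img by (intro conjI refl) (simp add: inj_on_def)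
 have bij': "bij_betw (\<lambda>k. k - 1) {1..r} {0..<r}" by (rule bij_betw_byWitness[of _ Suc]) auto
 have "det ?A = (\<Sum>p | p permutes {0..<r}. of_int (sign p) * (\<Prod>i = 0..<r. ?A $$ (i, p i)))"
  by (rule det_def') simp
 also have "\<dots> = (\<Sum>p | p permutes {1..r}. of_int (sign p) * (\<Prod>i = 1..r. a i (p i)))"
 proof (rule sum.reindex_bij_witness[where j = ?f and i = "map_permutation {1..r} (\<lambda>k. k - 1)"])
  fix p assume "p \<in> {p. p permutes {0..<r}}"
  then have p: "p permutes {0..<r}" by simp
  show "map_permutation {1..r} (\<lambda>k. k - 1) (?f p) = p" by (rule map_permutation_compose_inv[OF bij p]) simp
  show "?f p \<in> {p. p permutes {1..r}}" using map_permutation_permutes[OF bij p] by simp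
  have "(\<Prod>i = 1..r. a i (?f p i)) = (\<Prod>i\<in>Suc ` {0..<r}. a i (?f p i))" by (simp only: img)
  also have "\<dots> = (\<Prod>i = 0..<r. a (Suc i) (?f p (Suc i)))" by (subst prod.reindex) (auto simp: comp_def)
  also have "\<dots> = (\<Prod>i = 0..<r. ?A $$ (i, p i))"
  proof (rule prod.cong[OF refl])
   fix i assume i: "i \<in> {0..<r}"
   then have "p i \<in> {0..<r}" using p by (simp add: permutes_in_image)
   then show "a (Suc i) (?f p (Suc i)) = ?A $$ (i, p i)" using i map_permutation_apply[of Suc "{0..<r}" i p] by simp
  qed
  finally show "of_int (sign (?f p)) * (\<Prod>i = 1..r. a i (?f p i)) = of_int (sign p) * (\<Prod>i = 0..<r. ?A $$ (i, p i))"
   using sign_map_permutation[of Suc "{0..<r}" p] p by simp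
 next
  fix p assume "p \<in> {p. p permutes {1..r}}"
  then have p: "p permutes {1..r}" by simp
  show "?f (map_permutation {1..r} (\<lambda>k. k - 1) p) = p" by (rule map_permutation_compose_inv[OF bij' p]) simp
  show "map_permutation {1..r} (\<lambda>k. k - 1) p \<in> {p. p permutes {0..<r}}" using map_permutation_permutes[OF bij' p] by simp
 qed
 finally have d: "det ?A = (\<Sum>p | p permutes {1..r}. of_int (sign p) * (\<Prod>i = 1..r. a i (p i)))" .
 have "rep_ev (\<Prod>i = 1..r. a i (p i)) = prod_list (map (\<lambda>i. rep_ev (a i (p i))) [1..<r + 1])" for p
 proof -
  have "(\<Prod>i = 1..r. a i (p i)) = prod_list (map (\<lambda>i. a i (p i)) [1..<r + 1])"
   by (subst prod.distinct_set_conv_list[symmetric]) (auto intro!: prod.cong)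
  then show ?thesis by (simp add: rep_ev_prod_list comp_def)
 qed
 then show ?thesis unfolding sdet_def d by simp
qed

section \<open>Derivations of determinants\<close>

locale derivation =
 fixes D :: "'a::comm_ring_1 => 'a"
 assumes D_add: "D (a + b) = D a + D b" and D_mult: "D (a * b) = D a * b + a * D b"
begin

lemma D_zero [simp]: "D 0 = 0" using D_add[of 0 0] by simp

lemma D_one [simp]: "D 1 = 0" using D_mult[of 1 1] by simp

lemma D_uminus: "D (- a) = - D a"
 using D_add[of a "- a"] by (simp add: eq_neg_iff_add_eq_0 add.commute)

lemma D_sum: "D (sum h I) = (\<Sum>i\<in>I. D (h i))"
 by (induction I rule: infinite_finite_induct) (auto simp: D_add)

lemma D_prod: "finite I ==> D (prod h I) = (\<Sum>k\<in>I. \<Prod>i\<in>I. if i = k then D (h i) else h i)"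
proof (induction I rule: finite_induct)
 case (insert x I)
 have "(\<Prod>i\<in>insert x I. if i = k then D (h i) else h i) = h x * (\<Prod>i\<in>I. if i = k then D (h i) else h i)" if "k \<in> I" for k
  using insert that by (subst prod.insert) auto
 moreover have "(\<Prod>i\<in>insert x I. if i = x then D (h i) else h i) = D (h x) * (\<Prod>i\<in>I. h i)"
 proof -
  have "(\<Prod>i\<in>I. if i = x then D (h i) else h i) = (\<Prod>i\<in>I. h i)" using insert by (intro prod.cong) auto
  then show ?thesis using insert by simp
 qed
 ultimately show ?case using insert by (simp add: D_mult sum_distrib_left)
qed simp

lemma D_sign: "D (of_int (sign p) * a) = of_int (sign p) * D a"
 by (simp add: sign_def D_uminus)

lemma D_det:
 assumes A: "A \<in> carrier_mat n n"
 shows "D (det A) = (\<Sum>k<n. det (mat n n (\<lambda>(i, j). if i = k then D (A $$ (i, j)) else A $$ (i, j))))"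
proof -
 have "D (det A) = (\<Sum>p | p permutes {0..<n}. of_int (sign p) * (\<Sum>k\<in>{0..<n}. \<Prod>i\<in>{0..<n}. if i = k then D (A $$ (i, p i)) else A $$ (i, p i)))"
  unfolding det_def'[OF A] by (simp add: D_sum D_sign D_prod)
 also have "\<dots> = (\<Sum>k\<in>{0..<n}. \<Sum>p | p permutes {0..<n}. of_int (sign p) * (\<Prod>i\<in>{0..<n}. if i = k then D (A $$ (i, p i)) else A $$ (i, p i)))"
  by (subst sum.swap) (simp add: sum_distrib_left)
 also have "\<dots> = (\<Sum>k\<in>{0..<n}. det (mat n n (\<lambda>(i, j). if i = k then D (A $$ (i, j)) else A $$ (i, j))))"
 proof (rule sum.cong[OF refl])
  fix k assume "k \<in> {0..<n}"
  have "(\<Prod>i\<in>{0..<n}. if i = k then D (A $$ (i, p i)) else A $$ (i, p i))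
    = (\<Prod>i\<in>{0..<n}. mat n n (\<lambda>(i, j). if i = k then D (A $$ (i, j)) else A $$ (i, j)) $$ (i, p i))" if "p permutes {0..<n}" for p
   using that permutes_in_image[OF that] by (intro prod.cong) auto
  then show "(\<Sum>p | p permutes {0..<n}. of_int (sign p) * (\<Prod>i\<in>{0..<n}. if i = k then D (A $$ (i, p i)) else A $$ (i, p i)))
    = det (mat n n (\<lambda>(i, j). if i = k then D (A $$ (i, j)) else A $$ (i, j)))"
   by (subst det_def'[of _ n]) auto
 qed
 finally show ?thesis by (simp add: atLeast0LessThan)
qed

lemma det_zero_row:
 assumes A: "(A :: 'a mat) \<in> carrier_mat n n" and k: "k < n" "\<And>j. j < n ==> A $$ (k, j) = 0" shows "det A = 0"
proof -
 have "det A = (\<Sum>j<n. A $$ (k, j) * cofactor A k j)" by (rule laplace_expansion_row[OF A k(1)])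
 then show ?thesis using k by simp
qed

text \<open>
 All terms of the Leibniz rule over the rows vanish except the one for the row that the derivation moves.
\<close>

lemma D_det_row:
 assumes A: "A \<in> carrier_mat n n"
  and D: "\<And>i j. i < n ==> j < n ==> D (A $$ (i, j)) = (if i = b then c j else 0)"
 shows "D (det A) = (if b < n then det (mat n n (\<lambda>(i, j). if i = b then c j else A $$ (i, j))) else 0)"
proof -
 have "det (mat n n (\<lambda>(i, j). if i = k then D (A $$ (i, j)) else A $$ (i, j))) =
  (if k = b then det (mat n n (\<lambda>(i, j). if i = b then c j else A $$ (i, j))) else 0)" if k: "k < n" for k
 proof (cases "k = b")
  case True
  then show ?thesis by (auto intro!: arg_cong[of _ _ det] eq_matI simp: D)
 next
  case False
  have "det (mat n n (\<lambda>(i, j). if i = k then D (A $$ (i, j)) else A $$ (i, j))) = 0"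
   by (rule det_zero_row[of _ n k]) (use k False in \<open>auto simp: D\<close>)
  then show ?thesis using False by simp
 qed
 then have "D (det A) = (\<Sum>k<n. if k = b then det (mat n n (\<lambda>(i, j). if i = b then c j else A $$ (i, j))) else 0)"
  unfolding D_det[OF A] by (intro sum.cong) auto
 then show ?thesis by simp
qed

lemma D_det_all:
 assumes A: "A \<in> carrier_mat n n" and D: "\<And>i j. i < n ==> j < n ==> D (A $$ (i, j)) = A $$ (i, j)"
 shows "D (det A) = of_nat n * det A"
proof -
 have "mat n n (\<lambda>(i, j). if i = k then D (A $$ (i, j)) else A $$ (i, j)) = A" for k
  using A by (intro eq_matI) (auto simp: D)
 then show ?thesis by (simp add: D_det[OF A])
qed

end

section \<open>Elements with nonzero body are not zero divisors\<close>

instantiation even_var :: linorder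
begin

definition less_eq_even_var :: "even_var => even_var => bool" where "less_eq_even_var u v \<longleftrightarrow> to_nat u \<le> to_nat v"
definition less_even_var :: "even_var => even_var => bool" where "less_even_var u v \<longleftrightarrow> to_nat u < to_nat v"

instance by standard (auto simp: less_eq_even_var_def less_even_var_def)

end

definition body :: "superpoly => even_poly" where "body f = gcoeff f {}"

lemma body_simps [simp]: "body (f + g) = body f + body g" "body (f * g) = body f * body g" "body 1 = 1" "body 0 = 0"
 by (simp_all add: body_def plus_grassmann.rep_eq times_grassmann.rep_eq one_grassmann.rep_eq zero_grassmann.rep_eq)

lemma body_deriv: "body (dd (Inl v) f) = even_poly_deriv v (body f)"
proof -
 have "even_poly_deriv v 0 = 0" by (rule poly_mapping_eqI) (simp add: even_poly_deriv.rep_eq)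
 then show ?thesis by (simp add: body_def coeff_map.rep_eq)
qed

text \<open>
 The body, the part without odd variables, takes values in a domain. In a product the coefficients of \<open>g\<close> with
 the fewest odd variables are multiplied by the body of \<open>f\<close> alone.
\<close>

lemma body_nonzero_cancel:
 assumes b: "body f \<noteq> 0" and fg: "f * g = 0" shows "g = 0"
proof (rule ccontr)
 assume "g \<noteq> 0"
 then have "\<exists>S. gcoeff g S \<noteq> 0" using gcoeff_inject_fun[of g 0] by (auto simp: zero_grassmann.rep_eq)
 then have "\<exists>k S. gcoeff g S \<noteq> 0 \<and> card S = k" by blast
 define k where "k = (LEAST k. \<exists>S. gcoeff g S \<noteq> 0 \<and> card S = k)"
 have "\<exists>S. gcoeff g S \<noteq> 0 \<and> card S = k" unfolding k_def by (rule LeastI_ex) fact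
 then obtain S where S: "gcoeff g S \<noteq> 0" "card S = k" by blast
 have fin: "finite S" using S(1) gcoeff_infinite by blast
 have "gcoeff g (S - T) = 0" if "T \<in> Pow S" "T \<noteq> {}" for T
 proof (rule ccontr)
  assume "gcoeff g (S - T) \<noteq> 0"
  then have "k \<le> card (S - T)" unfolding k_def by (intro Least_le) blast
  moreover have "card (S - T) < card S" using that fin by (intro psubset_card_mono) auto
  ultimately show False using S(2) by simp
 qed
 then have "gcoeff (f * g) S = (\<Sum>T\<in>Pow S. if T = {} then body f * gcoeff g S else 0)"
  unfolding times_grassmann.rep_eq by (intro sum.cong) (auto simp: body_def)
 also have "\<dots> = body f * gcoeff g S" using fin by simp
 finally show False using fg b S(1) by (simp add: zero_grassmann.rep_eq)
qed

section \<open>Superderivations\<close>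

declare gvar.simps [simp del]

text \<open>
 Superderivations of parity \<open>s\<close>. Both actions are by superderivations, which determines them on products by
 their values on variables.
\<close>

locale sder =
 fixes s :: bool and G :: "superpoly => superpoly"
 assumes G_add: "G (f + g) = G f + G g"
  and G_mult: "G (f * g) = G f * g + kpow s f * G g"
  and G_kap: "kap (G f) = (if s then - G (kap f) else G (kap f))"
begin

lemma G_zero [simp]: "G 0 = 0" using G_add[of 0 0] by simp

lemma G_one [simp]: "G 1 = 0" using G_mult[of 1 1] by (simp add: kpow_simps)

lemma G_uminus: "G (- f) = - G f"
 using G_add[of f "- f"] by (simp add: eq_neg_iff_add_eq_0 add.commute)

lemma G_sum: "G (sum h I) = (\<Sum>i\<in>I. G (h i))"
 by (induction I rule: infinite_finite_induct) (auto simp: G_add)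

lemma G_ev_mult: "G (rep_ev a * f) = G (rep_ev a) * f + rep_ev a * G f"
 by (simp add: G_mult)

lemma G_kill_prod_list: "(\<And>f. f \<in> set fs ==> G f = 0) ==> G (prod_list fs) = 0"
 by (induction fs) (auto simp: G_mult)

lemma G_sign: "G (of_int (sign p) * f) = of_int (sign p) * G f"
 by (simp add: sign_def G_uminus)

lemma G_kill_sdet:
 assumes "\<And>i j. i \<in> {1..r} ==> j \<in> {1..r} ==> G (a i j) = 0"
 shows "G (sdet r a) = 0"
proof -
 have "G (prod_list (map (\<lambda>i. a i (p i)) [1..<r + 1])) = 0" if "p permutes {1..r}" for p
  by (rule G_kill_prod_list) (use assms permutes_in_image[OF that] in auto)
 then show ?thesis by (simp add: sdet_def G_sum G_sign)
qed

text \<open>The factors are even, so no signs arise even if the derivation is odd.\<close>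

lemma G_prod_list:
 assumes "distinct is" "\<And>i. i \<in> set is ==> has_parity False (h i)" "\<And>i. i \<in> set is ==> i \<noteq> l ==> G (h i) = 0"
 shows "G (prod_list (map h is)) = (if l \<in> set is then prod_list (map (h(l := G (h l))) is) else 0)"
 using assms
proof (induction "is")
 case (Cons i "is")
 have e: "kpow s (h i) = h i" using Cons.prems(2)[of i] by (auto simp: kpow_def has_parity_iff)
 have m: "map (h(l := G (h l))) is = map h is" if "l \<notin> set is" using that by auto
 have IH: "G (prod_list (map h is)) = (if l \<in> set is then prod_list (map (h(l := G (h l))) is) else 0)"
  by (rule Cons.IH) (use Cons.prems in auto)
 show ?case
 proof (cases "l = i")
  case True
  then have l: "l \<notin> set is" using Cons.prems(1) by simp
  show ?thesis using True l by (simp add: G_mult e IH m)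
 next
  case False
  then have "G (h i) = 0" using Cons.prems(3)[of i] by simp
  then show ?thesis using False by (simp add: G_mult e IH fun_upd_def)
 qed
qed simp

end

lemma sder_op:
 assumes "\<And>t. t \<in> I ==> (oddv (A t) \<noteq> oddv (B t)) = s"
 shows "sder s (\<lambda>f. \<Sum>t\<in>I. sp_scale (c t) (zz (A t) (dd (B t) f)))"
proof
 fix f g
 show "(\<Sum>t\<in>I. sp_scale (c t) (zz (A t) (dd (B t) (f + g)))) =
  (\<Sum>t\<in>I. sp_scale (c t) (zz (A t) (dd (B t) f))) + (\<Sum>t\<in>I. sp_scale (c t) (zz (A t) (dd (B t) g)))"
  by (simp add: distrib_left SP.scale_right_distrib sum.distrib)
 have "zz (A t) (dd (B t) (f * g)) = zz (A t) (dd (B t) f) * g + kpow s f * zz (A t) (dd (B t) g)" if "t \<in> I" for t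
 proof -
  have "zz (A t) (kpow (oddv (B t)) f * dd (B t) g) = kpow s f * zz (A t) (dd (B t) g)"
   using assms[OF that] zv_commute[of "A t" "kpow (oddv (B t)) f"]
   by (simp add: mult.assoc[symmetric] kpow_simps)
  then show ?thesis by (simp add: dd_mult distrib_left mult.assoc)
 qed
 then show "(\<Sum>t\<in>I. sp_scale (c t) (zz (A t) (dd (B t) (f * g)))) =
  (\<Sum>t\<in>I. sp_scale (c t) (zz (A t) (dd (B t) f))) * g + kpow s f * (\<Sum>t\<in>I. sp_scale (c t) (zz (A t) (dd (B t) g)))"
  by (simp add: SP.scale_right_distrib sum.distrib sum_distrib_left sum_distrib_right)
 have "kap (zz (A t) (dd (B t) f)) = (if s then - zz (A t) (dd (B t) (kap f)) else zz (A t) (dd (B t) (kap f)))" if "t \<in> I" for t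
  using assms[OF that] by (auto simp: kap_zz kap_dd)
 then show "kap (\<Sum>t\<in>I. sp_scale (c t) (zz (A t) (dd (B t) f))) =
  (if s then - (\<Sum>t\<in>I. sp_scale (c t) (zz (A t) (dd (B t) (kap f)))) else \<Sum>t\<in>I. sp_scale (c t) (zz (A t) (dd (B t) (kap f))))"
  by (simp add: kap_sum sum_negf)
qed

lemma sder_poly_act: "sder (odd_unit (glgl p q m n) x) (poly_act p q m n x)"
proof (cases x)
 case (Inl y)
 obtain a b where y: "y = (a, b)" by (cases y)
 have "sder (odd_idx a \<noteq> odd_idx b) (\<lambda>f. \<Sum>t\<in>sidx m n. sp_scale 1 (zz (gvar a t) (dd (gvar b t) f)))"
  by (rule sder_op) auto
 moreover have "poly_act p q m n x = (\<lambda>f. \<Sum>t\<in>sidx m n. sp_scale 1 (zz (gvar a t) (dd (gvar b t) f)))"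
  unfolding Inl y by (rule ext) (simp add: poly_act_Inl)
 ultimately show ?thesis unfolding Inl y odd_unit_Inl by simp
next
 case (Inr y)
 obtain a b where y: "y = (a, b)" by (cases y)
 have "sder (odd_idx a \<noteq> odd_idx b) (\<lambda>f. \<Sum>t\<in>sidx p q. sp_scale (koszul (odd_idx t) (odd_idx a \<noteq> odd_idx b)) (zz (gvar t a) (dd (gvar t b) f)))"
  by (rule sder_op) auto
 moreover have "poly_act p q m n x = (\<lambda>f. \<Sum>t\<in>sidx p q. sp_scale (koszul (odd_idx t) (odd_idx a \<noteq> odd_idx b)) (zz (gvar t a) (dd (gvar t b) f)))"
  unfolding Inr y by (rule ext) (simp add: poly_act_Inr)
 ultimately show ?thesis unfolding Inr y odd_unit_Inr by simp
qed

lemma sder_dd: "sder (oddv A) (dd A)"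
 by standard (auto simp: dd_mult kap_dd)

lemma dd_zv: "dd A (zv B) = (if A = B then 1 else 0)"
 using dd_zz[of A B 1] by simp

lemma act_Inl_gen:
 assumes "c \<in> sidx m n"
 shows "poly_act p q m n (Inl (a, b)) (zv (gvar b' c)) = (if b' = b then zv (gvar a c) else 0)"
proof -
 have "poly_act p q m n (Inl (a, b)) (zv (gvar b' c)) = (\<Sum>t\<in>sidx m n. if t = c then (if b' = b then zv (gvar a c) else 0) else 0)"
  unfolding poly_act_Inl by (intro sum.cong) (auto simp: dd_zv)
 then show ?thesis using assms by (simp add: sum.delta)
qed

lemma act_Inr_gen:
 assumes "a \<in> sidx p q"
 shows "poly_act p q m n (Inr (c, d)) (zv (gvar a d')) =
  (if d' = d then sp_scale (koszul (odd_idx a) (odd_idx c \<noteq> odd_idx d)) (zv (gvar a c)) else 0)"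
proof -
 have "poly_act p q m n (Inr (c, d)) (zv (gvar a d')) = (\<Sum>t\<in>sidx p q. if t = a then
  (if d' = d then sp_scale (koszul (odd_idx a) (odd_idx c \<noteq> odd_idx d)) (zv (gvar a c)) else 0) else 0)"
  unfolding poly_act_Inr by (intro sum.cong) (auto simp: dd_zv)
 then show ?thesis using assms by (simp add: sum.delta)
qed

text \<open>
 An even superderivation preserves parity and thus induces a derivation of the ring of even elements.
\<close>

definition evD :: "(superpoly => superpoly) => evsp => evsp" where "evD G a = Abs_ev (G (rep_ev a))"

lemma rep_evD: "sder False G ==> rep_ev (evD G a) = G (rep_ev a)"
 unfolding evD_def by (rule rep_ev_Abs) (simp add: has_parity_iff sder.G_kap)

lemma derivation_evD:
 assumes "sder False G" shows "derivation (evD G)"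
 by standard (simp_all add: rep_ev_inject[symmetric] rep_evD[OF assms] sder.G_add[OF assms] sder.G_mult[OF assms] kpow_def)

section \<open>Determinants in the even variables and Cramer's rule\<close>

abbreviation vx :: "nat => nat => svar" where "vx l i \<equiv> gvar (Inl i) (Inl l)"
abbreviation vy :: "nat => nat => svar" where "vy k j \<equiv> gvar (Inr j) (Inr k)"
abbreviation vxi :: "nat => nat => svar" where "vxi l j \<equiv> gvar (Inr j) (Inl l)"
abbreviation veta :: "nat => nat => svar" where "veta k i \<equiv> gvar (Inl i) (Inr k)"

text \<open>The leading principal minor of order \<open>r\<close>, indexed from \<open>1\<close>.\<close>

definition dt :: "(nat => nat => evsp) => nat => evsp" where
 "dt a r = det (mat r r (\<lambda>(i, j). a (Suc i) (Suc j)))"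

abbreviation de :: "nat => evsp" where "de \<equiv> dt xe"

lemma Delta_rep: "Delta r = rep_ev (de r)"
proof -
 have "sp_even (X l i) = rep_ev (xe l i)" for l i by (simp add: rep_xe gvar.simps)
 then show ?thesis by (simp add: Delta_def dt_def sdet_rep_ev)
qed

text \<open>
 Replacing column \<open>i'\<close> by column \<open>i\<close> gives the same determinant if \<open>i = i'\<close> and one with two equal columns
 otherwise.
\<close>

lemma dt_col:
 assumes G: "sder False G" and e: "i \<in> {1..r}" "i' \<in> {1..r}"
  and a: "\<And>l j. l \<in> {1..r} ==> j \<in> {1..r} ==> G (rep_ev (a l j)) = (if j = i' then rep_ev (a l i) else 0)"
 shows "G (rep_ev (dt a r)) = (if i = i' then rep_ev (dt a r) else 0)"
proof -
 interpret derivation "evD G" by (rule derivation_evD[OF G])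
 let ?A = "mat r r (\<lambda>(i, j). a (Suc i) (Suc j))"
 have D: "evD G (?A $$ (l, j)) = (if j = i' - 1 then ?A $$ (l, i - 1) else 0)" if "l < r" "j < r" for l j
  using that e a[of "Suc l" "Suc j"] by (auto simp: rep_ev_inject[symmetric] rep_evD[OF G])
 have lt: "i' - 1 < r" using e by auto
 have "evD G (det (transpose_mat ?A)) = (if i' - 1 < r then
  det (mat r r (\<lambda>(l, j). if l = i' - 1 then ?A $$ (j, i - 1) else transpose_mat ?A $$ (l, j))) else 0)"
  by (rule D_det_row) (use D in auto)
 note T = this[unfolded if_P[OF lt] det_transpose[of ?A r, OF mat_carrier]]
 have "evD G (det ?A) = (if i = i' then det ?A else 0)"
 proof (cases "i = i'")
  case True
  have "mat r r (\<lambda>(l, j). if l = i' - 1 then ?A $$ (j, i - 1) else transpose_mat ?A $$ (l, j)) = transpose_mat ?A"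
   by (rule eq_matI) (use True e in auto)
  then show ?thesis using T True det_transpose[of ?A r] by simp
 next
  case False
  have "det (mat r r (\<lambda>(l, j). if l = i' - 1 then ?A $$ (j, i - 1) else transpose_mat ?A $$ (l, j))) = 0"
   by (rule det_identical_rows[of _ r "i - 1" "i' - 1"]) (use False e in \<open>auto intro!: eq_vecI\<close>)
  then show ?thesis using T False by simp
 qed
 then show ?thesis using rep_evD[OF G, of "dt a r"] by (cases "i = i'") (simp_all add: dt_def)
qed

lemma dt_row:
 assumes G: "sder False G" and e: "i \<in> {1..r}" "i' \<in> {1..r}"
  and a: "\<And>l j. l \<in> {1..r} ==> j \<in> {1..r} ==> G (rep_ev (a l j)) = (if l = i' then rep_ev (a i j) else 0)"
 shows "G (rep_ev (dt a r)) = (if i = i' then rep_ev (dt a r) else 0)"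
proof -
 have "dt (\<lambda>l j. a j l) r = dt a r"
 proof -
  have "mat r r (\<lambda>(i, j). a (Suc j) (Suc i)) = transpose_mat (mat r r (\<lambda>(i, j). a (Suc i) (Suc j)))" by (rule eq_matI) auto
  then show ?thesis unfolding dt_def by (simp add: det_transpose[of _ r])
 qed
 then show ?thesis using dt_col[OF G e, of "\<lambda>l j. a j l"] a by simp
qed

lemma dt_scalar:
 assumes G: "sder False G" and a: "\<And>l j. l \<in> {1..r} ==> j \<in> {1..r} ==> G (rep_ev (a l j)) = rep_ev (a l j)"
 shows "G (rep_ev (dt a r)) = of_nat r * rep_ev (dt a r)"
proof -
 interpret derivation "evD G" by (rule derivation_evD[OF G])
 have "evD G (dt a r) = of_nat r * dt a r"
  unfolding dt_def by (rule D_det_all) (use a in \<open>auto simp: rep_ev_inject[symmetric] rep_evD[OF G]\<close>)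
 then show ?thesis using rep_evD[OF G, of "dt a r"] by simp
qed

lemma dt_kill:
 assumes G: "sder s G" and a: "\<And>l j. l \<in> {1..r} ==> j \<in> {1..r} ==> G (rep_ev (a l j)) = 0"
 shows "G (rep_ev (dt a r)) = 0"
 unfolding dt_def sdet_rep_ev[symmetric] by (rule sder.G_kill_sdet[OF G]) (rule a)

text \<open>
 Only the last row is affected, and it becomes a multiple of the last unit vector; expanding along it leaves the
 next smaller minor.
\<close>

lemma dt_corner:
 assumes G: "sder False G"
  and a: "\<And>l j. l \<in> {1..Suc r} ==> j \<in> {1..Suc r} ==> G (rep_ev (a l j)) = (if l = Suc r \<and> j = Suc r then rep_ev c else 0)"
 shows "G (rep_ev (dt a (Suc r))) = rep_ev (c * dt a r)"
proof -
 interpret derivation "evD G" by (rule derivation_evD[OF G])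
 let ?A = "mat (Suc r) (Suc r) (\<lambda>(i, j). a (Suc i) (Suc j))"
 let ?B = "mat (Suc r) (Suc r) (\<lambda>(i, j). if i = r then (if j = r then c else 0) else ?A $$ (i, j))"
 have "evD G (det ?A) = (if r < Suc r then det ?B else 0)"
  by (rule D_det_row) (use a in \<open>auto simp: rep_ev_inject[symmetric] rep_evD[OF G]\<close>)
 also have "\<dots> = det ?B" by simp
 also have "\<dots> = (\<Sum>j<Suc r. ?B $$ (r, j) * cofactor ?B r j)"
  by (rule laplace_expansion_row) auto
 also have "\<dots> = (\<Sum>j<Suc r. if j = r then c * cofactor ?B r r else 0)"
  by (rule sum.cong) auto
 also have "\<dots> = c * cofactor ?B r r" by simp
 also have "cofactor ?B r r = det (mat_delete ?B r r)" by (simp add: cofactor_def)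
 also have "mat_delete ?B r r = mat r r (\<lambda>(i, j). a (Suc i) (Suc j))"
  by (rule eq_matI) (auto simp: mat_delete_def)
 finally show ?thesis using rep_evD[OF G, of "dt a (Suc r)"] by (simp add: dt_def)
qed

text \<open>
 Differentiating with respect to the corner variable reduces the order by one, so no minor can have zero body.
\<close>

lemma body_dt_nonzero:
 assumes G: "\<And>r. Suc r \<le> N ==> \<exists>v. \<forall>l\<in>{1..Suc r}. \<forall>j\<in>{1..Suc r}. dd (Inl v) (rep_ev (a l j)) = (if l = Suc r \<and> j = Suc r then rep_ev c else 0)"
  and c: "body (rep_ev c) \<noteq> 0" and r: "r \<le> N"
 shows "body (rep_ev (dt a r)) \<noteq> 0"
 using r
proof (induction r)
 case 0
 have "dt a 0 = 1" unfolding dt_def by (rule det_dim_zero) simp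
 then show ?case by simp
next
 case (Suc r)
 obtain v where v: "\<forall>l\<in>{1..Suc r}. \<forall>j\<in>{1..Suc r}. dd (Inl v) (rep_ev (a l j)) = (if l = Suc r \<and> j = Suc r then rep_ev c else 0)"
  using G Suc.prems by blast
 have s: "sder False (dd (Inl v))" using sder_dd[of "Inl v"] by simp
 have "dd (Inl v) (rep_ev (dt a (Suc r))) = rep_ev (c * dt a r)"
  by (rule dt_corner[OF s]) (use v in blast)
 then have "even_poly_deriv v (body (rep_ev (dt a (Suc r)))) = body (rep_ev c) * body (rep_ev (dt a r))"
  unfolding body_deriv[symmetric] by simp
 moreover have "even_poly_deriv v 0 = 0" by (rule poly_mapping_eqI) (simp add: even_poly_deriv.rep_eq)
 ultimately show ?case using c Suc by auto
qed

lemma gvar_Inl_ex: "odd_idx a = odd_idx c ==> \<exists>v. gvar a c = Inl v"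
 by (cases a; cases c) (auto simp: gvar.simps)

lemma body_de: "body (rep_ev (de r)) \<noteq> 0"
proof (rule body_dt_nonzero[where N = r and c = 1])
 fix r
 obtain v where "vx (Suc r) (Suc r) = Inl v" using gvar_Inl_ex[of "Inl (Suc r)" "Inl (Suc r)"] by auto
 then have "\<forall>l\<in>{1..Suc r}. \<forall>j\<in>{1..Suc r}. dd (Inl v) (rep_ev (xe l j)) = (if l = Suc r \<and> j = Suc r then rep_ev 1 else 0)"
  by (metis (no_types, lifting) dd_zv gvar_inject one_evsp.rep_eq rep_xe sum.inject(1))
 then show "\<exists>v. \<forall>l\<in>{1..Suc r}. \<forall>j\<in>{1..Suc r}. dd (Inl v) (rep_ev (xe l j)) = (if l = Suc r \<and> j = Suc r then rep_ev 1 else 0)" by blast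
qed auto

lemma de_cancel: "rep_ev (de r ^ a) * f = rep_ev (de r ^ a) * g ==> f = g"
proof -
 assume "rep_ev (de r ^ a) * f = rep_ev (de r ^ a) * g"
 then have z: "rep_ev (de r ^ a) * (f - g) = 0" by (simp add: right_diff_distrib)
 have "body (rep_ev (de r ^ a)) \<noteq> 0"
  by (induction a) (auto simp: body_de)
 then have "f - g = 0" using z by (rule body_nonzero_cancel)
 then show ?thesis by simp
qed

text \<open>
 The cofactors of the matrix of the variables \<open>x\<close> are the partial derivatives of its determinant. Cramer's
 rule then becomes a statement about derivations that copy one row or column onto another.
\<close>

definition cof :: "nat => nat => nat => superpoly" where "cof m l i = dd (vx l i) (rep_ev (de m))"

lemma dd_xe: "dd A (rep_ev (xe l i)) = (if A = vx l i then 1 else 0)"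
 by (simp add: rep_xe dd_zv)

lemma cof_col:
 assumes "i \<in> {1..m}" "i' \<in> {1..m}"
 shows "(\<Sum>l\<in>{1..m}. zv (vx l i) * cof m l i') = (if i = i' then rep_ev (de m) else 0)"
proof -
 let ?G = "\<lambda>f. \<Sum>l\<in>{1..m}. sp_scale 1 (zz (vx l i) (dd (vx l i') f))"
 have G: "sder False ?G" by (rule sder_op) auto
 have "?G (rep_ev (xe l j)) = (\<Sum>t\<in>{1..m}. if t = l then (if j = i' then rep_ev (xe l i) else 0) else 0)" for l j
  by (intro sum.cong) (auto simp: rep_xe dd_zv)
 then have "?G (rep_ev (de m)) = (if i = i' then rep_ev (de m) else 0)"
  by (intro dt_col[OF G assms]) auto
 then show ?thesis by (simp add: cof_def)
qed

lemma cof_row: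
 assumes "l \<in> {1..m}" "l' \<in> {1..m}"
 shows "(\<Sum>i\<in>{1..m}. zv (vx l i) * cof m l' i) = (if l = l' then rep_ev (de m) else 0)"
proof -
 let ?G = "\<lambda>f. \<Sum>i\<in>{1..m}. sp_scale 1 (zz (vx l i) (dd (vx l' i) f))"
 have G: "sder False ?G" by (rule sder_op) auto
 have "?G (rep_ev (xe k j)) = (\<Sum>t\<in>{1..m}. if t = j then (if k = l' then rep_ev (xe l j) else 0) else 0)" for k j
  by (intro sum.cong) (auto simp: rep_xe dd_zv)
 then have "?G (rep_ev (de m)) = (if l = l' then rep_ev (de m) else 0)"
  by (intro dt_row[OF G assms]) auto
 then show ?thesis by (simp add: cof_def)
qed

lemma even_zvx: "zv (vx l i) * f = f * zv (vx l i)"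
 using zv_commute[of "vx l i" f] by (simp add: kpow_def)

text \<open>
 Multiplying by the cofactors recovers \<open>\<Delta>\<^sub>m u l\<close>, and \<open>\<Delta>\<^sub>m\<close> is not a zero divisor. Most identities for the
 elements \<open>Dl\<close> are verified in this way, after pairing with the rows of the matrix of variables \<open>x\<close>.
\<close>

lemma cramer_unique:
 assumes "\<And>i. i \<in> {1..m} ==> (\<Sum>l\<in>{1..m}. zv (vx l i) * u l) = (\<Sum>l\<in>{1..m}. zv (vx l i) * v l)" and l: "l \<in> {1..m}"
 shows "u l = v l"
proof -
 have e: "(\<Sum>i\<in>{1..m}. cof m l i * (\<Sum>k\<in>{1..m}. zv (vx k i) * w k)) = rep_ev (de m) * w l" for w
 proof -
  have *: "cof m l i * (zv (vx k i) * f) = zv (vx k i) * cof m l i * f" for i k f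
   using even_zvx[where l = k and i = i and f = "cof m l i"] by (simp add: mult.assoc[symmetric])
  have "(\<Sum>i\<in>{1..m}. cof m l i * (\<Sum>k\<in>{1..m}. zv (vx k i) * w k)) = (\<Sum>k\<in>{1..m}. (\<Sum>i\<in>{1..m}. zv (vx k i) * cof m l i) * w k)"
   unfolding sum_distrib_left sum_distrib_right by (subst sum.swap) (simp only: *)
  also have "\<dots> = (\<Sum>k\<in>{1..m}. if k = l then rep_ev (de m) * w l else 0)"
   by (intro sum.cong) (use l cof_row in auto)
  finally show ?thesis using l by simp
 qed
 have "rep_ev (de m) * u l = rep_ev (de m) * v l" unfolding e[symmetric] using assms(1) by simp
 then show ?thesis using de_cancel[of m 1] by simp
qed

section \<open>The even elements whose determinants are the vectors \<open>\<Gamma>\<close>\<close>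

text \<open>
 The odd derivation that replaces the variables \<open>x\<close> of row \<open>l\<close> by the variables \<open>\<eta>\<close> with lower index \<open>k\<close>.
\<close>

definition TD :: "nat => nat => nat => superpoly => superpoly" where
 "TD m k l f = (\<Sum>i\<in>{1..m}. sp_scale 1 (zz (veta k i) (dd (vx l i) f)))"

lemma sder_TD: "sder True (TD m k l)"
 unfolding TD_def[abs_def] by (rule sder_op) auto

text \<open>
 The determinant of the matrix of variables \<open>x\<close> with row \<open>l\<close> replaced by the variables \<open>\<eta>\<close> with lower index
 \<open>k\<close>.
\<close>

definition Dl :: "nat => nat => nat => superpoly" where "Dl m k l = TD m k l (rep_ev (de m))"

lemma Dl_cof: "Dl m k l = (\<Sum>i\<in>{1..m}. zv (veta k i) * cof m l i)"
 by (simp add: Dl_def TD_def cof_def)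

lemma kap_Dl: "kap (Dl m k l) = - Dl m k l"
 using sder.G_kap[OF sder_TD, of m k l "rep_ev (de m)"] by (simp add: Dl_def)

lemma odd_Dl: "has_parity True (Dl m k l)"
 by (simp add: has_parity_iff kap_Dl)

lemma cramer:
 assumes "i \<in> {1..m}"
 shows "(\<Sum>l\<in>{1..m}. zv (vx l i) * Dl m k l) = rep_ev (de m) * zv (veta k i)"
proof -
 have *: "zv (vx l i) * (zv (veta k i') * f) = zv (veta k i') * (zv (vx l i) * f)" for l i' f
  using even_zvx[where l = l and i = i and f = "zv (veta k i')"] by (simp only: mult.assoc[symmetric])
 have "(\<Sum>l\<in>{1..m}. zv (vx l i) * Dl m k l) = (\<Sum>i'\<in>{1..m}. zv (veta k i') * (\<Sum>l\<in>{1..m}. zv (vx l i) * cof m l i'))"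
  unfolding Dl_cof sum_distrib_left by (subst sum.swap) (simp only: *)
 also have "\<dots> = (\<Sum>i'\<in>{1..m}. if i' = i then zv (veta k i) * rep_ev (de m) else 0)"
  by (intro sum.cong) (use assms cof_col in auto)
 finally show ?thesis using assms by (simp add: rep_ev_commute)
qed

text \<open>
 The key to \<open>\<Gamma>\<close>: the sum over marked diagrams is the expansion of an ordinary determinant whose entries are
 these even elements. By Cramer's rule
 they are \<open>\<Delta>\<^sub>m\<close> times the entries of \<open>y + \<eta> x\<^sup>-\<^sup>1 \<xi>\<close>, with \<open>x\<close>, \<open>\<xi>\<close>, \<open>\<eta>\<close>, \<open>y\<close> the matrices of variables, and
 both odd simple root vectors kill them.
\<close>

definition ww :: "nat => nat => nat => superpoly" where
 "ww m k j = rep_ev (de m) * zv (vy k j) + (\<Sum>l\<in>{1..m}. Dl m k l * zv (vxi l j))"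

definition we :: "nat => nat => nat => evsp" where "we m k j = Abs_ev (ww m k j)"

lemma even_ww: "has_parity False (ww m k j)"
proof -
 have "has_parity False (Dl m k l * zv (vxi l j))" for l
  using has_parity_mult[OF odd_Dl has_parity_zv[of "vxi l j"]] by simp
 moreover have "has_parity False (rep_ev (de m) * zv (vy k j))"
  using has_parity_mult[OF even_rep_ev has_parity_zv[of "vy k j"]] by simp
 ultimately show ?thesis unfolding ww_def by (intro has_parity_add has_parity_sum) auto
qed

lemma rep_we: "rep_ev (we m k j) = ww m k j"
 unfolding we_def by (rule rep_ev_Abs[OF even_ww])

subsection \<open>\<open>\<Gamma>\<close> as a determinant\<close>

lemma TD_xe: "i \<in> {1..m} ==> TD m k l (rep_ev (xe l' i)) = (if l' = l then zv (veta k i) else 0)"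
proof -
 assume i: "i \<in> {1..m}"
 have "TD m k l (rep_ev (xe l' i)) = (\<Sum>t\<in>{1..m}. if t = i then (if l' = l then zv (veta k i) else 0) else 0)"
  unfolding TD_def by (intro sum.cong) (auto simp: rep_xe dd_zv)
 then show ?thesis using i by simp
qed

text \<open>
 For a marked column the determinant arises from \<open>\<Delta>\<^sub>m\<close> by the derivation \<open>TD\<close>, applied in row order.
\<close>

lemma sdet_X_entry:
 assumes D: "D \<in> marked_diagrams m r"
 shows "sdet m (X_entry D k) = (if \<exists>l. (l, k) \<in> D then Dl m k (THE l. (l, k) \<in> D) else rep_ev (de m))"
proof (cases "\<exists>l. (l, k) \<in> D")
 case False
 then have "X_entry D k = (\<lambda>l i. sp_even (X l i))" by (auto simp: X_entry_def fun_eq_iff)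
 then show ?thesis using False by (simp add: Delta_rep[symmetric] Delta_def)
next
 case True
 then obtain l where l: "(l, k) \<in> D" by blast
 have u: "(l', k) \<in> D \<longleftrightarrow> l' = l" for l' using D l unfolding marked_diagrams_def by blast
 have lm: "l \<in> {1..m}" using D l unfolding marked_diagrams_def by blast
 interpret sder True "TD m k l" by (rule sder_TD)
 have "TD m k l (prod_list (map (\<lambda>i. rep_ev (xe i (p i))) [1..<m + 1]))
   = prod_list (map (\<lambda>i. X_entry D k i (p i)) [1..<m + 1])" if p: "p permutes {1..m}" for p
 proof -
  let ?h = "\<lambda>i. rep_ev (xe i (p i))"
  have pin: "p i \<in> {1..m}" if "i \<in> {1..m}" for i using permutes_in_image[OF p] that by blast
  have t: "TD m k l (?h i) = (if i = l then zv (veta k (p i)) else 0)" if "i \<in> {1..m}" for i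
   using TD_xe[OF pin[OF that]] by simp
  have mem: "l \<in> set [1..<m + 1]" using lm by auto
  have "TD m k l (prod_list (map ?h [1..<m + 1])) = (if l \<in> set [1..<m + 1] then prod_list (map (?h(l := TD m k l (?h l))) [1..<m + 1]) else 0)"
   by (rule G_prod_list) (use t even_rep_ev in auto)
  also have "\<dots> = prod_list (map (?h(l := TD m k l (?h l))) [1..<m + 1])" by (rule if_P[OF mem])
  also have "map (?h(l := TD m k l (?h l))) [1..<m + 1] = map (\<lambda>i. X_entry D k i (p i)) [1..<m + 1]"
   using lm t[OF lm] by (intro map_cong refl) (auto simp: X_entry_def u rep_xe gvar.simps)
  finally show ?thesis .
 qed
 then have "TD m k l (sdet m (\<lambda>l i. rep_ev (xe l i))) = sdet m (X_entry D k)"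
  unfolding sdet_def by (simp add: G_sum G_sign)
 moreover have "sdet m (\<lambda>l i. rep_ev (xe l i)) = rep_ev (de m)" by (simp add: sdet_rep_ev dt_def)
 ultimately show ?thesis using l by (simp add: u Dl_def)
qed

lemma marked_diagrams_finite: "finite (marked_diagrams m r)" "D \<in> marked_diagrams m r ==> finite D"
proof -
 have "marked_diagrams m r \<subseteq> Pow ({1..m} \<times> {1..r})" by (auto simp: marked_diagrams_def)
 then show "finite (marked_diagrams m r)" by (rule finite_subset) simp
 show "D \<in> marked_diagrams m r ==> finite D"
  unfolding marked_diagrams_def using finite_subset[of D "{1..m} \<times> {1..r}"] by blast
qed

lemma marked_diagrams_Suc:
 "marked_diagrams m (Suc r) = marked_diagrams m r \<union> (\<Union>l\<in>{1..m}. insert (l, Suc r) ` marked_diagrams m r)"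
proof (intro equalityI subsetI)
 fix D assume D: "D \<in> marked_diagrams m (Suc r)"
 have sub: "D \<subseteq> {1..m} \<times> {1..Suc r}" and u: "\<And>j j' i. (j, i) \<in> D ==> (j', i) \<in> D ==> j = j'"
  using D unfolding marked_diagrams_def by blast+
 show "D \<in> marked_diagrams m r \<union> (\<Union>l\<in>{1..m}. insert (l, Suc r) ` marked_diagrams m r)"
 proof (cases "\<exists>l. (l, Suc r) \<in> D")
  case False
  have "(l, k) \<in> {1..m} \<times> {1..r}" if "(l, k) \<in> D" for l k
  proof -
   have "k \<noteq> Suc r" using False that by blast
   then show ?thesis using sub that by fastforce
  qed
  then have "D \<in> marked_diagrams m r" using u unfolding marked_diagrams_def by fast
  then show ?thesis by blast
 next
  case True
  then obtain l where l: "(l, Suc r) \<in> D" by blast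
  define E where "E = D - {(l, Suc r)}"
  have "(l', k) \<in> {1..m} \<times> {1..r}" if "(l', k) \<in> E" for l' k
  proof -
   have "k \<noteq> Suc r" using u[of l' "Suc r" l] l that unfolding E_def by blast
   then show ?thesis using sub that unfolding E_def by fastforce
  qed
  moreover have "j = j'" if "(j, i) \<in> E" "(j', i) \<in> E" for i j j' using that u unfolding E_def by blast
  ultimately have "E \<in> marked_diagrams m r" unfolding marked_diagrams_def by fast
  moreover have "D = insert (l, Suc r) E" using l unfolding E_def by blast
  moreover have "l \<in> {1..m}" using sub l by blast
  ultimately show ?thesis by blast
 qed
next
 fix D assume "D \<in> marked_diagrams m r \<union> (\<Union>l\<in>{1..m}. insert (l, Suc r) ` marked_diagrams m r)"
 then show "D \<in> marked_diagrams m (Suc r)"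
 proof (elim UnE UN_E imageE)
  assume "D \<in> marked_diagrams m r"
  then show ?thesis unfolding marked_diagrams_def by fastforce
 next
  fix l E assume l: "l \<in> {1..m}" and D: "D = insert (l, Suc r) E" and E: "E \<in> marked_diagrams m r"
  have "(j, Suc r) \<notin> E" for j using E unfolding marked_diagrams_def by auto
  then show ?thesis using E l unfolding marked_diagrams_def D by fastforce
 qed
qed

text \<open>
 A marked diagram records which summand is chosen from each factor: none of the \<open>Q k l\<close>, or the one for the row
 \<open>l\<close> of the marked box in column \<open>k\<close>.
\<close>

lemma distribute_marked:
 fixes P :: "nat => superpoly"
 shows "prod_list (map (\<lambda>k. P k + (\<Sum>l\<in>{1..m}. Q k l)) [1..<r + 1])
  = (\<Sum>D\<in>marked_diagrams m r. prod_list (map (\<lambda>k. if \<exists>l. (l, k) \<in> D then Q k (THE l. (l, k) \<in> D) else P k) [1..<r + 1]))"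
proof (induction r)
 case 0
 have "marked_diagrams m 0 = {{}}" by (auto simp: marked_diagrams_def)
 then show ?case by simp
next
 case (Suc r)
 let ?t = "\<lambda>D k. if \<exists>l. (l, k) \<in> D then Q k (THE l. (l, k) \<in> D) else P k"
 let ?F = "\<lambda>D r. prod_list (map (?t D) [1..<r + 1])"
 let ?M = "marked_diagrams m r"
 have new: "(j, Suc r) \<notin> D" if "D \<in> ?M" for D j using that unfolding marked_diagrams_def by auto
 have F: "?F D (Suc r) = ?F D r * ?t D (Suc r)" for D by simp
 have dist: "(\<Sum>D\<in>A. h D * p) + (\<Sum>l\<in>B. \<Sum>D\<in>A. h D * u l) = (\<Sum>D\<in>A. h D) * (p + (\<Sum>l\<in>B. u l))"
  for A :: "(nat \<times> nat) set set" and B :: "nat set" and h u and p :: superpoly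
  by (simp add: distrib_left sum_distrib_right sum_distrib_left sum.swap[of _ B A])
 have F0: "?F D (Suc r) = ?F D r * P (Suc r)" if "D \<in> ?M" for D
  unfolding F using new[OF that] by simp
 have F1: "?F (insert (l, Suc r) D) (Suc r) = ?F D r * Q (Suc r) l" if "D \<in> ?M" for D l
 proof -
  have "(j, Suc r) \<in> insert (l, Suc r) D \<longleftrightarrow> j = l" for j using new[OF that] by auto
  then have "?t (insert (l, Suc r) D) (Suc r) = Q (Suc r) l" by auto
  moreover have "?F (insert (l, Suc r) D) r = ?F D r" by (intro arg_cong[of _ _ prod_list] map_cong) auto
  ultimately show ?thesis unfolding F by simp
 qed
 have inj: "inj_on (insert (l, Suc r)) ?M" for l
  by (rule inj_onI) (simp add: insert_ident[OF new new])
 have disj1: "?M \<inter> (\<Union>l\<in>{1..m}. insert (l, Suc r) ` ?M) = {}"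
 proof -
  have "D \<notin> insert (l, Suc r) ` ?M" if "D \<in> ?M" for D l using new[OF that, of l] by blast
  then show ?thesis by blast
 qed
 have disj2: "insert (l, Suc r) ` ?M \<inter> insert (l', Suc r) ` ?M = {}" if "l \<noteq> l'" for l l'
 proof -
  have "insert (l, Suc r) D \<noteq> insert (l', Suc r) E" if "D \<in> ?M" "E \<in> ?M" for D E
   using new[OF that(2), of l] \<open>l \<noteq> l'\<close> by blast
  then show ?thesis by blast
 qed
 have "(\<Sum>D\<in>marked_diagrams m (Suc r). ?F D (Suc r)) = (\<Sum>D\<in>?M. ?F D (Suc r)) + (\<Sum>D\<in>(\<Union>l\<in>{1..m}. insert (l, Suc r) ` ?M). ?F D (Suc r))"
  unfolding marked_diagrams_Suc by (rule sum.union_disjoint[OF _ _ disj1]) (simp_all add: marked_diagrams_finite)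
 also have "(\<Sum>D\<in>(\<Union>l\<in>{1..m}. insert (l, Suc r) ` ?M). ?F D (Suc r)) = (\<Sum>l\<in>{1..m}. \<Sum>D\<in>insert (l, Suc r) ` ?M. ?F D (Suc r))"
  by (rule sum.UNION_disjoint) (simp_all add: marked_diagrams_finite disj2)
 also have "\<dots> = (\<Sum>l\<in>{1..m}. \<Sum>D\<in>?M. ?F D r * Q (Suc r) l)"
 proof (rule sum.cong[OF refl])
  fix l
  show "(\<Sum>D\<in>insert (l, Suc r) ` ?M. ?F D (Suc r)) = (\<Sum>D\<in>?M. ?F D r * Q (Suc r) l)"
   unfolding sum.reindex[OF inj] comp_def by (rule sum.cong[OF refl], rule F1)
 qed
 also have "(\<Sum>D\<in>?M. ?F D (Suc r)) = (\<Sum>D\<in>?M. ?F D r * P (Suc r))"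
  by (rule sum.cong[OF refl], rule F0)
 also have "\<dots> + (\<Sum>l\<in>{1..m}. \<Sum>D\<in>?M. ?F D r * Q (Suc r) l) = (\<Sum>D\<in>?M. ?F D r) * (P (Suc r) + (\<Sum>l\<in>{1..m}. Q (Suc r) l))"
  by (rule dist)
 also have "\<dots> = prod_list (map (\<lambda>k. P k + (\<Sum>l\<in>{1..m}. Q k l)) [1..<Suc r + 1])"
  unfolding Suc[symmetric] by simp
 finally show ?case by simp
qed

text \<open>Separating the two factors of homogeneous pairs of equal parity costs the sign of reversing the odd factors.\<close>

lemma prod_list_pairs:
 assumes "\<And>k. k \<in> {1..r} ==> has_parity (p k) (a k) \<and> has_parity (p k) (b k)"
 shows "prod_list (map (\<lambda>k. a k * b k) [1..<r + 1])
   = (-1) ^ (card {k\<in>{1..r}. p k} * (card {k\<in>{1..r}. p k} - 1) div 2)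
    * (prod_list (map a [1..<r + 1]) * prod_list (map b [1..<r + 1]))
  \<and> has_parity (odd (card {k\<in>{1..r}. p k})) (prod_list (map b [1..<r + 1]))"
 using assms
proof (induction r)
 case 0
 show ?case by (simp add: has_parity_iff)
next
 case (Suc r)
 let ?c = "card {k\<in>{1..r}. p k}" and ?A = "prod_list (map a [1..<r + 1])" and ?B = "prod_list (map b [1..<r + 1])"
 have IH: "prod_list (map (\<lambda>k. a k * b k) [1..<r + 1]) = (-1) ^ (?c * (?c - 1) div 2) * (?A * ?B)" "has_parity (odd ?c) ?B"
  using Suc by simp_all
 have pa: "has_parity (p (Suc r)) (a (Suc r))" and pb: "has_parity (p (Suc r)) (b (Suc r))" using Suc.prems[of "Suc r"] by simp_all
 have s: "{k\<in>{1..Suc r}. p k} = (if p (Suc r) then insert (Suc r) {k\<in>{1..r}. p k} else {k\<in>{1..r}. p k})"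
  by (auto simp: le_Suc_eq)
 have c: "card {k\<in>{1..Suc r}. p k} = (if p (Suc r) then Suc ?c else ?c)" unfolding s by auto
 have comm: "?B * a (Suc r) = (-1) ^ (if p (Suc r) then ?c else 0) * (a (Suc r) * ?B)"
  using supercommute[OF IH(2), of "a (Suc r)"] pa by (auto simp: kpow_def has_parity_iff)
 have sgn: "(-1) ^ (card {k\<in>{1..Suc r}. p k} * (card {k\<in>{1..Suc r}. p k} - 1) div 2)
   = ((-1) ^ (?c * (?c - 1) div 2) * (-1) ^ (if p (Suc r) then ?c else 0) :: superpoly)"
 proof (cases "p (Suc r)")
  case True
  have "Suc c * c = c * (c - 1) + c * 2" for c :: nat by (cases c) auto
  from this[of ?c] have "Suc ?c * ?c div 2 = ?c * (?c - 1) div 2 + ?c" by simp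
  then show ?thesis using True unfolding c by (simp add: power_add[symmetric])
 next
  case False
  then show ?thesis unfolding c by simp
 qed
 have neg: "z * ((-1) ^ k * w) = (-1) ^ k * (z * w)" for z w :: superpoly and k :: nat
  by (cases "even k") auto
 have "prod_list (map (\<lambda>k. a k * b k) [1..<Suc r + 1]) = (-1) ^ (?c * (?c - 1) div 2) * (?A * (?B * a (Suc r)) * b (Suc r))"
  using IH(1) by (simp add: mult.assoc)
 also have "\<dots> = (-1) ^ (?c * (?c - 1) div 2) * ((-1) ^ (if p (Suc r) then ?c else 0) * (?A * a (Suc r) * (?B * b (Suc r))))"
  unfolding comm neg[of ?A] by (simp only: mult.assoc)
 also have "\<dots> = (-1) ^ (card {k\<in>{1..Suc r}. p k} * (card {k\<in>{1..Suc r}. p k} - 1) div 2)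
    * (prod_list (map a [1..<Suc r + 1]) * prod_list (map b [1..<Suc r + 1]))"
  unfolding sgn by (simp add: mult.assoc)
 finally show ?case
  using has_parity_mult[OF IH(2) pb] unfolding c by (auto split: if_splits)
qed

text \<open>
 Expand each product of entries \<open>ww\<close> by \<open>distribute_marked\<close>. In each term \<open>prod_list_pairs\<close> collects the
 determinants in \<open>x\<close> and \<open>\<eta>\<close> on the left and the entries in \<open>\<xi>\<close> and \<open>y\<close> on the right, which is where
 the sign in the definition of \<open>\<Gamma>\<close> comes from.
\<close>

theorem Gamma_rep: "Gamma m r = rep_ev (dt (we m) r)"
proof -
 let ?M = "marked_diagrams m r" and ?l = "\<lambda>D k. THE l. (l, k) \<in> D"
 have expand: "prod_list (map (\<lambda>k. ww m k (p k)) [1..<r + 1])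
  = (\<Sum>D\<in>?M. (-1) ^ (card D * (card D - 1) div 2) * (prod_list (map (\<lambda>k. sdet m (X_entry D k)) [1..<r + 1])
     * prod_list (map (\<lambda>k. Y_entry D k (p k)) [1..<r + 1])))" for p :: "nat => nat"
 proof -
  have "prod_list (map (\<lambda>k. ww m k (p k)) [1..<r + 1]) = (\<Sum>D\<in>?M. prod_list (map
    (\<lambda>k. if \<exists>l. (l, k) \<in> D then Dl m k (?l D k) * zv (vxi (?l D k) (p k)) else rep_ev (de m) * zv (vy k (p k))) [1..<r + 1]))"
   unfolding ww_def by (rule distribute_marked)
  also have "\<dots> = (\<Sum>D\<in>?M. (-1) ^ (card D * (card D - 1) div 2) * (prod_list (map (\<lambda>k. sdet m (X_entry D k)) [1..<r + 1])
     * prod_list (map (\<lambda>k. Y_entry D k (p k)) [1..<r + 1])))"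
  proof (rule sum.cong[OF refl])
   fix D assume D: "D \<in> ?M"
   have "{k\<in>{1..r}. \<exists>l. (l, k) \<in> D} = snd ` D" using D unfolding marked_diagrams_def by force
   moreover have "inj_on snd D"
   proof (rule inj_onI)
    fix x y assume xy: "x \<in> D" "y \<in> D" "snd x = snd y"
    have "(fst x, snd x) \<in> D" using xy(1) by simp
    moreover have "(fst y, snd x) \<in> D" using xy(2) unfolding xy(3) by simp
    ultimately have "fst x = fst y" using D unfolding marked_diagrams_def by blast
    then show "x = y" using xy(3) by (simp add: prod_eq_iff)
   qed
   ultimately have c: "card {k\<in>{1..r}. \<exists>l. (l, k) \<in> D} = card D" by (simp add: card_image)
   have e: "(if \<exists>l. (l, k) \<in> D then Dl m k (?l D k) * zv (vxi (?l D k) (p k)) else rep_ev (de m) * zv (vy k (p k)))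
     = sdet m (X_entry D k) * Y_entry D k (p k)" for k
    unfolding sdet_X_entry[OF D] Y_entry_def by (auto simp: gvar.simps)
   have par: "has_parity (\<exists>l. (l, k) \<in> D) (sdet m (X_entry D k)) \<and> has_parity (\<exists>l. (l, k) \<in> D) (Y_entry D k (p k))" for k
    unfolding sdet_X_entry[OF D] Y_entry_def
    using has_parity_zv[of "vxi (?l D k) (p k)"] has_parity_zv[of "vy k (p k)"]
    by (auto simp: odd_Dl even_rep_ev gvar.simps)
   show "prod_list (map (\<lambda>k. if \<exists>l. (l, k) \<in> D then Dl m k (?l D k) * zv (vxi (?l D k) (p k)) else rep_ev (de m) * zv (vy k (p k))) [1..<r + 1])
    = (-1) ^ (card D * (card D - 1) div 2) * (prod_list (map (\<lambda>k. sdet m (X_entry D k)) [1..<r + 1])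
     * prod_list (map (\<lambda>k. Y_entry D k (p k)) [1..<r + 1]))"
    unfolding e using prod_list_pairs[of r "\<lambda>k. \<exists>l. (l, k) \<in> D" "\<lambda>k. sdet m (X_entry D k)" "\<lambda>k. Y_entry D k (p k)"] par
    unfolding c by blast
  qed
  finally show ?thesis .
 qed
 have sc: "of_int (sign p) * ((-1) ^ k * (f * g)) = (-1) ^ k * (f * (of_int (sign p) * g))" for p :: "nat => nat" and k :: nat and f g :: superpoly
  by (cases "even k"; auto simp: sign_def)
 have "rep_ev (dt (we m) r) = sdet r (\<lambda>k j. ww m k j)"
  by (simp add: dt_def sdet_rep_ev[symmetric] rep_we)
 also have "\<dots> = (\<Sum>p | p permutes {1..r}. \<Sum>D\<in>?M. (-1) ^ (card D * (card D - 1) div 2) * (prod_list (map (\<lambda>k. sdet m (X_entry D k)) [1..<r + 1])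
     * (of_int (sign p) * prod_list (map (\<lambda>k. Y_entry D k (p k)) [1..<r + 1]))))"
  unfolding sdet_def[of r] expand by (simp only: sum_distrib_left sc)
 also have "\<dots> = Gamma m r"
  unfolding Gamma_def sdet_def[of r "Y_entry _"] by (subst sum.swap) (simp only: sum_distrib_left)
 finally show ?thesis by simp
qed

subsection \<open>The action on the entries\<close>

lemma kpow_zvx: "kpow s (zv (vx l i)) = zv (vx l i)"
 using has_parity_zv[of "vx l i"] by (auto simp: kpow_def has_parity_iff)

context sder
begin

lemma G_cramer:
 assumes "i \<in> {1..m}"
 shows "(\<Sum>l\<in>{1..m}. G (zv (vx l i)) * Dl m k l) + (\<Sum>l\<in>{1..m}. zv (vx l i) * G (Dl m k l))
  = G (rep_ev (de m)) * zv (veta k i) + rep_ev (de m) * G (zv (veta k i))"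
 using arg_cong[OF cramer[OF assms, of k], of G]
 by (simp add: G_sum G_mult kpow_zvx sum.distrib)

lemma G_ww: "G (ww m k j) = G (rep_ev (de m)) * zv (vy k j) + rep_ev (de m) * G (zv (vy k j))
  + (\<Sum>l\<in>{1..m}. G (Dl m k l) * zv (vxi l j) + kpow s (Dl m k l) * G (zv (vxi l j)))"
 by (simp add: ww_def G_add G_sum G_mult)

text \<open>
 Applying \<open>G\<close> to Cramer's rule determines its values on \<open>Dl\<close> from those on the variables.
\<close>

lemma G_Dl_unique:
 assumes "\<And>i. i \<in> {1..m} ==> G (rep_ev (de m)) * zv (veta k i) + rep_ev (de m) * G (zv (veta k i))
   = (\<Sum>l\<in>{1..m}. G (zv (vx l i)) * Dl m k l) + (\<Sum>l\<in>{1..m}. zv (vx l i) * u l)" and "l \<in> {1..m}"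
 shows "G (Dl m k l) = u l"
proof (rule cramer_unique[OF _ assms(2)])
 fix i assume i: "i \<in> {1..m}"
 show "(\<Sum>l\<in>{1..m}. zv (vx l i) * G (Dl m k l)) = (\<Sum>l\<in>{1..m}. zv (vx l i) * u l)"
  using G_cramer[OF i, of k] assms(1)[OF i] by simp
qed

end

lemma sder_Inl: "sder (odd_idx a \<noteq> odd_idx b) (poly_act p q m n (Inl (a, b)))"
 using sder_poly_act[of p q m n "Inl (a, b)"] unfolding odd_unit_Inl .

lemma sder_Inr: "sder (odd_idx a \<noteq> odd_idx b) (poly_act p q m n (Inr (a, b)))"
 using sder_poly_act[of p q m n "Inr (a, b)"] unfolding odd_unit_Inr .

lemma koszul_simps [simp]: "koszul False s = 1" "koszul s False = 1" "koszul True True = -1"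
 by (auto simp: koszul_def)

lemma left_even_de:
 assumes "e \<in> {1..m}" "e' \<in> {1..m}"
 shows "poly_act m q m n (Inl (Inl e, Inl e')) (rep_ev (de m)) = (if e = e' then rep_ev (de m) else 0)"
proof (rule dt_col[OF _ assms])
 show "sder False (poly_act m q m n (Inl (Inl e, Inl e')))" using sder_Inl[of "Inl e" "Inl e'"] by simp
qed (simp add: rep_xe act_Inl_gen sidx_simps)

text \<open>
 Under the first action the elements \<open>ww\<close> form a row vector on which the even block acts through the trace and
 the odd block in the standard way (\<open>left_delta_ww\<close>); the odd simple root vector kills them.
\<close>

lemma left_even_ww:
 assumes e: "e \<in> {1..m}" "e' \<in> {1..m}" and k: "k \<in> {1..n}"
 shows "poly_act m q m n (Inl (Inl e, Inl e')) (ww m k j) = (if e = e' then ww m k j else 0)"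
proof -
 let ?G = "poly_act m q m n (Inl (Inl e, Inl e'))"
 interpret sder False ?G using sder_Inl[of "Inl e" "Inl e'"] by simp
 note [simp] = act_Inl_gen sidx_simps left_even_de[OF e]
 have D: "?G (Dl m k l) = (if e = e' then Dl m k l else 0)" if "l \<in> {1..m}" for l
 proof (rule G_Dl_unique[OF _ that])
  fix i assume i: "i \<in> {1..m}"
  have "(\<Sum>l\<in>{1..m}. ?G (zv (vx l i)) * Dl m k l) = (if i = e' then rep_ev (de m) * zv (veta k e) else 0)"
   using cramer[OF e(1), of k] by simp
  moreover have "(\<Sum>l\<in>{1..m}. zv (vx l i) * (if e = e' then Dl m k l else 0)) = (if e = e' then rep_ev (de m) * zv (veta k i) else 0)"
   using cramer[OF i, of k] by simp
  ultimately show "?G (rep_ev (de m)) * zv (veta k i) + rep_ev (de m) * ?G (zv (veta k i))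
   = (\<Sum>l\<in>{1..m}. ?G (zv (vx l i)) * Dl m k l) + (\<Sum>l\<in>{1..m}. zv (vx l i) * (if e = e' then Dl m k l else 0))"
   using k by simp
 qed
 show ?thesis unfolding G_ww using k by (auto simp: D kpow_def ww_def cong: sum.cong_simp)
qed

lemma left_kills_x_part:
 assumes "k \<in> {1..n}" "\<And>e. b \<noteq> Inl e"
 shows "poly_act m q m n (Inl (a, b)) (rep_ev (de m)) = 0" "l \<in> {1..m} ==> poly_act m q m n (Inl (a, b)) (Dl m k l) = 0"
proof -
 interpret sder "odd_idx a \<noteq> odd_idx b" "poly_act m q m n (Inl (a, b))" by (rule sder_Inl)
 note [simp] = act_Inl_gen sidx_simps
 have b: "Inl e \<noteq> b" for e using assms(2) by blast
 show d: "poly_act m q m n (Inl (a, b)) (rep_ev (de m)) = 0"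
  by (rule dt_kill[OF sder_Inl]) (use b in \<open>simp add: rep_xe\<close>)
 show "poly_act m q m n (Inl (a, b)) (Dl m k l) = 0" if "l \<in> {1..m}"
  by (rule G_Dl_unique[OF _ that]) (use assms(1) d b in simp)
qed

lemma left_delta_ww:
 assumes k: "k \<in> {1..n}"
 shows "poly_act m q m n (Inl (Inr a, Inr b)) (ww m k j) = (if j = b then ww m k a else 0)"
proof -
 let ?G = "poly_act m q m n (Inl (Inr a, Inr b))"
 interpret sder False ?G using sder_Inl[of "Inr a" "Inr b"] by simp
 have "?G (rep_ev (de m)) = 0" and "\<And>l. l \<in> {1..m} ==> ?G (Dl m k l) = 0"
  using left_kills_x_part[OF k, of "Inr b"] by auto
 then show ?thesis unfolding G_ww using k by (auto simp: act_Inl_gen sidx_simps kpow_def ww_def cong: sum.cong_simp)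
qed

text \<open>
 The operator turns \<open>\<xi>\<close> and \<open>y\<close> into \<open>x\<close> and \<open>\<eta>\<close>, and the two contributions cancel by Cramer's rule.
\<close>

lemma left_odd_ww:
 assumes k: "k \<in> {1..n}" and m: "m \<ge> 1"
 shows "poly_act m q m n (Inl (Inl m, Inr 1)) (ww m k j) = 0"
proof -
 let ?G = "poly_act m q m n (Inl (Inl m, Inr 1))"
 interpret sder True ?G using sder_Inl[of "Inl m" "Inr 1"] by simp
 have d: "?G (rep_ev (de m)) = 0" and D: "\<And>l. l \<in> {1..m} ==> ?G (Dl m k l) = 0"
  using left_kills_x_part[OF k, of "Inr 1"] by auto
 have "(\<Sum>l\<in>{1..m}. Dl m k l * zv (vx l m)) = rep_ev (de m) * zv (veta k m)"
  using cramer[of m m k] m by (simp add: even_zvx)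
 then show ?thesis unfolding G_ww using k by (auto simp: d D act_Inl_gen sidx_simps kpow_def kap_Dl sum_negf simp del: One_nat_def cong: sum.cong_simp)
qed

lemma right_even_de:
 assumes "a \<in> {1..m}" "b \<in> {1..m}"
 shows "poly_act m q m n (Inr (Inl a, Inl b)) (rep_ev (de m)) = (if a = b then rep_ev (de m) else 0)"
proof (rule dt_row[OF _ assms])
 show "sder False (poly_act m q m n (Inr (Inl a, Inl b)))" using sder_Inr[of "Inl a" "Inl b"] by simp
qed (simp add: rep_xe act_Inr_gen sidx_simps)

text \<open>
 On \<open>Dl\<close> the operator acts contragrediently, which compensates its action on \<open>\<xi>\<close>.
\<close>

lemma right_even_ww:
 assumes ab: "a \<in> {1..m}" "b \<in> {1..m}" and j: "j \<in> {1..q}"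
 shows "poly_act m q m n (Inr (Inl a, Inl b)) (ww m k j) = (if a = b then ww m k j else 0)"
proof -
 let ?G = "poly_act m q m n (Inr (Inl a, Inl b))"
 interpret sder False ?G using sder_Inr[of "Inl a" "Inl b"] by simp
 note [simp] = act_Inr_gen sidx_simps right_even_de[OF ab]
 have if_distrib_mult: "(if P then x else 0) * y = (if P then x * y else 0)" "y * (if P then x else 0) = (if P then y * x else 0)" for P and x y :: superpoly by auto
 have D: "?G (Dl m k l) = (if a = b then Dl m k l else 0) - (if l = a then Dl m k b else 0)" if "l \<in> {1..m}" for l
 proof (rule G_Dl_unique[OF _ that])
  fix i assume i: "i \<in> {1..m}"
  have "(\<Sum>l\<in>{1..m}. ?G (zv (vx l i)) * Dl m k l) = zv (vx a i) * Dl m k b"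
   using i ab by (simp add: if_distrib_mult)
  moreover have "(\<Sum>l\<in>{1..m}. zv (vx l i) * ((if a = b then Dl m k l else 0) - (if l = a then Dl m k b else 0)))
   = (if a = b then rep_ev (de m) * zv (veta k i) else 0) - zv (vx a i) * Dl m k b"
   using cramer[OF i, of k] ab by (simp add: right_diff_distrib sum_subtractf if_distrib_mult)
  ultimately show "?G (rep_ev (de m)) * zv (veta k i) + rep_ev (de m) * ?G (zv (veta k i))
   = (\<Sum>l\<in>{1..m}. ?G (zv (vx l i)) * Dl m k l) + (\<Sum>l\<in>{1..m}. zv (vx l i) * ((if a = b then Dl m k l else 0) - (if l = a then Dl m k b else 0)))"
   using i by simp
 qed
 have "(\<Sum>l\<in>{1..m}. ?G (Dl m k l) * zv (vxi l j) + kpow False (Dl m k l) * ?G (zv (vxi l j)))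
  = (\<Sum>l\<in>{1..m}. (if a = b then Dl m k l * zv (vxi l j) else 0) - (if l = a then Dl m k b * zv (vxi a j) else 0) + (if l = b then Dl m k b * zv (vxi a j) else 0))"
  using j by (intro sum.cong) (auto simp: D kpow_def left_diff_distrib)
 also have "\<dots> = (if a = b then (\<Sum>l\<in>{1..m}. Dl m k l * zv (vxi l j)) else 0)"
  using ab by (simp add: sum.distrib sum_subtractf)
 finally show ?thesis unfolding G_ww using j by (auto simp: ww_def)
qed

lemma right_delta_ww:
 assumes j: "j \<in> {1..q}"
 shows "poly_act m q m n (Inr (Inr a, Inr b)) (ww m k j) = (if k = b then ww m a j else 0)"
  "poly_act m q m n (Inr (Inr a, Inr b)) (rep_ev (de m)) = 0"
proof -
 let ?G = "poly_act m q m n (Inr (Inr a, Inr b))"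
 interpret sder False ?G using sder_Inr[of "Inr a" "Inr b"] by simp
 note [simp] = act_Inr_gen sidx_simps
 show d: "?G (rep_ev (de m)) = 0"
  by (rule dt_kill[where s = False]) (use sder_axioms in \<open>simp_all add: rep_xe\<close>)
 have D: "?G (Dl m k l) = (if k = b then Dl m a l else 0)" if "l \<in> {1..m}" for l
  by (rule G_Dl_unique[OF _ that]) (use cramer[of _ m a] d in simp)
 show "?G (ww m k j) = (if k = b then ww m a j else 0)"
  unfolding G_ww using j by (auto simp: D d kpow_def ww_def cong: sum.cong_simp)
qed

lemma right_odd_ww:
 assumes j: "j \<in> {1..q}" and m: "m \<ge> 1"
 shows "poly_act m q m n (Inr (Inl m, Inr 1)) (ww m k j) = 0" "poly_act m q m n (Inr (Inl m, Inr 1)) (rep_ev (de m)) = 0"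
proof -
 let ?G = "poly_act m q m n (Inr (Inl m, Inr 1))"
 interpret sder True ?G using sder_Inr[of "Inl m" "Inr 1"] by simp
 note [simp] = act_Inr_gen sidx_simps
 show d: "?G (rep_ev (de m)) = 0"
  by (rule dt_kill[where s = True]) (use sder_axioms in \<open>simp_all add: rep_xe\<close>)
 have if_distrib_mult: "(if P then x else 0) * y = (if P then x * y else 0)" "y * (if P then x else 0) = (if P then y * x else 0)" for P and x y :: superpoly by auto
 have D: "?G (Dl m k l) = (if l = m then if k = 1 then rep_ev (de m) else 0 else 0)" if "l \<in> {1..m}" for l
  by (rule G_Dl_unique[OF _ that]) (use d m in \<open>auto simp: if_distrib_mult rep_ev_commute\<close>)
 have "(\<Sum>l\<in>{1..m}. ?G (Dl m k l) * zv (vxi l j) + kpow True (Dl m k l) * ?G (zv (vxi l j)))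
   = (\<Sum>l\<in>{1..m}. if l = m then (if k = 1 then rep_ev (de m) * zv (vxi m j) else 0) else 0)"
  using j by (intro sum.cong) (auto simp: D simp del: One_nat_def)
 then show "?G (ww m k j) = 0" unfolding G_ww using j m by (auto simp: d simp del: One_nat_def)
qed

section \<open>Joint weights of products and quotients\<close>

lemma of_nat_scale: "sp_scale (of_nat k) f = of_nat k * f"
 by (induction k) (simp_all add: SP.scale_left_distrib distrib_right)

text \<open>
 A description by derivatives, hence one that passes to products and, where cancellation is possible, to
 quotients.
\<close>

lemma superpolys_dd: "f \<in> superpolys p q m n \<longleftrightarrow> (\<forall>A. \<not> in_range p q m n A \<longrightarrow> dd A f = 0)"
proof
 assume f: "f \<in> superpolys p q m n"
 show "\<forall>A. \<not> in_range p q m n A \<longrightarrow> dd A f = 0"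
 proof (intro allI impI cf_eqI)
  fix A x assume A: "\<not> in_range p q m n A"
  have "cf f (up A x) = 0" if "raisable A x"
   using f A cnt_up[OF that] unfolding superpolys_iff by (metis zero_less_Suc)
  then show "cf (dd A f) x = cf 0 x" by (simp add: cf_dd)
 qed
next
 assume *: "\<forall>A. \<not> in_range p q m n A \<longrightarrow> dd A f = 0"
 show "f \<in> superpolys p q m n"
  unfolding superpolys_iff
 proof (intro allI impI, rule ccontr)
  fix x A assume x: "cf f x \<noteq> 0" "cnt A x > 0" and A: "\<not> in_range p q m n A"
  have "cf (dd A f) (down A x) = of_nat (cnt A (down A x) + 1) * eps A (down A x) * cf f x"
   using x(2) by (simp add: cf_dd raisable_down up_down)
  moreover have "of_nat (cnt A (down A x) + 1) \<noteq> (0::complex)" by (simp only: of_nat_eq_0_iff)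
  ultimately show False using x(1) * A by simp
 qed
qed

lemma superpolys_mult: "f \<in> superpolys p q m n ==> g \<in> superpolys p q m n ==> f * g \<in> superpolys p q m n"
 by (simp add: superpolys_dd dd_mult)

lemma superpolys_one: "1 \<in> superpolys p q m n"
 by (simp add: superpolys_dd)

lemma superpolys_zv: "a \<in> sidx p q ==> c \<in> sidx m n ==> zv (gvar a c) \<in> superpolys p q m n"
 by (auto simp: superpolys_dd dd_zv)

lemma superpolys_sum: "(\<And>i. i \<in> I ==> h i \<in> superpolys p q m n) ==> sum h I \<in> superpolys p q m n"
 by (simp add: superpolys_dd)

lemma superpolys_dt:
 "(\<And>l j. l \<in> {1..r} ==> j \<in> {1..r} ==> rep_ev (a l j) \<in> superpolys p q m n) ==> rep_ev (dt a r) \<in> superpolys p q m n"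
 unfolding superpolys_dd by (meson dt_kill sder_dd)

lemma superpolys_de: "r \<le> m ==> rep_ev (de r) \<in> superpolys m q m n"
 by (rule superpolys_dt) (simp add: rep_xe superpolys_zv)

lemma superpolys_ww:
 assumes "k \<in> {1..n}" "j \<in> {1..q}" shows "ww m k j \<in> superpolys m q m n"
proof -
 have "Dl m k l \<in> superpolys m q m n" if l: "l \<in> {1..m}" for l
  unfolding Dl_cof cof_def
  by (intro superpolys_sum superpolys_mult superpolys_zv dd_superpolys superpolys_de) (use assms in auto)
 then show ?thesis unfolding ww_def using assms
  by (intro SP.subspace_add[OF superpolys_subspace] superpolys_sum superpolys_mult superpolys_zv superpolys_de) auto
qed

text \<open>
 Joint weight vectors killed by the simple root vectors. Zero is allowed, and the weights are given by arbitrary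
 functions, so that they add up under products.
\<close>

definition hwp :: "nat => nat => nat => (sindex => nat) => (sindex => nat) => superpoly => bool" where
 "hwp m q n \<alpha> \<beta> f \<longleftrightarrow> f \<in> superpolys m q m n \<and>
  (\<forall>a\<in>sidx m q. poly_act m q m n (Inl (a, a)) f = of_nat (\<alpha> a) * f) \<and>
  (\<forall>a\<in>sidx m n. poly_act m q m n (Inr (a, a)) f = of_nat (\<beta> a) * f) \<and>
  (\<forall>x\<in>simple_roots m q. poly_act m q m n (Inl x) f = 0) \<and>
  (\<forall>x\<in>simple_roots m n. poly_act m q m n (Inr x) f = 0)"

lemma joint_of_hwp:
 assumes "hwp m q n \<alpha> \<beta> f" "f \<noteq> 0" "\<And>a. a \<in> sidx m q ==> \<alpha> a = hook_weight m \<nu> a" "\<And>a. a \<in> sidx m n ==> \<beta> a = hook_weight m \<nu> a"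
 shows "joint_hw_vector m q n \<nu> f"
 using assms by (simp add: joint_hw_vector_def highest_weight_vector_def hwp_def of_nat_scale)

lemma sder_diag: "sder False (poly_act p q m n (Inl (a, a)))" "sder False (poly_act p q m n (Inr (a, a)))"
 using sder_Inl[of a a] sder_Inr[of a a] by simp_all

lemma hwp_one: "hwp m q n (\<lambda>_. 0) (\<lambda>_. 0) 1"
 using sder.G_one[OF sder_poly_act] by (simp add: hwp_def superpolys_one)

lemma weight_mult:
 assumes "sder False G" "G f = of_nat a * f" "G g = of_nat b * g"
 shows "G (f * g) = of_nat (a + b) * (f * g)"
proof -
 have "f * (of_nat b * g) = of_nat b * (f * g)" by (metis mult.assoc mult_of_nat_commute)
 then show ?thesis using assms by (simp add: sder.G_mult kpow_def distrib_right mult.assoc)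
qed

lemma kill_mult: "sder s G ==> G f = 0 ==> G g = 0 ==> G (f * g) = 0"
 by (simp add: sder.G_mult)

lemma hwp_mult:
 assumes "hwp m q n \<alpha> \<beta> f" "hwp m q n \<alpha>' \<beta>' g"
 shows "hwp m q n (\<lambda>a. \<alpha> a + \<alpha>' a) (\<lambda>a. \<beta> a + \<beta>' a) (f * g)"
 using assms unfolding hwp_def
 by (auto simp: superpolys_mult weight_mult[OF sder_diag(1)] weight_mult[OF sder_diag(2)] simp del: of_nat_add
   intro: kill_mult[OF sder_poly_act])

lemma hwp_prod_list:
 "(\<And>x. x \<in> set xs ==> hwp m q n (\<alpha> x) (\<beta> x) (h x)) ==>
  hwp m q n (\<lambda>a. \<Sum>x\<leftarrow>xs. \<alpha> x a) (\<lambda>a. \<Sum>x\<leftarrow>xs. \<beta> x a) (prod_list (map h xs))"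
 by (induction xs) (simp_all add: hwp_one hwp_mult)

lemma hwp_power: "hwp m q n \<alpha> \<beta> (rep_ev c) ==> hwp m q n (\<lambda>a. k * \<alpha> a) (\<lambda>a. k * \<beta> a) (rep_ev (c ^ k))"
proof (induction k)
 case 0 then show ?case using hwp_one by simp
next
 case (Suc k) then show ?case using hwp_mult[OF Suc.prems Suc.IH] by simp
qed

text \<open>A quotient by a power of \<open>\<Delta>\<^sub>m\<close> is again a joint weight vector since \<open>\<Delta>\<^sub>m\<close> is not a zero divisor.\<close>

lemma hwp_div:
 assumes d: "hwp m q n \<alpha>' \<beta>' (rep_ev (de m))"
  and h: "hwp m q n (\<lambda>a. k * \<alpha>' a + \<alpha> a) (\<lambda>a. k * \<beta>' a + \<beta> a) (rep_ev (de m ^ k) * f)"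
 shows "hwp m q n \<alpha> \<beta> f"
proof -
 let ?d = "rep_ev (de m ^ k)"
 note p = hwp_power[OF d, of k]
 have weight: "G f = of_nat b * f" if G: "sder False G" "G ?d = of_nat a * ?d" "G (?d * f) = of_nat (a + b) * (?d * f)" for G a b
 proof (rule de_cancel[of m k])
  have "?d * G f = G (?d * f) - G ?d * f" using sder.G_ev_mult[OF G(1)] by (simp del: rep_ev_power)
  also have "\<dots> = of_nat b * (?d * f)" unfolding G(2,3) by (simp add: distrib_right mult.assoc)
  also have "\<dots> = ?d * (of_nat b * f)" by (metis mult.assoc mult_of_nat_commute)
  finally show "?d * G f = ?d * (of_nat b * f)" .
 qed
 have kill: "G f = 0" if G: "sder s G" "G ?d = 0" "G (?d * f) = 0" for G s
  by (rule de_cancel[of m k]) (use sder.G_ev_mult[OF G(1), of "de m ^ k" f] G in \<open>simp del: rep_ev_power\<close>)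
 show ?thesis unfolding hwp_def
 proof (intro conjI ballI)
  show "f \<in> superpolys m q m n"
   unfolding superpolys_dd
   using kill[OF sder_dd] p h unfolding hwp_def superpolys_dd by blast
  show "poly_act m q m n (Inl (a, a)) f = of_nat (\<alpha> a) * f" if "a \<in> sidx m q" for a
   by (rule weight[OF sder_diag(1)]) (use p h that in \<open>unfold hwp_def, blast+\<close>)
  show "poly_act m q m n (Inr (a, a)) f = of_nat (\<beta> a) * f" if "a \<in> sidx m n" for a
   by (rule weight[OF sder_diag(2)]) (use p h that in \<open>unfold hwp_def, blast+\<close>)
  show "poly_act m q m n (Inl x) f = 0" if "x \<in> simple_roots m q" for x
   by (rule kill[OF sder_poly_act]) (use p h that in \<open>unfold hwp_def, blast+\<close>)
  show "poly_act m q m n (Inr x) f = 0" if "x \<in> simple_roots m n" for x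
   by (rule kill[OF sder_poly_act]) (use p h that in \<open>unfold hwp_def, blast+\<close>)
 qed
qed

lemma simple_rootsE:
 assumes "x \<in> simple_roots m n"
 obtains i where "x = (Inl i, Inl (Suc i))" "1 \<le> i" "Suc i \<le> m"
 | j where "x = (Inr j, Inr (Suc j))" "1 \<le> j" "Suc j \<le> n"
 | "x = (Inl m, Inr 1)" "1 \<le> m" "1 \<le> n"
proof -
 consider i where "x = (Inl (i - 1), Inl i)" "1 < i" "i \<le> m" | j where "x = (Inr (j - 1), Inr j)" "1 < j" "j \<le> n"
  | "x = (Inl m, Inr 1)" "1 \<le> m" "1 \<le> n"
  using assms unfolding Defs.simple_roots_def by (auto split: if_splits)
 then show ?thesis
 proof cases
  case (1 i) then show ?thesis using that(1)[of "i - 1"] by simp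
 next
  case (2 j) then show ?thesis using that(2)[of "j - 1"] by simp
 qed (use that(3) in simp)
qed

lemma sidxE:
 assumes "a \<in> sidx m n"
 obtains i where "a = Inl i" "i \<in> {1..m}" | j where "a = Inr j" "j \<in> {1..n}"
 using assms unfolding sidx_def by blast

text \<open>\<open>\<Delta>\<^sub>r\<close> is killed by raising operators: they copy one column (or row) onto another.\<close>

lemma hwp_Delta:
 assumes r: "r \<le> m"
 defines "\<alpha> \<equiv> \<lambda>a. case a of Inl i => of_bool (i \<le> r) | Inr j => (0::nat)"
 shows "hwp m q n \<alpha> \<alpha> (rep_ev (de r))"
proof -
 let ?L = "\<lambda>a b. poly_act m q m n (Inl (a, b))" and ?R = "\<lambda>a b. poly_act m q m n (Inr (a, b))"
 have L: "?L (Inl e) (Inl e') (rep_ev (de r)) = (if e = e' \<and> e' \<le> r then rep_ev (de r) else 0)"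
  if e: "e \<in> {1..m}" "e' \<in> {1..m}" "e \<le> e'" for e e'
 proof (cases "e' \<le> r")
  case True
  have "?L (Inl e) (Inl e') (rep_ev (de r)) = (if e = e' then rep_ev (de r) else 0)"
   by (rule dt_col) (use True e r sder_Inl[of "Inl e" "Inl e'"] in \<open>auto simp: rep_xe act_Inl_gen\<close>)
  then show ?thesis using True by simp
 next
  case False
  have "?L (Inl e) (Inl e') (rep_ev (de r)) = 0"
   by (rule dt_kill[OF sder_poly_act]) (use False r in \<open>auto simp: rep_xe act_Inl_gen\<close>)
  then show ?thesis using False by simp
 qed
 have L0: "?L a (Inr b) (rep_ev (de r)) = 0" for a b
  by (rule dt_kill[OF sder_poly_act]) (use r in \<open>auto simp: rep_xe act_Inl_gen\<close>)
 have R: "?R (Inl e) (Inl e') (rep_ev (de r)) = (if e = e' \<and> e' \<le> r then rep_ev (de r) else 0)"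
  if e: "e \<in> {1..m}" "e' \<in> {1..m}" "e \<le> e'" for e e'
 proof (cases "e' \<le> r")
  case True
  have "?R (Inl e) (Inl e') (rep_ev (de r)) = (if e = e' then rep_ev (de r) else 0)"
   by (rule dt_row) (use True e r sder_Inr[of "Inl e" "Inl e'"] in \<open>auto simp: rep_xe act_Inr_gen\<close>)
  then show ?thesis using True by simp
 next
  case False
  have "?R (Inl e) (Inl e') (rep_ev (de r)) = 0"
   by (rule dt_kill[OF sder_poly_act]) (use False r in \<open>auto simp: rep_xe act_Inr_gen\<close>)
  then show ?thesis using False by simp
 qed
 have R0: "?R a (Inr b) (rep_ev (de r)) = 0" for a b
  by (rule dt_kill[OF sder_poly_act]) (use r in \<open>auto simp: rep_xe act_Inr_gen\<close>)
 show ?thesis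
  unfolding hwp_def \<alpha>_def
 proof (intro conjI ballI)
  show "rep_ev (de r) \<in> superpolys m q m n" using r by (rule superpolys_de)
  show "?L a a (rep_ev (de r)) = of_nat (case a of Inl i => of_bool (i \<le> r) | Inr j => 0) * rep_ev (de r)" if "a \<in> sidx m q" for a
   using that by (elim sidxE) (auto simp: L L0)
  show "?R a a (rep_ev (de r)) = of_nat (case a of Inl i => of_bool (i \<le> r) | Inr j => 0) * rep_ev (de r)" if "a \<in> sidx m n" for a
   using that by (elim sidxE) (auto simp: R R0)
  show "poly_act m q m n (Inl x) (rep_ev (de r)) = 0" if "x \<in> simple_roots m q" for x
   using that by (elim simple_rootsE) (auto simp: L L0 simp del: One_nat_def)
  show "poly_act m q m n (Inr x) (rep_ev (de r)) = 0" if "x \<in> simple_roots m n" for x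
   using that by (elim simple_rootsE) (auto simp: R R0 simp del: One_nat_def)
 qed
qed

text \<open>
 The even operators act on the determinant of the entries \<open>ww\<close> by row and column operations or by scalars, and
 the odd simple root vectors kill the entries.
\<close>

lemma hwp_Gamma:
 assumes r: "r \<le> q" "r \<le> n"
 defines "\<alpha> \<equiv> \<lambda>a. case a of Inl i => r | Inr j => of_bool (j \<le> r)"
 shows "hwp m q n \<alpha> \<alpha> (rep_ev (dt (we m) r))"
proof -
 let ?L = "\<lambda>a b. poly_act m q m n (Inl (a, b))" and ?R = "\<lambda>a b. poly_act m q m n (Inr (a, b))" and ?g = "rep_ev (dt (we m) r)"
 have L1: "?L (Inl e) (Inl e') ?g = (if e = e' then of_nat r * ?g else 0)" if e: "e \<in> {1..m}" "e' \<in> {1..m}" for e e'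
 proof (cases "e = e'")
  case True
  have "?L (Inl e) (Inl e') ?g = of_nat r * ?g"
   by (rule dt_scalar) (use True e r sder_Inl[of "Inl e" "Inl e'"] left_even_ww in \<open>auto simp: rep_we\<close>)
  then show ?thesis using True by simp
 next
  case False
  have "?L (Inl e) (Inl e') ?g = 0"
   by (rule dt_kill[OF sder_poly_act]) (use False e r left_even_ww in \<open>auto simp: rep_we\<close>)
  then show ?thesis using False by simp
 qed
 have R1: "?R (Inl e) (Inl e') ?g = (if e = e' then of_nat r * ?g else 0)" if e: "e \<in> {1..m}" "e' \<in> {1..m}" for e e'
 proof (cases "e = e'")
  case True
  have "?R (Inl e) (Inl e') ?g = of_nat r * ?g"
   by (rule dt_scalar) (use True e r sder_Inr[of "Inl e" "Inl e'"] right_even_ww in \<open>auto simp: rep_we\<close>)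
  then show ?thesis using True by simp
 next
  case False
  have "?R (Inl e) (Inl e') ?g = 0"
   by (rule dt_kill[OF sder_poly_act]) (use False e r right_even_ww in \<open>auto simp: rep_we\<close>)
  then show ?thesis using False by simp
 qed
 have L2: "?L (Inr e) (Inr e') ?g = (if e = e' \<and> e' \<le> r then ?g else 0)" if e: "1 \<le> e" "e \<le> e'" for e e'
 proof (cases "e' \<le> r")
  case True
  have "?L (Inr e) (Inr e') ?g = (if e = e' then ?g else 0)"
   by (rule dt_col) (use True e r sder_Inl[of "Inr e" "Inr e'"] left_delta_ww in \<open>auto simp: rep_we\<close>)
  then show ?thesis using True by simp
 next
  case False
  have "?L (Inr e) (Inr e') ?g = 0"
   by (rule dt_kill[OF sder_poly_act]) (use False r left_delta_ww in \<open>auto simp: rep_we\<close>)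
  then show ?thesis using False by simp
 qed
 have R2: "?R (Inr e) (Inr e') ?g = (if e = e' \<and> e' \<le> r then ?g else 0)" if e: "1 \<le> e" "e \<le> e'" for e e'
 proof (cases "e' \<le> r")
  case True
  have "?R (Inr e) (Inr e') ?g = (if e = e' then ?g else 0)"
   by (rule dt_row) (use True e r sder_Inr[of "Inr e" "Inr e'"] right_delta_ww in \<open>auto simp: rep_we\<close>)
  then show ?thesis using True by simp
 next
  case False
  have "?R (Inr e) (Inr e') ?g = 0"
   by (rule dt_kill[OF sder_poly_act]) (use False r right_delta_ww in \<open>auto simp: rep_we\<close>)
  then show ?thesis using False by simp
 qed
 have L3: "?L (Inl m) (Inr 1) ?g = 0" if "1 \<le> m"
  by (rule dt_kill[OF sder_poly_act]) (use that r left_odd_ww in \<open>auto simp: rep_we simp del: One_nat_def\<close>)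
 have R3: "?R (Inl m) (Inr 1) ?g = 0" if "1 \<le> m"
  by (rule dt_kill[OF sder_poly_act]) (use that r right_odd_ww in \<open>auto simp: rep_we simp del: One_nat_def\<close>)
 show ?thesis
  unfolding hwp_def \<alpha>_def
 proof (intro conjI ballI)
  show "?g \<in> superpolys m q m n" by (rule superpolys_dt) (use r in \<open>auto simp: rep_we intro!: superpolys_ww\<close>)
  show "?L a a ?g = of_nat (case a of Inl i => r | Inr j => of_bool (j \<le> r)) * ?g" if "a \<in> sidx m q" for a
   using that by (elim sidxE) (auto simp: L1 L2)
  show "?R a a ?g = of_nat (case a of Inl i => r | Inr j => of_bool (j \<le> r)) * ?g" if "a \<in> sidx m n" for a
   using that by (elim sidxE) (auto simp: R1 R2)
  show "poly_act m q m n (Inl x) ?g = 0" if "x \<in> simple_roots m q" for x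
   using that by (elim simple_rootsE) (auto simp: L1 L2 L3 simp del: One_nat_def)
  show "poly_act m q m n (Inr x) ?g = 0" if "x \<in> simple_roots m n" for x
   using that by (elim simple_rootsE) (auto simp: R1 R2 R3 simp del: One_nat_def)
 qed
qed

lemma body_Gamma: "body (rep_ev (dt (we m) r)) \<noteq> 0"
proof (rule body_dt_nonzero[where N = r and c = "de m"])
 fix r
 obtain v where v: "vy (Suc r) (Suc r) = Inl v" using gvar_Inl_ex[of "Inr (Suc r)" "Inr (Suc r)"] by auto
 let ?A = "vy (Suc r) (Suc r)"
 interpret sder False "dd ?A" using sder_dd[of ?A] by simp
 have d: "dd ?A (rep_ev (de m)) = 0"
  by (rule dt_kill[OF sder_dd]) (simp add: dd_xe)
 have D: "dd ?A (Dl m k l) = 0" if "l \<in> {1..m}" for k l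
  by (rule G_Dl_unique[OF _ that]) (simp add: d dd_zv)
 have "dd ?A (ww m l j) = (if l = Suc r \<and> j = Suc r then rep_ev (de m) else 0)" for l j
  unfolding G_ww d by (auto simp: D dd_zv kpow_def cong: sum.cong_simp)
 then have "dd (Inl v) (ww m l j) = (if l = Suc r \<and> j = Suc r then rep_ev (de m) else 0)" for l j
  unfolding v .
 then show "\<exists>v. \<forall>l\<in>{1..Suc r}. \<forall>j\<in>{1..Suc r}. dd (Inl v) (rep_ev (we m l j)) = (if l = Suc r \<and> j = Suc r then rep_ev (de m) else 0)"
  by (intro exI[of _ v] ballI) (simp only: rep_we)
qed (auto simp: body_de)

section \<open>Divisibility by powers of \<open>\<Delta>\<^sub>m\<close>\<close>

lemma rep_ev_left_commute: "f * (rep_ev a * g) = rep_ev a * (f * g)"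
 by (simp only: mult.assoc[symmetric] rep_ev_commute[of a f])

lemma zvx_left_commute: "f * (zv (vx l i) * g) = zv (vx l i) * (f * g)"
 by (simp only: mult.assoc[symmetric] even_zvx[of i l f])

lemma of_nat_left_commute: "f * (of_nat k * g) = of_nat k * (f * g)" for f g :: superpoly
 by (metis mult.assoc mult_of_nat_commute)

text \<open>
 Divisibility by a power of \<open>\<Delta>\<^sub>m\<close> in the polynomial superalgebra; quotients are unique by \<open>de_cancel\<close>.
\<close>

definition dv :: "nat => nat => superpoly => bool" where
 "dv m a f \<longleftrightarrow> (\<exists>g. f = rep_ev (de m ^ a) * g)"

lemma dv_0 [simp]: "dv m 0 f" by (auto simp: dv_def)

lemma dv_add: "dv m a f ==> dv m a g ==> dv m a (f + g)"
 unfolding dv_def by (metis distrib_left)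

lemma dv_zero: "dv m a 0" unfolding dv_def by (metis mult_zero_right)

lemma dv_sum: "(\<And>i. i \<in> I ==> dv m a (h i)) ==> dv m a (sum h I)"
 by (induction I rule: infinite_finite_induct) (auto simp: dv_zero dv_add)

lemma dv_mult: assumes "dv m a f" "dv m b g" shows "dv m (a + b) (f * g)"
proof -
 obtain f' g' where fg: "f = rep_ev (de m ^ a) * f'" "g = rep_ev (de m ^ b) * g'" using assms unfolding dv_def by blast
 have "f * g = rep_ev (de m ^ a) * (f' * rep_ev (de m ^ b)) * g'" unfolding fg by (simp only: mult.assoc)
 also have "\<dots> = rep_ev (de m ^ (a + b)) * (f' * g')"
  unfolding rep_ev_commute[of "de m ^ b" f', symmetric] by (simp only: power_add times_evsp.rep_eq mult.assoc)
 finally show ?thesis unfolding dv_def by blast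
qed

lemma dv_de: "dv m 1 (rep_ev (de m))" unfolding dv_def by (rule exI[of _ 1]) simp

text \<open>
 Apply the derivation to Cramer's rule. Both resulting terms contribute the same product of \<open>\<eta>\<close> and \<open>Dl\<close>, since
 these anticommute, whence the factor two.
\<close>

lemma TD_Dl:
 assumes l: "l \<in> {1..m}" "l' \<in> {1..m}"
 shows "rep_ev (de m) * TD m k l (Dl m k l') = 2 * (Dl m k l * Dl m k l')"
proof -
 interpret sder True "TD m k l" by (rule sder_TD)
 let ?d = "rep_ev (de m)" and ?D = "Dl m k"
 show ?thesis
 proof (rule cramer_unique[where m = m and l = l' and u = "\<lambda>l'. ?d * TD m k l (?D l')" and v = "\<lambda>l'. 2 * (?D l * ?D l')", OF _ l(2)])
  fix i assume i: "i \<in> {1..m}"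
  have x: "TD m k l (zv (vx t i)) = (if t = l then zv (veta k i) else 0)" for t
   using TD_xe[OF i] by (simp add: rep_xe)
  have eta: "TD m k l (zv (veta k i)) = 0" by (simp add: TD_def dd_zv)
  have "(\<Sum>t\<in>{1..m}. TD m k l (zv (vx t i)) * ?D t) = (\<Sum>t\<in>{1..m}. if t = l then zv (veta k i) * ?D l else 0)"
   by (intro sum.cong) (auto simp: x)
  also have "\<dots> = zv (veta k i) * ?D l" using l(1) by simp
  finally have "zv (veta k i) * ?D l + (\<Sum>t\<in>{1..m}. zv (vx t i) * TD m k l (?D t)) = ?D l * zv (veta k i)"
   using G_cramer[OF i, of k] by (simp add: eta Dl_def)
  moreover have "zv (veta k i) * ?D l = - (?D l * zv (veta k i))"
   using zv_commute[of "veta k i" "?D l"] by (simp add: kpow_def kap_Dl)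
  ultimately have e: "(\<Sum>t\<in>{1..m}. zv (vx t i) * TD m k l (?D t)) = 2 * (?D l * zv (veta k i))"
   by (simp add: mult_2 algebra_simps)
  have "(\<Sum>t\<in>{1..m}. zv (vx t i) * (?d * TD m k l (?D t))) = ?d * (\<Sum>t\<in>{1..m}. zv (vx t i) * TD m k l (?D t))"
   unfolding sum_distrib_left by (intro sum.cong refl rep_ev_left_commute)
  also have "\<dots> = 2 * (?D l * (?d * zv (veta k i)))"
   unfolding e by (simp add: mult_2 distrib_left rep_ev_left_commute)
  also have "\<dots> = 2 * (?D l * (\<Sum>t\<in>{1..m}. zv (vx t i) * ?D t))" by (simp only: cramer[OF i])
  also have "\<dots> = (\<Sum>t\<in>{1..m}. zv (vx t i) * (2 * (?D l * ?D t)))"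
  proof -
   have "?D l * (zv (vx t i) * ?D t) = zv (vx t i) * (?D l * ?D t)" for t by (rule zvx_left_commute)
   then show ?thesis by (simp add: mult_2 distrib_left sum_distrib_left sum.distrib)
  qed
  finally show "(\<Sum>t\<in>{1..m}. zv (vx t i) * (?d * TD m k l (?D t))) = (\<Sum>t\<in>{1..m}. zv (vx t i) * (2 * (?D l * ?D t)))" .
 qed
qed

lemma TD_prod_Dl:
 assumes l: "l \<in> {1..m}" "set ls \<subseteq> {1..m}"
 shows "rep_ev (de m) * TD m k l (prod_list (map (Dl m k) ls)) = of_nat (2 * length ls) * (Dl m k l * prod_list (map (Dl m k) ls))"
 using l(2)
proof (induction ls)
 case Nil
 show ?case by (simp add: sder.G_one[OF sder_TD])
next
 case (Cons l' ls)
 let ?d = "rep_ev (de m)" and ?D = "Dl m k" and ?R = "prod_list (map (Dl m k) ls)"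
 have IH: "?d * TD m k l ?R = of_nat (2 * length ls) * (?D l * ?R)" using Cons by simp
 have anti: "?D l' * ?D l = - (?D l * ?D l')"
  using supercommute[OF odd_Dl, of m k l' "?D l"] by (simp add: kpow_def kap_Dl)
 have "?d * TD m k l (?D l' * ?R) = ?d * TD m k l (?D l') * ?R - ?d * ?D l' * TD m k l ?R"
  by (simp add: sder.G_mult[OF sder_TD] kpow_def kap_Dl distrib_left right_diff_distrib mult.assoc)
 also have "?d * ?D l' * TD m k l ?R = ?D l' * (?d * TD m k l ?R)" by (simp only: rep_ev_commute[of _ "?D l'"] mult.assoc)
 also have "\<dots> = of_nat (2 * length ls) * ((?D l' * ?D l) * ?R)"
  unfolding IH by (simp only: of_nat_left_commute mult.assoc)
 also have "?d * TD m k l (?D l') = 2 * (?D l * ?D l')" using TD_Dl[of l m l' k] l(1) Cons.prems by simp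
 finally show ?case unfolding anti by (simp add: algebra_simps mult_2)
qed

text \<open>
 Suppose \<open>Dl\<close> products of length \<open>c + 1\<close> are \<open>\<Delta>\<^sub>m\<^sup>c E\<close>. Applying \<open>TD\<close> and using \<open>TD_prod_Dl\<close> shows that one more
 factor gives a multiple of \<open>\<Delta>\<^sub>m\<^sup>c\<^sup>+\<^sup>1\<close> with quotient \<open>TD E / (c + 2)\<close>.
\<close>

lemma dv_prod_Dl:
 assumes "set ls \<subseteq> {1..m}" shows "dv m (length ls - 1) (prod_list (map (Dl m k) ls))"
 using assms
proof (induction ls)
 case (Cons l ls)
 let ?d = "rep_ev (de m)" and ?R = "prod_list (map (Dl m k) ls)"
 show ?case
 proof (cases "ls = []")
  case False
  define c where "c = length ls - 1"
  have len: "length ls = Suc c" using False by (simp add: c_def)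
  interpret sder True "TD m k l" by (rule sder_TD)
  obtain E where E: "?R = rep_ev (de m ^ c) * E" using Cons unfolding dv_def c_def by auto
  have pw: "?d * TD m k l (rep_ev (de m ^ c)) = of_nat c * (rep_ev (de m ^ c) * Dl m k l)" for c
  proof (induction c)
   case (Suc c)
   have "?d * TD m k l (rep_ev (de m ^ Suc c)) = ?d * Dl m k l * rep_ev (de m ^ c) + ?d * (?d * TD m k l (rep_ev (de m ^ c)))"
    unfolding power_Suc times_evsp.rep_eq G_ev_mult by (simp only: Dl_def distrib_left mult.assoc)
   also have "?d * Dl m k l * rep_ev (de m ^ c) = rep_ev (de m ^ Suc c) * Dl m k l"
    by (simp only: power_Suc times_evsp.rep_eq mult.assoc rep_ev_commute[of "de m ^ c" "Dl m k l"])
   also have "?d * (?d * TD m k l (rep_ev (de m ^ c))) = of_nat c * (rep_ev (de m ^ Suc c) * Dl m k l)"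
    unfolding Suc power_Suc times_evsp.rep_eq by (simp only: of_nat_left_commute mult.assoc)
   finally show ?case by (simp add: distrib_right del: rep_ev_power)
  qed simp
  have a: "rep_ev (de m ^ Suc c) * TD m k l E = ?d * TD m k l ?R - of_nat c * (Dl m k l * ?R)"
  proof -
   have "?d * TD m k l ?R = ?d * TD m k l (rep_ev (de m ^ c)) * E + rep_ev (de m ^ Suc c) * TD m k l E"
    unfolding E G_ev_mult by (simp only: power_Suc times_evsp.rep_eq distrib_left mult.assoc)
   also have "?d * TD m k l (rep_ev (de m ^ c)) * E = of_nat c * (Dl m k l * ?R)"
    unfolding pw E by (simp only: mult.assoc rep_ev_commute[of "de m ^ c" "Dl m k l"])
   finally show ?thesis by simp
  qed
  have "?d * TD m k l ?R = of_nat (2 * length ls) * (Dl m k l * ?R)"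
   using TD_prod_Dl[of l m ls k] Cons.prems by simp
  then have "rep_ev (de m ^ Suc c) * TD m k l E = of_nat (c + 2) * (Dl m k l * ?R)"
   unfolding a len by (simp add: algebra_simps mult_2)
  then have "sp_scale (1 / of_nat (c + 2)) (rep_ev (de m ^ Suc c) * TD m k l E) = sp_scale (1 / of_nat (c + 2) * of_nat (c + 2)) (Dl m k l * ?R)"
   unfolding SP.scale_scale[symmetric] by (simp only: of_nat_scale)
  moreover have "1 / of_nat (c + 2) * of_nat (c + 2) = (1::complex)"
  proof -
   have nz: "of_nat (c + 2) \<noteq> (0::complex)" by (simp only: of_nat_eq_0_iff)
   show ?thesis by (simp only: times_divide_eq_left mult_1_left divide_self[OF nz])
  qed
  ultimately have "Dl m k l * ?R = rep_ev (de m ^ Suc c) * sp_scale (1 / of_nat (c + 2)) (TD m k l E)"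
   by (simp only: SP.scale_one mult_scale_right)
  then have "dv m (Suc c) (Dl m k l * ?R)" unfolding dv_def by (rule exI)
  then show ?thesis using len by simp
 qed simp
qed simp

text \<open>
 Expanding one entry \<open>ww\<close>, the first summand supplies a factor \<open>\<Delta>\<^sub>m\<close>, the others exchange it for a factor \<open>Dl\<close>.
 All entries must have the same row index \<open>k\<close>.
\<close>

lemma dv_prod_ww_Dl:
 assumes "set ls \<subseteq> {1..m}"
 shows "dv m (length js + length ls - 1) (rep_ev (prod_list (map (we m k) js)) * prod_list (map (Dl m k) ls))"
 using assms
proof (induction js arbitrary: ls)
 case Nil
 then show ?case using dv_prod_Dl by simp
next
 case (Cons j js)
 let ?W = "rep_ev (prod_list (map (we m k) js))" and ?R = "prod_list (map (Dl m k) ls)" and ?d = "rep_ev (de m)"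
 let ?N = "length js + length ls"
 have "dv m ?N (?d * zv (vy k j) * (?W * ?R))"
 proof (cases "?N = 0")
  case False
  have "dv m (1 + (?N - 1)) (?d * (zv (vy k j) * (?W * ?R)))"
   using dv_mult[OF dv_de dv_mult[OF dv_0 Cons.IH[OF Cons.prems]]] by simp
  then show ?thesis using False by (simp add: mult.assoc)
 qed simp
 moreover have "dv m ?N (Dl m k l * zv (vxi l j) * (?W * ?R))" if l: "l \<in> {1..m}" for l
 proof -
  have s: "dv m (0 + ?N) (- zv (vxi l j) * (?W * (Dl m k l * ?R)))"
   using dv_mult[OF dv_0[where f = "- zv (vxi l j)"] Cons.IH[of "l # ls"]] l Cons.prems by simp
  have "Dl m k l * zv (vxi l j) = - zv (vxi l j) * Dl m k l"
   using zv_commute[of "vxi l j" "Dl m k l"] by (simp add: kpow_def kap_Dl)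
  then have "Dl m k l * zv (vxi l j) * (?W * ?R) = - zv (vxi l j) * (Dl m k l * (?W * ?R))" by (simp only: mult.assoc)
  also have "Dl m k l * (?W * ?R) = ?W * (Dl m k l * ?R)" by (rule rep_ev_left_commute)
  finally have "Dl m k l * zv (vxi l j) * (?W * ?R) = - zv (vxi l j) * (?W * (Dl m k l * ?R))" .
  then show ?thesis using s by (simp only: add_0)
 qed
 ultimately have "dv m ?N (?d * zv (vy k j) * (?W * ?R) + (\<Sum>l\<in>{1..m}. Dl m k l * zv (vxi l j) * (?W * ?R)))"
  by (intro dv_add dv_sum) auto
 then show ?case by (simp add: rep_we ww_def distrib_right sum_distrib_right mult.assoc)
qed

lemma dv_prod_we:
 assumes "finite J" shows "dv m (card J - 1) (rep_ev (\<Prod>i\<in>J. we m k (h i)))"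
proof -
 obtain xs where xs: "set xs = J" "distinct xs" using finite_distinct_list[OF assms] by blast
 then have "(\<Prod>i\<in>J. we m k (h i)) = prod_list (map (we m k) (map h xs))"
  using prod.distinct_set_conv_list[OF xs(2), of "\<lambda>i. we m k (h i)"] by (simp add: comp_def)
 moreover have "card J = length xs" using xs distinct_card by metis
 ultimately show ?thesis using dv_prod_ww_Dl[of "[]" m "map h xs" k] by simp
qed

lemma dv_prod: "finite K ==> (\<And>k. k \<in> K ==> dv m (c k) (rep_ev (h k))) ==> dv m (sum c K) (rep_ev (prod h K))"
 by (induction K rule: finite_induct) (auto simp: dv_mult)

text \<open>
 In an expansion of a product of determinants \<open>dt (we m) (\<rho> i)\<close>, the row \<open>k\<close> contributes one factor
 for each \<open>i\<close> with \<open>k < \<rho> i\<close>; all but one of these factors yield a factor \<open>\<Delta>\<^sub>m\<close>.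
\<close>

theorem Gamma_product_divisible:
 assumes I: "finite I" "i0 \<in> I" and \<rho>: "\<And>i. i \<in> I ==> \<rho> i \<le> \<rho> i0"
 shows "dv m (\<Sum>i\<in>I - {i0}. \<rho> i) (rep_ev (\<Prod>i\<in>I. dt (we m) (\<rho> i)))"
proof -
 let ?K = "{..<\<rho> i0}"
 have "dt (we m) (\<rho> i) = (\<Sum>p | p permutes {0..<\<rho> i}. of_int (sign p) * (\<Prod>k = 0..<\<rho> i. we m (Suc k) (Suc (p k))))" for i
 proof -
  have "(\<Prod>k = 0..<\<rho> i. mat (\<rho> i) (\<rho> i) (\<lambda>(i, j). we m (Suc i) (Suc j)) $$ (k, p k)) = (\<Prod>k = 0..<\<rho> i. we m (Suc k) (Suc (p k)))"
   if "p permutes {0..<\<rho> i}" for p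
   using permutes_in_image[OF that] by (intro prod.cong) auto
  then show ?thesis unfolding dt_def by (subst det_def'[OF mat_carrier]) (intro sum.cong, auto)
 qed
 then have "(\<Prod>i\<in>I. dt (we m) (\<rho> i)) = (\<Sum>g\<in>PiE I (\<lambda>i. {p. p permutes {0..<\<rho> i}}). \<Prod>i\<in>I. of_int (sign (g i)) * (\<Prod>k = 0..<\<rho> i. we m (Suc k) (Suc (g i k))))"
  by (simp add: prod_sum_PiE[OF I(1)] finite_permutations)
 moreover have "dv m (\<Sum>i\<in>I - {i0}. \<rho> i) (rep_ev (\<Prod>i\<in>I. of_int (sign (g i)) * (\<Prod>k = 0..<\<rho> i. we m (Suc k) (Suc (g i k)))))" for g
 proof -
  let ?J = "\<lambda>k. {i\<in>I. k < \<rho> i}"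
  have "(\<Prod>i\<in>I. \<Prod>k = 0..<\<rho> i. we m (Suc k) (Suc (g i k))) = (\<Prod>i\<in>I. \<Prod>k\<in>?K. if k < \<rho> i then we m (Suc k) (Suc (g i k)) else 1)"
  proof (rule prod.cong[OF refl])
   fix i assume "i \<in> I"
   then have "{0..<\<rho> i} = {k\<in>?K. k < \<rho> i}" using \<rho>[of i] by auto
   then show "(\<Prod>k = 0..<\<rho> i. we m (Suc k) (Suc (g i k))) = (\<Prod>k\<in>?K. if k < \<rho> i then we m (Suc k) (Suc (g i k)) else 1)"
    using prod.inter_filter[of ?K "\<lambda>k. we m (Suc k) (Suc (g i k))" "\<lambda>k. k < \<rho> i"] by simp
  qed
  also have "\<dots> = (\<Prod>k\<in>?K. \<Prod>i\<in>I. if k < \<rho> i then we m (Suc k) (Suc (g i k)) else 1)"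
   by (rule prod.swap)
  also have "\<dots> = (\<Prod>k\<in>?K. \<Prod>i\<in>?J k. we m (Suc k) (Suc (g i k)))"
   by (intro prod.cong refl prod.inter_filter[symmetric] I(1))
  finally have e: "(\<Prod>i\<in>I. of_int (sign (g i)) * (\<Prod>k = 0..<\<rho> i. we m (Suc k) (Suc (g i k))))
   = (\<Prod>i\<in>I. of_int (sign (g i))) * (\<Prod>k\<in>?K. \<Prod>i\<in>?J k. we m (Suc k) (Suc (g i k)))"
   by (simp add: prod.distrib)
  have "(\<Sum>i\<in>I - {i0}. \<rho> i) = (\<Sum>k\<in>?K. card (?J k) - 1)"
  proof -
   have "\<rho> i = (\<Sum>k\<in>?K. if k < \<rho> i then 1 else 0)" if "i \<in> I" for i
   proof -
    have "{k\<in>?K. k < \<rho> i} = {..<\<rho> i}" using \<rho>[OF that] by auto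
    then have "(\<Sum>k\<in>{k\<in>?K. k < \<rho> i}. 1) = \<rho> i" by simp
    then show ?thesis by (simp only: sum.inter_filter[OF finite_lessThan])
   qed
   then have "(\<Sum>i\<in>I - {i0}. \<rho> i) = (\<Sum>i\<in>I - {i0}. \<Sum>k\<in>?K. if k < \<rho> i then 1 else 0)" by (intro sum.cong) auto
   also have "\<dots> = (\<Sum>k\<in>?K. \<Sum>i\<in>I - {i0}. if k < \<rho> i then 1 else 0)" by (rule sum.swap)
   also have "\<dots> = (\<Sum>k\<in>?K. card (?J k) - 1)"
   proof (rule sum.cong[OF refl])
    fix k assume k: "k \<in> ?K"
    have "(\<Sum>i\<in>I - {i0}. if k < \<rho> i then 1 else 0) = card {i\<in>I - {i0}. k < \<rho> i}"
     using I(1) by (simp add: sum.inter_filter[symmetric])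
    also have "{i\<in>I - {i0}. k < \<rho> i} = ?J k - {i0}" by auto
    also have "card \<dots> = card (?J k) - 1" using k I by (simp add: card_Diff_singleton)
    finally show "(\<Sum>i\<in>I - {i0}. if k < \<rho> i then 1 else 0) = card (?J k) - 1" .
   qed
   finally show ?thesis .
  qed
  then have "dv m (\<Sum>i\<in>I - {i0}. \<rho> i) (rep_ev (\<Prod>k\<in>?K. \<Prod>i\<in>?J k. we m (Suc k) (Suc (g i k))))"
   using I(1) by (simp only:) (intro dv_prod dv_prod_we finite_lessThan, simp)
  then have "dv m (0 + (\<Sum>i\<in>I - {i0}. \<rho> i)) (rep_ev (\<Prod>i\<in>I. of_int (sign (g i))) * rep_ev (\<Prod>k\<in>?K. \<Prod>i\<in>?J k. we m (Suc k) (Suc (g i k))))"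
   by (intro dv_mult dv_0)
  then show ?thesis unfolding e by (simp only: times_evsp.rep_eq add_0)
 qed
 ultimately show ?thesis by (simp add: dv_sum)
qed

section \<open>Highest weight vectors for all hook shapes\<close>

text \<open>Rows decrease, so the rows of length at least \<open>j\<close> form an initial segment.\<close>

lemma le_col_iff:
 assumes \<nu>: "young \<nu>" and ij: "1 \<le> i" "1 \<le> j"
 shows "i \<le> col \<nu> j \<longleftrightarrow> j \<le> row \<nu> i"
proof -
 let ?S = "{i\<in>{1..length \<nu>}. j \<le> row \<nu> i}"
 have S: "k \<in> ?S" if "1 \<le> k" "k \<le> l" "l \<in> ?S" for k l
  using row_antitone[OF \<nu> that(1,2)] that by auto
 have "?S = {1..card ?S}"
 proof (cases "?S = {}")
  case False
  have fin: "finite ?S" by simp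
  define M where "M = Max ?S"
  have M: "M \<in> ?S" unfolding M_def by (rule Max_in[OF fin False])
  have le: "k \<le> M" if "k \<in> ?S" for k unfolding M_def by (rule Max_ge[OF fin that])
  have e: "?S = {1..M}"
  proof (intro equalityI subsetI)
   fix k assume "k \<in> ?S"
   then show "k \<in> {1..M}" using le[of k] by auto
  next
   fix k assume "k \<in> {1..M}"
   then have "1 \<le> k" "k \<le> M" by simp_all
   then show "k \<in> ?S" by (rule S[OF _ _ M])
  qed
  have "card ?S = card {1..M}" by (rule arg_cong[OF e])
  then show ?thesis using e by simp
 qed simp
 then have "(i \<in> ?S) = (i \<in> {1..card ?S})" by (rule arg_cong)
 then have "i \<le> col \<nu> j \<longleftrightarrow> i \<in> ?S" using ij(1) unfolding Defs.col_def atLeastAtMost_iff by blast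
 also have "\<dots> \<longleftrightarrow> j \<le> row \<nu> i" using ij row_pos_iff[OF \<nu> ij(1)] by auto
 finally show ?thesis .
qed

lemma col_le_length: "col \<nu> j \<le> length \<nu>"
proof -
 have "col \<nu> j \<le> card {1..length \<nu>}" unfolding Defs.col_def by (rule card_mono) auto
 then show ?thesis by simp
qed

lemma sum_list_of_bool: "(\<Sum>x\<leftarrow>[a + 1..<b + 1]. of_bool (x \<le> c)) = min b c - (a::nat)"
 by (induction b) (auto simp: min_def not_le)

lemma sum_list_const_zero: "(\<Sum>x\<leftarrow>xs. 0) = (0::nat)" by (induction xs) auto

lemma body_prod_list: "(\<And>x. x \<in> set xs ==> body (h x) \<noteq> 0) ==> body (prod_list (map h xs)) \<noteq> 0"
 by (induction xs) auto

lemma sum_col_of_bool: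
 assumes \<nu>: "young \<nu>" and i: "1 \<le> i"
 shows "(\<Sum>j\<leftarrow>[r + 1..<row \<nu> 1 + 1]. of_bool (i \<le> col \<nu> j)) = row \<nu> i - r"
proof -
 have "(\<Sum>j\<leftarrow>[r + 1..<row \<nu> 1 + 1]. of_bool (i \<le> col \<nu> j)) = (\<Sum>j\<leftarrow>[r + 1..<row \<nu> 1 + 1]. of_bool (j \<le> row \<nu> i) :: nat)"
  by (intro arg_cong[of _ _ sum_list] map_cong refl) (use le_col_iff[OF \<nu> i] in auto)
 then show ?thesis
  using sum_list_of_bool[where a = r and b = "row \<nu> 1" and c = "row \<nu> i"] row_antitone[OF \<nu> order_refl i] by (simp add: min_absorb2 del: upt_Suc)
qed

lemma hwp_cong:
 assumes "hwp m q n \<alpha> \<beta> f" "\<And>a. a \<in> sidx m q ==> \<alpha> a = \<alpha>' a" "\<And>a. a \<in> sidx m n ==> \<beta> a = \<beta>' a"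
 shows "hwp m q n \<alpha>' \<beta>' f"
 using assms by (simp add: hwp_def)

theorem joint_hw_short:
 assumes \<nu>: "young \<nu>" "length \<nu> \<le> m"
 shows "joint_hw_vector m q n \<nu> (prod_list (map (\<lambda>j. Delta (col \<nu> j)) [1..<row \<nu> 1 + 1]))"
proof -
 let ?xs = "[1..<row \<nu> 1 + 1]"
 let ?\<alpha> = "\<lambda>j a. case a of Inl i => of_bool (i \<le> col \<nu> j) | Inr j => (0::nat)"
 have c: "col \<nu> j \<le> m" for j using col_le_length[of \<nu> j] \<nu>(2) by simp
 have hw: "hwp m q n (\<lambda>a. \<Sum>j\<leftarrow>?xs. ?\<alpha> j a) (\<lambda>a. \<Sum>j\<leftarrow>?xs. ?\<alpha> j a) (prod_list (map (\<lambda>j. rep_ev (de (col \<nu> j))) ?xs))"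
  by (rule hwp_prod_list) (rule hwp_Delta[OF c])
 have "body (prod_list (map (\<lambda>j. rep_ev (de (col \<nu> j))) ?xs)) \<noteq> 0"
  by (rule body_prod_list) (rule body_de)
 then have nz: "prod_list (map (\<lambda>j. rep_ev (de (col \<nu> j))) ?xs) \<noteq> 0" using body_simps(4) by metis
 have w: "(\<Sum>j\<leftarrow>?xs. ?\<alpha> j a) = hook_weight m \<nu> a" if "a \<in> sidx m k" for a k
  using that
 proof (cases rule: sidxE)
  case (1 i)
  then show ?thesis using sum_col_of_bool[OF \<nu>(1), of i 0] by (simp add: hook_weight_def)
 next
  case (2 j)
  then show ?thesis using c[of j] by (simp add: hook_weight_def sum_list_const_zero)
 qed
 show ?thesis unfolding Delta_rep by (rule joint_of_hwp[OF hw nz w w])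
qed

text \<open>
 Divisibility gives the quotient. Weights: each even index receives \<open>r\<close> from the first factor \<open>\<Gamma>\<close>, the remaining
 factors \<open>\<Gamma>\<close> are compensated by the division, and the factors \<open>\<Delta>\<close> supply the rest of the row; the odd weights are
 the columns of the part of the diagram below row \<open>m\<close>.
\<close>

theorem joint_hw_long:
 assumes \<nu>: "young \<nu>" "row \<nu> (m + 1) \<le> min q n" and s: "s \<ge> 1" "length \<nu> = m + s"
  and r: "r = row \<nu> (m + 1)"
 obtains f where "f \<in> superpolys m q m n"
  "\<And>g. Delta m ^ (\<Sum>i = m + 2..m + s. row \<nu> i) * g =
    prod_list (map (\<lambda>i. Gamma m (row \<nu> i)) [m + 1..<m + s + 1]) * prod_list (map (\<lambda>j. Delta (col \<nu> j)) [r + 1..<row \<nu> 1 + 1]) \<longleftrightarrow> g = f"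
  "joint_hw_vector m q n \<nu> f"
proof -
 let ?I = "[m + 1..<m + s + 1]" and ?J = "[r + 1..<row \<nu> 1 + 1]"
 let ?\<rho> = "row \<nu>" and ?a = "\<Sum>i = m + 2..m + s. row \<nu> i"
 let ?G = "prod_list (map (\<lambda>i. rep_ev (dt (we m) (?\<rho> i))) ?I)" and ?D = "prod_list (map (\<lambda>j. rep_ev (de (col \<nu> j))) ?J)"
 let ?\<alpha> = "\<lambda>i a. case a of Inl _ => ?\<rho> i | Inr j => of_bool (j \<le> ?\<rho> i)"
 let ?\<beta> = "\<lambda>j a. case a of Inl i => of_bool (i \<le> col \<nu> j) | Inr j => (0::nat)"
 let ?\<gamma> = "\<lambda>a. case a of Inl i => of_bool (i \<le> m) | Inr j => (0::nat)"
 have row_le: "?\<rho> i \<le> r" if "i \<ge> m + 1" for i using row_antitone[OF \<nu>(1), of "m + 1" i] that r by simp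
 have col_le: "col \<nu> j \<le> m" if "j \<ge> r + 1" for j
  using le_col_iff[OF \<nu>(1), of "m + 1" j] that r by linarith
 have G: "?G = rep_ev (\<Prod>i\<in>{m + 1..m + s}. dt (we m) (?\<rho> i))"
 proof -
  have "(\<Prod>i\<in>{m + 1..m + s}. dt (we m) (?\<rho> i)) = prod_list (map (\<lambda>i. dt (we m) (?\<rho> i)) ?I)"
   using prod.distinct_set_conv_list[of ?I "\<lambda>i. dt (we m) (?\<rho> i)"] by (simp add: atLeastLessThanSuc_atLeastAtMost del: upt_Suc)
  then show ?thesis by (simp add: rep_ev_prod_list comp_def del: upt_Suc)
 qed
 have "dv m (\<Sum>i\<in>{m + 1..m + s} - {m + 1}. ?\<rho> i) ?G"
  unfolding G by (rule Gamma_product_divisible) (use s(1) row_le r in auto)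
 moreover have "{m + 1..m + s} - {m + 1} = {m + 2..m + s}" by auto
 ultimately have "dv m (?a + 0) (?G * ?D)" by (intro dv_mult dv_0) simp
 then obtain f where f: "?G * ?D = rep_ev (de m ^ ?a) * f" unfolding dv_def by auto
 have hwR: "hwp m q n (\<lambda>a. (\<Sum>i\<leftarrow>?I. ?\<alpha> i a) + (\<Sum>j\<leftarrow>?J. ?\<beta> j a)) (\<lambda>a. (\<Sum>i\<leftarrow>?I. ?\<alpha> i a) + (\<Sum>j\<leftarrow>?J. ?\<beta> j a)) (?G * ?D)"
 proof (intro hwp_mult hwp_prod_list)
  fix i assume "i \<in> set ?I"
  then have "?\<rho> i \<le> r" using row_le by (simp del: upt_Suc)
  then show "hwp m q n (?\<alpha> i) (?\<alpha> i) (rep_ev (dt (we m) (?\<rho> i)))" using \<nu>(2) r by (intro hwp_Gamma) auto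
 next
  fix j assume "j \<in> set ?J"
  then show "hwp m q n (?\<beta> j) (?\<beta> j) (rep_ev (de (col \<nu> j)))" using col_le by (intro hwp_Delta) auto
 qed
 have w: "(\<Sum>i\<leftarrow>?I. ?\<alpha> i a) + (\<Sum>j\<leftarrow>?J. ?\<beta> j a) = ?a * ?\<gamma> a + hook_weight m \<nu> a" if "a \<in> sidx m k" for a k
  using that
 proof (cases rule: sidxE)
  case (1 i)
  have "(\<Sum>i\<leftarrow>?I. ?\<rho> i) = (\<Sum>i\<in>{m + 1..m + s}. ?\<rho> i)"
   by (simp add: sum_list_distinct_conv_sum_set atLeastLessThanSuc_atLeastAtMost del: upt_Suc)
  also have "\<dots> = r + ?a" using s(1) r by (subst sum.atLeast_Suc_atMost) auto
  finally have "(\<Sum>i\<leftarrow>?I. ?\<rho> i) = r + ?a" .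
  moreover have "r \<le> row \<nu> i" using row_antitone[OF \<nu>(1), of i "m + 1"] 1 r by simp
  ultimately show ?thesis using 1 sum_col_of_bool[OF \<nu>(1), of i r] by (simp add: hook_weight_def del: upt_Suc)
 next
  case (2 j)
  have "(\<Sum>i\<leftarrow>?I. of_bool (j \<le> ?\<rho> i)) = (\<Sum>i\<leftarrow>?I. of_bool (i \<le> col \<nu> j) :: nat)"
   by (intro arg_cong[of _ _ sum_list] map_cong refl) (use le_col_iff[OF \<nu>(1), of _ j] 2 in auto)
  moreover have "col \<nu> j \<le> m + s" using s(2) col_le_length[of \<nu> j] by simp
  ultimately have "(\<Sum>i\<leftarrow>?I. of_bool (j \<le> ?\<rho> i)) = col \<nu> j - m"
   using sum_list_of_bool[of "col \<nu> j" m "m + s"] by (simp add: min_absorb2 del: upt_Suc)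
  then show ?thesis using 2 by (simp add: hook_weight_def sum_list_const_zero del: upt_Suc)
 qed
 have "hwp m q n (\<lambda>a. ?a * ?\<gamma> a + hook_weight m \<nu> a) (\<lambda>a. ?a * ?\<gamma> a + hook_weight m \<nu> a) (rep_ev (de m ^ ?a) * f)"
  unfolding f[symmetric] by (rule hwp_cong[OF hwR w w])
 then have hw: "hwp m q n (hook_weight m \<nu>) (hook_weight m \<nu>) f"
  by (rule hwp_div[OF hwp_Delta[OF order_refl]])
 have "body (?G * ?D) \<noteq> 0" unfolding body_simps mult_eq_0_iff
  using body_prod_list[of ?I "\<lambda>i. rep_ev (dt (we m) (?\<rho> i))"] body_prod_list[of ?J "\<lambda>j. rep_ev (de (col \<nu> j))"] body_Gamma body_de by blast
 then have "f \<noteq> 0" unfolding f by auto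
 then have "joint_hw_vector m q n \<nu> f" by (rule joint_of_hwp[OF hw]) (rule refl)+
 moreover have "Delta m ^ ?a * g = prod_list (map (\<lambda>i. Gamma m (row \<nu> i)) ?I) * prod_list (map (\<lambda>j. Delta (col \<nu> j)) ?J) \<longleftrightarrow> g = f" for g
  unfolding Delta_rep Gamma_rep f rep_ev_power[symmetric] using de_cancel[of m ?a g f] by blast
 ultimately show ?thesis using that hw unfolding hwp_def by blast
qed

lemma joint_hw_exists:
 assumes \<nu>: "young \<nu>" "row \<nu> (m + 1) \<le> min q n"
 shows "\<exists>f. joint_hw_vector m q n \<nu> f"
proof (cases "length \<nu> \<le> m")
 case True
 then show ?thesis using joint_hw_short[OF \<nu>(1)] by blast
next
 case False
 then have "length \<nu> - m \<ge> 1" "length \<nu> = m + (length \<nu> - m)" by auto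
 then show ?thesis using joint_hw_long[OF \<nu> _ _ refl] by metis
qed

section \<open>The decomposition theorem\<close>

theorem theorem4p4:
 fixes m q n :: nat
 shows
  "(\<forall>W :: ((sindex \<times> sindex) + (sindex \<times> sindex), 'w::ab_group_add) rep.
    irreducible_rep (lie_prod (gl m q) (gl m n)) W \<longrightarrow>
    (appears_in_decomposition (lie_prod (gl m q) (gl m n)) (poly_rep m q m n) W \<longleftrightarrow>
     (\<exists>\<nu>. young \<nu> \<and> row \<nu> (m + 1) \<le> min q n \<and> is_VV m q n \<nu> W)))
   \<and> (\<forall>\<nu>. young \<nu> \<and> row \<nu> (m + 1) \<le> min q n \<longrightarrow>
    (\<exists>W :: ((sindex \<times> sindex) + (sindex \<times> sindex), superpoly) rep.
     is_VV m q n \<nu> W \<and>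
     appears_in_decomposition (lie_prod (gl m q) (gl m n)) (poly_rep m q m n) W))
   \<and> (\<forall>\<nu>. young \<nu> \<and> length \<nu> \<le> m \<longrightarrow>
    joint_hw_vector m q n \<nu> (prod_list (map (\<lambda>j. Delta (col \<nu> j)) [1..<row \<nu> 1 + 1])))
   \<and> (\<forall>\<nu> s. young \<nu> \<and> row \<nu> (m + 1) \<le> min q n \<and> s \<ge> 1 \<and> length \<nu> = m + s \<longrightarrow>
    (\<exists>r \<le> min q n. col \<nu> r > m \<and> col \<nu> (r + 1) \<le> m) \<and>
    (\<forall>r \<le> min q n. col \<nu> r > m \<and> col \<nu> (r + 1) \<le> m \<longrightarrow>
     (\<exists>f \<in> superpolys m q m n.
      (\<forall>g \<in> superpolys m q m n.
       Delta m ^ (\<Sum>i = m + 2..m + s. row \<nu> i) * g =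
        prod_list (map (\<lambda>i. Gamma m (row \<nu> i)) [m + 1..<m + s + 1]) *
        prod_list (map (\<lambda>j. Delta (col \<nu> j)) [r + 1..<row \<nu> 1 + 1])
       \<longleftrightarrow> g = f) \<and>
      joint_hw_vector m q n \<nu> f)))"
proof (intro conjI allI impI)
 fix W :: "((sindex \<times> sindex) + (sindex \<times> sindex), 'w::ab_group_add) rep"
 assume W: "irreducible_rep (lie_prod (gl m q) (gl m n)) W"
 show "appears_in_decomposition (lie_prod (gl m q) (gl m n)) (poly_rep m q m n) W \<longleftrightarrow>
  (\<exists>\<nu>. young \<nu> \<and> row \<nu> (m + 1) \<le> min q n \<and> is_VV m q n \<nu> W)"
 proof
  assume "appears_in_decomposition (lie_prod (gl m q) (gl m n)) (poly_rep m q m n) W"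
  then show "\<exists>\<nu>. young \<nu> \<and> row \<nu> (m + 1) \<le> min q n \<and> is_VV m q n \<nu> W" by (rule appears_imp_is_VV[OF W])
 next
  assume "\<exists>\<nu>. young \<nu> \<and> row \<nu> (m + 1) \<le> min q n \<and> is_VV m q n \<nu> W"
  then obtain \<nu> where \<nu>: "young \<nu>" "row \<nu> (m + 1) \<le> min q n" "is_VV m q n \<nu> W" by blast
  obtain f where "joint_hw_vector m q n \<nu> f" using joint_hw_exists[OF \<nu>(1,2)] by blast
  then show "appears_in_decomposition (lie_prod (gl m q) (gl m n)) (poly_rep m q m n) W"
   by (rule is_VV_imp_appears[OF W \<nu>(3)])
 qed
next
 fix \<nu> assume "young \<nu> \<and> row \<nu> (m + 1) \<le> min q n"
 then obtain f where "joint_hw_vector m q n \<nu> f" using joint_hw_exists by blast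
 then show "\<exists>W :: ((sindex \<times> sindex) + (sindex \<times> sindex), superpoly) rep. is_VV m q n \<nu> W \<and>
   appears_in_decomposition (lie_prod (gl m q) (gl m n)) (poly_rep m q m n) W"
  by (rule joint_hw_component)
next
 fix \<nu> assume "young \<nu> \<and> length \<nu> \<le> m"
 then show "joint_hw_vector m q n \<nu> (prod_list (map (\<lambda>j. Delta (col \<nu> j)) [1..<row \<nu> 1 + 1]))"
  using joint_hw_short by blast
next
 fix \<nu> s assume *: "young \<nu> \<and> row \<nu> (m + 1) \<le> min q n \<and> s \<ge> 1 \<and> length \<nu> = m + s"
 let ?r = "row \<nu> (m + 1)"
 have \<nu>: "young \<nu>" using * by blast
 have pos: "?r \<ge> 1" using row_pos_iff[OF \<nu>, of "m + 1"] * by simp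
 have "col \<nu> ?r > m" "col \<nu> (?r + 1) \<le> m"
  using le_col_iff[OF \<nu>, of "m + 1" ?r] le_col_iff[OF \<nu>, of "m + 1" "?r + 1"] pos by auto
 then show "\<exists>r \<le> min q n. col \<nu> r > m \<and> col \<nu> (r + 1) \<le> m" using * by blast
next
 fix \<nu> s r assume *: "young \<nu> \<and> row \<nu> (m + 1) \<le> min q n \<and> s \<ge> 1 \<and> length \<nu> = m + s"
  and r: "col \<nu> r > m \<and> col \<nu> (r + 1) \<le> m"
 have \<nu>: "young \<nu>" using * by blast
 have pos: "row \<nu> (m + 1) \<ge> 1" using row_pos_iff[OF \<nu>, of "m + 1"] * by simp
 \<comment> \<open>The second condition bounds \<open>\<nu>\<^sub>m\<^sub>+\<^sub>1\<close> by \<open>r\<close>, the first one \<open>r\<close> by \<open>\<nu>\<^sub>m\<^sub>+\<^sub>1\<close>; for the latter \<open>r\<close> must be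
  positive, as \<open>col \<nu> 0\<close> is a dummy value.\<close>
 have ge: "row \<nu> (m + 1) \<le> r" using le_col_iff[OF \<nu>, of "m + 1" "r + 1"] r by simp
 then have "r \<le> row \<nu> (m + 1)" using le_col_iff[OF \<nu>, of "m + 1" r] r pos by simp
 then have e: "r = row \<nu> (m + 1)" using ge by simp
 obtain f where f: "f \<in> superpolys m q m n" "\<And>g. Delta m ^ (\<Sum>i = m + 2..m + s. row \<nu> i) * g =
    prod_list (map (\<lambda>i. Gamma m (row \<nu> i)) [m + 1..<m + s + 1]) * prod_list (map (\<lambda>j. Delta (col \<nu> j)) [r + 1..<row \<nu> 1 + 1]) \<longleftrightarrow> g = f"
   "joint_hw_vector m q n \<nu> f"
  using joint_hw_long[of \<nu> m q n s r] * e by metis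
 show "\<exists>f \<in> superpolys m q m n. (\<forall>g \<in> superpolys m q m n.
       Delta m ^ (\<Sum>i = m + 2..m + s. row \<nu> i) * g =
        prod_list (map (\<lambda>i. Gamma m (row \<nu> i)) [m + 1..<m + s + 1]) *
        prod_list (map (\<lambda>j. Delta (col \<nu> j)) [r + 1..<row \<nu> 1 + 1])
       \<longleftrightarrow> g = f) \<and> joint_hw_vector m q n \<nu> f"
  using f by blast
qed

end
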